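(* (i) Let $A(x,D_x)$ be an $m\times m$ matrix of generalised pseudodifferential operators with symbol (entries) in $\mathcal{G}^{\mathrm{sc}}_{S^0(\mathbb{R}^{2n})}$. If there exist a representative $(A_\varepsilon)_\varepsilon$ of $A(x,\xi)$ and slow scale nets $(c_\varepsilon^{-1})_\varepsilon$ and $(r_\varepsilon^{-1})_\varepsilon$ such that $\mathrm{Re}\,A_\varepsilon(x,\xi)\ge c_\varepsilon I$ for $|\xi|\ge r_\varepsilon$, then there exists a slow scale net $(c_{1,\varepsilon})_\varepsilon$ such that $$\mathrm{Re}(A_\varepsilon(x,D_x)u,u)\ge c_\varepsilon\|u\|_0^2-c_{1,\varepsilon}\|u\|^2_{-1/2}$$ for all vectors $u$ with components in $\mathscr{S}(\mathbb{R}^n)$ and all $\varepsilon\in(0,1]$. (ii) Let $A(x,D_x)$ be an $m\times m$ matrix of generalised pseudodifferential operators with symbol (entries) in $\mathcal{G}^{\mathrm{lsc}}_{S^0(\mathbb{R}^{2n})}$. If there exist a representative $(A_\varepsilon)_\varepsilon$ of $A(x,\xi)$ and logarithmic slow scale nets $(c_\varepsilon^{-1})_\varepsilon$ and $(r_\varepsilon^{-1})_\varepsilon$ such that $\mathrm{Re}\,A_\varepsilon(x,\xi)\ge c_\varepsilon I$ for $|\xi|\ge r_\varepsilon$, then there exists a logarithmic slow scale net $(c_{1,\varepsilon})_\varepsilon$ such that $$\mathrm{Re}(A_\varepsilon(x,D_x)u,u)\ge c_\varepsilon\|u\|_0^2-c_{1,\varepsilon}\|u\|^2_{-1/2}$$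 for all vectors $u$ with components in $\mathscr{S}(\mathbb{R}^n)$ and all $\varepsilon\in(0,1]$.
   Context: Nets are indexed by $\varepsilon\in(0,1]$; $O$-estimates are as $\varepsilon\to0$. A net $(\omega_\varepsilon)_\varepsilon$ of real numbers is a slow scale net if $|\omega_\varepsilon|=O(\varepsilon^{-p})$ for all $p>0$, and a logarithmic slow scale net if $|\omega_\varepsilon|=O(\log^p(1/\varepsilon))$ for all $p>0$. $S^0(\mathbb{R}^{2n})$ is the space of symbols with finite seminorms $|a|^{(0)}_l=\sup_{(x,\xi)\in\mathbb{R}^{2n},|\alpha+\beta|\le l}\langle\xi\rangle^{|\alpha|}|\partial_\xi^\alpha\partial_x^\beta a(x,\xi)|$, where $\langle\xi\rangle=(1+|\xi|^2)^{1/2}$. $\mathcal{G}^{\mathrm{sc}}_{S^0(\mathbb{R}^{2n})}$ (resp. $\mathcal{G}^{\mathrm{lsc}}_{S^0(\mathbb{R}^{2n})}$) consists of the classes of nets $(a_\varepsilon)_\varepsilon$ in $S^0(\mathbb{R}^{2n})$ such that for each $l$ there is a slow scale net (resp. logarithmic slow scale net) $(\omega_\varepsilon)_\varepsilon$ with $|a_\varepsilon|^{(0)}_l=O(\omega_\varepsilon)$, modulo the negligible nets ($|a_\varepsilon|^{(0)}_l=O(\varepsilon^q)$ for all $l,q\in\mathbb{N}$). For matrices, $A^\ast=\overline{A}^{T}$, $\mathrm{Re}\,A=(A+A^\ast)/2$, and $A\ge B$ means $\overline{z}^{T}(A-B)z\ge0$ for all $z\in\mathbb{C}^m$, $z\neq0$.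 $(\cdot,\cdot)$ is the scalar product of $L^2(\mathbb{R}^n)^m$ and $\|u\|_s=\|\langle D_x\rangle^su\|_{L^2}$ is the Sobolev norm of order $s$, $\langle D_x\rangle^s$ being the pseudodifferential operator with symbol $\langle\xi\rangle^s$.
   Formalization: In both parts r_ε itself, not r_ε^{-1}, is required to be a (logarithmic) slow scale net: as printed the claim fails, e.g. for c_ε=1, r_ε=exp(1/ε), A_ε=(1-2χ(ξ/r_ε))I with χ a smooth cut-off equal to 1 on |ξ|≤1/2 and 0 for |ξ|≥1. *)

theory Defs
  imports "HOL-Analysis.Analysis" "HOL-Library.Landau_Symbols"
begin

text \<open>
  A net indexed by \<open>\<epsilon> \<in> (0,1]\<close> is a function on \<^typ>\<open>real\<close> of which only the values on
  \<^term>\<open>{0<..1::real}\<close> matter; \<open>O\<close>-estimates as \<open>\<epsilon> \<rightarrow> 0\<close> are Landau estimates along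
  \<^term>\<open>at_right (0::real)\<close>.
\<close>

definition slow_scale :: "(real \<Rightarrow> real) \<Rightarrow> bool" where
  "slow_scale \<omega> \<longleftrightarrow> (\<forall>p>0. \<omega> \<in> O[at_right 0](\<lambda>\<epsilon>. \<epsilon> powr (- p)))"

definition log_slow_scale :: "(real \<Rightarrow> real) \<Rightarrow> bool" where
  "log_slow_scale \<omega> \<longleftrightarrow> (\<forall>p>0. \<omega> \<in> O[at_right 0](\<lambda>\<epsilon>. ln (1 / \<epsilon>) powr p))"


definition partial_deriv ::
  "'a::real_normed_vector \<Rightarrow> ('a \<Rightarrow> 'b::real_normed_vector) \<Rightarrow> 'a \<Rightarrow> 'b" where
  "partial_deriv v f = (\<lambda>x. frechet_derivative f (at x) v)"

text \<open>All iterated partial derivatives are (totally) differentiable, i.e. \<open>f\<close> is \<open>C\<^sup>\<infinity>\<close>.\<close>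

definition smooth :: "('a::euclidean_space \<Rightarrow> 'b::real_normed_vector) \<Rightarrow> bool" where
  "smooth f \<longleftrightarrow> (\<forall>vs. set vs \<subseteq> Basis \<longrightarrow> foldr partial_deriv vs f differentiable_on UNIV)"

text \<open>
  \<open>\<partial>\<^sup>\<alpha> f\<close> for a multi-index \<open>\<alpha>\<close>, with respect to the directions \<open>e i\<close>. The index type carries
  no order, so some list is chosen in which each index \<open>i\<close> occurs \<open>\<alpha> i\<close> times; for smooth \<open>f\<close>
  the result does not depend on this choice.
\<close>

definition multi_deriv ::
  "('n::finite \<Rightarrow> 'a::real_normed_vector) \<Rightarrow> ('n \<Rightarrow> nat) \<Rightarrow> ('a \<Rightarrow> 'b::real_normed_vector) \<Rightarrow> 'a \<Rightarrow> 'b"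
  where
  "multi_deriv e \<alpha> f =
     foldr (\<lambda>i. partial_deriv (e i)) (SOME is. \<forall>i. count_list is i = \<alpha> i) f"

definition jap :: "'a::real_normed_vector \<Rightarrow> real" where
  "jap \<xi> = (1 + (norm \<xi>)\<^sup>2) powr (1 / 2)"

text \<open>Points of \<open>\<real>\<^sup>2\<^sup>n\<close> are pairs \<open>(x, \<xi>)\<close>.\<close>

type_synonym 'n symbol = "(real ^ 'n) \<times> (real ^ 'n) \<Rightarrow> complex"

definition d_x :: "('n::finite \<Rightarrow> nat) \<Rightarrow> 'n symbol \<Rightarrow> 'n symbol" where
  "d_x \<beta> = multi_deriv (\<lambda>i. (axis i 1, 0)) \<beta>"

definition d_xi :: "('n::finite \<Rightarrow> nat) \<Rightarrow> 'n symbol \<Rightarrow> 'n symbol" where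
  "d_xi \<alpha> = multi_deriv (\<lambda>i. (0, axis i 1)) \<alpha>"

definition S0_values :: "nat \<Rightarrow> 'n::finite symbol \<Rightarrow> real set" where
  "S0_values l a =
     {jap \<xi> ^ (\<Sum>i\<in>UNIV. \<alpha> i) * norm (d_xi \<alpha> (d_x \<beta> a) (x, \<xi>)) | x \<xi> \<alpha> \<beta>.
        (\<Sum>i\<in>UNIV. \<alpha> i + \<beta> i) \<le> l}"

text \<open>Being a real supremum, the seminorm is meaningful only for bounded sets of values.\<close>

definition S0_seminorm :: "nat \<Rightarrow> 'n::finite symbol \<Rightarrow> real" where
  "S0_seminorm l a = Sup (S0_values l a)"

definition S0 :: "'n::finite symbol set" where
  "S0 = {a. smooth a \<and> (\<forall>l. bdd_above (S0_values l a))}"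

definition schwartz :: "(real ^ 'n::finite \<Rightarrow> complex) \<Rightarrow> bool" where
  "schwartz u \<longleftrightarrow> smooth u \<and>
     (\<forall>\<alpha> \<beta> :: 'n \<Rightarrow> nat.
        bounded (range (\<lambda>x. (\<Prod>i\<in>UNIV. (x $ i) ^ \<alpha> i) *\<^sub>R multi_deriv (\<lambda>i. axis i 1) \<beta> u x)))"


text \<open>
  \<open>Sc\<close> is the class of scales that measures moderateness.
\<close>

definition moderate_nets ::
  "((real \<Rightarrow> real) \<Rightarrow> bool) \<Rightarrow> (real \<Rightarrow> 'n::finite symbol) set" where
  "moderate_nets Sc =
     {a. (\<forall>\<epsilon>\<in>{0<..1}. a \<epsilon> \<in> S0) \<and>
         (\<forall>l. \<exists>\<omega>. Sc \<omega> \<and> (\<lambda>\<epsilon>. S0_seminorm l (a \<epsilon>)) \<in> O[at_right 0](\<omega>))}"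

definition negligible_net :: "(real \<Rightarrow> 'n::finite symbol) \<Rightarrow> bool" where
  "negligible_net a \<longleftrightarrow>
     (\<forall>\<epsilon>\<in>{0<..1}. a \<epsilon> \<in> S0) \<and>
     (\<forall>l q :: nat. (\<lambda>\<epsilon>. S0_seminorm l (a \<epsilon>)) \<in> O[at_right 0](\<lambda>\<epsilon>. \<epsilon> ^ q))"

definition net_rel ::
  "((real \<Rightarrow> real) \<Rightarrow> bool) \<Rightarrow> ((real \<Rightarrow> 'n::finite symbol) \<times> (real \<Rightarrow> 'n symbol)) set" where
  "net_rel Sc = {(a, b). a \<in> moderate_nets Sc \<and> b \<in> moderate_nets Sc \<and>
                         negligible_net (\<lambda>\<epsilon> z. a \<epsilon> z - b \<epsilon> z)}"

definition G_sc :: "(real \<Rightarrow> 'n::finite symbol) set set" where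
  "G_sc = moderate_nets slow_scale // net_rel slow_scale"

definition G_lsc :: "(real \<Rightarrow> 'n::finite symbol) set set" where
  "G_lsc = moderate_nets log_slow_scale // net_rel log_slow_scale"

text \<open>
  A matrix symbol is a matrix-valued function, a generalised matrix symbol is a matrix of
  classes of nets of scalar symbols; representatives are taken entrywise.
\<close>

type_synonym ('n, 'm) matrix_symbol = "(real ^ 'n) \<times> (real ^ 'n) \<Rightarrow> complex ^ 'm ^ 'm"

definition representative ::
  "(real \<Rightarrow> ('n::finite, 'm::finite) matrix_symbol) \<Rightarrow>
   ((real \<Rightarrow> 'n symbol) set) ^ 'm ^ 'm \<Rightarrow> bool" where
  "representative A\<epsilon> A \<longleftrightarrow> (\<forall>i j. (\<lambda>\<epsilon> z. A\<epsilon> \<epsilon> z $ i $ j) \<in> A $ i $ j)"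


definition fourier :: "(real ^ 'n::finite \<Rightarrow> complex) \<Rightarrow> real ^ 'n \<Rightarrow> complex" where
  "fourier u \<xi> = (LINT x|lborel. exp (- \<i> * complex_of_real (x \<bullet> \<xi>)) * u x)"

definition psido :: "'n::finite symbol \<Rightarrow> (real ^ 'n \<Rightarrow> complex) \<Rightarrow> real ^ 'n \<Rightarrow> complex" where
  "psido a u x =
     complex_of_real ((2 * pi) powr (- real CARD('n))) *
     (LINT \<xi>|lborel. exp (\<i> * complex_of_real (x \<bullet> \<xi>)) * a (x, \<xi>) * fourier u \<xi>)"

definition matrix_psido ::
  "('n::finite, 'm::finite) matrix_symbol \<Rightarrow> (real ^ 'n \<Rightarrow> complex ^ 'm) \<Rightarrow> real ^ 'n \<Rightarrow> complex ^ 'm"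
  where
  "matrix_psido A u x = (\<chi> i. \<Sum>j\<in>UNIV. psido (\<lambda>z. A z $ i $ j) (\<lambda>y. u y $ j) x)"

definition L2_inner ::
  "(real ^ 'n::finite \<Rightarrow> complex ^ 'm::finite) \<Rightarrow> (real ^ 'n \<Rightarrow> complex ^ 'm) \<Rightarrow> complex" where
  "L2_inner f g = (LINT x|lborel. (\<Sum>j\<in>UNIV. f x $ j * cnj (g x $ j)))"

definition L2_norm :: "(real ^ 'n::finite \<Rightarrow> complex ^ 'm::finite) \<Rightarrow> real" where
  "L2_norm f = sqrt (LINT x|lborel. (norm (f x))\<^sup>2)"

definition sobolev_norm :: "real \<Rightarrow> (real ^ 'n::finite \<Rightarrow> complex ^ 'm::finite) \<Rightarrow> real" where
  "sobolev_norm s u =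
     L2_norm (\<lambda>x. \<chi> j. psido (\<lambda>(y, \<xi>). complex_of_real (jap \<xi> powr s)) (\<lambda>y. u y $ j) x)"


definition adj :: "complex ^ 'm ^ 'm::finite \<Rightarrow> complex ^ 'm ^ 'm" where
  "adj A = transpose (map_matrix cnj A)"

definition Re_mat :: "complex ^ 'm ^ 'm::finite \<Rightarrow> complex ^ 'm ^ 'm" where
  "Re_mat A = (1 / 2) *\<^sub>R (A + adj A)"

text \<open>As for the order of complex numbers, being \<open>\<ge> 0\<close> includes being real.\<close>

definition mat_ge :: "complex ^ 'm ^ 'm::finite \<Rightarrow> complex ^ 'm ^ 'm \<Rightarrow> bool" where
  "mat_ge A B \<longleftrightarrow>
     (\<forall>z. z \<noteq> 0 \<longrightarrow> (\<Sum>i\<in>UNIV. cnj (z $ i) * ((A - B) *v z) $ i) \<in> \<real>\<^sub>\<ge>\<^sub>0)"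

text \<open>
  In a hypothesis "\<open>Re A\<epsilon> (x, \<xi>) \<ge> c \<epsilon> I\<close> for \<open>\<bar>\<xi>\<bar> \<ge> r \<epsilon>\<close>" of Garding's inequality it is \<open>r\<close>
  itself that has to be a slow scale net. The printed hypothesis asks this of \<open>r\<^sup>-\<^sup>1\<close>, which
  does not restrict how large \<open>r\<close> is, and then the inequality fails: take \<open>c = 1\<close>,
  \<open>r \<epsilon> = exp (1 / \<epsilon>)\<close> and \<open>A\<epsilon> (x, \<xi>) = 1 - 2 \<chi> (\<xi> / r \<epsilon>)\<close> with a smooth cut-off
  \<open>0 \<le> \<chi> \<le> 1\<close> supported in the unit ball and equal to 1 near 0. The \<open>S\<^sup>0\<close>-seminorms are bounded
  in \<open>\<epsilon>\<close>, but the remainder constant cannot be smaller than a multiple of \<open>r \<epsilon>\<close>.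
\<close>

end

theory Submission
  imports Defs "HOL-Probability.Probability"
begin

text \<open>
  Replacing \<open>c\<close> by \<open>c' = max c (-T)\<close> with \<open>T\<close> a multiple of the seminorms of \<open>A\<close>, the symbol \<open>A - c' I\<close> has real
  part at least \<open>- M / jap \<xi>\<close>, where \<open>M\<close> is a multiple of \<open>T * (1 + \<bar>r\<bar>)\<close>. So it suffices to prove a sharp
  Garding inequality whose constant is linear in \<open>M\<close> and in finitely many seminorms.

  Integrating by parts in \<open>\<xi>\<close> with \<open>1 - (2/3) \<Delta>\<^sub>\<xi>\<close> inserts powers of \<open>1 / (1 + (2/3) \<bar>x - y\<bar>\<^sup>2)\<close> into the
  kernel at the price of an error of order \<open>-1\<close> in the symbol. These powers are superpositions of
  \<open>exp (-2\<alpha>\<bar>x - k\<bar>\<^sup>2) exp (-\<alpha>\<bar>y - k\<bar>\<^sup>2)\<close>, hence the form is an average over \<open>(\<alpha>, k)\<close> of forms in which both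
  arguments and the amplitude carry a Gaussian cut-off. In each of these the symbol at \<open>\<xi>\<close> is compared with
  its average against squared Gaussian packets of width \<open>jap \<xi> powr (1/2)\<close> around \<open>\<xi>\<close>, for which positivity
  can be used pointwise in \<open>x\<close>. As the first moments of the packets vanish, the difference has a kernel
  bounded by \<open>(1 / jap \<xi> + 1 / jap \<eta>) / jap (\<xi> - \<eta>) ^ N\<close>, and Schur's test applies. The constants
  are polynomial in \<open>\<alpha>\<close> and \<open>1 / sqrt \<alpha>\<close>, and the average has weight \<open>\<alpha> powr (3 n / 2) * exp (-\<alpha>)\<close>.
\<close>

section \<open>Gaussian integrals\<close>

text \<open>The route is dictated by the constants: they must be explicit in finitely many seminorms
  and \<open>\<bar>r\<bar>\<close>, because sums and products of such quantities stay in a class of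
  scales.

  The obstacle is that symbols do not decay in \<open>x\<close>. On the frequency side the kernel of
  the form is then no convergent integral, and Schur's test has nothing to act on; the Gaussian
  cut-off in \<open>x\<close> repairs this. The superposition over \<open>(\<alpha>, k)\<close> is
  an exact identity with nonnegative weights, so lower bounds survive it and no pieces have to be
  glued.

  The width of the packets is forced: their variance, of size \<open>jap \<xi>\<close>, meets second
  derivatives of size \<open>1 / (jap \<xi>)\<^sup>2\<close>, and the product
  \<open>1 / jap \<xi>\<close> is exactly what the norm of order -1/2 pays for.

  The truncation of \<open>c\<close> is there because \<open>c\<close> may be very negative, which
  would spoil the seminorms of \<open>A - c I\<close>. The form is at least \<open>- T\<close>
  anyway, so nothing is lost by stopping there.\<close>

abbreviation wave :: "'a::real_inner \<Rightarrow> 'a \<Rightarrow> complex" where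
  "wave x \<xi> \<equiv> exp (\<i> * complex_of_real (x \<bullet> \<xi>))"

abbreviation wave_cnj :: "'a::real_inner \<Rightarrow> 'a \<Rightarrow> complex" where
  "wave_cnj x \<xi> \<equiv> exp (- \<i> * complex_of_real (x \<bullet> \<xi>))"

section \<open>Affine substitutions and product integrals for Lebesgue measure\<close>

lemma lborel_integrable_affine:
  fixes f :: "'a::euclidean_space \<Rightarrow> 'b::{banach,second_countable_topology}"
  assumes "integrable lborel f" "c \<noteq> 0"
  shows "integrable lborel (\<lambda>x. f (t + c *\<^sub>R x))"
proof -
  have "integrable (density (distr lborel borel (\<lambda>x. t + c *\<^sub>R x)) (\<lambda>_. ennreal (\<bar>c\<bar>^DIM('a)))) f"
    using assms(1) lborel_affine[OF assms(2), of t] by (simp add: ennreal_power[symmetric])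
  then have "integrable (distr lborel borel (\<lambda>x. t + c *\<^sub>R x)) (\<lambda>x. \<bar>c\<bar>^DIM('a) *\<^sub>R f x)"
    using assms(1) by (subst (asm) integrable_density) auto
  then have "integrable lborel (\<lambda>x. \<bar>c\<bar>^DIM('a) *\<^sub>R f (t + c *\<^sub>R x))"
    by (rule integrable_distr[rotated]) simp
  from integrable_scaleR_right[OF this, of "inverse (\<bar>c\<bar>^DIM('a))"]
  show ?thesis using assms(2) by simp
qed

lemma lborel_integral_affine:
  fixes f :: "'a::euclidean_space \<Rightarrow> 'b::{banach,second_countable_topology}"
  assumes "f \<in> borel_measurable borel" "c \<noteq> 0"
  shows "(LINT x|lborel. f x) = \<bar>c\<bar>^DIM('a) *\<^sub>R (LINT x|lborel. f (t + c *\<^sub>R x))"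
proof -
  have "(LINT x|lborel. f x) = (LINT x|density (distr lborel borel (\<lambda>x. t + c *\<^sub>R x)) (\<lambda>_. ennreal (\<bar>c\<bar>^DIM('a))). f x)"
    using lborel_affine[OF assms(2), of t] by (simp add: ennreal_power[symmetric])
  also have "\<dots> = (LINT x|distr lborel borel (\<lambda>x. t + c *\<^sub>R x). \<bar>c\<bar>^DIM('a) *\<^sub>R f x)"
    using assms by (subst integral_density) auto
  also have "\<dots> = (LINT x|lborel. \<bar>c\<bar>^DIM('a) *\<^sub>R f (t + c *\<^sub>R x))"
    using assms by (subst integral_distr) auto
  finally show ?thesis by simp
qed

lemma lborel_integral_shift:
  fixes f :: "'a::euclidean_space \<Rightarrow> 'b::{banach,second_countable_topology}"
  assumes "f \<in> borel_measurable borel"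
  shows "(LINT x|lborel. f (t + x)) = (LINT x|lborel. f x)"
  using lborel_integral_affine[OF assms, of 1 t] by simp

lemma lborel_integrable_shift:
  fixes f :: "'a::euclidean_space \<Rightarrow> 'b::{banach,second_countable_topology}"
  assumes "integrable lborel f"
  shows "integrable lborel (\<lambda>x. f (t + x))"
  using lborel_integrable_affine[OF assms, of 1 t] by simp

lemma lborel_integral_reflect:
  fixes f :: "'a::euclidean_space \<Rightarrow> 'b::{banach,second_countable_topology}"
  assumes "f \<in> borel_measurable borel"
  shows "(LINT x|lborel. f (t - x)) = (LINT x|lborel. f x)"
  using lborel_integral_affine[OF assms, of "-1" t] by simp

lemma lborel_integrable_reflect:
  fixes f :: "'a::euclidean_space \<Rightarrow> 'b::{banach,second_countable_topology}"
  assumes "integrable lborel f"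
  shows "integrable lborel (\<lambda>x. f (t - x))"
  using lborel_integrable_affine[OF assms, of "-1" t] by simp

text \<open>Lebesgue measure is the image of the product of one-dimensional Lebesgue measures over
  \<open>Basis\<close>, so Fubini applies coordinate by coordinate. The Gaussian integrals and the
  integrability of negative powers of \<open>jap\<close> are reduced to one dimension this
  way.\<close>

lemma
  fixes f :: "'a::euclidean_space \<Rightarrow> real \<Rightarrow> 'b::{real_normed_field,banach,second_countable_topology}"
  assumes "\<And>b. b \<in> Basis \<Longrightarrow> integrable lborel (f b)"
  shows lborel_integrable_prod: "integrable lborel (\<lambda>x::'a. \<Prod>b\<in>Basis. f b (x \<bullet> b))"
    and lborel_integral_prod: "(LINT x|lborel. (\<Prod>b\<in>Basis. f b ((x::'a) \<bullet> b))) = (\<Prod>b\<in>Basis. (LINT s|lborel. f b s))"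
proof -
  interpret product_sigma_finite "\<lambda>b::'a. lborel :: real measure" ..
  have [measurable]: "f b \<in> borel_measurable borel" if "b \<in> Basis" for b
    using assms[OF that] by auto
  have m: "(\<lambda>x::'a. \<Prod>b\<in>Basis. f b (x \<bullet> b)) \<in> borel_measurable borel"
    by (intro borel_measurable_prod) measurable
  have eq: "(\<Prod>b\<in>Basis. f b ((\<Sum>b'\<in>Basis. p b' *\<^sub>R b') \<bullet> b)) = (\<Prod>b\<in>Basis. f b (p b))" for p :: "'a \<Rightarrow> real"
    by (intro prod.cong) (auto simp: inner_sum_left_Basis)
  have g: "(\<lambda>p. \<Sum>b\<in>Basis. p b *\<^sub>R b) \<in> measurable (\<Pi>\<^sub>M b\<in>(Basis::'a set). (lborel :: real measure)) borel"
    by measurable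
  have i: "integrable (\<Pi>\<^sub>M b\<in>(Basis::'a set). lborel) (\<lambda>p. \<Prod>b\<in>Basis. f b (p b))"
    using assms by (intro product_integrable_prod) auto
  show "integrable lborel (\<lambda>x::'a. \<Prod>b\<in>Basis. f b (x \<bullet> b))"
    by (subst lborel_eq, subst integrable_distr_eq[OF g m]) (use i in \<open>simp add: eq\<close>)
  show "(LINT x|lborel. (\<Prod>b\<in>Basis. f b ((x::'a) \<bullet> b))) = (\<Prod>b\<in>Basis. (LINT s|lborel. f b s))"
    by (subst lborel_eq, subst integral_distr[OF g m])
      (use assms in \<open>simp add: eq product_integral_prod\<close>)
qed

section \<open>Fourier transforms, products and moments of Gaussians\<close>

lemma
  assumes "\<alpha> > 0"
  shows gaussian_fourier_real_integrable: "integrable lborel (\<lambda>x::real. exp (- \<i> * complex_of_real (x * t)) * complex_of_real (exp (- \<alpha> * x\<^sup>2)))" (is ?I)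
    and gaussian_fourier_real: "(LINT x|lborel. exp (- \<i> * complex_of_real (x * t)) * complex_of_real (exp (- \<alpha> * x\<^sup>2)))
       = complex_of_real (sqrt (pi / \<alpha>) * exp (- t\<^sup>2 / (4 * \<alpha>)))" (is ?E)
proof -
  \<comment> \<open>Rescaling by \<open>c\<close> turns \<open>exp (- \<alpha> * x\<^sup>2)\<close>
    into a multiple of the standard normal density, whose characteristic function is known.\<close>
  define c where "c = 1 / sqrt (2 * \<alpha>)"
  have c: "c > 0" "c\<^sup>2 = 1 / (2 * \<alpha>)" using assms by (auto simp: c_def power_divide)
  have n: "integrable lborel (\<lambda>x. std_normal_density x)" by simp
  have i0: "integrable lborel (\<lambda>x. iexp (- (c * t) * x) * complex_of_real (std_normal_density x))"
    by (rule Bochner_Integration.integrable_bound[OF n]) (auto simp: norm_mult)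
  have "complex_of_real (exp (- ((- (c * t))\<^sup>2) / 2)) = char std_normal_distribution (- (c * t))"
    by (simp add: char_std_normal_distribution)
  also have "\<dots> = (LINT x|lborel. std_normal_density x *\<^sub>R iexp (- (c * t) * x))"
    unfolding char_def by (subst integral_density) auto
  finally have e0: "(LINT x|lborel. iexp (- (c * t) * x) * complex_of_real (std_normal_density x)) = complex_of_real (exp (- ((c * t)\<^sup>2) / 2))"
    by (simp add: scaleR_conv_of_real mult.commute)
  let ?f = "\<lambda>x. exp (- \<i> * complex_of_real (x * t)) * complex_of_real (exp (- \<alpha> * x\<^sup>2))"
  have eq: "?f (0 + c *\<^sub>R x) = complex_of_real (sqrt (2 * pi)) * (iexp (- (c * t) * x) * complex_of_real (std_normal_density x))" for x
  proof -
    have "\<alpha> * (c * x)\<^sup>2 = x\<^sup>2 / 2" using assms by (simp add: power_mult_distrib c(2))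
    then show ?thesis by (simp add: std_normal_density_def algebra_simps)
  qed
  have m: "?f \<in> borel_measurable borel" by measurable
  have i1: "integrable lborel (\<lambda>x. ?f (0 + c *\<^sub>R x))" unfolding eq using i0 by (rule integrable_mult_right)
  have "integrable lborel (\<lambda>x. (\<lambda>x. ?f (0 + c *\<^sub>R x)) (0 + (1/c) *\<^sub>R x))"
    using i1 by (rule lborel_integrable_affine) (use c in auto)
  then show ?I using c by simp
  have "(LINT x|lborel. ?f x) = \<bar>c\<bar> ^ DIM(real) *\<^sub>R (LINT x|lborel. ?f (0 + c *\<^sub>R x))"
    by (rule lborel_integral_affine[OF m]) (use c in auto)
  also have "\<dots> = complex_of_real (c * sqrt (2 * pi) * exp (- ((c * t)\<^sup>2) / 2))"
    unfolding eq integral_mult_right_zero e0 using c by (simp add: scaleR_conv_of_real)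
  also have "c * sqrt (2 * pi) = sqrt (pi / \<alpha>)"
    by (simp add: c_def real_sqrt_divide real_sqrt_mult)
  also have "- (c * t)\<^sup>2 / 2 = - t\<^sup>2 / (4 * \<alpha>)" by (simp add: power_mult_distrib c(2))
  finally show ?E .
qed

lemma norm_sq_Basis: "(norm (x::'a::euclidean_space))\<^sup>2 = (\<Sum>b\<in>Basis. (x \<bullet> b)\<^sup>2)"
  by (subst power2_norm_eq_inner, subst euclidean_inner) (simp add: power2_eq_square)

lemma
  fixes \<xi> :: "'a::euclidean_space"
  assumes "\<alpha> > 0"
  shows gaussian_fourier_integrable: "integrable lborel (\<lambda>x. wave_cnj x \<xi> * complex_of_real (exp (- \<alpha> * (norm x)\<^sup>2)))" (is ?I)
    and gaussian_fourier: "(LINT x|lborel. wave_cnj x \<xi> * complex_of_real (exp (- \<alpha> * (norm x)\<^sup>2)))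
       = complex_of_real (sqrt (pi / \<alpha>) ^ DIM('a) * exp (- (norm \<xi>)\<^sup>2 / (4 * \<alpha>)))" (is ?E)
proof -
  let ?f = "\<lambda>b s. exp (- \<i> * complex_of_real (s * (\<xi> \<bullet> b))) * complex_of_real (exp (- \<alpha> * s\<^sup>2))"
  have eq: "(\<Prod>b\<in>Basis. ?f b (x \<bullet> b)) = wave_cnj x \<xi> * complex_of_real (exp (- \<alpha> * (norm x)\<^sup>2))" for x
    unfolding norm_sq_Basis euclidean_inner[of x \<xi>]
    by (simp add: prod.distrib exp_sum[symmetric] sum_negf sum_distrib_left of_real_prod[symmetric] del: of_real_prod of_real_mult)
  have i: "integrable lborel (?f b)" for b
    by (rule gaussian_fourier_real_integrable[OF assms])
  show ?I using lborel_integrable_prod[of ?f, OF i] unfolding eq .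
  have "(LINT x|lborel. wave_cnj x \<xi> * complex_of_real (exp (- \<alpha> * (norm x)\<^sup>2)))
     = (\<Prod>b\<in>Basis. complex_of_real (sqrt (pi / \<alpha>) * exp (- (\<xi> \<bullet> b)\<^sup>2 / (4 * \<alpha>))))"
    using lborel_integral_prod[of ?f, OF i] unfolding eq by (simp only: gaussian_fourier_real[OF assms])
  also have "\<dots> = complex_of_real (sqrt (pi / \<alpha>) ^ DIM('a) * exp (- (norm \<xi>)\<^sup>2 / (4 * \<alpha>)))"
    unfolding norm_sq_Basis
    by (simp add: prod.distrib exp_sum[symmetric] sum_negf sum_divide_distrib of_real_prod[symmetric] del: of_real_prod of_real_mult)
  finally show ?E .
qed

lemma
  assumes "\<alpha> > 0"
  shows gaussian_integrable: "integrable lborel (\<lambda>x::'a::euclidean_space. exp (- \<alpha> * (norm x)\<^sup>2))"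
    and gaussian_integral: "(LINT x::'a|lborel. exp (- \<alpha> * (norm x)\<^sup>2)) = sqrt (pi / \<alpha>) ^ DIM('a)"
proof -
  have "integrable lborel (\<lambda>x::'a. complex_of_real (exp (- \<alpha> * (norm x)\<^sup>2)))"
    using gaussian_fourier_integrable[OF assms, of "0::'a"] by simp
  then show "integrable lborel (\<lambda>x::'a. exp (- \<alpha> * (norm x)\<^sup>2))"
    by (subst (asm) complex_of_real_integrable_eq)
  have "complex_of_real (LINT x::'a|lborel. exp (- \<alpha> * (norm x)\<^sup>2)) = complex_of_real (sqrt (pi / \<alpha>) ^ DIM('a))"
    using gaussian_fourier[OF assms, of "0::'a"] by (simp flip: integral_complex_of_real)
  then show "(LINT x::'a|lborel. exp (- \<alpha> * (norm x)\<^sup>2)) = sqrt (pi / \<alpha>) ^ DIM('a)"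
    by (simp only: of_real_eq_iff)
qed

lemma
  fixes k :: "'a::euclidean_space"
  assumes "\<alpha> > 0"
  shows gaussian_shift_integrable: "integrable lborel (\<lambda>x. exp (- \<alpha> * (norm (x - k))\<^sup>2))"
    and gaussian_shift_integral: "(LINT x|lborel. exp (- \<alpha> * (norm (x - k))\<^sup>2)) = sqrt (pi / \<alpha>) ^ DIM('a)"
  using lborel_integrable_shift[OF gaussian_integrable[OF assms], of "-k"]
    lborel_integral_shift[of "\<lambda>x::'a. exp (- \<alpha> * (norm x)\<^sup>2)" "-k"] gaussian_integral[OF assms, where 'a='a]
  by (simp_all)

text \<open>The point \<open>k\<close> is compared with the weighted mean of \<open>x\<close> and
  \<open>y\<close>; what is left over does not depend on \<open>k\<close>. The coefficient
  \<open>a * b / (a + b)\<close> equals \<open>2 / 3 * \<alpha>\<close> for the weights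
  \<open>2 * \<alpha>\<close> and \<open>\<alpha>\<close>, which is where the number 2/3 in
  \<open>resolvent_op\<close> and \<open>bessel_weight\<close> comes from.\<close>

lemma complete_square:
  fixes x y k :: "'a::real_inner"
  assumes "a + b \<noteq> (0::real)"
  shows "a * (norm (x - k))\<^sup>2 + b * (norm (y - k))\<^sup>2
     = (a + b) * (norm (k - (1 / (a + b)) *\<^sub>R (a *\<^sub>R x + b *\<^sub>R y)))\<^sup>2 + a * b / (a + b) * (norm (x - y))\<^sup>2"
proof -
  define c where "c = 1 / (a + b)"
  have c: "(a + b) * c = 1" using assms by (simp add: c_def)
  define v where "v = a *\<^sub>R x + b *\<^sub>R y"
  have e: "(norm (u - w))\<^sup>2 = u \<bullet> u - 2 * (u \<bullet> w) + w \<bullet> w" for u w :: 'a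
    by (simp add: power2_norm_eq_inner algebra_simps inner_commute)
  have "(a + b) * (norm (k - c *\<^sub>R v))\<^sup>2 = (a + b) * (k \<bullet> k) - 2 * ((a + b) * c) * (k \<bullet> v) + ((a + b) * c) * c * (v \<bullet> v)"
    unfolding e by (simp add: algebra_simps)
  also have "\<dots> = (a + b) * (k \<bullet> k) - 2 * (k \<bullet> v) + c * (v \<bullet> v)" unfolding c by simp
  finally have 1: "(a + b) * (norm (k - c *\<^sub>R v))\<^sup>2 = (a + b) * (k \<bullet> k) - 2 * (k \<bullet> v) + c * (v \<bullet> v)" .
  have 2: "v \<bullet> v + a * b * (norm (x - y))\<^sup>2 = (a + b) * (a * (x \<bullet> x) + b * (y \<bullet> y))"
    unfolding e v_def by (simp add: algebra_simps inner_commute)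
  have 3: "c * (v \<bullet> v) + c * (a * b * (norm (x - y))\<^sup>2) = a * (x \<bullet> x) + b * (y \<bullet> y)"
    unfolding distrib_left[symmetric] 2 using c by (simp add: mult.assoc[symmetric] mult.commute[of c])
  have "a * (norm (x - k))\<^sup>2 + b * (norm (y - k))\<^sup>2 = (a + b) * (k \<bullet> k) - 2 * (k \<bullet> v) + (a * (x \<bullet> x) + b * (y \<bullet> y))"
    unfolding e v_def by (simp add: algebra_simps inner_commute)
  then show ?thesis using 1 3 by (simp add: c_def v_def)
qed

text \<open>Integrating out the common centre leaves a Gaussian in the difference. This gives the
  overlap of two packets of different width, and it is the identity behind the superposition of
  powers of \<open>bessel_weight\<close>.\<close>

lemma
  fixes x y :: "'a::euclidean_space"
  assumes "a > 0" "b > 0"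
  shows gaussian_product_integrable: "integrable lborel (\<lambda>k. exp (- a * (norm (x - k))\<^sup>2) * exp (- b * (norm (y - k))\<^sup>2))"
    and gaussian_product_integral: "(LINT k|lborel. exp (- a * (norm (x - k))\<^sup>2) * exp (- b * (norm (y - k))\<^sup>2))
      = sqrt (pi / (a + b)) ^ DIM('a) * exp (- (a * b / (a + b)) * (norm (x - y))\<^sup>2)"
proof -
  let ?m = "(1 / (a + b)) *\<^sub>R (a *\<^sub>R x + b *\<^sub>R y)"
  have ab: "a + b > 0" using assms by simp
  have eq: "exp (- a * (norm (x - k))\<^sup>2) * exp (- b * (norm (y - k))\<^sup>2)
     = exp (- (a * b / (a + b)) * (norm (x - y))\<^sup>2) * exp (- (a + b) * (norm (k - ?m))\<^sup>2)" for k
  proof -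
    have "- a * (norm (x - k))\<^sup>2 + - b * (norm (y - k))\<^sup>2
      = - (a * b / (a + b)) * (norm (x - y))\<^sup>2 + - (a + b) * (norm (k - ?m))\<^sup>2"
      using complete_square[of a b x k y] ab by linarith
    then show ?thesis by (simp only: exp_add[symmetric])
  qed
  show "integrable lborel (\<lambda>k. exp (- a * (norm (x - k))\<^sup>2) * exp (- b * (norm (y - k))\<^sup>2))"
    unfolding eq by (rule integrable_mult_right) (rule gaussian_shift_integrable[OF ab])
  show "(LINT k|lborel. exp (- a * (norm (x - k))\<^sup>2) * exp (- b * (norm (y - k))\<^sup>2))
      = sqrt (pi / (a + b)) ^ DIM('a) * exp (- (a * b / (a + b)) * (norm (x - y))\<^sup>2)"
    unfolding eq integral_mult_right_zero gaussian_shift_integral[OF ab] by simp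
qed

text \<open>The exponential series in \<open>s\<^sup>2 / 2\<close> controls the even power
  \<open>s ^ k * s ^ k\<close>; a general power is reached through
  \<open>s ^ k \<le> 1 + s ^ k * s ^ k\<close>.\<close>

lemma power_le_exp_half_square: "\<exists>C\<ge>1. \<forall>s\<ge>0. s ^ k \<le> C * exp (s\<^sup>2 / 2 :: real)"
proof (rule exI[of _ "1 + 2 ^ k * fact k"], intro conjI allI impI)
  show "1 \<le> (1 + 2 ^ k * fact k :: real)" by simp
  fix s :: real assume s: "s \<ge> 0"
  define y where "y = s\<^sup>2 / 2"
  have "(\<Sum>n\<in>{k}. y ^ n /\<^sub>R fact n) \<le> exp y"
    unfolding exp_def by (intro sum_le_suminf summable_exp_generic) (auto simp: y_def)
  then have "y ^ k \<le> fact k * exp y"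
    by (simp add: field_simps)
  then have "2 ^ k * y ^ k \<le> 2 ^ k * (fact k * exp y)" by (intro mult_left_mono) auto
  moreover have "2 ^ k * y ^ k = s ^ k * s ^ k"
    by (simp add: y_def power_mult_distrib[symmetric] power2_eq_square)
  moreover have "s ^ k \<le> 1 + s ^ k * s ^ k"
  proof -
    have "0 \<le> (s ^ k - 1/2) * (s ^ k - 1/2)" by simp
    also have "\<dots> = s ^ k * s ^ k - s ^ k + 1/4" by (simp add: algebra_simps)
    finally show ?thesis by linarith
  qed
  moreover have "1 \<le> exp y" by (simp add: y_def)
  moreover have "(1 + 2 ^ k * fact k) * exp y = exp y + 2 ^ k * (fact k * exp y)"
    by (simp add: distrib_right mult.assoc)
  ultimately show "s ^ k \<le> (1 + 2 ^ k * fact k) * exp (s\<^sup>2 / 2)"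
    unfolding y_def[symmetric] by linarith
qed

text \<open>One half of the exponent absorbs the polynomial. Measuring \<open>x\<close> in units of
  \<open>1 / sqrt \<alpha>\<close> keeps \<open>C\<close> independent of \<open>\<alpha>\<close>, as
  the later average over \<open>\<alpha>\<close> requires.\<close>

lemma gaussian_moment:
  "\<exists>C\<ge>1. \<forall>\<alpha>>0. integrable lborel (\<lambda>x::'a::euclidean_space. (sqrt \<alpha> * norm x) ^ k * exp (- \<alpha> * (norm x)\<^sup>2))
     \<and> (LINT x::'a|lborel. (sqrt \<alpha> * norm x) ^ k * exp (- \<alpha> * (norm x)\<^sup>2)) \<le> C * (1 / sqrt \<alpha>) ^ DIM('a)"
proof -
  obtain C where C: "C \<ge> 1" "\<And>s. s \<ge> 0 \<Longrightarrow> s ^ k \<le> C * exp (s\<^sup>2 / 2 :: real)"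
    using power_le_exp_half_square by blast
  show ?thesis
  proof (intro exI[of _ "C * sqrt (2 * pi) ^ DIM('a)"] conjI allI impI)
    have "1 \<le> sqrt (2 * pi) ^ DIM('a)" using pi_ge_two by (intro one_le_power) auto
    then show "1 \<le> C * sqrt (2 * pi) ^ DIM('a)" using C(1) by (metis mult_mono' mult_1 zero_le_one)
    fix \<alpha> :: real assume \<alpha>: "\<alpha> > 0"
    have le: "(sqrt \<alpha> * norm x) ^ k * exp (- \<alpha> * (norm x)\<^sup>2) \<le> C * exp (- (\<alpha> / 2) * (norm x)\<^sup>2)" for x :: 'a
    proof -
      have "(sqrt \<alpha> * norm x) ^ k * exp (- \<alpha> * (norm x)\<^sup>2) \<le> (C * exp (\<alpha> * (norm x)\<^sup>2 / 2)) * exp (- \<alpha> * (norm x)\<^sup>2)"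
        using C(2)[of "sqrt \<alpha> * norm x"] \<alpha> by (intro mult_right_mono) (auto simp: power_mult_distrib)
      also have "\<dots> = C * exp (- (\<alpha> / 2) * (norm x)\<^sup>2)" by (simp flip: exp_add)
      finally show ?thesis .
    qed
    have g: "integrable lborel (\<lambda>x::'a. C * exp (- (\<alpha> / 2) * (norm x)\<^sup>2))"
      by (rule integrable_mult_right, rule gaussian_integrable) (use \<alpha> in auto)
    show i: "integrable lborel (\<lambda>x::'a. (sqrt \<alpha> * norm x) ^ k * exp (- \<alpha> * (norm x)\<^sup>2))"
      by (rule Bochner_Integration.integrable_bound[OF g])
        (use le \<alpha> C in \<open>auto simp: intro!: AE_I2 order.trans[OF _ abs_ge_self]\<close>)
    have "(LINT x::'a|lborel. (sqrt \<alpha> * norm x) ^ k * exp (- \<alpha> * (norm x)\<^sup>2)) \<le> (LINT x::'a|lborel. C * exp (- (\<alpha> / 2) * (norm x)\<^sup>2))"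
      by (rule integral_mono[OF i g le])
    also have "\<dots> = C * sqrt (pi / (\<alpha> / 2)) ^ DIM('a)"
      using gaussian_integral[of "\<alpha>/2", where 'a='a] \<alpha> by simp
    also have "sqrt (pi / (\<alpha> / 2)) = sqrt (2 * pi) * (1 / sqrt \<alpha>)"
      by (simp add: real_sqrt_mult real_sqrt_divide)
    finally show "(LINT x::'a|lborel. (sqrt \<alpha> * norm x) ^ k * exp (- \<alpha> * (norm x)\<^sup>2)) \<le> C * sqrt (2 * pi) ^ DIM('a) * (1 / sqrt \<alpha>) ^ DIM('a)"
      by (simp only: power_mult_distrib mult.assoc)
  qed
qed

text \<open>Tonelli with a majorant given section by section: \<open>g x\<close> is integrated in
  \<open>y\<close>, and \<open>G\<close> dominates the result in \<open>x\<close>. The exchanges of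
  integrals below are justified through this criterion or its product form.\<close>

lemma integrable_pair_lborel:
  fixes f :: "'a::euclidean_space \<Rightarrow> 'b::euclidean_space \<Rightarrow> 'c::{banach, second_countable_topology}"
  assumes "case_prod f \<in> borel_measurable borel"
    and "\<And>x y. norm (f x y) \<le> g x y"
    and "\<And>x. integrable lborel (g x)" and "\<And>x. (LINT y|lborel. g x y) \<le> G x" and "integrable lborel G"
  shows "integrable (lborel \<Otimes>\<^sub>M lborel) (case_prod f)"
proof (rule lborel_pair.Fubini_integrable)
  have m[measurable]: "case_prod f \<in> borel_measurable (lborel \<Otimes>\<^sub>M lborel)"
    using assms(1) by (simp add: lborel_prod)
  show "case_prod f \<in> borel_measurable (lborel \<Otimes>\<^sub>M lborel)" by fact
  have i: "integrable lborel (f x)" for x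
  proof (rule Bochner_Integration.integrable_bound[OF assms(3)[of x]])
    show "f x \<in> borel_measurable lborel"
      using measurable_Pair2[OF m, of x] by (simp add: comp_def)
    show "AE y in lborel. norm (f x y) \<le> norm (g x y)"
      using assms(2) by (auto intro: order.trans[OF _ abs_ge_self])
  qed
  then show "AE x in lborel. integrable lborel (\<lambda>y. case_prod f (x, y))" by simp
  have "(LINT y|lborel. norm (f x y)) \<le> G x" for x
    by (rule order.trans[OF integral_mono assms(4)]) (use i assms in auto)
  moreover have "(\<lambda>x. LINT y|lborel. norm (f x y)) \<in> borel_measurable lborel"
    by measurable
  ultimately show "integrable lborel (\<lambda>x. LINT y|lborel. norm (case_prod f (x, y)))"
    by (intro Bochner_Integration.integrable_bound[OF assms(5)])
       (auto intro!: AE_I2 order.trans[OF _ abs_ge_self] simp: integral_nonneg_AE)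
qed

lemma integrable_pair_lborel_mult:
  fixes f :: "'a::euclidean_space \<Rightarrow> 'b::euclidean_space \<Rightarrow> 'c::{banach, second_countable_topology}"
  assumes "case_prod f \<in> borel_measurable borel"
    and "\<And>x y. norm (f x y) \<le> g x * h y"
    and "integrable lborel g" and "integrable lborel h"
  shows "integrable (lborel \<Otimes>\<^sub>M lborel) (case_prod f)"
proof (rule integrable_pair_lborel[where g = "\<lambda>x y. g x * h y" and G = "\<lambda>x. g x * (LINT y|lborel. h y)"])
qed (use assms in auto)

section \<open>Fourier inversion and the Plancherel theorem\<close>

lemma continuous_on_integral_param:
  fixes F :: "'z::metric_space \<Rightarrow> 'a::euclidean_space \<Rightarrow> 'b::{banach, second_countable_topology}"
  assumes "\<And>x. continuous_on UNIV (\<lambda>z. F z x)" and m: "\<And>z. F z \<in> borel_measurable borel"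
    and "\<And>z x. norm (F z x) \<le> w x" and "integrable lborel w"
  shows "continuous_on UNIV (\<lambda>z. LINT x|lborel. F z x)"
  unfolding continuous_on_sequentially comp_def
proof (intro allI ballI impI, elim conjE)
  fix X :: "nat \<Rightarrow> 'z" and a assume X: "X \<longlonglongrightarrow> a"
  show "(\<lambda>n. LINT x|lborel. F (X n) x) \<longlonglongrightarrow> (LINT x|lborel. F a x)"
  proof (rule integral_dominated_convergence[where w = w])
    show "AE x in lborel. (\<lambda>i. F (X i) x) \<longlonglongrightarrow> F a x"
    proof (rule AE_I2)
      fix x show "(\<lambda>i. F (X i) x) \<longlonglongrightarrow> F a x"
        using continuous_on_tendsto_compose[OF assms(1) X] by simp
    qed
  qed (use assms in auto)
qed

text \<open>Dominated convergence of the difference quotients along sequences. The mean value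
  inequality turns the bound \<open>w\<close> on the derivative into the same bound on all
  quotients, so one majorant serves both.\<close>

lemma has_vector_derivative_integral_param:
  fixes F :: "real \<Rightarrow> 'a::euclidean_space \<Rightarrow> 'b::{banach, second_countable_topology}"
  assumes d: "\<And>s x. ((\<lambda>s. F s x) has_vector_derivative F' s x) (at s)"
    and i: "\<And>s. integrable lborel (F s)" and m: "\<And>s. F' s \<in> borel_measurable borel"
    and b: "\<And>s x. norm (F' s x) \<le> w x" and w: "integrable lborel w"
  shows "((\<lambda>s. LINT x|lborel. F s x) has_vector_derivative (LINT x|lborel. F' s x)) (at s)"
proof -
  have "((\<lambda>h. (1 / h) *\<^sub>R ((LINT x|lborel. F (s + h) x) - (LINT x|lborel. F s x))) \<longlongrightarrow> (LINT x|lborel. F' s x)) (at 0)"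
    unfolding tendsto_at_iff_sequentially
  proof (intro allI impI)
    fix X :: "nat \<Rightarrow> real" assume X: "\<forall>i. X i \<in> UNIV - {0}" "X \<longlonglongrightarrow> 0"
    have "(\<lambda>n. LINT x|lborel. (1 / X n) *\<^sub>R (F (s + X n) x - F s x)) \<longlonglongrightarrow> (LINT x|lborel. F' s x)"
    proof (rule integral_dominated_convergence[where w = w])
      show "AE x in lborel. (\<lambda>n. (1 / X n) *\<^sub>R (F (s + X n) x - F s x)) \<longlonglongrightarrow> F' s x"
      proof (rule AE_I2)
        fix x
        have "((\<lambda>h. (1 / (h - s)) *\<^sub>R (F h x - F s x)) \<longlongrightarrow> F' s x) (at s)"
        proof -
          have "((\<lambda>y. (F y x - (F s x + (y - s) *\<^sub>R F' s x)) /\<^sub>R norm (y - s)) \<longlongrightarrow> 0) (at s)"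
            using d[of x s] unfolding has_vector_derivative_def has_derivative_at_within by (simp add: diff_diff_eq)
          then have "((\<lambda>y. norm ((F y x - (F s x + (y - s) *\<^sub>R F' s x)) /\<^sub>R norm (y - s))) \<longlongrightarrow> 0) (at s)"
            by (rule tendsto_norm_zero)
          then have "((\<lambda>y. norm ((1 / (y - s)) *\<^sub>R (F y x - F s x) - F' s x)) \<longlongrightarrow> 0) (at s)"
          proof (rule Lim_transform_eventually)
            show "\<forall>\<^sub>F y in at s. norm ((F y x - (F s x + (y - s) *\<^sub>R F' s x)) /\<^sub>R norm (y - s)) =
                  norm ((1 / (y - s)) *\<^sub>R (F y x - F s x) - F' s x)"
              unfolding eventually_at_filter
            proof (rule always_eventually, intro allI impI)
              fix y assume y: "y \<noteq> s"
              have "(1 / (y - s)) *\<^sub>R (F y x - F s x) - F' s x = (1 / (y - s)) *\<^sub>R (F y x - (F s x + (y - s) *\<^sub>R F' s x))"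
                using y by (simp add: scaleR_right_diff_distrib scaleR_right_distrib)
              then show "norm ((F y x - (F s x + (y - s) *\<^sub>R F' s x)) /\<^sub>R norm (y - s)) =
                  norm ((1 / (y - s)) *\<^sub>R (F y x - F s x) - F' s x)"
                by (simp add: divide_inverse)
            qed
          qed
          then show ?thesis using tendsto_norm_zero_iff Lim_null by blast
        qed
        moreover have "(\<lambda>n. s + X n) \<longlonglongrightarrow> s" using tendsto_add[OF tendsto_const X(2), of s] by simp
        ultimately have "((\<lambda>h. (1 / (h - s)) *\<^sub>R (F h x - F s x)) \<circ> (\<lambda>n. s + X n)) \<longlonglongrightarrow> F' s x"
          unfolding tendsto_at_iff_sequentially using X(1) by auto
        then show "(\<lambda>n. (1 / X n) *\<^sub>R (F (s + X n) x - F s x)) \<longlonglongrightarrow> F' s x" by (simp add: comp_def)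
      qed
      fix n
      show "AE x in lborel. norm ((1 / X n) *\<^sub>R (F (s + X n) x - F s x)) \<le> w x"
      proof (rule AE_I2)
        fix x
        have "norm (F (s + X n) x - F s x) \<le> w x * norm (s + X n - s)"
        proof (rule differentiable_bound)
          show "convex (UNIV :: real set)" by simp
          show "((\<lambda>s. F s x) has_derivative (\<lambda>h. h *\<^sub>R F' t x)) (at t within UNIV)" for t
            using d[of x t] by (simp add: has_vector_derivative_def)
          show "onorm (\<lambda>h. h *\<^sub>R F' t x) \<le> w x" for t
            by (rule onorm_le) (use b[of t x] in \<open>simp add: mult.commute mult_left_mono\<close>)
        qed auto
        then show "norm ((1 / X n) *\<^sub>R (F (s + X n) x - F s x)) \<le> w x"
          using X(1) by (simp add: divide_simps)
      qed
    qed (use i m w in auto)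
    then show "((\<lambda>h. (1 / h) *\<^sub>R ((LINT x|lborel. F (s + h) x) - (LINT x|lborel. F s x))) \<circ> X) \<longlonglongrightarrow> (LINT x|lborel. F' s x)"
      using i by (simp add: comp_def)
  qed
  then have "((\<lambda>h. norm ((1 / h) *\<^sub>R ((LINT x|lborel. F (s + h) x) - (LINT x|lborel. F s x)) - (LINT x|lborel. F' s x))) \<longlongrightarrow> 0) (at 0)"
    unfolding tendsto_norm_zero_iff by (rule LIM_zero)
  then have "((\<lambda>h. norm ((LINT x|lborel. F (s + h) x) - (LINT x|lborel. F s x) - h *\<^sub>R (LINT x|lborel. F' s x)) / norm h) \<longlongrightarrow> 0) (at 0)"
  proof (rule Lim_transform_eventually)
    show "\<forall>\<^sub>F h in at 0. norm ((1 / h) *\<^sub>R ((LINT x|lborel. F (s + h) x) - (LINT x|lborel. F s x)) - (LINT x|lborel. F' s x)) =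
       norm ((LINT x|lborel. F (s + h) x) - (LINT x|lborel. F s x) - h *\<^sub>R (LINT x|lborel. F' s x)) / norm h"
      unfolding eventually_at_filter
    proof (rule always_eventually, intro allI impI)
      fix h :: real assume h: "h \<noteq> 0"
      have "(1 / h) *\<^sub>R ((LINT x|lborel. F (s + h) x) - (LINT x|lborel. F s x)) - (LINT x|lborel. F' s x)
        = (1 / h) *\<^sub>R ((LINT x|lborel. F (s + h) x) - (LINT x|lborel. F s x) - h *\<^sub>R (LINT x|lborel. F' s x))"
        using h by (simp add: scaleR_right_diff_distrib)
      then show "norm ((1 / h) *\<^sub>R ((LINT x|lborel. F (s + h) x) - (LINT x|lborel. F s x)) - (LINT x|lborel. F' s x)) =
       norm ((LINT x|lborel. F (s + h) x) - (LINT x|lborel. F s x) - h *\<^sub>R (LINT x|lborel. F' s x)) / norm h"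
        by simp
    qed
  qed
  then show ?thesis
    unfolding has_vector_derivative_def has_derivative_at by (simp add: bounded_linear_scaleR_left)
qed

text \<open>By the fundamental theorem of calculus \<open>h (v + x) - h x\<close> is the integral of
  \<open>h'\<close> over the segment from \<open>x\<close> to \<open>x + v\<close>. Integrated over
  \<open>x\<close>, one side vanishes and the other is the integral of \<open>h'\<close>, both by
  translation invariance. All integrations by parts rest on this form, in which integrability takes
  the place of boundary terms at infinity.\<close>

lemma integral_directional_derivative_zero:
  fixes h :: "'a::euclidean_space \<Rightarrow> complex"
  assumes d: "\<And>x s. ((\<lambda>s. h (x + s *\<^sub>R v)) has_vector_derivative h' (x + s *\<^sub>R v)) (at s)"
    and i: "integrable lborel h" and i': "integrable lborel h'" and c: "continuous_on UNIV h'"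
  shows "(LINT x|lborel. h' x) = 0"
proof -
  define f where "f = (\<lambda>s x. indicator {0..1::real} s *\<^sub>R h' (s *\<^sub>R v + x))"
  have m[measurable]: "h' \<in> borel_measurable borel" using i' by auto
  have "integrable (lborel \<Otimes>\<^sub>M lborel) (case_prod f)"
  proof (rule integrable_pair_lborel[where g = "\<lambda>s x. indicator {0..1::real} s * norm (h' (s *\<^sub>R v + x))" and G = "\<lambda>s. indicator {0..1::real} s * (LINT x|lborel. norm (h' x))"])
    show "case_prod f \<in> borel_measurable borel" unfolding f_def
      by (simp add: borel_prod[symmetric])
    show "norm (f s x) \<le> indicator {0..1} s * norm (h' (s *\<^sub>R v + x))" for s x by (simp add: f_def)
    show "integrable lborel (\<lambda>x. indicator {0..1::real} s * norm (h' (s *\<^sub>R v + x)))" for s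
      by (intro integrable_mult_right integrable_norm lborel_integrable_shift i')
    show "(LINT x|lborel. indicator {0..1::real} s * norm (h' (s *\<^sub>R v + x))) \<le> indicator {0..1::real} s * (LINT x|lborel. norm (h' x))" for s
      using lborel_integral_shift[of "\<lambda>x. norm (h' x)" "s *\<^sub>R v"] by simp
    show "integrable lborel (\<lambda>s. indicator {0..1::real} s * (LINT x|lborel. norm (h' x)))"
      by (intro integrable_mult_left) (auto simp: integrable_indicator_iff)
  qed
  then have "(LINT x|lborel. LINT s|lborel. f s x) = (LINT s|lborel. LINT x|lborel. f s x)"
    by (rule lborel_pair.Fubini_integral)
  moreover have "(LINT s|lborel. f s x) = h (v + x) - h x" for x
  proof -
    have "(LINT s|lborel. indicator {0..1} s *\<^sub>R h' (x + s *\<^sub>R v)) = h (x + 1 *\<^sub>R v) - h (x + 0 *\<^sub>R v)"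
      by (rule integral_FTC_Icc)
        (auto intro!: has_vector_derivative_at_within d continuous_intros continuous_on_compose2[OF c])
    then show ?thesis by (simp add: f_def add.commute)
  qed
  moreover have "(LINT x|lborel. f s x) = indicator {0..1} s *\<^sub>R (LINT x|lborel. h' x)" for s
    using lborel_integral_shift[of h' "s *\<^sub>R v"] by (simp add: f_def)
  moreover have "(LINT x|lborel. h (v + x) - h x) = 0"
    using i lborel_integral_shift[of h v] lborel_integrable_shift[OF i, of v] by simp
  ultimately show ?thesis by (simp add: integral_scaleR_left)
qed

lemma norm_exp_i [simp]:
  "norm (exp (\<i> * complex_of_real t)) = 1" "norm (exp (- \<i> * complex_of_real t)) = 1"
  "norm (exp (- (\<i> * complex_of_real t))) = 1"
  by (simp_all add: norm_exp_eq_Re)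

section \<open>Inversion and Plancherel by Gaussian regularisation\<close>

lemma fourier_integrand_integrable:
  fixes f :: "real^'n::finite \<Rightarrow> complex"
  assumes "integrable lborel f"
  shows "integrable lborel (\<lambda>x. wave_cnj x \<xi> * f x)"
proof (rule Bochner_Integration.integrable_bound[OF assms])
  have [measurable]: "f \<in> borel_measurable borel" using assms by auto
  show "(\<lambda>x. wave_cnj x \<xi> * f x) \<in> borel_measurable lborel" by measurable
qed (simp add: norm_mult)

lemma norm_fourier_le: "norm (fourier f \<xi>) \<le> (LINT x|lborel. norm (f x))"
  unfolding fourier_def by (rule order.trans[OF integral_norm_bound]) (simp add: norm_mult)

lemma continuous_on_fourier:
  fixes f :: "real^'n::finite \<Rightarrow> complex"
  assumes "integrable lborel f"
  shows "continuous_on UNIV (fourier f)"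
  unfolding fourier_def
proof (rule continuous_on_integral_param[where w = "\<lambda>x. norm (f x)"])
  have [measurable]: "f \<in> borel_measurable borel" using assms by auto
  show "(\<lambda>x. wave_cnj x \<xi> * f x) \<in> borel_measurable borel" for \<xi> by measurable
  show "continuous_on UNIV (\<lambda>\<xi>. wave_cnj x \<xi> * f x)" for x
    by (intro continuous_intros)
qed (use assms in \<open>simp_all add: norm_mult\<close>)

lemma borel_measurable_fourier[measurable]: "integrable lborel f \<Longrightarrow> fourier f \<in> borel_measurable borel"
  by (intro borel_measurable_continuous_onI continuous_on_fourier)

text \<open>Continuity gives the pointwise limit and boundedness the majorant. The Gaussian is not
  normalised, hence the factor \<open>sqrt pi ^ DIM('a)\<close>.\<close>

lemma approximate_identity:
  fixes f :: "'a::euclidean_space \<Rightarrow> complex"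
  assumes c: "continuous_on UNIV f" and b: "\<And>x. norm (f x) \<le> B" and s: "s \<longlonglongrightarrow> 0"
  shows "(\<lambda>j. LINT w|lborel. f (x - s j *\<^sub>R w) * complex_of_real (exp (- (norm w)\<^sup>2))) \<longlonglongrightarrow> complex_of_real (sqrt pi ^ DIM('a)) * f x"
proof -
  have m[measurable]: "f \<in> borel_measurable borel" using c by (rule borel_measurable_continuous_onI)
  have g: "integrable lborel (\<lambda>w::'a. exp (- (norm w)\<^sup>2))" "(LINT w::'a|lborel. exp (- (norm w)\<^sup>2)) = sqrt pi ^ DIM('a)"
    using gaussian_integrable[of 1, where 'a='a] gaussian_integral[of 1, where 'a='a] by auto
  have "(\<lambda>j. LINT w|lborel. f (x - s j *\<^sub>R w) * complex_of_real (exp (- (norm w)\<^sup>2))) \<longlonglongrightarrow> (LINT w|lborel. f x * complex_of_real (exp (- (norm (w::'a))\<^sup>2)))"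
  proof (rule integral_dominated_convergence[where w = "\<lambda>w. B * exp (- (norm w)\<^sup>2)"])
    show "AE w in lborel. (\<lambda>j. f (x - s j *\<^sub>R w) * complex_of_real (exp (- (norm w)\<^sup>2))) \<longlonglongrightarrow> f x * complex_of_real (exp (- (norm w)\<^sup>2))"
    proof (rule AE_I2, rule tendsto_mult_right)
      fix w :: 'a
      have "(\<lambda>j. x - s j *\<^sub>R w) \<longlonglongrightarrow> x - 0 *\<^sub>R w" by (intro tendsto_intros s)
      then show "(\<lambda>j. f (x - s j *\<^sub>R w)) \<longlonglongrightarrow> f x"
        using continuous_on_tendsto_compose[OF c] by fastforce
    qed
    show "AE w in lborel. norm (f (x - s j *\<^sub>R w) * complex_of_real (exp (- (norm w)\<^sup>2))) \<le> B * exp (- (norm w)\<^sup>2)" for j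
      using b by (auto simp: norm_mult intro!: mult_right_mono)
  qed (use g in auto)
  also have "(LINT w|lborel. f x * complex_of_real (exp (- (norm (w::'a))\<^sup>2))) = complex_of_real (sqrt pi ^ DIM('a)) * f x"
    unfolding integral_mult_right_zero integral_complex_of_real g by simp
  finally show ?thesis .
qed

lemma gaussian_fourier':
  fixes \<xi> :: "'a::euclidean_space"
  assumes "\<alpha> > 0"
  shows "(LINT x|lborel. wave x \<xi> * complex_of_real (exp (- \<alpha> * (norm x)\<^sup>2)))
       = complex_of_real (sqrt (pi / \<alpha>) ^ DIM('a) * exp (- (norm \<xi>)\<^sup>2 / (4 * \<alpha>)))"
  using gaussian_fourier[OF assms, of "- \<xi>"] by simp

text \<open>The Gaussian factor makes the double integral over \<open>\<xi>\<close> and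
  \<open>y\<close> absolutely convergent, so the order can be exchanged. With the exponent
  \<open>s\<^sup>2 / 4\<close> the inner integral is a Gaussian in \<open>x - y\<close> of width
  \<open>s\<close>, and the substitution \<open>y = x - s w\<close> turns the rest into an average
  of \<open>f\<close> near \<open>x\<close>.\<close>

lemma regularized_inversion:
  fixes f :: "real^'n::finite \<Rightarrow> complex"
  assumes i: "integrable lborel f" and s: "s > 0"
  shows "(LINT \<xi>|lborel. fourier f \<xi> * wave x \<xi> * complex_of_real (exp (- (s\<^sup>2 / 4) * (norm \<xi>)\<^sup>2)))
    = complex_of_real ((2 * sqrt pi) ^ CARD('n)) * (LINT w|lborel. f (x - s *\<^sub>R w) * complex_of_real (exp (- (norm w)\<^sup>2)))"
proof -
  define \<delta> where "\<delta> = s\<^sup>2 / 4"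
  have \<delta>: "\<delta> > 0" "sqrt (pi / \<delta>) = 2 * sqrt pi / s" using s by (auto simp: \<delta>_def real_sqrt_divide real_sqrt_mult)
  have [measurable]: "f \<in> borel_measurable borel" using i by auto
  define h where "h = (\<lambda>\<xi> y. wave (x - y) \<xi> * complex_of_real (exp (- \<delta> * (norm \<xi>)\<^sup>2)) * f y)"
  have h: "integrable (lborel \<Otimes>\<^sub>M lborel) (case_prod h)"
  proof (rule integrable_pair_lborel_mult[where g = "\<lambda>\<xi>. exp (- \<delta> * (norm \<xi>)\<^sup>2)" and h = "\<lambda>y. norm (f y)"])
    show "case_prod h \<in> borel_measurable borel" unfolding h_def by (simp add: borel_prod[symmetric])
    show "integrable lborel (\<lambda>\<xi>::real^'n. exp (- \<delta> * (norm \<xi>)\<^sup>2))" by (rule gaussian_integrable[OF \<delta>(1)])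
  qed (use i in \<open>auto simp: h_def norm_mult\<close>)
  have "(LINT \<xi>|lborel. fourier f \<xi> * wave x \<xi> * complex_of_real (exp (- \<delta> * (norm \<xi>)\<^sup>2)))
     = (LINT \<xi>|lborel. LINT y|lborel. h \<xi> y)"
  proof (rule Bochner_Integration.integral_cong[OF refl])
    fix \<xi> :: "real^'n"
    define E where "E = wave x \<xi> * complex_of_real (exp (- \<delta> * (norm \<xi>)\<^sup>2))"
    have "wave (x - y) \<xi> = wave_cnj y \<xi> * wave x \<xi>" for y
      by (simp add: inner_diff_left exp_add[symmetric] algebra_simps)
    then have e: "h \<xi> = (\<lambda>y. wave_cnj y \<xi> * f y * E)"
      by (simp add: h_def E_def mult_ac)
    show "fourier f \<xi> * wave x \<xi> * complex_of_real (exp (- \<delta> * (norm \<xi>)\<^sup>2)) = (LINT y|lborel. h \<xi> y)"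
      unfolding e integral_mult_left_zero by (simp add: fourier_def E_def)
  qed
  also have "\<dots> = (LINT y|lborel. LINT \<xi>|lborel. h \<xi> y)"
    by (rule lborel_pair.Fubini_integral[OF h, symmetric])
  also have "\<dots> = (LINT y|lborel. complex_of_real ((2 * sqrt pi / s) ^ CARD('n) * exp (- (norm (x - y))\<^sup>2 / (4 * \<delta>))) * f y)"
  proof (rule Bochner_Integration.integral_cong[OF refl])
    fix y
    have "(LINT \<xi>|lborel. h \<xi> y) = (LINT \<xi>|lborel. wave \<xi> (x - y) * complex_of_real (exp (- \<delta> * (norm \<xi>)\<^sup>2))) * f y"
      unfolding h_def integral_mult_left_zero by (simp add: inner_commute)
    then show "(LINT \<xi>|lborel. h \<xi> y) = complex_of_real ((2 * sqrt pi / s) ^ CARD('n) * exp (- (norm (x - y))\<^sup>2 / (4 * \<delta>))) * f y"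
      unfolding gaussian_fourier'[OF \<delta>(1)] \<delta>(2) by simp
  qed
  also have "\<dots> = \<bar>- s\<bar> ^ DIM(real^'n) *\<^sub>R (LINT w|lborel. complex_of_real ((2 * sqrt pi / s) ^ CARD('n) * exp (- (norm (x - (x + (- s) *\<^sub>R w)))\<^sup>2 / (4 * \<delta>))) * f (x + (- s) *\<^sub>R w))"
    by (rule lborel_integral_affine) (use s in auto)
  also have "\<dots> = complex_of_real (s ^ CARD('n)) * (LINT w|lborel. complex_of_real ((2 * sqrt pi / s) ^ CARD('n)) * (f (x - s *\<^sub>R w) * complex_of_real (exp (- (norm w)\<^sup>2))))"
  proof -
    have "complex_of_real ((2 * sqrt pi / s) ^ CARD('n) * exp (- (norm (x - (x + (- s) *\<^sub>R w)))\<^sup>2 / (4 * \<delta>))) * f (x + (- s) *\<^sub>R w)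
       = complex_of_real ((2 * sqrt pi / s) ^ CARD('n)) * (f (x - s *\<^sub>R w) * complex_of_real (exp (- (norm w)\<^sup>2)))" for w
    proof -
      have "(norm (x - (x + (- s) *\<^sub>R w)))\<^sup>2 = s\<^sup>2 * (norm w)\<^sup>2" using s by (simp add: power_mult_distrib)
      then have 1: "- (norm (x - (x + (- s) *\<^sub>R w)))\<^sup>2 / (4 * \<delta>) = - (norm w)\<^sup>2" using s by (simp add: \<delta>_def)
      have 2: "x + (- s) *\<^sub>R w = x - s *\<^sub>R w" by simp
      show ?thesis unfolding 1 unfolding 2 by (simp only: of_real_mult mult_ac)
    qed
    moreover have "\<bar>- s\<bar> ^ DIM(real^'n) *\<^sub>R z = complex_of_real (s ^ CARD('n)) * z" for z :: complex
      using s by (simp add: scaleR_conv_of_real[of _ z])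
    ultimately show ?thesis by (simp only:)
  qed
  also have "\<dots> = complex_of_real (s ^ CARD('n) * (2 * sqrt pi / s) ^ CARD('n)) * (LINT w|lborel. f (x - s *\<^sub>R w) * complex_of_real (exp (- (norm w)\<^sup>2)))"
    unfolding integral_mult_right_zero by simp
  also have "s ^ CARD('n) * (2 * sqrt pi / s) ^ CARD('n) = (2 * sqrt pi) ^ CARD('n)"
    using s by (simp add: power_divide)
  finally show ?thesis unfolding \<delta>_def .
qed

lemma two_sqrt_pi_sqrt_pi: "(2 * sqrt pi) ^ n * sqrt pi ^ n = (2 * pi) ^ n"
proof -
  have "2 * sqrt pi * sqrt pi = 2 * pi" by simp
  moreover have "(2 * sqrt pi) ^ n * sqrt pi ^ n = (2 * sqrt pi * sqrt pi) ^ n"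
    by (rule power_mult_distrib[symmetric])
  ultimately show ?thesis by (simp only:)
qed

text \<open>The regularised integral is taken to the limit in two ways: by dominated convergence on
  the frequency side, and as an approximate identity on the other.\<close>

lemma fourier_inversion:
  fixes f :: "real^'n::finite \<Rightarrow> complex"
  assumes i: "integrable lborel f" and c: "continuous_on UNIV f" and b: "\<And>x. norm (f x) \<le> B"
    and i': "integrable lborel (fourier f)"
  shows "(LINT \<xi>|lborel. wave x \<xi> * fourier f \<xi>) = complex_of_real ((2 * pi) ^ CARD('n)) * f x"
proof (rule LIMSEQ_unique)
  define s where "s = (\<lambda>j. inverse (real (Suc j)))"
  have s: "s \<longlonglongrightarrow> 0" "\<And>j. s j > 0" unfolding s_def by (rule LIMSEQ_inverse_real_of_nat) auto
  let ?r = "\<lambda>j. LINT \<xi>|lborel. fourier f \<xi> * wave x \<xi> * complex_of_real (exp (- ((s j)\<^sup>2 / 4) * (norm \<xi>)\<^sup>2))"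
  have [measurable]: "fourier f \<in> borel_measurable borel" using i' by auto
  show "?r \<longlonglongrightarrow> (LINT \<xi>|lborel. wave x \<xi> * fourier f \<xi>)"
  proof (rule integral_dominated_convergence[where w = "\<lambda>\<xi>. norm (fourier f \<xi>)"])
    show "AE \<xi> in lborel. (\<lambda>j. fourier f \<xi> * wave x \<xi> * complex_of_real (exp (- ((s j)\<^sup>2 / 4) * (norm \<xi>)\<^sup>2))) \<longlonglongrightarrow> (wave x \<xi>) * fourier f \<xi>"
    proof (rule AE_I2)
      fix \<xi> :: "real^'n"
      have "(\<lambda>j. fourier f \<xi> * wave x \<xi> * complex_of_real (exp (- ((s j)\<^sup>2 / 4) * (norm \<xi>)\<^sup>2))) \<longlonglongrightarrow> fourier f \<xi> * wave x \<xi> * complex_of_real (exp (- (0\<^sup>2 / 4) * (norm \<xi>)\<^sup>2))"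
        by (intro tendsto_intros s) auto
      then show "(\<lambda>j. fourier f \<xi> * wave x \<xi> * complex_of_real (exp (- ((s j)\<^sup>2 / 4) * (norm \<xi>)\<^sup>2))) \<longlonglongrightarrow> (wave x \<xi>) * fourier f \<xi>"
        by (simp add: mult.commute)
    qed
    show "AE \<xi> in lborel. norm (fourier f \<xi> * wave x \<xi> * complex_of_real (exp (- ((s j)\<^sup>2 / 4) * (norm \<xi>)\<^sup>2))) \<le> norm (fourier f \<xi>)" for j
      by (auto simp: norm_mult intro!: mult_left_le)
  qed (use i' in auto)
  have "?r \<longlonglongrightarrow> complex_of_real ((2 * sqrt pi) ^ CARD('n)) * (complex_of_real (sqrt pi ^ DIM(real^'n)) * f x)"
    unfolding regularized_inversion[OF i s(2)]
    by (intro tendsto_mult_left approximate_identity[OF c b s(1)])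
  then show "?r \<longlonglongrightarrow> complex_of_real ((2 * pi) ^ CARD('n)) * f x"
    unfolding two_sqrt_pi_sqrt_pi[symmetric] by (simp add: mult.assoc)
qed

text \<open>Pairing the regularised inversion with \<open>cnj (f x)\<close> evaluates the damped
  integral of the squared transform. The damping factor increases to 1, so monotone convergence
  yields the square integrability of the transform along with the value.\<close>

lemma
  fixes f :: "real^'n::finite \<Rightarrow> complex"
  assumes i: "integrable lborel f" and c: "continuous_on UNIV f" and b: "\<And>x. norm (f x) \<le> B"
  shows plancherel_integrable: "integrable lborel (\<lambda>\<xi>. (norm (fourier f \<xi>))\<^sup>2)"
    and plancherel: "(LINT \<xi>|lborel. (norm (fourier f \<xi>))\<^sup>2) = (2 * pi) ^ CARD('n) * (LINT x|lborel. (norm (f x))\<^sup>2)"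
proof -
  define s where "s = (\<lambda>j. inverse (real (Suc j)))"
  have s: "s \<longlonglongrightarrow> 0" "\<And>j. s j > 0" "decseq s" unfolding s_def
    by (rule LIMSEQ_inverse_real_of_nat) (auto simp: decseq_def field_simps)
  have [measurable]: "f \<in> borel_measurable borel" using i by auto
  note [measurable] = borel_measurable_fourier[OF i]
  have [measurable]: "(\<lambda>x. cnj (f x)) \<in> borel_measurable borel"
    by (intro borel_measurable_continuous_onI continuous_intros c)
  let ?g = "\<lambda>j \<xi>. (norm (fourier f \<xi>))\<^sup>2 * exp (- ((s j)\<^sup>2 / 4) * (norm \<xi>)\<^sup>2)"
  define L where "L = (LINT x|lborel. norm (f x))"
  have L: "norm (fourier f \<xi>) \<le> L" for \<xi> unfolding L_def by (rule norm_fourier_le)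
  have L0: "L \<ge> 0" unfolding L_def by simp
  have B0: "B \<ge> 0" using b[of 0] norm_ge_zero order.trans by blast
  have g: "integrable lborel (\<lambda>\<xi>::real^'n. exp (- ((s j)\<^sup>2 / 4) * (norm \<xi>)\<^sup>2))" for j
    by (rule gaussian_integrable) (use s(2)[of j] in auto)
  have ig: "integrable lborel (?g j)" for j
    by (rule Bochner_Integration.integrable_bound[OF integrable_mult_right[OF g[of j], of "L\<^sup>2"]])
      (use L L0 in \<open>auto simp: abs_mult intro!: mult_right_mono power_mono\<close>)
  have val: "complex_of_real (LINT \<xi>|lborel. ?g j \<xi>) = (LINT x|lborel. cnj (f x) * (complex_of_real ((2 * sqrt pi) ^ CARD('n)) *
      (LINT w|lborel. f (x - s j *\<^sub>R w) * complex_of_real (exp (- (norm w)\<^sup>2)))))" for j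
  proof -
    define h where "h = (\<lambda>\<xi> x. cnj (f x) * (fourier f \<xi> * wave x \<xi> * complex_of_real (exp (- ((s j)\<^sup>2 / 4) * (norm \<xi>)\<^sup>2))))"
    have h: "integrable (lborel \<Otimes>\<^sub>M lborel) (case_prod h)"
    proof (rule integrable_pair_lborel_mult[where g = "\<lambda>\<xi>. L * exp (- ((s j)\<^sup>2 / 4) * (norm \<xi>)\<^sup>2)" and h = "\<lambda>y. norm (f y)"])
      show "case_prod h \<in> borel_measurable borel" unfolding h_def by (simp add: borel_prod[symmetric])
      show "norm (h x y) \<le> L * exp (- ((s j)\<^sup>2 / 4) * (norm x)\<^sup>2) * norm (f y)" for x y
        using L[of x] by (auto simp: h_def norm_mult mult.commute intro!: mult_left_mono)
      show "integrable lborel (\<lambda>\<xi>::real^'n. L * exp (- ((s j)\<^sup>2 / 4) * (norm \<xi>)\<^sup>2))" by (intro integrable_mult_right g)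
    qed (use i in auto)
    have "complex_of_real (LINT \<xi>|lborel. ?g j \<xi>) = (LINT \<xi>|lborel. complex_of_real (?g j \<xi>))"
      by (rule integral_complex_of_real[symmetric])
    also have "\<dots> = (LINT \<xi>|lborel. LINT x|lborel. h \<xi> x)"
    proof (rule Bochner_Integration.integral_cong[OF refl])
      fix \<xi> :: "real^'n"
      have "cnj (fourier f \<xi>) = (LINT x|lborel. cnj (f x) * wave x \<xi>)"
      proof -
        have "(LINT x|lborel. cnj (f x) * wave x \<xi>) = (LINT x|lborel. cnj (wave_cnj x \<xi> * f x))"
          by (rule Bochner_Integration.integral_cong) (simp_all add: exp_cnj mult.commute)
        then show ?thesis unfolding fourier_def by (simp only: Bochner_Integration.integral_cnj)
      qed
      moreover have "complex_of_real (?g j \<xi>) = cnj (fourier f \<xi>) * (fourier f \<xi> * complex_of_real (exp (- ((s j)\<^sup>2 / 4) * (norm \<xi>)\<^sup>2)))"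
        by (simp only: of_real_mult complex_norm_square mult_ac)
      ultimately have "complex_of_real (?g j \<xi>) = (LINT x|lborel. cnj (f x) * wave x \<xi> * (fourier f \<xi> * complex_of_real (exp (- ((s j)\<^sup>2 / 4) * (norm \<xi>)\<^sup>2))))"
        by simp
      then show "complex_of_real (?g j \<xi>) = (LINT x|lborel. h \<xi> x)" by (simp add: h_def mult_ac)
    qed
    also have "\<dots> = (LINT x|lborel. LINT \<xi>|lborel. h \<xi> x)"
      by (rule lborel_pair.Fubini_integral[OF h, symmetric])
    also have "\<dots> = (LINT x|lborel. cnj (f x) * (LINT \<xi>|lborel. fourier f \<xi> * wave x \<xi> * complex_of_real (exp (- ((s j)\<^sup>2 / 4) * (norm \<xi>)\<^sup>2))))"
      unfolding h_def integral_mult_right_zero ..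
    finally show ?thesis unfolding regularized_inversion[OF i s(2)] .
  qed
  define K where "K = (2 * sqrt pi) ^ CARD('n) * (B * sqrt pi ^ CARD('n))"
  have "(\<lambda>j. LINT x|lborel. cnj (f x) * (complex_of_real ((2 * sqrt pi) ^ CARD('n)) *
      (LINT w|lborel. f (x - s j *\<^sub>R w) * complex_of_real (exp (- (norm w)\<^sup>2))))) \<longlonglongrightarrow>
      (LINT x|lborel. cnj (f x) * (complex_of_real ((2 * sqrt pi) ^ CARD('n)) * (complex_of_real (sqrt pi ^ DIM(real^'n)) * f x)))"
  proof (rule integral_dominated_convergence[where w = "\<lambda>x. K * norm (f x)"])
    have n: "norm (LINT w|lborel. f (x - s j *\<^sub>R w) * complex_of_real (exp (- (norm w)\<^sup>2))) \<le> B * sqrt pi ^ CARD('n)" for x j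
    proof -
      have g1: "integrable lborel (\<lambda>w::real^'n. exp (- (norm w)\<^sup>2))" "(LINT w::real^'n|lborel. exp (- (norm w)\<^sup>2)) = sqrt pi ^ CARD('n)"
        using gaussian_integrable[of 1, where 'a="real^'n"] gaussian_integral[of 1, where 'a="real^'n"] by auto
      have "norm (LINT w|lborel. f (x - s j *\<^sub>R w) * complex_of_real (exp (- (norm w)\<^sup>2))) \<le> (LINT w|lborel. norm (f (x - s j *\<^sub>R w) * complex_of_real (exp (- (norm w)\<^sup>2))))"
        by (rule integral_norm_bound)
      also have "\<dots> \<le> (LINT w::real^'n|lborel. B * exp (- (norm w)\<^sup>2))"
        by (rule Bochner_Integration.integral_mono')
          (use g1 b B0 in \<open>auto simp: norm_mult intro!: mult_right_mono\<close>)
      finally show ?thesis using g1 by simp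
    qed
    show "AE x in lborel. norm (cnj (f x) * (complex_of_real ((2 * sqrt pi) ^ CARD('n)) * (LINT w|lborel. f (x - s j *\<^sub>R w) * complex_of_real (exp (- (norm w)\<^sup>2))))) \<le> K * norm (f x)" for j
    proof (rule AE_I2)
      fix x
      have "norm (cnj (f x) * (complex_of_real ((2 * sqrt pi) ^ CARD('n)) * (LINT w|lborel. f (x - s j *\<^sub>R w) * complex_of_real (exp (- (norm w)\<^sup>2)))))
         = norm (f x) * ((2 * sqrt pi) ^ CARD('n) * norm (LINT w|lborel. f (x - s j *\<^sub>R w) * complex_of_real (exp (- (norm w)\<^sup>2))))"
        by (simp only: norm_mult complex_mod_cnj norm_of_real) simp
      also have "\<dots> \<le> norm (f x) * K" unfolding K_def by (intro mult_left_mono n) auto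
      finally show "norm (cnj (f x) * (complex_of_real ((2 * sqrt pi) ^ CARD('n)) * (LINT w|lborel. f (x - s j *\<^sub>R w) * complex_of_real (exp (- (norm w)\<^sup>2))))) \<le> K * norm (f x)"
        by (simp add: mult.commute)
    qed
    show "AE x in lborel. (\<lambda>j. cnj (f x) * (complex_of_real ((2 * sqrt pi) ^ CARD('n)) *
      (LINT w|lborel. f (x - s j *\<^sub>R w) * complex_of_real (exp (- (norm w)\<^sup>2))))) \<longlonglongrightarrow>
       cnj (f x) * (complex_of_real ((2 * sqrt pi) ^ CARD('n)) * (complex_of_real (sqrt pi ^ DIM(real^'n)) * f x))"
      by (intro AE_I2 tendsto_mult_left approximate_identity[OF c b s(1)])
  qed (use i in auto)
  also have "(LINT x|lborel. cnj (f x) * (complex_of_real ((2 * sqrt pi) ^ CARD('n)) * (complex_of_real (sqrt pi ^ DIM(real^'n)) * f x)))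
     = (LINT x|lborel. complex_of_real ((2 * pi) ^ CARD('n) * (norm (f x))\<^sup>2))"
    unfolding two_sqrt_pi_sqrt_pi[symmetric] of_real_mult complex_norm_square by (simp add: mult_ac)
  also have "\<dots> = complex_of_real ((2 * pi) ^ CARD('n) * (LINT x|lborel. (norm (f x))\<^sup>2))"
    unfolding integral_complex_of_real integral_mult_right_zero ..
  finally have lim: "(\<lambda>j. LINT \<xi>|lborel. ?g j \<xi>) \<longlonglongrightarrow> (2 * pi) ^ CARD('n) * (LINT x|lborel. (norm (f x))\<^sup>2)"
    unfolding val[symmetric] tendsto_of_real_iff .
  have mono: "AE \<xi> in lborel. mono (\<lambda>j. ?g j \<xi>)"
  proof (rule AE_I2)
    fix \<xi> :: "real^'n"
    show "mono (\<lambda>j. ?g j \<xi>)"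
    proof (rule monoI)
      fix j k :: nat assume "j \<le> k"
      then have "s k \<le> s j" using s(3) by (simp add: decseq_def)
      then have "(s k)\<^sup>2 \<le> (s j)\<^sup>2" using s(2)[of k] by (intro power_mono) auto
      then show "?g j \<xi> \<le> ?g k \<xi>" by (auto intro!: mult_left_mono mult_right_mono)
    qed
  qed
  have pt: "AE \<xi> in lborel. (\<lambda>j. ?g j \<xi>) \<longlonglongrightarrow> (norm (fourier f \<xi>))\<^sup>2"
  proof (rule AE_I2)
    fix \<xi> :: "real^'n"
    have "(\<lambda>j. ?g j \<xi>) \<longlonglongrightarrow> (norm (fourier f \<xi>))\<^sup>2 * exp (- (0\<^sup>2 / 4) * (norm \<xi>)\<^sup>2)"
      by (intro tendsto_intros s) auto
    then show "(\<lambda>j. ?g j \<xi>) \<longlonglongrightarrow> (norm (fourier f \<xi>))\<^sup>2" by simp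
  qed
  have pos: "AE \<xi> in lborel. 0 \<le> ?g j \<xi>" for j by simp
  show "integrable lborel (\<lambda>\<xi>. (norm (fourier f \<xi>))\<^sup>2)"
    by (rule integral_monotone_convergence_nonneg(1)[OF ig mono pos pt lim]) simp
  show "(LINT \<xi>|lborel. (norm (fourier f \<xi>))\<^sup>2) = (2 * pi) ^ CARD('n) * (LINT x|lborel. (norm (f x))\<^sup>2)"
    by (rule integral_monotone_convergence_nonneg(2)[OF ig mono pos pt lim]) simp
qed

section \<open>Derivatives and symbol estimates\<close>

lemma has_derivative_frechet:
  "f differentiable_on UNIV \<Longrightarrow> (f has_derivative frechet_derivative f (at x)) (at x)"
  by (simp add: frechet_derivative_works[symmetric] differentiable_on_def)

lemma partial_deriv_unique: "(f has_derivative f') (at x) \<Longrightarrow> partial_deriv v f x = f' v"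
  unfolding partial_deriv_def using frechet_derivative_at by metis

lemma partial_deriv_line:
  assumes "f differentiable_on UNIV"
  shows "((\<lambda>s. f (x + s *\<^sub>R v)) has_vector_derivative partial_deriv v f (x + s *\<^sub>R v)) (at s)"
proof -
  let ?D = "frechet_derivative f (at (x + s *\<^sub>R v))"
  have f: "(f has_derivative ?D) (at (x + s *\<^sub>R v))" by (rule has_derivative_frechet[OF assms])
  have l: "((\<lambda>s. x + s *\<^sub>R v) has_derivative (\<lambda>t. t *\<^sub>R v)) (at s)"
    by (auto intro!: derivative_eq_intros)
  have "((\<lambda>s. f (x + s *\<^sub>R v)) has_derivative (\<lambda>t. ?D (t *\<^sub>R v))) (at s)"
    by (rule has_derivative_compose[OF l f])
  moreover have "?D (t *\<^sub>R v) = t *\<^sub>R ?D v" for t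
    using f by (intro linear_cmul) (auto dest: has_derivative_linear)
  ultimately show ?thesis by (simp add: has_vector_derivative_def partial_deriv_def)
qed

text \<open>The second difference is symmetric in \<open>u\<close> and \<open>v\<close>, so its
  limit identifies the two mixed derivatives. It is computed from the first-order expansion of
  \<open>partial_deriv u f\<close> at \<open>x\<close>, used under the mean value inequality in
  direction \<open>u\<close>.\<close>

lemma second_difference_limit:
  fixes f :: "'a::real_normed_vector \<Rightarrow> 'b::real_normed_vector"
  assumes f: "f differentiable_on UNIV" and d: "partial_deriv u f differentiable_on UNIV"
  shows "((\<lambda>h. (1 / h\<^sup>2) *\<^sub>R (f (x + h *\<^sub>R u + h *\<^sub>R v) - f (x + h *\<^sub>R u) - f (x + h *\<^sub>R v) + f x)) \<longlongrightarrow> partial_deriv v (partial_deriv u f) x) (at_right 0)"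
proof (rule tendstoI)
  fix e :: real assume e: "e > 0"
  define g where "g = partial_deriv u f"
  define D where "D = frechet_derivative g (at x)"
  \<comment> \<open>Large enough that both increments \<open>h *\<^sub>R v + s *\<^sub>R u\<close>
    and \<open>s *\<^sub>R u\<close> have norm at most \<open>h * M\<close>, and that the two
    expansion errors together stay below \<open>e / 2 * h\<close>.\<close>
  define M where "M = 2 * norm u + norm v + 1"
  have M: "M > 0" "2 * norm u + norm v \<le> M" by (auto simp: M_def add_nonneg_pos)
  have gD: "(g has_derivative D) (at x)" unfolding g_def D_def by (rule has_derivative_frechet[OF d])
  then have lin: "linear D" by (rule has_derivative_linear)
  have "e / (2 * M) > 0" using e M by simp
  then obtain \<delta> where \<delta>: "\<delta> > 0" "\<And>y. norm (y - x) < \<delta> \<Longrightarrow> norm (g y - g x - D (y - x)) \<le> e / (2 * M) * norm (y - x)"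
    using gD unfolding has_derivative_at_alt by blast
  have "\<forall>\<^sub>F h in at_right 0. h < \<delta> / M" by (rule eventually_at_rightI[of 0 "\<delta> / M"]) (use \<delta> M in auto)
  moreover have "\<forall>\<^sub>F h in at_right (0::real). h > 0" by (simp add: eventually_at_right_less)
  ultimately show "\<forall>\<^sub>F h in at_right 0. dist ((1 / h\<^sup>2) *\<^sub>R (f (x + h *\<^sub>R u + h *\<^sub>R v) - f (x + h *\<^sub>R u) - f (x + h *\<^sub>R v) + f x)) (partial_deriv v (partial_deriv u f) x) < e"
  proof eventually_elim
    case (elim h)
    have hM: "h * M < \<delta>" using elim M by (simp add: pos_less_divide_eq)
    \<comment> \<open>The increment of \<open>\<psi>\<close> over \<open>{0..h}\<close> is the
      second difference minus \<open>h\<^sup>2 *\<^sub>R D v\<close>. With the linear term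
      subtracted, the derivative of \<open>\<psi>\<close> is the difference of two expansion errors
      of \<open>g\<close> at \<open>x\<close>.\<close>
    define \<psi> where "\<psi> = (\<lambda>s. f ((x + h *\<^sub>R v) + s *\<^sub>R u) - f (x + s *\<^sub>R u) - s *\<^sub>R D (h *\<^sub>R v))"
    have der: "(\<psi> has_vector_derivative (g ((x + h *\<^sub>R v) + s *\<^sub>R u) - g (x + s *\<^sub>R u) - D (h *\<^sub>R v))) (at s)" for s
      unfolding \<psi>_def g_def by (auto intro!: derivative_eq_intros partial_deriv_line[OF f])
    have bd: "norm (g ((x + h *\<^sub>R v) + s *\<^sub>R u) - g (x + s *\<^sub>R u) - D (h *\<^sub>R v)) \<le> e / 2 * h" if s: "s \<in> {0..h}" for s
    proof -
      have n1: "norm (h *\<^sub>R v + s *\<^sub>R u) \<le> h * (norm v + norm u)"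
        by (rule order.trans[OF norm_triangle_ineq]) (use s elim in \<open>simp add: distrib_left mult_right_mono\<close>)
      have n2: "norm (s *\<^sub>R u) \<le> h * norm u" using s elim by (simp add: mult_right_mono)
      have hh: "h * (norm v + norm u) \<le> h * M" "h * norm u \<le> h * M"
        using elim by (auto simp: M_def intro!: mult_left_mono)
      have "D (h *\<^sub>R v) = D (h *\<^sub>R v + s *\<^sub>R u) - D (s *\<^sub>R u)" using lin by (simp add: linear_add)
      then have "g ((x + h *\<^sub>R v) + s *\<^sub>R u) - g (x + s *\<^sub>R u) - D (h *\<^sub>R v)
        = (g (x + (h *\<^sub>R v + s *\<^sub>R u)) - g x - D ((x + (h *\<^sub>R v + s *\<^sub>R u)) - x)) - (g (x + s *\<^sub>R u) - g x - D ((x + s *\<^sub>R u) - x))"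
        by (simp add: add.assoc)
      also have "norm \<dots> \<le> norm (g (x + (h *\<^sub>R v + s *\<^sub>R u)) - g x - D ((x + (h *\<^sub>R v + s *\<^sub>R u)) - x)) + norm (g (x + s *\<^sub>R u) - g x - D ((x + s *\<^sub>R u) - x))"
        by (rule norm_triangle_ineq4)
      also have "\<dots> \<le> e / (2 * M) * norm (h *\<^sub>R v + s *\<^sub>R u) + e / (2 * M) * norm (s *\<^sub>R u)"
        using \<delta>(2)[of "x + (h *\<^sub>R v + s *\<^sub>R u)"] \<delta>(2)[of "x + s *\<^sub>R u"] n1 n2 hh hM by (intro add_mono) auto
      also have "\<dots> \<le> e / (2 * M) * (h * (norm v + norm u)) + e / (2 * M) * (h * norm u)"
        using n1 n2 e M by (intro add_mono mult_left_mono) auto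
      also have "\<dots> = e / (2 * M) * (h * (2 * norm u + norm v))" by (simp add: algebra_simps)
      also have "\<dots> \<le> e / (2 * M) * (h * M)" using e M elim by (intro mult_left_mono) auto
      also have "\<dots> = e / 2 * h" using M by simp
      finally show ?thesis .
    qed
    have "norm (\<psi> h - \<psi> 0) \<le> e / 2 * h * norm (h - 0)"
    proof (rule differentiable_bound[where S = "{0..h}"])
      show "(\<psi> has_derivative (\<lambda>t. t *\<^sub>R (g ((x + h *\<^sub>R v) + s *\<^sub>R u) - g (x + s *\<^sub>R u) - D (h *\<^sub>R v)))) (at s within {0..h})" for s
        using der[of s] unfolding has_vector_derivative_def by (rule has_derivative_at_withinI)
      show "onorm (\<lambda>t. t *\<^sub>R (g ((x + h *\<^sub>R v) + s *\<^sub>R u) - g (x + s *\<^sub>R u) - D (h *\<^sub>R v))) \<le> e / 2 * h" if "s \<in> {0..h}" for s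
        proof (rule onorm_le)
        fix t :: real
        show "norm (t *\<^sub>R (g ((x + h *\<^sub>R v) + s *\<^sub>R u) - g (x + s *\<^sub>R u) - D (h *\<^sub>R v))) \<le> e / 2 * h * norm t"
          using mult_left_mono[OF bd[OF that], of "\<bar>t\<bar>"] by (simp only: norm_scaleR real_norm_def abs_ge_zero mult.commute)
      qed
    qed (use elim in auto)
    moreover have "\<psi> h - \<psi> 0 = f (x + h *\<^sub>R u + h *\<^sub>R v) - f (x + h *\<^sub>R u) - f (x + h *\<^sub>R v) + f x - h\<^sup>2 *\<^sub>R D v"
      using lin by (simp add: \<psi>_def algebra_simps linear_cmul power2_eq_square)
    ultimately have le: "norm (f (x + h *\<^sub>R u + h *\<^sub>R v) - f (x + h *\<^sub>R u) - f (x + h *\<^sub>R v) + f x - h\<^sup>2 *\<^sub>R D v) \<le> e / 2 * h\<^sup>2"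
      using elim by (simp add: power2_eq_square)
    define z where "z = f (x + h *\<^sub>R u + h *\<^sub>R v) - f (x + h *\<^sub>R u) - f (x + h *\<^sub>R v) + f x"
    have "(1 / h\<^sup>2) *\<^sub>R z - D v = (1 / h\<^sup>2) *\<^sub>R (z - h\<^sup>2 *\<^sub>R D v)"
      using elim by (simp add: scaleR_right_diff_distrib)
    then have "norm ((1 / h\<^sup>2) *\<^sub>R z - D v) = norm (z - h\<^sup>2 *\<^sub>R D v) / h\<^sup>2" by simp
    also have "\<dots> \<le> e / 2" using le elim unfolding z_def[symmetric] by (simp add: divide_le_eq)
    also have "\<dots> < e" using e by simp
    finally show ?case by (simp add: dist_norm z_def D_def g_def partial_deriv_def)
  qed
qed

lemma partial_deriv_commute:
  fixes f :: "'a::real_normed_vector \<Rightarrow> 'b::real_normed_vector"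
  assumes f: "f differentiable_on UNIV" and u: "partial_deriv u f differentiable_on UNIV"
    and v: "partial_deriv v f differentiable_on UNIV"
  shows "partial_deriv v (partial_deriv u f) = partial_deriv u (partial_deriv v f)"
proof
  fix x
  have "((\<lambda>h. (1 / h\<^sup>2) *\<^sub>R (f (x + h *\<^sub>R v + h *\<^sub>R u) - f (x + h *\<^sub>R v) - f (x + h *\<^sub>R u) + f x)) \<longlongrightarrow> partial_deriv u (partial_deriv v f) x) (at_right 0)"
    by (rule second_difference_limit[OF f v])
  then have "((\<lambda>h. (1 / h\<^sup>2) *\<^sub>R (f (x + h *\<^sub>R u + h *\<^sub>R v) - f (x + h *\<^sub>R u) - f (x + h *\<^sub>R v) + f x)) \<longlongrightarrow> partial_deriv u (partial_deriv v f) x) (at_right 0)"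
    by (simp add: algebra_simps)
  then show "partial_deriv v (partial_deriv u f) x = partial_deriv u (partial_deriv v f) x"
    using second_difference_limit[OF f u, of x v] tendsto_unique[OF trivial_limit_at_right_real] by blast
qed

abbreviation iter_deriv :: "'a::real_normed_vector list \<Rightarrow> ('a \<Rightarrow> 'b::real_normed_vector) \<Rightarrow> 'a \<Rightarrow> 'b" where
  "iter_deriv vs f \<equiv> foldr partial_deriv vs f"

lemma smooth_differentiable: "smooth f \<Longrightarrow> set vs \<subseteq> Basis \<Longrightarrow> iter_deriv vs f differentiable_on UNIV"
  unfolding smooth_def by blast

lemma smooth_differentiable0: "smooth f \<Longrightarrow> f differentiable_on UNIV"
  using smooth_differentiable[of f "[]"] by simp

lemma smooth_iter_deriv: "smooth f \<Longrightarrow> set vs \<subseteq> Basis \<Longrightarrow> smooth (iter_deriv vs f)"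
  unfolding smooth_def by (metis foldr_append le_sup_iff set_append comp_apply)

lemma smooth_partial_deriv: "smooth f \<Longrightarrow> v \<in> Basis \<Longrightarrow> smooth (partial_deriv v f)"
  using smooth_iter_deriv[of f "[v]"] by simp

lemma smooth_continuous: "smooth f \<Longrightarrow> continuous_on UNIV f"
  using smooth_differentiable0 differentiable_imp_continuous_on by blast

lemma iter_deriv_move:
  assumes "smooth f" "set (a # xs @ ys) \<subseteq> Basis"
  shows "iter_deriv (xs @ a # ys) f = iter_deriv (a # xs @ ys) f"
  using assms(2)
proof (induction xs)
  case (Cons x xs)
  let ?g = "iter_deriv (xs @ ys) f"
  have "smooth ?g" by (rule smooth_iter_deriv[OF assms(1)]) (use Cons in auto)
  then have "partial_deriv x (partial_deriv a ?g) = partial_deriv a (partial_deriv x ?g)"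
    using Cons(2) by (intro partial_deriv_commute smooth_differentiable0 smooth_partial_deriv) auto
  then show ?case using Cons by simp
qed simp

text \<open>\<open>multi_deriv\<close> differentiates along an unspecified list with prescribed
  multiplicities. Since derivatives commute, any list with the same multiset may replace it, and the
  proof can work with concrete lists throughout.\<close>

lemma iter_deriv_perm:
  assumes "smooth f" "set vs \<subseteq> Basis" "mset vs = mset ws"
  shows "iter_deriv vs f = iter_deriv ws f"
  using assms(2,3)
proof (induction vs arbitrary: ws)
  case (Cons v vs)
  then have "v \<in> set ws" by (metis list.set_intros(1) mset_eq_setD)
  then obtain xs ys where ws: "ws = xs @ v # ys" by (meson split_list)
  then have m: "mset vs = mset (xs @ ys)" using Cons(3) by simp
  have s: "set (v # xs @ ys) \<subseteq> Basis" using Cons(2,3) ws by (metis mset_eq_setD Un_insert_right list.simps(15) set_append)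
  have "iter_deriv ws f = iter_deriv (v # xs @ ys) f" unfolding ws by (rule iter_deriv_move[OF assms(1) s])
  then show ?case using Cons(1)[OF _ m] Cons(2) by simp
qed simp

lemma partial_deriv_bounded_linear:
  assumes "bounded_linear h" "f differentiable_on UNIV"
  shows "partial_deriv v (\<lambda>x. h (f x)) = (\<lambda>x. h (partial_deriv v f x))"
    and "(\<lambda>x. h (f x)) differentiable_on UNIV"
proof -
  have d: "((\<lambda>x. h (f x)) has_derivative (\<lambda>v. h (frechet_derivative f (at x) v))) (at x)" for x
    by (rule bounded_linear.has_derivative[OF assms(1) has_derivative_frechet[OF assms(2)]])
  show "partial_deriv v (\<lambda>x. h (f x)) = (\<lambda>x. h (partial_deriv v f x))"
    using partial_deriv_unique[OF d] by (auto simp: partial_deriv_def)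
  show "(\<lambda>x. h (f x)) differentiable_on UNIV"
    using d by (auto simp: differentiable_on_def differentiable_def)
qed

lemma partial_deriv_add:
  assumes "f differentiable_on UNIV" "g differentiable_on UNIV"
  shows "partial_deriv v (\<lambda>x. f x + g x) = (\<lambda>x. partial_deriv v f x + partial_deriv v g x)"
    and "(\<lambda>x. f x + g x) differentiable_on UNIV"
proof -
  have d: "((\<lambda>x. f x + g x) has_derivative (\<lambda>v. frechet_derivative f (at x) v + frechet_derivative g (at x) v)) (at x)" for x
    by (intro has_derivative_add has_derivative_frechet assms)
  show "partial_deriv v (\<lambda>x. f x + g x) = (\<lambda>x. partial_deriv v f x + partial_deriv v g x)"
    using partial_deriv_unique[OF d] by (auto simp: partial_deriv_def)
  show "(\<lambda>x. f x + g x) differentiable_on UNIV"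
    using d by (auto simp: differentiable_on_def differentiable_def)
qed

lemma partial_deriv_mult:
  fixes f g :: "'a::real_normed_vector \<Rightarrow> 'b::real_normed_algebra"
  assumes "f differentiable_on UNIV" "g differentiable_on UNIV"
  shows "partial_deriv v (\<lambda>x. f x * g x) = (\<lambda>x. f x * partial_deriv v g x + partial_deriv v f x * g x)"
    and "(\<lambda>x. f x * g x) differentiable_on UNIV"
proof -
  have d: "((\<lambda>x. f x * g x) has_derivative (\<lambda>v. f x * frechet_derivative g (at x) v + frechet_derivative f (at x) v * g x)) (at x)" for x
    by (intro has_derivative_mult has_derivative_frechet assms)
  show "partial_deriv v (\<lambda>x. f x * g x) = (\<lambda>x. f x * partial_deriv v g x + partial_deriv v f x * g x)"
    using partial_deriv_unique[OF d] by (auto simp: partial_deriv_def)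
  show "(\<lambda>x. f x * g x) differentiable_on UNIV"
    using d by (auto simp: differentiable_on_def differentiable_def)
qed

lemma iter_deriv_bounded_linear:
  assumes "bounded_linear h" "smooth f" "set vs \<subseteq> Basis"
  shows "iter_deriv vs (\<lambda>x. h (f x)) = (\<lambda>x. h (iter_deriv vs f x))"
  using assms(3)
  by (induction vs) (auto simp: partial_deriv_bounded_linear(1)[OF assms(1) smooth_differentiable[OF assms(2)]])

lemma smooth_bounded_linear:
  fixes f :: "'c::euclidean_space \<Rightarrow> 'a::real_normed_vector"
  assumes "bounded_linear h" "smooth f"
  shows "smooth (\<lambda>x. h (f x))"
  unfolding smooth_def[of "\<lambda>x. h (f x)"]
proof (intro allI impI)
  fix vs :: "'c list" assume vs: "set vs \<subseteq> Basis"
  show "iter_deriv vs (\<lambda>x. h (f x)) differentiable_on UNIV"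
    unfolding iter_deriv_bounded_linear[OF assms vs]
    by (rule partial_deriv_bounded_linear(2)[OF assms(1) smooth_differentiable[OF assms(2) vs]])
qed

lemma iter_deriv_add:
  assumes "smooth f" "smooth g" "set vs \<subseteq> Basis"
  shows "iter_deriv vs (\<lambda>x. f x + g x) = (\<lambda>x. iter_deriv vs f x + iter_deriv vs g x)"
  using assms(3)
  by (induction vs) (auto simp: partial_deriv_add(1)[OF smooth_differentiable[OF assms(1)] smooth_differentiable[OF assms(2)]])

lemma smooth_add: "smooth f \<Longrightarrow> smooth g \<Longrightarrow> smooth (\<lambda>x. f x + g x)"
  unfolding smooth_def[of "\<lambda>x. f x + g x"]
  by (auto simp: iter_deriv_add intro!: partial_deriv_add(2) smooth_differentiable)

lemma iter_deriv_const: "iter_deriv vs (\<lambda>x. c) = (\<lambda>x. if vs = [] then c else 0)"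
proof (induction vs)
  case (Cons v vs)
  have "partial_deriv v (\<lambda>x. d) = (\<lambda>x. 0)" for d :: 'b
    by (rule ext) (simp add: partial_deriv_def)
  then show ?case using Cons by (cases vs) auto
qed simp

lemma smooth_const: "smooth (\<lambda>x. c)"
  unfolding smooth_def iter_deriv_const by (auto intro: differentiable_on_const)

lemma partial_deriv_slice:
  assumes "f differentiable_on UNIV"
  shows "partial_deriv v (\<lambda>\<zeta>. f (x, \<zeta>)) = (\<lambda>\<zeta>. partial_deriv (0, v) f (x, \<zeta>))"
    and "(\<lambda>\<zeta>. f (x, \<zeta>)) differentiable_on UNIV"
proof -
  have d: "((\<lambda>\<zeta>. f (x, \<zeta>)) has_derivative (\<lambda>v. frechet_derivative f (at (x, \<zeta>)) (0, v))) (at \<zeta>)" for \<zeta>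
    by (rule has_derivative_compose[where f = "\<lambda>\<zeta>. (x, \<zeta>)"])
      (auto intro!: derivative_eq_intros has_derivative_frechet[OF assms])
  show "partial_deriv v (\<lambda>\<zeta>. f (x, \<zeta>)) = (\<lambda>\<zeta>. partial_deriv (0, v) f (x, \<zeta>))"
    using partial_deriv_unique[OF d] by (auto simp: partial_deriv_def)
  show "(\<lambda>\<zeta>. f (x, \<zeta>)) differentiable_on UNIV"
    using d by (auto simp: differentiable_on_def differentiable_def)
qed

section \<open>Symbol estimates along lists of directions\<close>

abbreviation ex :: "'n::finite \<Rightarrow> (real^'n) \<times> (real^'n)" where "ex i \<equiv> (axis i 1, 0)"
abbreviation exi :: "'n::finite \<Rightarrow> (real^'n) \<times> (real^'n)" where "exi i \<equiv> (0, axis i 1)"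

lemma ex_exi_Basis [simp]: "ex i \<in> Basis" "exi i \<in> Basis"
  by (auto simp: Basis_prod_def axis_in_Basis_iff)

text \<open>Symbols of order \<open>- m\<close> with \<open>l\<close> derivatives under control.
  Lists of directions replace multi-indices so that one more derivative is one more list element,
  and a single number \<open>K\<close> carries all the bounds because the final constant has to be
  linear in it.\<close>

definition symbol_bound :: "nat \<Rightarrow> nat \<Rightarrow> real \<Rightarrow> 'n::finite symbol \<Rightarrow> bool" where
  "symbol_bound l m K a \<longleftrightarrow> smooth a \<and> (\<forall>is js x \<xi>. length is + length js \<le> l \<longrightarrow>
     jap \<xi> ^ (length js + m) * norm (iter_deriv (map exi js @ map ex is) a (x, \<xi>)) \<le> K)"

lemma sum_count_list: "(\<Sum>i\<in>(UNIV::'a::finite set). count_list xs i) = length xs"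
proof (induction xs)
  case (Cons a xs)
  have "(\<Sum>i\<in>UNIV. count_list (a # xs) i) = (\<Sum>i\<in>UNIV. count_list xs i + (if a = i then 1 else 0))"
    by (rule sum.cong) auto
  then show ?case using Cons by (simp add: sum.distrib)
qed simp

lemma multi_deriv_count_list:
  fixes e :: "'n::finite \<Rightarrow> 'a::euclidean_space"
  assumes "smooth f" "range e \<subseteq> Basis"
  shows "multi_deriv e (count_list xs) f = iter_deriv (map e xs) f"
proof -
  let ?ys = "SOME is. \<forall>i. count_list is i = count_list xs i"
  have "\<forall>i. count_list ?ys i = count_list xs i" by (rule someI[of _ xs]) simp
  then have "mset ?ys = mset xs" by (intro multiset_eqI) (simp add: count_mset)
  then have "mset (map e ?ys) = mset (map e xs)" by simp
  then have "iter_deriv (map e ?ys) f = iter_deriv (map e xs) f"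
    by (intro iter_deriv_perm assms(1)) (use assms(2) in auto)
  then show ?thesis by (simp add: multi_deriv_def foldr_map comp_def)
qed

lemma jap_eq: "jap \<xi> = sqrt (1 + (norm \<xi>)\<^sup>2)"
  by (simp add: jap_def powr_half_sqrt)

lemma jap_ge_1: "jap \<xi> \<ge> 1"
  by (simp add: jap_eq)

lemma jap_pos: "jap \<xi> > 0"
  using jap_ge_1[of \<xi>] by linarith

text \<open>Every pair of lists is counted by a pair of multi-indices, so the corresponding value
  belongs to the set whose supremum is the seminorm; membership in \<open>S0\<close> makes that
  supremum an upper bound.\<close>

lemma S0_symbol_bound:
  fixes a :: "'n::finite symbol"
  assumes "a \<in> S0"
  shows "symbol_bound l 0 (S0_seminorm l a) a"
  unfolding symbol_bound_def
proof (intro conjI allI impI)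
  show sm: "smooth a" using assms by (simp add: S0_def)
  fix "is" js :: "'n list" and x \<xi> assume l: "length is + length js \<le> l"
  have 1: "d_x (count_list is) a = iter_deriv (map ex is) a"
    unfolding d_x_def by (rule multi_deriv_count_list[OF sm]) auto
  have 2: "d_xi (count_list js) (d_x (count_list is) a) = iter_deriv (map exi js @ map ex is) a"
    unfolding d_xi_def 1 by (subst multi_deriv_count_list) (auto intro!: smooth_iter_deriv sm)
  have "jap \<xi> ^ (\<Sum>i\<in>UNIV. count_list js i) * norm (d_xi (count_list js) (d_x (count_list is) a) (x, \<xi>)) \<in> S0_values l a"
    unfolding S0_values_def mem_Collect_eq
    by (rule exI[of _ x], rule exI[of _ \<xi>], rule exI[of _ "count_list js"], rule exI[of _ "count_list is"])
      (use l in \<open>simp add: sum.distrib sum_count_list\<close>)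
  then show "jap \<xi> ^ (length js + 0) * norm (iter_deriv (map exi js @ map ex is) a (x, \<xi>)) \<le> S0_seminorm l a"
    unfolding 2 sum_count_list S0_seminorm_def using assms by (auto simp: S0_def intro!: cSup_upper)
qed

lemma symbol_bound_le0:
  assumes "symbol_bound l m K a"
  shows "jap \<xi> ^ m * norm (a (x, \<xi>)) \<le> K"
proof -
  have "\<And>is js x \<xi>. length is + length js \<le> l \<Longrightarrow> jap \<xi> ^ (length js + m) * norm (iter_deriv (map exi js @ map ex is) a (x, \<xi>)) \<le> K"
    using assms unfolding symbol_bound_def by blast
  from this[of "[]" "[]"] show ?thesis by simp
qed

lemma symbol_bound_nonneg: "symbol_bound l m K a \<Longrightarrow> 0 \<le> K"
  using symbol_bound_le0[of l m K a 0 0] jap_pos[of "0::real^'a"]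
  by (meson mult_nonneg_nonneg norm_ge_zero order.trans less_imp_le zero_le_power)

lemma symbol_bound_mono:
  fixes a :: "'n::finite symbol"
  assumes "symbol_bound l m K a" "l' \<le> l" "m' \<le> m" "K \<le> K'"
  shows "symbol_bound l' m' K' a"
  unfolding symbol_bound_def
proof (intro conjI allI impI)
  show "smooth a" using assms(1) by (simp add: symbol_bound_def)
  fix "is" js :: "'n list" and x \<xi> :: "real^'n"
  assume "length is + length js \<le> l'"
  then have a: "smooth a \<and> (\<forall>is js x \<xi>. length is + length js \<le> l \<longrightarrow> jap \<xi> ^ (length js + m) * cmod (iter_deriv (map exi js @ map ex is) a (x, \<xi>)) \<le> K)"
    and le: "l' \<le> l" "m' \<le> m" "K \<le> K'" "length is + length js \<le> l'"
    using assms unfolding symbol_bound_def by auto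
  have "jap \<xi> ^ (length js + m') \<le> jap \<xi> ^ (length js + m)"
    using le jap_ge_1 by (intro power_increasing) auto
  then have "jap \<xi> ^ (length js + m') * cmod (iter_deriv (map exi js @ map ex is) a (x, \<xi>)) \<le> jap \<xi> ^ (length js + m) * cmod (iter_deriv (map exi js @ map ex is) a (x, \<xi>))"
    by (intro mult_right_mono) auto
  also have "\<dots> \<le> K" using a le by auto
  finally show "jap \<xi> ^ (length js + m') * cmod (iter_deriv (map exi js @ map ex is) a (x, \<xi>)) \<le> K'" using le by simp
qed

lemma symbol_bound_add:
  assumes "symbol_bound l m K a" "symbol_bound l m K' b"
  shows "symbol_bound l m (K + K') (\<lambda>z. a z + b z)"
  unfolding symbol_bound_def
proof (intro conjI allI impI)
  show "smooth (\<lambda>z. a z + b z)" using assms by (auto simp: symbol_bound_def intro: smooth_add)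
  fix "is" js :: "'a list" and x \<xi> assume l: "length is + length js \<le> l"
  have 1: "iter_deriv (map exi js @ map ex is) (\<lambda>z. a z + b z) = (\<lambda>z. iter_deriv (map exi js @ map ex is) a z + iter_deriv (map exi js @ map ex is) b z)"
    using assms by (intro iter_deriv_add) (auto simp: symbol_bound_def)
  have "jap \<xi> ^ (length js + m) * norm (iter_deriv (map exi js @ map ex is) (\<lambda>z. a z + b z) (x, \<xi>))
     \<le> jap \<xi> ^ (length js + m) * (norm (iter_deriv (map exi js @ map ex is) a (x, \<xi>)) + norm (iter_deriv (map exi js @ map ex is) b (x, \<xi>)))"
    unfolding 1 using jap_pos[of \<xi>] by (intro mult_left_mono norm_triangle_ineq) auto
  also have "\<dots> \<le> K + K'" unfolding distrib_left using assms l by (intro add_mono) (auto simp: symbol_bound_def)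
  finally show "jap \<xi> ^ (length js + m) * norm (iter_deriv (map exi js @ map ex is) (\<lambda>z. a z + b z) (x, \<xi>)) \<le> K + K'" .
qed

lemma symbol_bound_bounded_linear:
  assumes "symbol_bound l m K a" and h: "bounded_linear h" "\<And>z. norm (h z) \<le> C * norm z" and C: "C \<ge> 0"
  shows "symbol_bound l m (C * K) (\<lambda>z. h (a z))"
  unfolding symbol_bound_def
proof (intro conjI allI impI)
  have sm: "smooth a" using assms by (simp add: symbol_bound_def)
  show "smooth (\<lambda>z. h (a z))" by (rule smooth_bounded_linear[OF h(1) sm])
  fix "is" js :: "'a list" and x \<xi> assume l: "length is + length js \<le> l"
  have 1: "iter_deriv (map exi js @ map ex is) (\<lambda>z. h (a z)) = (\<lambda>z. h (iter_deriv (map exi js @ map ex is) a z))"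
    by (intro iter_deriv_bounded_linear h sm) auto
  have "jap \<xi> ^ (length js + m) * norm (iter_deriv (map exi js @ map ex is) (\<lambda>z. h (a z)) (x, \<xi>))
    \<le> jap \<xi> ^ (length js + m) * (C * norm (iter_deriv (map exi js @ map ex is) a (x, \<xi>)))"
    unfolding 1 using jap_pos[of \<xi>] by (intro mult_left_mono h) auto
  also have "\<dots> = C * (jap \<xi> ^ (length js + m) * norm (iter_deriv (map exi js @ map ex is) a (x, \<xi>)))" by simp
  also have "\<dots> \<le> C * K" using assms l by (intro mult_left_mono) (auto simp: symbol_bound_def)
  finally show "jap \<xi> ^ (length js + m) * norm (iter_deriv (map exi js @ map ex is) (\<lambda>z. h (a z)) (x, \<xi>)) \<le> C * K" .
qed

lemma symbol_bound_zero: "0 \<le> K \<Longrightarrow> symbol_bound l m K (\<lambda>z. 0)"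
  by (auto simp: symbol_bound_def smooth_const iter_deriv_const)

lemma symbol_bound_const: "symbol_bound l 0 (norm c) (\<lambda>z. c)"
  by (auto simp: symbol_bound_def smooth_const iter_deriv_const)

lemma symbol_bound_sum:
  assumes "finite I" "\<And>i. i \<in> I \<Longrightarrow> symbol_bound l m K (a i)" "0 \<le> K"
  shows "symbol_bound l m (real (card I) * K) (\<lambda>z. \<Sum>i\<in>I. a i z)"
  using assms(1,2)
proof (induction I rule: finite_induct)
  case (insert i I)
  then show ?case using symbol_bound_add[of l m K "a i" "real (card I) * K" "\<lambda>z. \<Sum>i\<in>I. a i z"]
    by (simp add: distrib_right)
qed (simp add: symbol_bound_zero)

text \<open>The new direction stands at the end of the list and is commuted into the
  \<open>exi\<close> block, where it counts as one further power of \<open>jap\<close>. A frequency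
  derivative thus uses one of the \<open>l\<close> derivatives and lowers the order by one.\<close>

lemma symbol_bound_exi:
  assumes "symbol_bound (Suc l) m K a"
  shows "symbol_bound l (Suc m) K (partial_deriv (exi j) a)"
  unfolding symbol_bound_def
proof (intro conjI allI impI)
  have sm: "smooth a" using assms by (simp add: symbol_bound_def)
  show "smooth (partial_deriv (exi j) a)" by (rule smooth_partial_deriv[OF sm]) simp
  fix "is" js :: "'a list" and x \<xi> assume l: "length is + length js \<le> l"
  have "iter_deriv (map exi js @ map ex is) (partial_deriv (exi j) a) = iter_deriv ((map exi js @ map ex is) @ [exi j]) a" by simp
  also have "\<dots> = iter_deriv (map exi (j # js) @ map ex is) a"
    by (rule iter_deriv_perm[OF sm]) auto
  finally have "jap \<xi> ^ (length js + Suc m) * norm (iter_deriv (map exi js @ map ex is) (partial_deriv (exi j) a) (x, \<xi>)) =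
    jap \<xi> ^ (length (j # js) + m) * norm (iter_deriv (map exi (j # js) @ map ex is) a (x, \<xi>))" by simp
  also have "\<dots> \<le> K" using assms l unfolding symbol_bound_def by (metis add_Suc_right length_Cons not_less_eq_eq)
  finally show "jap \<xi> ^ (length js + Suc m) * norm (iter_deriv (map exi js @ map ex is) (partial_deriv (exi j) a) (x, \<xi>)) \<le> K" .
qed

lemma symbol_bound_ex:
  assumes "symbol_bound (Suc l) m K a"
  shows "symbol_bound l m K (partial_deriv (ex j) a)"
  unfolding symbol_bound_def
proof (intro conjI allI impI)
  have sm: "smooth a" using assms by (simp add: symbol_bound_def)
  show "smooth (partial_deriv (ex j) a)" by (rule smooth_partial_deriv[OF sm]) simp
  fix "is" js :: "'a list" and x \<xi> assume l: "length is + length js \<le> l"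
  have "iter_deriv (map exi js @ map ex is) (partial_deriv (ex j) a) = iter_deriv (map exi js @ map ex (is @ [j])) a" by simp
  then show "jap \<xi> ^ (length js + m) * norm (iter_deriv (map exi js @ map ex is) (partial_deriv (ex j) a) (x, \<xi>)) \<le> K"
    using assms l unfolding symbol_bound_def by (metis Suc_le_mono add_Suc length_append_singleton)
qed

lemma symbol_bound_le: "symbol_bound l m K a \<Longrightarrow> norm (a (x, \<xi>)) \<le> K / jap \<xi> ^ m"
  using symbol_bound_le0[of l m K a \<xi> x] jap_pos[of \<xi>] by (simp add: pos_le_divide_eq mult.commute)

text \<open>The operator \<open>1 - (2/3) \<Delta>\<close> in the frequency. On the kernel
  \<open>wave (x - y) \<xi>\<close> it acts as multiplication by
  \<open>1 + (2/3) * (norm (x - y))\<^sup>2\<close>, the reciprocal of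
  \<open>bessel_weight (x - y)\<close>.\<close>

definition resolvent_op :: "'n::finite symbol \<Rightarrow> 'n symbol" where
  "resolvent_op a = (\<lambda>z. a z - (2/3) * (\<Sum>j\<in>UNIV. partial_deriv (exi j) (partial_deriv (exi j) a) z))"

text \<open>Two frequency derivatives lower the order by two. The factor \<open>CARD('n)\<close>
  counts the axes, and 2/3 is estimated by 1.\<close>

lemma symbol_bound_resolvent_diff:
  fixes a :: "'n::finite symbol" and K :: real
  assumes "symbol_bound (Suc (Suc l)) m K a"
  shows "symbol_bound l (Suc (Suc m)) (real CARD('n) * K) (\<lambda>z. resolvent_op a z - a z)"
proof -
  have "symbol_bound l (Suc (Suc m)) (real CARD('n) * K) (\<lambda>z. \<Sum>j\<in>UNIV. partial_deriv (exi j) (partial_deriv (exi j) a) z)"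
    by (rule symbol_bound_sum) (auto intro!: symbol_bound_exi assms symbol_bound_nonneg[OF assms])
  then have "symbol_bound l (Suc (Suc m)) (1 * (real CARD('n) * K)) (\<lambda>z. - (2/3) * (\<Sum>j\<in>UNIV. partial_deriv (exi j) (partial_deriv (exi j) a) z))"
    by (rule symbol_bound_bounded_linear[OF _ bounded_linear_mult_right]) (simp_all add: norm_mult)
  then show ?thesis by (simp add: resolvent_op_def)
qed

lemma symbol_bound_resolvent:
  fixes a :: "'n::finite symbol" and K :: real
  assumes "symbol_bound (Suc (Suc l)) m K a"
  shows "symbol_bound l m ((real CARD('n) + 1) * K) (resolvent_op a)"
proof -
  have K: "0 \<le> K" by (rule symbol_bound_nonneg[OF assms])
  have "symbol_bound l m (real CARD('n) * K + K) (\<lambda>z. (resolvent_op a z - a z) + a z)"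
    by (intro symbol_bound_add symbol_bound_mono[OF symbol_bound_resolvent_diff[OF assms]] symbol_bound_mono[OF assms]) auto
  then show ?thesis by (simp add: algebra_simps)
qed

lemma symbol_bound_resolvent_iter:
  fixes a :: "'n::finite symbol" and K :: real
  assumes "symbol_bound (l + 2 * J) m K a"
  shows "symbol_bound l m ((real CARD('n) + 1) ^ J * K) ((resolvent_op ^^ J) a)"
  using assms
proof (induction J arbitrary: l)
  case (Suc J)
  have "symbol_bound (Suc (Suc l)) m ((real CARD('n) + 1) ^ J * K) ((resolvent_op ^^ J) a)"
    by (rule Suc.IH) (use Suc.prems in simp)
  then have "symbol_bound l m ((real CARD('n) + 1) * ((real CARD('n) + 1) ^ J * K)) (resolvent_op ((resolvent_op ^^ J) a))"
    using symbol_bound_resolvent by fastforce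
  then show ?case by (simp add: mult.assoc)
qed simp

lemma resolvent_iter_diff:
  fixes a :: "'n::finite symbol" and K :: real
  assumes "symbol_bound (2 * J) 0 K a"
  shows "norm ((resolvent_op ^^ J) a (x, \<xi>) - a (x, \<xi>)) \<le> real J * (real CARD('n) + 1) ^ J * K / jap \<xi>"
proof -
  have K: "0 \<le> K" by (rule symbol_bound_nonneg[OF assms])
  have "norm ((resolvent_op ^^ i) a (x, \<xi>) - a (x, \<xi>)) \<le> real i * (real CARD('n) + 1) ^ J * K / jap \<xi>" if "i \<le> J" for i
    using that
  proof (induction i)
    case (Suc i)
    let ?b = "(resolvent_op ^^ i) a"
    have "symbol_bound 2 0 ((real CARD('n) + 1) ^ i * K) ?b"
      by (rule symbol_bound_resolvent_iter, rule symbol_bound_mono[OF assms]) (use Suc.prems in auto)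
    then have "symbol_bound 0 (Suc (Suc 0)) (real CARD('n) * ((real CARD('n) + 1) ^ i * K)) (\<lambda>z. resolvent_op ?b z - ?b z)"
      by (intro symbol_bound_resolvent_diff) (simp add: numeral_2_eq_2)
    then have "symbol_bound 0 1 ((real CARD('n) + 1) ^ J * K) (\<lambda>z. resolvent_op ?b z - ?b z)"
    proof (rule symbol_bound_mono)
      have "real CARD('n) * ((real CARD('n) + 1) ^ i * K) \<le> (real CARD('n) + 1) * ((real CARD('n) + 1) ^ i * K)"
        using K by (intro mult_right_mono) auto
      also have "\<dots> = (real CARD('n) + 1) ^ Suc i * K" by simp
      also have "\<dots> \<le> (real CARD('n) + 1) ^ J * K" using Suc.prems K by (intro mult_right_mono power_increasing) auto
      finally show "real CARD('n) * ((real CARD('n) + 1) ^ i * K) \<le> (real CARD('n) + 1) ^ J * K" by simp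
    qed auto
    then have "norm (resolvent_op ?b (x, \<xi>) - ?b (x, \<xi>)) \<le> (real CARD('n) + 1) ^ J * K / jap \<xi>"
      using symbol_bound_le by fastforce
    moreover have "norm (?b (x, \<xi>) - a (x, \<xi>)) \<le> real i * (real CARD('n) + 1) ^ J * K / jap \<xi>" using Suc by auto
    moreover have "norm ((resolvent_op ^^ Suc i) a (x, \<xi>) - a (x, \<xi>)) \<le> norm (resolvent_op ?b (x, \<xi>) - ?b (x, \<xi>)) + norm (?b (x, \<xi>) - a (x, \<xi>))"
      using norm_triangle_ineq[of "resolvent_op ?b (x, \<xi>) - ?b (x, \<xi>)" "?b (x, \<xi>) - a (x, \<xi>)"] by simp
    moreover have "real (Suc i) * (real CARD('n) + 1) ^ J * K / jap \<xi> = (real CARD('n) + 1) ^ J * K / jap \<xi> + real i * (real CARD('n) + 1) ^ J * K / jap \<xi>"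
      by (simp add: algebra_simps add_divide_distrib)
    ultimately show ?case by linarith
  qed simp
  then show ?thesis by blast
qed

section \<open>Gaussian packets\<close>

lemma jap_norm_Pair: "jap x = norm (1::real, x)"
  by (simp add: jap_eq norm_Pair)

text \<open>\<open>jap x\<close> is the Euclidean norm of the pair \<open>(1, x)\<close>, so this is
  the reverse triangle inequality.\<close>

lemma jap_lipschitz: "\<bar>jap x - jap y\<bar> \<le> norm (x - y)"
  using norm_triangle_ineq3[of "(1::real, x)" "(1::real, y)"] by (simp add: jap_norm_Pair norm_Pair)

lemma jap_ge_norm: "norm x \<le> jap x"
  by (simp add: jap_eq real_le_rsqrt)

lemma jap_minus: "jap (- x) = jap x" "jap (x - y) = jap (y - x)"
  by (simp_all add: jap_def norm_minus_commute)

text \<open>Peetre's inequality with exponent one. It moves a weight from one frequency to another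
  at the price of one power of the bracket of their difference.\<close>

lemma jap_peetre: "jap x \<le> 2 * jap y * jap (x - y)"
proof -
  have "jap x \<le> jap y + norm (x - y)" using jap_lipschitz[of x y] by linarith
  also have "\<dots> \<le> jap y + jap (x - y)" using jap_ge_norm[of "x - y"] by simp
  also have "\<dots> \<le> jap y * jap (x - y) + jap y * jap (x - y)"
    using jap_ge_1[of y] jap_ge_1[of "x - y"] by (intro add_mono) (auto simp: mult_le_cancel_left1 mult_le_cancel_right1)
  finally show ?thesis by simp
qed

lemma continuous_on_jap [continuous_intros]: "continuous_on A f \<Longrightarrow> continuous_on A (\<lambda>x. jap (f x))"
  unfolding jap_eq by (intro continuous_intros)

lemma borel_measurable_jap [measurable]: "(jap :: 'a::euclidean_space \<Rightarrow> real) \<in> borel_measurable borel"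
  by (intro borel_measurable_continuous_onI continuous_intros)

text \<open>The normalisation makes the square a probability density in \<open>\<zeta>\<close>. The
  width depends on the first argument, so the arguments are not interchangeable: the frequencies of
  the form come first, the variable of averaging second.\<close>

definition packet :: "'a::euclidean_space \<Rightarrow> 'a \<Rightarrow> real" where
  "packet \<xi> \<zeta> = sqrt (sqrt (1 / (pi * jap \<xi>))) ^ DIM('a) * exp (- (1 / (2 * jap \<xi>)) * (norm (\<xi> - \<zeta>))\<^sup>2)"

lemma packet_nonneg: "packet \<xi> \<zeta> \<ge> 0"
  using jap_pos[of \<xi>] by (simp add: packet_def)

lemma packet_le_1: "packet \<xi> \<zeta> \<le> 1"
proof -
  have "pi * jap \<xi> \<ge> 1 * 1" using pi_ge_two jap_ge_1[of \<xi>] by (intro mult_mono) auto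
  then have "sqrt (sqrt (1 / (pi * jap \<xi>))) ^ DIM('a) \<le> 1" by (intro power_le_one) auto
  moreover have "exp (- (1 / (2 * jap \<xi>)) * (norm (\<xi> - \<zeta>))\<^sup>2) \<le> 1" using jap_pos[of \<xi>] by simp
  ultimately show ?thesis unfolding packet_def using mult_mono[of _ 1 _ 1] jap_pos[of \<xi>] by fastforce
qed

lemma continuous_on_packet [continuous_intros]:
  assumes "continuous_on A f" "continuous_on A g"
  shows "continuous_on A (\<lambda>x. packet (f x) (g x))"
proof -
  have "jap (f x) \<noteq> 0" for x using jap_pos[of "f x"] by simp
  then show ?thesis unfolding packet_def by (intro continuous_intros assms) auto
qed

lemma packet_square: "(packet \<xi> (\<zeta>::'a::euclidean_space))\<^sup>2 = sqrt (1 / (pi * jap \<xi>)) ^ DIM('a) * exp (- (1 / jap \<xi>) * (norm (\<zeta> - \<xi>))\<^sup>2)"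
proof -
  have 1: "(sqrt (sqrt (1 / (pi * jap \<xi>))) ^ DIM('a))\<^sup>2 = sqrt (1 / (pi * jap \<xi>)) ^ DIM('a)"
    using jap_pos[of \<xi>] by (simp add: power_mult[symmetric] mult.commute[of _ 2]) (simp add: power_mult)
  have 2: "(exp (- (1 / (2 * jap \<xi>)) * (norm (\<xi> - \<zeta>))\<^sup>2))\<^sup>2 = exp (- (1 / jap \<xi>) * (norm (\<zeta> - \<xi>))\<^sup>2)"
    using jap_pos[of \<xi>] by (simp add: exp_double[symmetric] norm_minus_commute)
  show ?thesis unfolding packet_def power_mult_distrib 1 2 ..
qed

lemma
  fixes \<xi> :: "'a::euclidean_space"
  shows packet_square_integrable: "integrable lborel (\<lambda>\<zeta>. (packet \<xi> \<zeta>)\<^sup>2)"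
    and packet_square_integral: "(LINT \<zeta>|lborel. (packet \<xi> \<zeta>)\<^sup>2) = 1"
proof -
  have j: "1 / jap \<xi> > 0" using jap_pos[of \<xi>] by simp
  show "integrable lborel (\<lambda>\<zeta>. (packet \<xi> \<zeta>)\<^sup>2)"
    unfolding packet_square by (rule integrable_mult_right) (rule gaussian_shift_integrable[OF j])
  have "sqrt (1 / (pi * jap \<xi>)) * sqrt (pi / (1 / jap \<xi>)) = 1"
    using jap_pos[of \<xi>] by (simp add: real_sqrt_mult[symmetric])
  then show "(LINT \<zeta>|lborel. (packet \<xi> \<zeta>)\<^sup>2) = 1"
    unfolding packet_square integral_mult_right_zero gaussian_shift_integral[OF j]
    by (metis power_mult_distrib power_one)
qed

text \<open>The prefactor is a power of the square root of the geometric over the arithmetic mean of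
  the two brackets. It measures the difference of the widths, the exponential that of the centres;
  both are at most 1 and equal to 1 for \<open>\<xi> = \<eta>\<close>.\<close>

lemma
  fixes \<xi> \<eta> :: "'a::euclidean_space"
  shows packet_prod_integrable: "integrable lborel (\<lambda>\<zeta>. packet \<xi> \<zeta> * packet \<eta> \<zeta>)"
    and packet_prod_integral: "(LINT \<zeta>|lborel. packet \<xi> \<zeta> * packet \<eta> \<zeta>)
      = sqrt (2 * sqrt (jap \<xi> * jap \<eta>) / (jap \<xi> + jap \<eta>)) ^ DIM('a) * exp (- (norm (\<xi> - \<eta>))\<^sup>2 / (2 * (jap \<xi> + jap \<eta>)))"
proof -
  define S T where "S = jap \<xi>" and "T = jap \<eta>"
  have ST: "S > 0" "T > 0" by (auto simp: S_def T_def jap_pos)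
  let ?a = "1 / (2 * S)" and ?b = "1 / (2 * T)"
  have ab: "?a > 0" "?b > 0" using ST by auto
  have eq: "packet \<xi> \<zeta> * packet \<eta> \<zeta> = (sqrt (sqrt (1 / (pi * S))) ^ DIM('a) * sqrt (sqrt (1 / (pi * T))) ^ DIM('a)) * (exp (- ?a * (norm (\<xi> - \<zeta>))\<^sup>2) * exp (- ?b * (norm (\<eta> - \<zeta>))\<^sup>2))" for \<zeta>
    by (simp only: packet_def S_def T_def mult_ac)
  show "integrable lborel (\<lambda>\<zeta>. packet \<xi> \<zeta> * packet \<eta> \<zeta>)"
    unfolding eq by (rule integrable_mult_right) (rule gaussian_product_integrable[OF ab])
  have s1: "?a + ?b = (S + T) / (2 * S * T)" using ST by (simp add: field_simps)
  have s2: "?a * ?b / (?a + ?b) = 1 / (2 * (S + T))" unfolding s1 using ST by (simp add: field_simps)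
  have "sqrt (sqrt (1 / (pi * S))) * sqrt (sqrt (1 / (pi * T))) * sqrt (pi / (?a + ?b)) = sqrt (2 * sqrt (S * T) / (S + T))"
  proof -
    have "sqrt (1 / (pi * S)) * sqrt (1 / (pi * T)) = 1 / (pi * sqrt (S * T))"
    proof -
      have "sqrt (1 / (pi * S)) * sqrt (1 / (pi * T)) = sqrt (1 / (pi\<^sup>2 * (S * T)))"
        by (simp add: real_sqrt_mult[symmetric] power2_eq_square mult_ac)
      also have "\<dots> = 1 / (pi * sqrt (S * T))"
        by (simp add: real_sqrt_divide real_sqrt_mult)
      finally show ?thesis .
    qed
    then have "sqrt (1 / (pi * S)) * sqrt (1 / (pi * T)) * (pi / (?a + ?b)) = 1 / (pi * sqrt (S * T)) * (pi / ((S + T) / (2 * S * T)))"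
      unfolding s1 by simp
    also have "\<dots> = 2 * (S * T / sqrt (S * T)) / (S + T)" using ST by (simp add: field_simps)
    also have "S * T / sqrt (S * T) = sqrt (S * T)" using ST by (simp add: real_div_sqrt)
    finally show ?thesis by (simp only: real_sqrt_mult[symmetric])
  qed
  then show "(LINT \<zeta>|lborel. packet \<xi> \<zeta> * packet \<eta> \<zeta>)
      = sqrt (2 * sqrt (jap \<xi> * jap \<eta>) / (jap \<xi> + jap \<eta>)) ^ DIM('a) * exp (- (norm (\<xi> - \<eta>))\<^sup>2 / (2 * (jap \<xi> + jap \<eta>)))"
    unfolding eq integral_mult_right_zero gaussian_product_integral[OF ab] s2 S_def[symmetric] T_def[symmetric]
    by (simp add: power_mult_distrib[symmetric] mult.assoc[symmetric] del: real_sqrt_mult real_sqrt_divide)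
qed

text \<open>By the normalisation the integral is twice the amount by which the overlap falls short
  of 1. Different widths contribute \<open>1 - q\<close>, different centres at most
  \<open>y\<close>. Both are bounded by a multiple of
  \<open>(norm (\<xi> - \<eta>))\<^sup>2 / jap \<xi>\<close>, the former because \<open>jap\<close>
  is Lipschitz.\<close>

lemma
  fixes \<xi> \<eta> :: "'a::euclidean_space"
  shows packet_diff_square_integrable: "integrable lborel (\<lambda>\<zeta>. (packet \<xi> \<zeta> - packet \<eta> \<zeta>)\<^sup>2)"
    and packet_diff_square_le: "(LINT \<zeta>|lborel. (packet \<xi> \<zeta> - packet \<eta> \<zeta>)\<^sup>2) \<le> (2 * DIM('a) + 1) * (norm (\<xi> - \<eta>))\<^sup>2 / jap \<xi>"
proof -
  have eq: "(packet \<xi> \<zeta> - packet \<eta> \<zeta>)\<^sup>2 = (packet \<xi> \<zeta>)\<^sup>2 + (packet \<eta> \<zeta>)\<^sup>2 - 2 * (packet \<xi> \<zeta> * packet \<eta> \<zeta>)" for \<zeta>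
    by (simp add: power2_diff)
  show "integrable lborel (\<lambda>\<zeta>. (packet \<xi> \<zeta> - packet \<eta> \<zeta>)\<^sup>2)"
    unfolding eq by (intro Bochner_Integration.integrable_diff Bochner_Integration.integrable_add packet_square_integrable integrable_mult_right packet_prod_integrable)
  define S T d where "S = jap \<xi>" and "T = jap \<eta>" and "d = norm (\<xi> - \<eta>)"
  have ST: "S \<ge> 1" "T \<ge> 1" by (auto simp: S_def T_def jap_ge_1)
  have d: "d \<ge> 0" "\<bar>S - T\<bar> \<le> d" by (auto simp: d_def S_def T_def jap_lipschitz)
  define Q where "Q = 2 * sqrt (S * T) / (S + T)"
  have st: "sqrt S * sqrt S = S" "sqrt T * sqrt T = T" "sqrt S * sqrt T = sqrt (S * T)" using ST by (auto simp: real_sqrt_mult)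
  have Q0: "Q \<ge> 0" using ST by (simp add: Q_def)
  have "1 - Q = (sqrt S - sqrt T)\<^sup>2 / (S + T)"
    using ST st by (simp add: Q_def power2_diff field_simps)
  moreover have "(sqrt S - sqrt T)\<^sup>2 \<le> d\<^sup>2"
  proof -
    have "\<bar>sqrt S - sqrt T\<bar> * 1 \<le> \<bar>sqrt S - sqrt T\<bar> * (sqrt S + sqrt T)"
      using ST by (intro mult_left_mono) (auto intro: add_increasing2)
    also have "\<dots> = \<bar>(sqrt S - sqrt T) * (sqrt S + sqrt T)\<bar>" using ST by (simp add: abs_mult)
    also have "(sqrt S - sqrt T) * (sqrt S + sqrt T) = S - T" using st by (simp add: algebra_simps)
    finally show ?thesis using d by (auto intro!: abs_le_square_iff[THEN iffD1] simp: abs_le_iff)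
  qed
  ultimately have Q1: "1 - Q \<le> d\<^sup>2 / S" "Q \<le> 1"
  proof -
    have "(sqrt S - sqrt T)\<^sup>2 / (S + T) \<le> d\<^sup>2 / (S + T)" using ST \<open>(sqrt S - sqrt T)\<^sup>2 \<le> d\<^sup>2\<close> by (intro divide_right_mono) auto
    also have "\<dots> \<le> d\<^sup>2 / S" using ST by (intro divide_left_mono) auto
    finally show "1 - Q \<le> d\<^sup>2 / S" using \<open>1 - Q = _\<close> by simp
    have "0 \<le> (sqrt S - sqrt T)\<^sup>2 / (S + T)" using ST by simp
    then show "Q \<le> 1" using \<open>1 - Q = _\<close> by linarith
  qed
  define q where "q = sqrt Q ^ DIM('a)"
  have q: "q \<le> 1" "q \<ge> 0" using Q0 Q1 by (auto simp: q_def intro: power_le_one)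
  \<comment> \<open>Half-integer powers of \<open>Q\<close> are avoided: passing from
    \<open>sqrt Q\<close> to the smaller \<open>Q\<close> brings the estimate to Bernoulli's
    inequality.\<close>
  have "Q \<le> sqrt Q" using Q0 Q1 by (metis mult_left_le real_sqrt_ge_zero real_sqrt_le_1_iff real_sqrt_mult_self abs_of_nonneg)
  then have "Q ^ DIM('a) \<le> q" unfolding q_def using Q0 by (intro power_mono)
  moreover have "1 + real DIM('a) * (Q - 1) \<le> (1 + (Q - 1)) ^ DIM('a)"
    by (rule Bernoulli_inequality) (use Q0 in simp)
  ultimately have q1: "1 - q \<le> DIM('a) * (1 - Q)" by (simp add: algebra_simps)
  define y where "y = d\<^sup>2 / (2 * (S + T))"
  have y: "y \<ge> 0" "y \<le> d\<^sup>2 / (2 * S)" using ST by (auto simp: y_def intro!: divide_left_mono)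
  have e: "1 - y \<le> exp (- y)" "exp (- y) \<le> 1" using exp_ge_add_one_self[of "-y"] y by auto
  have "q * (1 - exp (- y)) \<le> 1 * (1 - exp (- y))" using q e by (intro mult_right_mono) auto
  then have "1 - q * exp (- y) \<le> (1 - q) + y" using e by (simp add: algebra_simps)
  also have "\<dots> \<le> DIM('a) * (d\<^sup>2 / S) + d\<^sup>2 / (2 * S)"
    using q1 mult_left_mono[OF Q1(1), of "real DIM('a)"] y by linarith
  finally have main: "1 - q * exp (- y) \<le> DIM('a) * (d\<^sup>2 / S) + d\<^sup>2 / (2 * S)" .
  have "(LINT \<zeta>|lborel. (packet \<xi> \<zeta> - packet \<eta> \<zeta>)\<^sup>2) = 1 + 1 - 2 * (q * exp (- y))"
    unfolding eq by (simp add: packet_square_integrable packet_prod_integrable packet_square_integral packet_prod_integral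
        q_def y_def Q_def S_def T_def d_def)
  also have "\<dots> = 2 * (1 - q * exp (- y))" by simp
  also have "\<dots> \<le> 2 * (DIM('a) * (d\<^sup>2 / S) + d\<^sup>2 / (2 * S))" by (intro mult_left_mono main) simp
  also have "\<dots> = (2 * DIM('a) + 1) * d\<^sup>2 / S" by (simp add: algebra_simps add_divide_distrib)
  finally show "(LINT \<zeta>|lborel. (packet \<xi> \<zeta> - packet \<eta> \<zeta>)\<^sup>2) \<le> (2 * DIM('a) + 1) * (norm (\<xi> - \<eta>))\<^sup>2 / jap \<xi>"
    by (simp add: S_def d_def)
qed

text \<open>After rescaling by \<open>1 / jap \<xi>\<close> this is the second Gaussian moment, and
  the normalisation of the packet cancels the Jacobian. The variance has the size of the squared
  width.\<close>

lemma packet_second_moment: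
  "\<exists>C\<ge>0. \<forall>\<xi>::'a::euclidean_space. integrable lborel (\<lambda>\<zeta>. (norm (\<zeta> - \<xi>))\<^sup>2 * (packet \<xi> \<zeta>)\<^sup>2)
     \<and> (LINT \<zeta>|lborel. (norm (\<zeta> - \<xi>))\<^sup>2 * (packet \<xi> \<zeta>)\<^sup>2) \<le> C * jap \<xi>"
proof -
  obtain C where C: "C \<ge> 1" "\<And>\<alpha>. \<alpha> > 0 \<Longrightarrow> integrable lborel (\<lambda>x::'a. (sqrt \<alpha> * norm x) ^ 2 * exp (- \<alpha> * (norm x)\<^sup>2))"
     "\<And>\<alpha>. \<alpha> > 0 \<Longrightarrow> (LINT x::'a|lborel. (sqrt \<alpha> * norm x) ^ 2 * exp (- \<alpha> * (norm x)\<^sup>2)) \<le> C * (1 / sqrt \<alpha>) ^ DIM('a)"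
    using gaussian_moment[of 2, where 'a='a] by blast
  show ?thesis
  proof (intro exI[of _ C] conjI allI)
    fix \<xi> :: 'a
    define \<alpha> where "\<alpha> = 1 / jap \<xi>"
    have \<alpha>: "\<alpha> > 0" using jap_pos[of \<xi>] by (simp add: \<alpha>_def)
    let ?g = "\<lambda>x::'a. (sqrt \<alpha> * norm x) ^ 2 * exp (- \<alpha> * (norm x)\<^sup>2)"
    have eq: "(norm (\<zeta> - \<xi>))\<^sup>2 * (packet \<xi> \<zeta>)\<^sup>2 = jap \<xi> * sqrt (1 / (pi * jap \<xi>)) ^ DIM('a) * ?g (- \<xi> + \<zeta>)" for \<zeta>
      using jap_pos[of \<xi>] by (simp add: packet_square \<alpha>_def power_mult_distrib)
    show "integrable lborel (\<lambda>\<zeta>. (norm (\<zeta> - \<xi>))\<^sup>2 * (packet \<xi> \<zeta>)\<^sup>2)"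
      unfolding eq by (intro integrable_mult_right lborel_integrable_shift C \<alpha>)
    have "(LINT \<zeta>|lborel. (norm (\<zeta> - \<xi>))\<^sup>2 * (packet \<xi> \<zeta>)\<^sup>2) = jap \<xi> * sqrt (1 / (pi * jap \<xi>)) ^ DIM('a) * (LINT \<zeta>|lborel. ?g \<zeta>)"
      unfolding eq integral_mult_right_zero by (subst lborel_integral_shift) simp_all
    also have "\<dots> \<le> jap \<xi> * sqrt (1 / (pi * jap \<xi>)) ^ DIM('a) * (C * (1 / sqrt \<alpha>) ^ DIM('a))"
      using jap_pos[of \<xi>] by (intro mult_left_mono C \<alpha>) auto
    also have "\<dots> = C * jap \<xi> * (sqrt (1 / (pi * jap \<xi>)) * (1 / sqrt \<alpha>)) ^ DIM('a)"
      by (simp only: power_mult_distrib mult_ac)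
    also have "sqrt (1 / (pi * jap \<xi>)) * (1 / sqrt \<alpha>) = sqrt (1 / pi)"
      using jap_pos[of \<xi>] by (simp add: \<alpha>_def real_sqrt_divide real_sqrt_mult)
    also have "C * jap \<xi> * sqrt (1 / pi) ^ DIM('a) \<le> C * jap \<xi> * 1"
      using jap_pos[of \<xi>] C(1) pi_ge_two by (intro mult_left_mono power_le_one) auto
    finally show "(LINT \<zeta>|lborel. (norm (\<zeta> - \<xi>))\<^sup>2 * (packet \<xi> \<zeta>)\<^sup>2) \<le> C * jap \<xi>" by simp
  qed (use C in auto)
qed

text \<open>The integrand is odd under the reflection of \<open>\<zeta>\<close> about
  \<open>\<xi>\<close>. This removes the linear Taylor term, which taken in absolute value would
  only give an error of size \<open>jap \<xi> powr (-1/2)\<close>.\<close>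

lemma packet_first_moment:
  fixes \<xi> v :: "'a::euclidean_space"
  shows "(LINT \<zeta>|lborel. ((\<zeta> - \<xi>) \<bullet> v) * (packet \<xi> \<zeta>)\<^sup>2) = 0"
proof -
  have [measurable]: "packet \<xi> \<in> borel_measurable borel"
    by (intro borel_measurable_continuous_onI continuous_intros)
  have "(LINT \<zeta>|lborel. ((\<zeta> - \<xi>) \<bullet> v) * (packet \<xi> \<zeta>)\<^sup>2) = (LINT \<zeta>|lborel. (((2 *\<^sub>R \<xi> - \<zeta>) - \<xi>) \<bullet> v) * (packet \<xi> (2 *\<^sub>R \<xi> - \<zeta>))\<^sup>2)"
    by (rule lborel_integral_reflect[symmetric]) measurable
  also have "\<dots> = (LINT \<zeta>|lborel. - (((\<zeta> - \<xi>) \<bullet> v) * (packet \<xi> \<zeta>)\<^sup>2))"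
  proof (rule Bochner_Integration.integral_cong[OF refl])
    fix \<zeta>
    have "(2 *\<^sub>R \<xi> - \<zeta>) - \<xi> = - (\<zeta> - \<xi>)" by (simp add: scaleR_2)
    then show "(((2 *\<^sub>R \<xi> - \<zeta>) - \<xi>) \<bullet> v) * (packet \<xi> (2 *\<^sub>R \<xi> - \<zeta>))\<^sup>2 = - (((\<zeta> - \<xi>) \<bullet> v) * (packet \<xi> \<zeta>)\<^sup>2)"
      by (simp only: packet_square norm_minus_cancel inner_minus_left mult_minus_left)
  qed
  finally show ?thesis by simp
qed

section \<open>Taylor expansion of symbols in the frequency\<close>

lemma partial_deriv_expand:
  fixes f :: "real^'n::finite \<Rightarrow> 'b::real_normed_vector"
  assumes "f differentiable_on UNIV"
  shows "partial_deriv w f x = (\<Sum>j\<in>UNIV. (w $ j) *\<^sub>R partial_deriv (axis j 1) f x)"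
proof -
  have lin: "linear (frechet_derivative f (at x))"
    by (rule has_derivative_linear[OF has_derivative_frechet[OF assms]])
  have "w = (\<Sum>j\<in>UNIV. (w $ j) *\<^sub>R axis j 1)"
    by (simp add: basis_expansion scalar_mult_eq_scaleR[symmetric])
  then have "frechet_derivative f (at x) w = frechet_derivative f (at x) (\<Sum>j\<in>UNIV. (w $ j) *\<^sub>R axis j 1)" by simp
  then show ?thesis unfolding partial_deriv_def by (simp add: linear_sum[OF lin] linear_cmul[OF lin])
qed

lemma partial_deriv_bound:
  fixes f :: "real^'n::finite \<Rightarrow> 'b::real_normed_vector"
  assumes "f differentiable_on UNIV" "\<And>j. norm (partial_deriv (axis j 1) f x) \<le> M"
  shows "norm (partial_deriv w f x) \<le> CARD('n) * norm w * M"
proof -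
  have "norm (partial_deriv w f x) \<le> (\<Sum>j\<in>UNIV. norm ((w $ j) *\<^sub>R partial_deriv (axis j 1) f x))"
    unfolding partial_deriv_expand[OF assms(1), of w] by (rule norm_sum)
  also have "\<dots> \<le> (\<Sum>j\<in>(UNIV::'n set). norm w * M)"
    using assms(2) by (intro sum_mono) (auto intro!: mult_mono simp: component_le_norm_cart)
  finally show ?thesis by simp
qed

lemma segment_increment_bound:
  fixes f :: "real^'n::finite \<Rightarrow> 'b::real_normed_vector"
  assumes "f differentiable_on UNIV" "\<And>s j. s \<in> {0..1} \<Longrightarrow> norm (partial_deriv (axis j 1) f (x + s *\<^sub>R w)) \<le> M" "t \<in> {0..1}"
  shows "norm (f (x + t *\<^sub>R w) - f x) \<le> CARD('n) * norm w * M"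
proof -
  have "norm (partial_deriv (axis undefined 1) f (x + 0 *\<^sub>R w)) \<le> M" by (rule assms(2)) simp
  then have M: "M \<ge> 0" by (rule order.trans[OF norm_ge_zero])
  have "norm (f (x + t *\<^sub>R w) - f (x + 0 *\<^sub>R w)) \<le> (CARD('n) * norm w * M) * norm (t - 0)"
  proof (rule differentiable_bound[where S = "{0..1}"])
    show "((\<lambda>s. f (x + s *\<^sub>R w)) has_derivative (\<lambda>h. h *\<^sub>R partial_deriv w f (x + s *\<^sub>R w))) (at s within {0..1})" for s
      using partial_deriv_line[OF assms(1), of x w s] unfolding has_vector_derivative_def by (rule has_derivative_at_withinI)
    show "onorm (\<lambda>h. h *\<^sub>R partial_deriv w f (x + s *\<^sub>R w)) \<le> CARD('n) * norm w * M" if "s \<in> {0..1}" for s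
    proof (rule onorm_le)
      fix h :: real
      show "norm (h *\<^sub>R partial_deriv w f (x + s *\<^sub>R w)) \<le> CARD('n) * norm w * M * norm h"
        using mult_left_mono[OF partial_deriv_bound[OF assms(1) assms(2)[OF that], of w], of "\<bar>h\<bar>"]
        by (simp only: norm_scaleR real_norm_def abs_ge_zero mult.commute)
    qed
  qed (use assms(3) in auto)
  also have "\<dots> \<le> (CARD('n) * norm w * M) * 1" using assms(3) M by (intro mult_left_mono) auto
  finally show ?thesis by simp
qed

text \<open>What a symbol of order zero provides at a frozen position: two frequency derivatives
  with the decay of the symbol class, as much as an expansion to second order consumes.\<close>

definition order_zero :: "real \<Rightarrow> (real^'n::finite \<Rightarrow> complex) \<Rightarrow> bool" where
  "order_zero K h \<longleftrightarrow> h differentiable_on UNIV \<and> (\<forall>\<zeta>. norm (h \<zeta>) \<le> K) \<and>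
     (\<forall>j. partial_deriv (axis j 1) h differentiable_on UNIV \<and>
       (\<forall>\<zeta>. norm (partial_deriv (axis j 1) h \<zeta>) \<le> K / jap \<zeta>) \<and>
       (\<forall>k \<zeta>. norm (partial_deriv (axis k 1) (partial_deriv (axis j 1) h) \<zeta>) \<le> K / (jap \<zeta>)\<^sup>2))"

lemma jap_segment:
  assumes "norm w \<le> jap \<xi> / 2" "s \<in> {0..1}"
  shows "jap \<xi> / 2 \<le> jap (\<xi> + s *\<^sub>R w)"
proof -
  have "s * norm w \<le> 1 * norm w" using assms by (intro mult_right_mono) auto
  then show ?thesis using jap_lipschitz[of "\<xi> + s *\<^sub>R w" \<xi>] assms by simp
qed

text \<open>For \<open>norm w \<le> J / 2\<close> the bracket stays comparable to \<open>J\<close>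
  along the whole segment, and the second derivatives yield the part \<open>4 * n\<^sup>2\<close> of
  the constant. For larger increments \<open>norm w / J\<close> exceeds 1/2, and the three terms are
  estimated one by one, which accounts for \<open>8 + 2 * n\<close>.\<close>

lemma order_zero_taylor:
  fixes h :: "real^'n::finite \<Rightarrow> complex"
  assumes h: "order_zero K h"
  shows "norm (h \<zeta> - h \<xi> - partial_deriv (\<zeta> - \<xi>) h \<xi>) \<le> (8 + 2 * real CARD('n) + 4 * (real CARD('n))\<^sup>2) * K * (norm (\<zeta> - \<xi>))\<^sup>2 / (jap \<xi>)\<^sup>2"
proof -
  define n :: real where "n = CARD('n)"
  have n: "n \<ge> 0" by (simp add: n_def)
  define w where "w = \<zeta> - \<xi>"
  define J where "J = jap \<xi>"
  have J: "J \<ge> 1" by (simp add: J_def jap_ge_1)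
  have d: "h differentiable_on UNIV" and b0: "\<And>\<zeta>. norm (h \<zeta>) \<le> K"
    and d1: "\<And>j. partial_deriv (axis j 1) h differentiable_on UNIV"
    and b1: "\<And>j \<zeta>. norm (partial_deriv (axis j 1) h \<zeta>) \<le> K / jap \<zeta>"
    and b2: "\<And>j k \<zeta>. norm (partial_deriv (axis k 1) (partial_deriv (axis j 1) h) \<zeta>) \<le> K / (jap \<zeta>)\<^sup>2"
    using h by (auto simp: order_zero_def)
  have K: "K \<ge> 0" using b0[of 0] norm_ge_zero order.trans by blast
  have "norm (h \<zeta> - h \<xi> - partial_deriv w h \<xi>) \<le> (8 + 2 * n + 4 * n\<^sup>2) * K * (norm w)\<^sup>2 / J\<^sup>2"
  proof (cases "norm w \<le> J / 2")
    case True
    have J2: "J / 2 \<le> jap (\<xi> + s *\<^sub>R w)" if "s \<in> {0..1}" for s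
      using jap_segment[OF _ that, of w \<xi>] True by (simp add: J_def)
    have b2': "norm (partial_deriv (axis k 1) (partial_deriv (axis j 1) h) (\<xi> + s *\<^sub>R w)) \<le> 4 * K / J\<^sup>2" if "s \<in> {0..1}" for s j k
    proof -
      have "(J / 2)\<^sup>2 \<le> (jap (\<xi> + s *\<^sub>R w))\<^sup>2" using J2[OF that] J by (intro power_mono) auto
      then have "K / (jap (\<xi> + s *\<^sub>R w))\<^sup>2 \<le> K / (J / 2)\<^sup>2" using K J jap_pos[of "\<xi> + s *\<^sub>R w"] by (intro divide_left_mono) auto
      then show ?thesis using b2[of k j "\<xi> + s *\<^sub>R w"] by (simp add: power_divide mult.commute)
    qed
    have inc: "norm (partial_deriv w h (\<xi> + s *\<^sub>R w) - partial_deriv w h (\<xi> + 0 *\<^sub>R w)) \<le> 4 * n\<^sup>2 * K * (norm w)\<^sup>2 / J\<^sup>2" if s: "s \<in> {0..1}" for s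
    proof -
      have "norm (partial_deriv w h (\<xi> + s *\<^sub>R w) - partial_deriv w h \<xi>) = norm (\<Sum>j\<in>UNIV. (w $ j) *\<^sub>R (partial_deriv (axis j 1) h (\<xi> + s *\<^sub>R w) - partial_deriv (axis j 1) h \<xi>))"
        unfolding partial_deriv_expand[OF d, of w] by (simp add: sum_subtractf scaleR_right_diff_distrib)
      also have "\<dots> \<le> (\<Sum>j\<in>(UNIV::'n set). norm w * (n * norm w * (4 * K / J\<^sup>2)))"
      proof (rule sum_norm_le)
        fix j
        have "norm (partial_deriv (axis j 1) h (\<xi> + s *\<^sub>R w) - partial_deriv (axis j 1) h \<xi>) \<le> n * norm w * (4 * K / J\<^sup>2)"
          unfolding n_def by (rule segment_increment_bound[OF d1 b2' s])
        then show "norm ((w $ j) *\<^sub>R (partial_deriv (axis j 1) h (\<xi> + s *\<^sub>R w) - partial_deriv (axis j 1) h \<xi>)) \<le> norm w * (n * norm w * (4 * K / J\<^sup>2))"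
          unfolding norm_scaleR real_norm_def by (intro mult_mono component_le_norm_cart) auto
      qed
      also have "\<dots> = 4 * n\<^sup>2 * K * (norm w)\<^sup>2 / J\<^sup>2" by (simp add: n_def power2_eq_square)
      finally show ?thesis by simp
    qed
    have "norm (h (\<xi> + 1 *\<^sub>R w) - h (\<xi> + 0 *\<^sub>R w) - (1 - 0) *\<^sub>R partial_deriv w h (\<xi> + 0 *\<^sub>R w)) \<le> norm (1 - 0 :: real) * (4 * n\<^sup>2 * K * (norm w)\<^sup>2 / J\<^sup>2)"
      by (rule vector_differentiable_bound_linearization[where S = "{0..1}" and f = "\<lambda>s. h (\<xi> + s *\<^sub>R w)"])
        (auto intro!: has_vector_derivative_at_within partial_deriv_line d inc simp: closed_segment_eq_real_ivl simp del: scaleR_zero_left)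
    then have "norm (h \<zeta> - h \<xi> - partial_deriv w h \<xi>) \<le> 4 * n\<^sup>2 * K * (norm w)\<^sup>2 / J\<^sup>2" by (simp add: w_def)
    also have "\<dots> \<le> (8 + 2 * n + 4 * n\<^sup>2) * K * (norm w)\<^sup>2 / J\<^sup>2"
      using n K by (intro divide_right_mono mult_right_mono) auto
    finally show ?thesis .
  next
    case False
    define r where "r = norm w / J"
    have r: "2 * r \<ge> 1" using False J by (simp add: r_def field_simps)
    then have "1 * 1 \<le> (2 * r) * (2 * r)" by (intro mult_mono) auto
    then have r2: "1 \<le> 4 * r\<^sup>2" "r \<le> 2 * r\<^sup>2" using mult_right_mono[OF r, of r] r by (auto simp: power2_eq_square)
    have "norm (h \<zeta> - h \<xi> - partial_deriv w h \<xi>) \<le> norm (h \<zeta>) + norm (h \<xi>) + norm (partial_deriv w h \<xi>)"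
      by (meson add_mono norm_triangle_ineq4 order.refl order.trans)
    also have "\<dots> \<le> K + K + n * norm w * (K / J)"
      unfolding n_def J_def by (intro add_mono b0 partial_deriv_bound d b1)
    also have "\<dots> = K * 2 + n * K * r" by (simp add: r_def)
    also have "\<dots> \<le> K * (8 * r\<^sup>2) + n * K * (2 * r\<^sup>2)"
      using r2 K n by (intro add_mono mult_left_mono) auto
    also have "\<dots> \<le> (8 + 2 * n + 4 * n\<^sup>2) * K * r\<^sup>2" using K n by (simp add: algebra_simps)
    finally show ?thesis by (simp add: r_def power_divide)
  qed
  then show ?thesis by (simp add: n_def w_def J_def)
qed

text \<open>The same division into near and far increments with first derivatives: the near ones
  give \<open>2 * n\<close>, the far ones 4.\<close>

lemma order_zero_increment:
  fixes h :: "real^'n::finite \<Rightarrow> complex"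
  assumes h: "order_zero K h"
  shows "norm (h \<zeta> - h \<xi>) \<le> (4 + 2 * real CARD('n)) * K * norm (\<zeta> - \<xi>) / jap \<xi>"
proof -
  define n :: real where "n = CARD('n)"
  have n: "n \<ge> 0" by (simp add: n_def)
  define w where "w = \<zeta> - \<xi>"
  define J where "J = jap \<xi>"
  have J: "J \<ge> 1" by (simp add: J_def jap_ge_1)
  have d: "h differentiable_on UNIV" and b0: "\<And>\<zeta>. norm (h \<zeta>) \<le> K"
    and b1: "\<And>j \<zeta>. norm (partial_deriv (axis j 1) h \<zeta>) \<le> K / jap \<zeta>"
    using h by (auto simp: order_zero_def)
  have K: "K \<ge> 0" using b0[of 0] norm_ge_zero order.trans by blast
  have "norm (h \<zeta> - h \<xi>) \<le> (4 + 2 * n) * K * norm w / J"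
  proof (cases "norm w \<le> J / 2")
    case True
    have b1': "norm (partial_deriv (axis j 1) h (\<xi> + s *\<^sub>R w)) \<le> 2 * K / J" if "s \<in> {0..1}" for s j
    proof -
      have "J / 2 \<le> jap (\<xi> + s *\<^sub>R w)" using jap_segment[OF _ that, of w \<xi>] True by (simp add: J_def)
      then have "K / jap (\<xi> + s *\<^sub>R w) \<le> K / (J / 2)" using K J jap_pos[of "\<xi> + s *\<^sub>R w"] by (intro divide_left_mono) auto
      then show ?thesis using b1[of j "\<xi> + s *\<^sub>R w"] by (simp add: mult.commute)
    qed
    have "norm (h (\<xi> + 1 *\<^sub>R w) - h \<xi>) \<le> n * norm w * (2 * K / J)"
      unfolding n_def by (rule segment_increment_bound[OF d b1']) auto
    also have "\<dots> = (2 * n) * K * norm w / J" by simp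
    also have "\<dots> \<le> (4 + 2 * n) * K * norm w / J" using K J by (intro divide_right_mono mult_right_mono) auto
    finally show ?thesis by (simp add: w_def)
  next
    case False
    then have "1 \<le> 2 * (norm w / J)" using J by (simp add: field_simps)
    then have "2 * K * 1 \<le> 2 * K * (2 * (norm w / J))" using K by (intro mult_left_mono) auto
    moreover have "norm (h \<zeta> - h \<xi>) \<le> 2 * K" using norm_triangle_ineq4[of "h \<zeta>" "h \<xi>"] b0[of \<zeta>] b0[of \<xi>] by linarith
    ultimately have "norm (h \<zeta> - h \<xi>) \<le> 4 * K * norm w / J" by simp
    also have "\<dots> \<le> (4 + 2 * n) * K * norm w / J" using K J n by (intro divide_right_mono mult_right_mono) auto
    finally show ?thesis .
  qed
  then show ?thesis by (simp add: n_def w_def J_def)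
qed

lemma order_zero_continuous: "order_zero K h \<Longrightarrow> continuous_on UNIV h"
  unfolding order_zero_def using differentiable_imp_continuous_on by blast

lemma order_zero_nonneg: "order_zero K h \<Longrightarrow> 0 \<le> K"
  unfolding order_zero_def using norm_ge_zero order.trans by blast

lemma order_zero_integrable:
  assumes "order_zero K h" "integrable lborel g"
  shows "integrable lborel (\<lambda>\<zeta>. h \<zeta> * complex_of_real (g \<zeta>))"
proof (rule Bochner_Integration.integrable_bound[OF integrable_mult_right[OF assms(2), of K]])
  have [measurable]: "h \<in> borel_measurable borel" "g \<in> borel_measurable borel"
    using assms borel_measurable_continuous_onI order_zero_continuous by auto
  show "(\<lambda>\<zeta>. h \<zeta> * complex_of_real (g \<zeta>)) \<in> borel_measurable lborel" by measurable
  show "AE \<zeta> in lborel. norm (h \<zeta> * complex_of_real (g \<zeta>)) \<le> norm (K * g \<zeta>)"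
    using assms(1) by (auto simp: order_zero_def norm_mult abs_mult order_zero_nonneg[OF assms(1)] intro!: mult_right_mono)
qed

text \<open>When the expansion about \<open>\<xi>\<close> is integrated against the squared packet,
  the constant term returns \<open>h \<xi>\<close>, the linear term vanishes by symmetry, and the
  remainder is paid by the variance.\<close>

lemma order_zero_packet_average:
  "\<exists>C\<ge>0. \<forall>K h (\<xi>::real^'n::finite). order_zero K h \<longrightarrow>
     norm (h \<xi> - (LINT \<zeta>|lborel. h \<zeta> * complex_of_real ((packet \<xi> \<zeta>)\<^sup>2))) \<le> C * K / jap \<xi>"
proof -
  obtain C where C: "C \<ge> 0" "\<And>\<xi>::real^'n. integrable lborel (\<lambda>\<zeta>. (norm (\<zeta> - \<xi>))\<^sup>2 * (packet \<xi> \<zeta>)\<^sup>2)"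
     "\<And>\<xi>::real^'n. (LINT \<zeta>|lborel. (norm (\<zeta> - \<xi>))\<^sup>2 * (packet \<xi> \<zeta>)\<^sup>2) \<le> C * jap \<xi>"
    using packet_second_moment[where 'a="real^'n"] by blast
  define c :: real where "c = (8 + 2 * real CARD('n) + 4 * (real CARD('n))\<^sup>2)"
  have c: "c \<ge> 0" by (simp add: c_def)
  show ?thesis
  proof (intro exI[of _ "c * C"] conjI allI impI)
    fix K and h :: "real^'n \<Rightarrow> complex" and \<xi> :: "real^'n" assume h: "order_zero K h"
    have d: "h differentiable_on UNIV" using h by (simp add: order_zero_def)
    have [measurable]: "h \<in> borel_measurable borel" using borel_measurable_continuous_onI order_zero_continuous[OF h] by auto
    have [measurable]: "packet \<xi> \<in> borel_measurable borel" by (intro borel_measurable_continuous_onI continuous_intros)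
    have K: "K \<ge> 0" by (rule order_zero_nonneg[OF h])
    let ?R = "\<lambda>\<zeta>. h \<zeta> - h \<xi> - partial_deriv (\<zeta> - \<xi>) h \<xi>"
    let ?p = "\<lambda>\<zeta>. complex_of_real ((packet \<xi> \<zeta>)\<^sup>2)"
    let ?l = "\<lambda>\<zeta>. (\<Sum>j\<in>UNIV. partial_deriv (axis j 1) h \<xi> * complex_of_real (((\<zeta> - \<xi>) \<bullet> axis j 1) * (packet \<xi> \<zeta>)\<^sup>2))"
    have i1: "integrable lborel (\<lambda>\<zeta>. h \<zeta> * ?p \<zeta>)" by (rule order_zero_integrable[OF h packet_square_integrable])
    have i2: "integrable lborel (\<lambda>\<zeta>. h \<xi> * ?p \<zeta>)" by (intro integrable_mult_right integrable_of_real packet_square_integrable)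
    have i3: "integrable lborel (\<lambda>\<zeta>. ((\<zeta> - \<xi>) \<bullet> axis j 1) * (packet \<xi> \<zeta>)\<^sup>2)" for j
    proof (rule Bochner_Integration.integrable_bound[OF Bochner_Integration.integrable_add[OF C(2)[of \<xi>] packet_square_integrable[of \<xi>]]])
      show "AE \<zeta> in lborel. norm (((\<zeta> - \<xi>) \<bullet> axis j 1) * (packet \<xi> \<zeta>)\<^sup>2) \<le> norm ((norm (\<zeta> - \<xi>))\<^sup>2 * (packet \<xi> \<zeta>)\<^sup>2 + (packet \<xi> \<zeta>)\<^sup>2)"
      proof (rule AE_I2)
        fix \<zeta>
        define r where "r = norm (\<zeta> - \<xi>)"
        have "\<bar>(\<zeta> - \<xi>) \<bullet> axis j 1\<bar> \<le> r" using component_le_norm_cart[of "\<zeta> - \<xi>" j] by (simp add: inner_axis r_def)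
        also have "r \<le> r\<^sup>2 + 1" using sum_squares_bound[of r 1] by (smt (verit) mult.right_neutral one_power2 zero_le_power2 norm_ge_zero r_def)
        finally have "\<bar>(\<zeta> - \<xi>) \<bullet> axis j 1\<bar> * (packet \<xi> \<zeta>)\<^sup>2 \<le> (r\<^sup>2 + 1) * (packet \<xi> \<zeta>)\<^sup>2" by (intro mult_right_mono) auto
        then show "norm (((\<zeta> - \<xi>) \<bullet> axis j 1) * (packet \<xi> \<zeta>)\<^sup>2) \<le> norm ((norm (\<zeta> - \<xi>))\<^sup>2 * (packet \<xi> \<zeta>)\<^sup>2 + (packet \<xi> \<zeta>)\<^sup>2)"
          by (simp add: r_def abs_mult distrib_right)
      qed
    qed measurable
    have i3': "integrable lborel ?l" by (intro Bochner_Integration.integrable_sum integrable_mult_right integrable_of_real i3)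
    have l: "(LINT \<zeta>|lborel. ?l \<zeta>) = 0"
      by (subst Bochner_Integration.integral_sum) (auto intro!: integrable_mult_right integrable_of_real i3 simp: packet_first_moment simp del: of_real_mult of_real_power)
    have eq: "?R \<zeta> * ?p \<zeta> = h \<zeta> * ?p \<zeta> - h \<xi> * ?p \<zeta> - ?l \<zeta>" for \<zeta>
    proof -
      have "(\<Sum>j\<in>UNIV. ((\<zeta> - \<xi>) $ j) *\<^sub>R partial_deriv (axis j 1) h \<xi>) * ?p \<zeta> = ?l \<zeta>"
        unfolding sum_distrib_right by (intro sum.cong refl) (simp add: inner_axis scaleR_conv_of_real mult_ac)
      then show ?thesis
        unfolding partial_deriv_expand[OF d, of "\<zeta> - \<xi>"] left_diff_distrib by (simp only:)
    qed
    have iR: "integrable lborel (\<lambda>\<zeta>. ?R \<zeta> * ?p \<zeta>)" unfolding eq by (intro Bochner_Integration.integrable_diff i1 i2 i3')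
    have "(LINT \<zeta>|lborel. ?R \<zeta> * ?p \<zeta>) = (LINT \<zeta>|lborel. h \<zeta> * ?p \<zeta>) - h \<xi>"
      unfolding eq using i1 i2 i3' l
      by (simp add: integral_complex_of_real packet_square_integral del: of_real_power of_real_mult)
    then have "norm (h \<xi> - (LINT \<zeta>|lborel. h \<zeta> * ?p \<zeta>)) = norm (LINT \<zeta>|lborel. ?R \<zeta> * ?p \<zeta>)"
      by (simp add: norm_minus_commute)
    also have "\<dots> \<le> (LINT \<zeta>|lborel. norm (?R \<zeta> * ?p \<zeta>))" by (rule integral_norm_bound)
    also have "\<dots> \<le> (LINT \<zeta>|lborel. (c * K / (jap \<xi>)\<^sup>2) * ((norm (\<zeta> - \<xi>))\<^sup>2 * (packet \<xi> \<zeta>)\<^sup>2))"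
    proof (rule integral_mono[OF integrable_norm[OF iR] integrable_mult_right[OF C(2)]])
      fix \<zeta>
      have "norm (?R \<zeta> * ?p \<zeta>) = norm (?R \<zeta>) * (packet \<xi> \<zeta>)\<^sup>2" by (simp add: norm_mult norm_power)
      also have "\<dots> \<le> (c * K * (norm (\<zeta> - \<xi>))\<^sup>2 / (jap \<xi>)\<^sup>2) * (packet \<xi> \<zeta>)\<^sup>2"
        unfolding c_def by (intro mult_right_mono order_zero_taylor[OF h]) auto
      finally show "norm (?R \<zeta> * ?p \<zeta>) \<le> (c * K / (jap \<xi>)\<^sup>2) * ((norm (\<zeta> - \<xi>))\<^sup>2 * (packet \<xi> \<zeta>)\<^sup>2)" by simp
    qed
    also have "\<dots> \<le> (c * K / (jap \<xi>)\<^sup>2) * (C * jap \<xi>)"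
      unfolding integral_mult_right_zero using c K by (intro mult_left_mono C) auto
    also have "\<dots> = c * C * K / jap \<xi>" using jap_pos[of \<xi>] by (simp add: power2_eq_square)
    finally show "norm (h \<xi> - (LINT \<zeta>|lborel. h \<zeta> * ?p \<zeta>)) \<le> c * C * K / jap \<xi>" .
  qed (use c C in auto)
qed

text \<open>Polarisation: a product of packets is half of the sum of their squares minus the square
  of their difference. Averages against the squares return the values at the two centres up to the
  reciprocal bracket, the squared difference contributes
  \<open>(norm (\<xi> - \<eta>))\<^sup>2 / jap \<xi>\<close>, and moving \<open>s\<close> and
  \<open>t\<close> between the centres costs a first-order increment.\<close>

lemma order_zero_symmetrized:
  "\<exists>C\<ge>0. \<forall>K s t (\<xi>::real^'n::finite) \<eta>. order_zero K s \<longrightarrow> order_zero K t \<longrightarrow>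
     norm ((s \<xi> + t \<eta>) / 2 - (LINT \<zeta>|lborel. (s \<zeta> + t \<zeta>) / 2 * complex_of_real (packet \<xi> \<zeta> * packet \<eta> \<zeta>)))
       \<le> C * K * (jap (\<xi> - \<eta>))\<^sup>2 * (1 / jap \<xi> + 1 / jap \<eta>)"
proof -
  obtain C where C: "C \<ge> 0" "\<And>K h (\<xi>::real^'n). order_zero K h \<Longrightarrow>
     norm (h \<xi> - (LINT \<zeta>|lborel. h \<zeta> * complex_of_real ((packet \<xi> \<zeta>)\<^sup>2))) \<le> C * K / jap \<xi>"
    using order_zero_packet_average[where 'n='n] by blast
  define n where "n = real CARD('n)"
  have n: "n \<ge> 0" by (simp add: n_def)
  show ?thesis
  proof (intro exI[of _ "2 * C + (2 * n + 1) + (4 + 2 * n)"] conjI allI impI)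
    show "0 \<le> 2 * C + (2 * n + 1) + (4 + 2 * n)" using C n by simp
    fix K and s t :: "real^'n \<Rightarrow> complex" and \<xi> \<eta> :: "real^'n" assume s: "order_zero K s" and t: "order_zero K t"
    have K: "K \<ge> 0" by (rule order_zero_nonneg[OF s])
    define j where "j = jap (\<xi> - \<eta>)"
    have j: "j \<ge> 1" "norm (\<xi> - \<eta>) \<le> j" "norm (\<eta> - \<xi>) \<le> j" by (auto simp: j_def jap_ge_1 jap_ge_norm norm_minus_commute[of \<eta>])
    define a where "a = 1 / jap \<xi>"
    define b where "b = 1 / jap \<eta>"
    have ab: "a > 0" "b > 0" by (auto simp: a_def b_def jap_pos)
    let ?P = "\<lambda>\<zeta>. complex_of_real ((packet \<xi> \<zeta>)\<^sup>2)"
    let ?Q = "\<lambda>\<zeta>. complex_of_real ((packet \<eta> \<zeta>)\<^sup>2)"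
    let ?D = "\<lambda>\<zeta>. complex_of_real ((packet \<xi> \<zeta> - packet \<eta> \<zeta>)\<^sup>2)"
    have int: "integrable lborel (\<lambda>\<zeta>. h \<zeta> * ?P \<zeta>)" "integrable lborel (\<lambda>\<zeta>. h \<zeta> * ?Q \<zeta>)" "integrable lborel (\<lambda>\<zeta>. h \<zeta> * ?D \<zeta>)"
      if "order_zero K h" for h
      by (intro order_zero_integrable[OF that] packet_square_integrable packet_diff_square_integrable)+
    have eq: "(s \<zeta> + t \<zeta>) / 2 * complex_of_real (packet \<xi> \<zeta> * packet \<eta> \<zeta>) =
       (1/4) * (((s \<zeta> * ?P \<zeta> + t \<zeta> * ?P \<zeta>) + (s \<zeta> * ?Q \<zeta> + t \<zeta> * ?Q \<zeta>)) - (s \<zeta> * ?D \<zeta> + t \<zeta> * ?D \<zeta>))" for \<zeta>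
      by (simp add: power2_diff algebra_simps)
    have I: "(LINT \<zeta>|lborel. (s \<zeta> + t \<zeta>) / 2 * complex_of_real (packet \<xi> \<zeta> * packet \<eta> \<zeta>)) =
       (1/4) * ((((LINT \<zeta>|lborel. s \<zeta> * ?P \<zeta>) + (LINT \<zeta>|lborel. t \<zeta> * ?P \<zeta>)) + ((LINT \<zeta>|lborel. s \<zeta> * ?Q \<zeta>) + (LINT \<zeta>|lborel. t \<zeta> * ?Q \<zeta>)))
        - ((LINT \<zeta>|lborel. s \<zeta> * ?D \<zeta>) + (LINT \<zeta>|lborel. t \<zeta> * ?D \<zeta>)))"
      unfolding eq integral_mult_right_zero
      by (simp only: Bochner_Integration.integral_add Bochner_Integration.integral_diff Bochner_Integration.integrable_add int s t)
    \<comment> \<open>The averages return a quarter of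
      \<open>s \<xi> + t \<xi> + s \<eta> + t \<eta>\<close>; the two increments at the end correct
      this to \<open>(s \<xi> + t \<eta>) / 2\<close>.\<close>
    have dec: "(s \<xi> + t \<eta>) / 2 - (LINT \<zeta>|lborel. (s \<zeta> + t \<zeta>) / 2 * complex_of_real (packet \<xi> \<zeta> * packet \<eta> \<zeta>)) =
      (1/4) * ((s \<xi> - (LINT \<zeta>|lborel. s \<zeta> * ?P \<zeta>)) + (t \<xi> - (LINT \<zeta>|lborel. t \<zeta> * ?P \<zeta>))
       + (s \<eta> - (LINT \<zeta>|lborel. s \<zeta> * ?Q \<zeta>)) + (t \<eta> - (LINT \<zeta>|lborel. t \<zeta> * ?Q \<zeta>))
       + (LINT \<zeta>|lborel. s \<zeta> * ?D \<zeta>) + (LINT \<zeta>|lborel. t \<zeta> * ?D \<zeta>) + (t \<eta> - t \<xi>) - (s \<eta> - s \<xi>))"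
      unfolding I by (simp add: field_simps)
    have B: "norm (LINT \<zeta>|lborel. h \<zeta> * ?D \<zeta>) \<le> (2 * n + 1) * K * j\<^sup>2 * a" if h: "order_zero K h" for h
    proof -
      have "norm (LINT \<zeta>|lborel. h \<zeta> * ?D \<zeta>) \<le> (LINT \<zeta>|lborel. norm (h \<zeta> * ?D \<zeta>))" by (rule integral_norm_bound)
      also have "\<dots> \<le> (LINT \<zeta>|lborel. K * (packet \<xi> \<zeta> - packet \<eta> \<zeta>)\<^sup>2)"
      proof (rule integral_mono[OF integrable_norm[OF int(3)[OF h]] integrable_mult_right[OF packet_diff_square_integrable]])
        fix \<zeta>
        have "norm (h \<zeta> * ?D \<zeta>) = norm (h \<zeta>) * (packet \<xi> \<zeta> - packet \<eta> \<zeta>)\<^sup>2"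
          by (simp only: norm_mult norm_of_real) simp
        also have "\<dots> \<le> K * (packet \<xi> \<zeta> - packet \<eta> \<zeta>)\<^sup>2"
          using h by (intro mult_right_mono) (auto simp: order_zero_def)
        finally show "norm (h \<zeta> * ?D \<zeta>) \<le> K * (packet \<xi> \<zeta> - packet \<eta> \<zeta>)\<^sup>2" .
      qed
      also have "\<dots> \<le> K * ((2 * DIM(real^'n) + 1) * (norm (\<xi> - \<eta>))\<^sup>2 / jap \<xi>)"
        unfolding integral_mult_right_zero by (intro mult_left_mono packet_diff_square_le K)
      also have "\<dots> = (2 * n + 1) * K * (norm (\<xi> - \<eta>))\<^sup>2 * a" by (simp add: a_def n_def)
      also have "\<dots> \<le> (2 * n + 1) * K * j\<^sup>2 * a"
        using j n K ab by (intro mult_right_mono mult_left_mono power_mono) auto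
      finally show ?thesis .
    qed
    have A1: "norm (h \<xi> - (LINT \<zeta>|lborel. h \<zeta> * ?P \<zeta>)) \<le> C * K * j\<^sup>2 * a" if h: "order_zero K h" for h
    proof -
      have "norm (h \<xi> - (LINT \<zeta>|lborel. h \<zeta> * ?P \<zeta>)) \<le> C * K * 1 * a" using C(2)[OF h, of \<xi>] by (simp add: a_def)
      also have "\<dots> \<le> C * K * j\<^sup>2 * a" using j C K ab by (intro mult_right_mono mult_left_mono) (auto simp: one_le_power)
      finally show ?thesis .
    qed
    have A2: "norm (h \<eta> - (LINT \<zeta>|lborel. h \<zeta> * ?Q \<zeta>)) \<le> C * K * j\<^sup>2 * b" if h: "order_zero K h" for h
    proof -
      have "norm (h \<eta> - (LINT \<zeta>|lborel. h \<zeta> * ?Q \<zeta>)) \<le> C * K * 1 * b" using C(2)[OF h, of \<eta>] by (simp add: b_def)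
      also have "\<dots> \<le> C * K * j\<^sup>2 * b" using j C K ab by (intro mult_right_mono mult_left_mono) (auto simp: one_le_power)
      finally show ?thesis .
    qed
    have D: "norm (h \<eta> - h \<xi>) \<le> (4 + 2 * n) * K * j\<^sup>2 * a" if h: "order_zero K h" for h
    proof -
      have "norm (h \<eta> - h \<xi>) \<le> (4 + 2 * n) * K * norm (\<eta> - \<xi>) * a" using order_zero_increment[OF h, of \<eta> \<xi>] by (simp add: a_def n_def)
      also have "\<dots> \<le> (4 + 2 * n) * K * j\<^sup>2 * a"
      proof (intro mult_right_mono mult_left_mono)
        have "norm (\<eta> - \<xi>) * 1 \<le> j * j" using j by (intro mult_mono) auto
        then show "norm (\<eta> - \<xi>) \<le> j\<^sup>2" by (simp add: power2_eq_square)
      qed (use n K ab in auto)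
      finally show ?thesis .
    qed
    have tri: "norm (x1 + x2 + x3 + x4 + x5 + x6 + x7 - x8) \<le> norm x1 + norm x2 + norm x3 + norm x4 + norm x5 + norm x6 + norm x7 + norm x8" for x1 x2 x3 x4 x5 x6 x7 x8 :: complex
      by (intro order.trans[OF norm_triangle_ineq4] order.trans[OF norm_triangle_ineq] add_mono order.refl)
    define X Y where "X = K * j\<^sup>2 * a" and "Y = K * j\<^sup>2 * b"
    have XY: "X \<ge> 0" "Y \<ge> 0" using K ab by (auto simp: X_def Y_def)
    have e: "C * K * j\<^sup>2 * a = C * X" "C * K * j\<^sup>2 * b = C * Y" "(2 * n + 1) * K * j\<^sup>2 * a = (2 * n + 1) * X" "(4 + 2 * n) * K * j\<^sup>2 * a = (4 + 2 * n) * X"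
      by (auto simp: X_def Y_def)
    have "norm ((s \<xi> + t \<eta>) / 2 - (LINT \<zeta>|lborel. (s \<zeta> + t \<zeta>) / 2 * complex_of_real (packet \<xi> \<zeta> * packet \<eta> \<zeta>)))
       \<le> norm (1 / 4 :: complex) * (C * K * j\<^sup>2 * a + C * K * j\<^sup>2 * a + C * K * j\<^sup>2 * b + C * K * j\<^sup>2 * b + (2 * n + 1) * K * j\<^sup>2 * a + (2 * n + 1) * K * j\<^sup>2 * a + (4 + 2 * n) * K * j\<^sup>2 * a + (4 + 2 * n) * K * j\<^sup>2 * a)"
      unfolding dec norm_mult by (intro mult_left_mono order.trans[OF tri] add_mono A1 A2 B D s t) simp
    also have "\<dots> = (1/4) * (2 * (C * X) + 2 * (C * Y) + (10 * X + 8 * (n * X)))"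
      unfolding e by (simp add: algebra_simps)
    also have "\<dots> \<le> 2 * (C * X) + 2 * (C * Y) + (5 * X + 4 * (n * X)) + (5 * Y + 4 * (n * Y))"
    proof -
      have "1 / 4 * (2 * p + 2 * q + (10 * x + 8 * u)) \<le> 2 * p + 2 * q + (5 * x + 4 * u) + (5 * y + 4 * v)"
        if "0 \<le> p" "0 \<le> q" "0 \<le> x" "0 \<le> y" "0 \<le> u" "0 \<le> v" for p q x y u v :: real
        using that by simp
      then show ?thesis using XY C n by simp
    qed
    also have "\<dots> = (2 * C + (2 * n + 1) + (4 + 2 * n)) * (X + Y)" by (simp add: algebra_simps)
    also have "\<dots> = (2 * C + (2 * n + 1) + (4 + 2 * n)) * K * j\<^sup>2 * (a + b)" by (simp add: X_def Y_def algebra_simps)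
    finally show "norm ((s \<xi> + t \<eta>) / 2 - (LINT \<zeta>|lborel. (s \<zeta> + t \<zeta>) / 2 * complex_of_real (packet \<xi> \<zeta> * packet \<eta> \<zeta>)))
       \<le> (2 * C + (2 * n + 1) + (4 + 2 * n)) * K * (jap (\<xi> - \<eta>))\<^sup>2 * (1 / jap \<xi> + 1 / jap \<eta>)"
      unfolding j_def a_def b_def .
  qed
qed

section \<open>Decay of oscillatory integrals with a Gaussian cut-off\<close>

definition gauss_monomial :: "real \<Rightarrow> real^'n::finite \<Rightarrow> 'n \<Rightarrow> nat \<Rightarrow> real^'n \<Rightarrow> real" where
  "gauss_monomial \<alpha> k j l x = (sqrt \<alpha> * (x - k) $ j) ^ l * exp (- \<alpha> * (norm (x - k))\<^sup>2)"

lemma continuous_gauss_monomial: "continuous_on A (gauss_monomial \<alpha> k j l)"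
  unfolding gauss_monomial_def by (intro continuous_intros)

lemma borel_measurable_gauss_monomial [measurable]: "gauss_monomial \<alpha> k j l \<in> borel_measurable borel"
  by (intro borel_measurable_continuous_onI continuous_gauss_monomial)

lemma gauss_monomial_moment:
  "\<exists>C\<ge>0. \<forall>\<alpha>>0. \<forall>k j. integrable lborel (gauss_monomial \<alpha> (k::real^'n::finite) j l)
      \<and> (LINT x|lborel. \<bar>gauss_monomial \<alpha> k j l x\<bar>) \<le> C * (1 / sqrt \<alpha>) ^ CARD('n)"
proof -
  obtain C where C: "C \<ge> 1" "\<And>\<alpha>. \<alpha> > 0 \<Longrightarrow> integrable lborel (\<lambda>x::real^'n. (sqrt \<alpha> * norm x) ^ l * exp (- \<alpha> * (norm x)\<^sup>2))"
     "\<And>\<alpha>. \<alpha> > 0 \<Longrightarrow> (LINT x::real^'n|lborel. (sqrt \<alpha> * norm x) ^ l * exp (- \<alpha> * (norm x)\<^sup>2)) \<le> C * (1 / sqrt \<alpha>) ^ DIM(real^'n)"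
    using gaussian_moment[of l, where 'a="real^'n"] by blast
  show ?thesis
  proof (intro exI[of _ C] conjI allI impI)
    fix \<alpha> :: real and k :: "real^'n" and j assume \<alpha>: "\<alpha> > 0"
    let ?g = "\<lambda>x::real^'n. (sqrt \<alpha> * norm x) ^ l * exp (- \<alpha> * (norm x)\<^sup>2)"
    have le: "\<bar>gauss_monomial \<alpha> k j l x\<bar> \<le> ?g (- k + x)" for x
    proof -
      have "\<bar>sqrt \<alpha> * (x - k) $ j\<bar> \<le> sqrt \<alpha> * norm (x - k)"
        using \<alpha> component_le_norm_cart[of "x - k" j] by (simp add: abs_mult)
      then have "\<bar>sqrt \<alpha> * (x - k) $ j\<bar> ^ l \<le> (sqrt \<alpha> * norm (x - k)) ^ l" by (intro power_mono) auto
      then show ?thesis unfolding gauss_monomial_def abs_mult power_abs by (auto intro!: mult_right_mono)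
    qed
    have i: "integrable lborel (\<lambda>x. ?g (- k + x))" by (intro lborel_integrable_shift C \<alpha>)
    show g: "integrable lborel (gauss_monomial \<alpha> k j l)"
      by (rule Bochner_Integration.integrable_bound[OF i]) (use le in \<open>auto intro!: AE_I2 order.trans[OF _ abs_ge_self]\<close>)
    have "(LINT x|lborel. \<bar>gauss_monomial \<alpha> k j l x\<bar>) \<le> (LINT x|lborel. ?g (- k + x))"
      by (rule integral_mono[OF integrable_abs[OF g] i le])
    also have "\<dots> = (LINT x|lborel. ?g x)" by (rule lborel_integral_shift) measurable
    also have "\<dots> \<le> C * (1 / sqrt \<alpha>) ^ CARD('n)" using C(3)[OF \<alpha>] by simp
    finally show "(LINT x|lborel. \<bar>gauss_monomial \<alpha> k j l x\<bar>) \<le> C * (1 / sqrt \<alpha>) ^ CARD('n)" .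
  qed (use C in auto)
qed

text \<open>With \<open>sqrt \<alpha>\<close> built into the monomial, the family is closed under
  differentiation along axis \<open>j\<close> at the price of exactly one factor
  \<open>sqrt \<alpha>\<close>. For \<open>l = 0\<close> the first term carries the factor 0, so the
  truncated \<open>l - 1\<close> does no harm.\<close>

lemma gauss_monomial_line:
  assumes "\<alpha> > 0"
  shows "((\<lambda>s. gauss_monomial \<alpha> k j l (x + s *\<^sub>R axis j 1)) has_real_derivative
    sqrt \<alpha> * (real l * gauss_monomial \<alpha> k j (l - 1) (x + s *\<^sub>R axis j 1) - 2 * gauss_monomial \<alpha> k j (Suc l) (x + s *\<^sub>R axis j 1))) (at s)"
proof -
  define a b where "a = (x - k) $ j" and "b = (norm (x - k))\<^sup>2"
  have 1: "(x + s *\<^sub>R axis j 1 - k) $ j = a + s" for s by (simp add: a_def)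
  have 2: "(norm (x + s *\<^sub>R axis j 1 - k))\<^sup>2 = b + 2 * s * a + s\<^sup>2" for s
  proof -
    have "x + s *\<^sub>R axis j 1 - k = (x - k) + s *\<^sub>R axis j 1" by simp
    then show ?thesis
      by (simp only: power2_norm_eq_inner inner_add_left inner_add_right inner_scaleR_left inner_scaleR_right a_def b_def)
        (simp add: inner_axis inner_commute[of "axis j 1"] power2_eq_square inner_axis_axis algebra_simps)
  qed
  have s: "sqrt \<alpha> * sqrt \<alpha> = \<alpha>" using assms by simp
  have "((\<lambda>s. (sqrt \<alpha> * (a + s)) ^ l * exp (- \<alpha> * (b + 2 * s * a + s\<^sup>2))) has_real_derivative
     (real l * (sqrt \<alpha> * (a + s)) ^ (l - 1) * sqrt \<alpha>) * exp (- \<alpha> * (b + 2 * s * a + s\<^sup>2)) + (sqrt \<alpha> * (a + s)) ^ l * (exp (- \<alpha> * (b + 2 * s * a + s\<^sup>2)) * (- \<alpha> * (2 * a + 2 * s)))) (at s)"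
    by (auto intro!: derivative_eq_intros simp: algebra_simps)
  also have "- \<alpha> * (2 * a + 2 * s) = - (sqrt \<alpha> * sqrt \<alpha>) * (2 * a + 2 * s)" unfolding s ..
  also have "(real l * (sqrt \<alpha> * (a + s)) ^ (l - 1) * sqrt \<alpha>) * exp (- \<alpha> * (b + 2 * s * a + s\<^sup>2)) + (sqrt \<alpha> * (a + s)) ^ l * (exp (- \<alpha> * (b + 2 * s * a + s\<^sup>2)) * (- (sqrt \<alpha> * sqrt \<alpha>) * (2 * a + 2 * s)))
    = sqrt \<alpha> * (real l * ((sqrt \<alpha> * (a + s)) ^ (l - 1) * exp (- \<alpha> * (b + 2 * s * a + s\<^sup>2))) - 2 * ((sqrt \<alpha> * (a + s)) ^ Suc l * exp (- \<alpha> * (b + 2 * s * a + s\<^sup>2))))"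
    by (simp only: power_Suc) (simp add: algebra_simps del: real_sqrt_mult_self)
  finally show ?thesis unfolding gauss_monomial_def 1 2 .
qed

lemma exp_line:
  "((\<lambda>s. wave_cnj (x + s *\<^sub>R v) \<theta>) has_vector_derivative
     wave_cnj (x + s *\<^sub>R v) \<theta> * (- \<i> * complex_of_real (v \<bullet> \<theta>))) (at s)"
proof -
  have "((\<lambda>z. exp (- \<i> * (complex_of_real (x \<bullet> \<theta>) + z * complex_of_real (v \<bullet> \<theta>)))) has_field_derivative
     exp (- \<i> * (complex_of_real (x \<bullet> \<theta>) + complex_of_real s * complex_of_real (v \<bullet> \<theta>))) * (- \<i> * complex_of_real (v \<bullet> \<theta>))) (at (complex_of_real s))"
    by (auto intro!: derivative_eq_intros)
  from has_vector_derivative_real_field[OF this, of UNIV] show ?thesis by (simp add: inner_add_left)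
qed

text \<open>A function with its successive derivatives along \<open>v\<close>, all under one bound.
  Listing them as a sequence separates the integration by parts from the way in which the
  derivatives are obtained, here by differentiating under an integral.\<close>

definition deriv_chain :: "nat \<Rightarrow> 'a::real_normed_vector \<Rightarrow> real \<Rightarrow> (nat \<Rightarrow> 'a \<Rightarrow> complex) \<Rightarrow> bool" where
  "deriv_chain N v \<kappa> \<sigma> \<longleftrightarrow> (\<forall>i\<le>N. continuous_on UNIV (\<sigma> i) \<and> (\<forall>x. norm (\<sigma> i x) \<le> \<kappa>)) \<and>
     (\<forall>i<N. \<forall>x s. ((\<lambda>s. \<sigma> i (x + s *\<^sub>R v)) has_vector_derivative \<sigma> (Suc i) (x + s *\<^sub>R v)) (at s))"

text \<open>Each integration by parts trades a factor \<open>\<theta> $ j\<close> for a derivative.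
  It falls on \<open>\<sigma>\<close>, giving the next member of the chain with the same bound, or
  on the Gaussian, giving the neighbouring powers \<open>l - 1\<close> and \<open>Suc l\<close> with
  a factor \<open>sqrt \<alpha>\<close>. This is why the induction on \<open>N\<close> treats all
  \<open>l\<close> at once.\<close>

lemma gaussian_oscillatory_decay:
  "\<exists>C\<ge>0. \<forall>\<alpha>>0. \<forall>k \<theta> \<kappa> \<sigma>. deriv_chain N (axis j 1 :: real^'n::finite) \<kappa> \<sigma> \<longrightarrow>
     \<bar>\<theta> $ j\<bar> ^ N * norm (LINT x|lborel. wave_cnj x \<theta> * complex_of_real (gauss_monomial \<alpha> k j l x) * \<sigma> 0 x)
       \<le> C * \<kappa> * (1 + sqrt \<alpha>) ^ N * (1 / sqrt \<alpha>) ^ CARD('n)"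
proof (induction N arbitrary: l)
  case 0
  obtain C where C: "C \<ge> 0" "\<And>\<alpha> (k::real^'n) j. \<alpha> > 0 \<Longrightarrow> integrable lborel (gauss_monomial \<alpha> k j l)"
      "\<And>\<alpha> (k::real^'n) j. \<alpha> > 0 \<Longrightarrow> (LINT x|lborel. \<bar>gauss_monomial \<alpha> k j l x\<bar>) \<le> C * (1 / sqrt \<alpha>) ^ CARD('n)"
    using gauss_monomial_moment[of l, where 'n='n] by blast
  show ?case
  proof (intro exI[of _ C] conjI allI impI)
    fix \<alpha> :: real and k \<theta> :: "real^'n" and \<kappa> \<sigma>
    assume \<alpha>: "\<alpha> > 0" and \<sigma>: "deriv_chain 0 (axis j 1 :: real^'n) \<kappa> \<sigma>"
    have b: "norm (\<sigma> 0 x) \<le> \<kappa>" for x using \<sigma> by (simp add: deriv_chain_def)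
    have \<kappa>: "\<kappa> \<ge> 0" using b[of 0] norm_ge_zero order.trans by blast
    have "norm (LINT x|lborel. wave_cnj x \<theta> * complex_of_real (gauss_monomial \<alpha> k j l x) * \<sigma> 0 x)
      \<le> (LINT x|lborel. norm (wave_cnj x \<theta> * complex_of_real (gauss_monomial \<alpha> k j l x) * \<sigma> 0 x))"
      by (rule integral_norm_bound)
    also have "\<dots> \<le> (LINT x|lborel. \<kappa> * \<bar>gauss_monomial \<alpha> k j l x\<bar>)"
      by (rule Bochner_Integration.integral_mono')
        (use C(2)[OF \<alpha>] b \<kappa> in \<open>auto simp: norm_mult mult.commute[of "\<bar>_\<bar>"] intro!: mult_right_mono\<close>)
    also have "\<dots> \<le> \<kappa> * (C * (1 / sqrt \<alpha>) ^ CARD('n))"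
      unfolding integral_mult_right_zero by (intro mult_left_mono C \<alpha> \<kappa>)
    finally show "\<bar>\<theta> $ j\<bar> ^ 0 * norm (LINT x|lborel. wave_cnj x \<theta> * complex_of_real (gauss_monomial \<alpha> k j l x) * \<sigma> 0 x)
       \<le> C * \<kappa> * (1 + sqrt \<alpha>) ^ 0 * (1 / sqrt \<alpha>) ^ CARD('n)" by (simp add: mult_ac)
  qed (use C in auto)
next
  case (Suc N)
  define Q where "Q = (\<lambda>l C. C \<ge> 0 \<and> (\<forall>\<alpha>>0. \<forall>k \<theta> \<kappa> \<sigma>. deriv_chain N (axis j 1 :: real^'n) \<kappa> \<sigma> \<longrightarrow>
     \<bar>\<theta> $ j\<bar> ^ N * norm (LINT x|lborel. wave_cnj x \<theta> * complex_of_real (gauss_monomial \<alpha> k j l x) * \<sigma> 0 x)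
       \<le> C * \<kappa> * (1 + sqrt \<alpha>) ^ N * (1 / sqrt \<alpha>) ^ CARD('n)))"
  have "\<forall>l. \<exists>C. Q l C" unfolding Q_def using Suc.IH by blast
  then obtain C where Q: "\<forall>l. Q l (C l)" using choice[of Q] by blast
  have C0: "C l \<ge> 0" for l using Q by (simp add: Q_def)
  have C: "\<bar>\<theta> $ j\<bar> ^ N * norm (LINT x|lborel. wave_cnj x \<theta> * complex_of_real (gauss_monomial \<alpha> k j l x) * \<sigma> 0 x)
       \<le> C l * \<kappa> * (1 + sqrt \<alpha>) ^ N * (1 / sqrt \<alpha>) ^ CARD('n)"
    if "\<alpha> > 0" "deriv_chain N (axis j 1 :: real^'n) \<kappa> \<sigma>" for l \<alpha> k \<theta> \<kappa> \<sigma>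
    using Q that unfolding Q_def by blast
  have gi: "integrable lborel (gauss_monomial \<alpha> k j l)" if "\<alpha> > 0" for \<alpha> l and k :: "real^'n"
    using gauss_monomial_moment[of l, where 'n='n] that by blast
  show ?case
  proof (intro exI[of _ "real l * C (l - 1) + 2 * C (Suc l) + C l"] conjI allI impI)
    show "0 \<le> real l * C (l - 1) + 2 * C (Suc l) + C l" using C0 by simp
    fix \<alpha> :: real and k \<theta> :: "real^'n" and \<kappa> \<sigma>
    assume \<alpha>: "\<alpha> > 0" and \<sigma>: "deriv_chain (Suc N) (axis j 1 :: real^'n) \<kappa> \<sigma>"
    let ?v = "axis j 1 :: real^'n"
    let ?e = "\<lambda>x. wave_cnj x \<theta>"
    let ?g = "\<lambda>l x. complex_of_real (gauss_monomial \<alpha> k j l x)"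
    have s0: "deriv_chain N ?v \<kappa> \<sigma>" using \<sigma> by (simp add: deriv_chain_def)
    have s1: "deriv_chain N ?v \<kappa> (\<lambda>i. \<sigma> (Suc i))" using \<sigma> by (simp add: deriv_chain_def)
    have c: "continuous_on UNIV (\<sigma> i)" and b: "norm (\<sigma> i x) \<le> \<kappa>" if "i \<le> 1" for i x
      using \<sigma> that by (auto simp: deriv_chain_def)
    have d: "((\<lambda>s. \<sigma> 0 (x + s *\<^sub>R ?v)) has_vector_derivative \<sigma> 1 (x + s *\<^sub>R ?v)) (at s)" for x s
      using \<sigma> by (auto simp: deriv_chain_def)
    have "norm (\<sigma> 0 0) \<le> \<kappa>" by (rule b) simp
    then have \<kappa>: "\<kappa> \<ge> 0" by (rule order.trans[OF norm_ge_zero])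
    define I where "I = (\<lambda>l i. LINT x|lborel. ?e x * ?g l x * \<sigma> i x)"
    have i: "integrable lborel (\<lambda>x. ?e x * ?g l x * \<sigma> i x)" if "i \<le> 1" for l i
    proof (rule Bochner_Integration.integrable_bound[OF integrable_mult_right[OF gi[OF \<alpha>, of k l], of \<kappa>]])
      have [measurable]: "\<sigma> i \<in> borel_measurable borel" using c[OF that] by (rule borel_measurable_continuous_onI)
      show "(\<lambda>x. ?e x * ?g l x * \<sigma> i x) \<in> borel_measurable lborel" by measurable
      show "AE x in lborel. norm (?e x * ?g l x * \<sigma> i x) \<le> norm (\<kappa> * gauss_monomial \<alpha> k j l x)"
        using b[OF that] \<kappa> by (auto simp: norm_mult abs_mult mult.commute[of \<kappa>] intro!: mult_left_mono)
    qed
    \<comment> \<open>The derivative of the integrand along axis \<open>j\<close> in the shape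
      produced by the product rule. Its integral vanishes, and \<open>eqh\<close> sorts it into the
      integrals of the recursion.\<close>
    let ?h' = "\<lambda>x. (?e x * ?g l x) * \<sigma> 1 x + (?e x * complex_of_real (sqrt \<alpha> * (real l * gauss_monomial \<alpha> k j (l - 1) x - 2 * gauss_monomial \<alpha> k j (Suc l) x)) + (?e x * (- \<i> * complex_of_real (?v \<bullet> \<theta>))) * ?g l x) * \<sigma> 0 x"
    have eqh: "?h' x = (?e x * ?g l x * \<sigma> 1 x + (complex_of_real (sqrt \<alpha> * real l) * (?e x * ?g (l - 1) x * \<sigma> 0 x) - complex_of_real (2 * sqrt \<alpha>) * (?e x * ?g (Suc l) x * \<sigma> 0 x))) + (- \<i> * complex_of_real (\<theta> $ j)) * (?e x * ?g l x * \<sigma> 0 x)" for x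
      by (simp add: inner_axis' algebra_simps)
    have "(LINT x|lborel. ?h' x) = 0"
    proof (rule integral_directional_derivative_zero[where h = "\<lambda>x. ?e x * ?g l x * \<sigma> 0 x" and v = ?v])
      show "((\<lambda>s. ?e (x + s *\<^sub>R ?v) * ?g l (x + s *\<^sub>R ?v) * \<sigma> 0 (x + s *\<^sub>R ?v)) has_vector_derivative ?h' (x + s *\<^sub>R ?v)) (at s)" for x s
        by (intro has_vector_derivative_mult exp_line has_vector_derivative_of_real gauss_monomial_line \<alpha> d)
      show "integrable lborel ?h'" unfolding eqh
        by (intro Bochner_Integration.integrable_add Bochner_Integration.integrable_diff integrable_mult_right i) auto
      show "continuous_on UNIV ?h'"
        by (intro continuous_intros continuous_gauss_monomial c) auto
    qed (rule i, simp)
    also have "(LINT x|lborel. ?h' x) = (I l 1 + (complex_of_real (sqrt \<alpha> * real l) * I (l - 1) 0 - complex_of_real (2 * sqrt \<alpha>) * I (Suc l) 0)) + (- \<i> * complex_of_real (\<theta> $ j)) * I l 0"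
      unfolding eqh I_def using i
      by (simp only: Bochner_Integration.integral_add Bochner_Integration.integral_diff Bochner_Integration.integrable_add Bochner_Integration.integrable_diff integrable_mult_right integral_mult_right_zero le0 order.refl)
    finally have rec: "\<i> * complex_of_real (\<theta> $ j) * I l 0 = I l 1 + (complex_of_real (sqrt \<alpha> * real l) * I (l - 1) 0 - complex_of_real (2 * sqrt \<alpha>) * I (Suc l) 0)"
      by (simp add: algebra_simps add_eq_0_iff)
    have "norm (\<i> * complex_of_real (\<theta> $ j) * I l 0) \<le> norm (I l 1) + (norm (complex_of_real (sqrt \<alpha> * real l) * I (l - 1) 0) + norm (complex_of_real (2 * sqrt \<alpha>) * I (Suc l) 0))"
      unfolding rec by (rule order.trans[OF norm_triangle_ineq add_left_mono[OF norm_triangle_ineq4]])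
    then have t: "\<bar>\<theta> $ j\<bar> * norm (I l 0) \<le> norm (I l 1) + (sqrt \<alpha> * real l * norm (I (l - 1) 0) + 2 * sqrt \<alpha> * norm (I (Suc l) 0))"
      using \<alpha> by (simp add: norm_mult)
    define T where "T = \<kappa> * (1 + sqrt \<alpha>) ^ N * (1 / sqrt \<alpha>) ^ CARD('n)"
    have T: "T \<ge> 0" using \<kappa> \<alpha> by (simp add: T_def)
    have B0: "\<bar>\<theta> $ j\<bar> ^ N * norm (I m 0) \<le> C m * T" for m unfolding I_def T_def using C[OF \<alpha> s0, of \<theta> k m] by (simp add: mult_ac)
    have B1: "\<bar>\<theta> $ j\<bar> ^ N * norm (I l 1) \<le> C l * T" unfolding I_def T_def using C[OF \<alpha> s1, of \<theta> k l] by (simp add: mult_ac)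
    have "\<bar>\<theta> $ j\<bar> ^ Suc N * norm (I l 0) = \<bar>\<theta> $ j\<bar> ^ N * (\<bar>\<theta> $ j\<bar> * norm (I l 0))" by simp
    also have "\<dots> \<le> \<bar>\<theta> $ j\<bar> ^ N * (norm (I l 1) + (sqrt \<alpha> * real l * norm (I (l - 1) 0) + 2 * sqrt \<alpha> * norm (I (Suc l) 0)))"
      by (rule mult_left_mono[OF t]) simp
    also have "\<dots> = \<bar>\<theta> $ j\<bar> ^ N * norm (I l 1) + (sqrt \<alpha> * real l * (\<bar>\<theta> $ j\<bar> ^ N * norm (I (l - 1) 0)) + 2 * sqrt \<alpha> * (\<bar>\<theta> $ j\<bar> ^ N * norm (I (Suc l) 0)))"
      by (simp add: algebra_simps)
    also have "\<dots> \<le> C l * T + (sqrt \<alpha> * real l * (C (l - 1) * T) + 2 * sqrt \<alpha> * (C (Suc l) * T))"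
      using \<alpha> by (intro add_mono mult_left_mono B0 B1) auto
    also have "\<dots> \<le> (real l * C (l - 1) + 2 * C (Suc l) + C l) * T * (1 + sqrt \<alpha>)"
      using T C0 \<alpha> by (simp add: algebra_simps)
    also have "\<dots> = (real l * C (l - 1) + 2 * C (Suc l) + C l) * \<kappa> * (1 + sqrt \<alpha>) ^ Suc N * (1 / sqrt \<alpha>) ^ CARD('n)"
      by (simp add: T_def mult_ac)
    finally show "\<bar>\<theta> $ j\<bar> ^ Suc N * norm (LINT x|lborel. ?e x * ?g l x * \<sigma> 0 x) \<le> (real l * C (l - 1) + 2 * C (Suc l) + C l) * \<kappa> * (1 + sqrt \<alpha>) ^ Suc N * (1 / sqrt \<alpha>) ^ CARD('n)"
      unfolding I_def .
  qed
qed

text \<open>The maximum of 1 and the absolute coordinates bounds \<open>jap \<theta>\<close> up to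
  the factor \<open>CARD('n) + 1\<close>. Decay along every single axis therefore gives decay in
  \<open>jap \<theta>\<close>.\<close>

lemma jap_power_le: "jap (\<theta>::real^'n::finite) ^ N \<le> (real CARD('n) + 1) ^ N * (1 + (\<Sum>j\<in>UNIV. \<bar>\<theta> $ j\<bar> ^ N))"
proof -
  define S where "S = insert 1 (range (\<lambda>j. \<bar>\<theta> $ j\<bar>))"
  define m where "m = Max S"
  have S: "finite S" "S \<noteq> {}" by (auto simp: S_def)
  have m: "1 \<le> m" "\<And>j. \<bar>\<theta> $ j\<bar> \<le> m" unfolding m_def by (rule Max_ge[OF S(1)], simp add: S_def)+
  have "jap \<theta> \<le> 1 + norm \<theta>" using jap_lipschitz[of \<theta> 0] by (simp add: jap_def)
  also have "\<dots> \<le> 1 + (\<Sum>j\<in>UNIV. \<bar>\<theta> $ j\<bar>)" using norm_le_l1_cart[of \<theta>] by simp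
  also have "\<dots> \<le> m + (\<Sum>j\<in>(UNIV::'n set). m)" by (intro add_mono sum_mono m)
  also have "\<dots> = (real CARD('n) + 1) * m" by (simp add: algebra_simps)
  finally have "jap \<theta> ^ N \<le> ((real CARD('n) + 1) * m) ^ N" using jap_pos[of \<theta>] by (intro power_mono) auto
  also have "\<dots> = (real CARD('n) + 1) ^ N * m ^ N" by (rule power_mult_distrib)
  also have "m ^ N \<le> 1 + (\<Sum>j\<in>UNIV. \<bar>\<theta> $ j\<bar> ^ N)"
  proof -
    have "m \<in> S" unfolding m_def by (rule Max_in[OF S])
    then consider "m = 1" | j where "m = \<bar>\<theta> $ j\<bar>" by (auto simp: S_def)
    then show ?thesis
    proof cases
      case 1
      then show ?thesis by (simp add: sum_nonneg)
    next
      case 2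
      have "\<bar>\<theta> $ j\<bar> ^ N \<le> (\<Sum>j\<in>UNIV. \<bar>\<theta> $ j\<bar> ^ N)" by (rule member_le_sum) auto
      then show ?thesis using 2 by simp
    qed
  qed
  finally show ?thesis by (simp add: mult_left_mono)
qed

text \<open>The amplitude of the symmetrised form minus its packet average. Two symbols occur
  because the Hermitian part of a matrix symbol couples the entry \<open>(i, j)\<close> with the
  conjugate of the entry \<open>(j, i)\<close>.\<close>

definition symmetrized_error :: "'n::finite symbol \<Rightarrow> 'n symbol \<Rightarrow> real^'n \<Rightarrow> real^'n \<Rightarrow> real^'n \<Rightarrow> complex" where
  "symmetrized_error a b \<xi> \<eta> x = (a (x, \<xi>) + b (x, \<eta>)) / 2 -
     (LINT \<zeta>|lborel. (a (x, \<zeta>) + b (x, \<zeta>)) / 2 * complex_of_real (packet \<xi> \<zeta> * packet \<eta> \<zeta>))"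

lemma symbol_bound_smooth: "symbol_bound l m K a \<Longrightarrow> smooth a"
  by (simp add: symbol_bound_def)

lemma symbol_bound_order_zero:
  assumes "symbol_bound (Suc (Suc l)) 0 K a"
  shows "order_zero K (\<lambda>\<zeta>. a (x, \<zeta>))"
proof -
  have d: "a differentiable_on UNIV" using symbol_bound_smooth[OF assms] by (rule smooth_differentiable0)
  have s1: "symbol_bound (Suc l) 1 K (partial_deriv (exi j) a)" for j using symbol_bound_exi[OF assms] by simp
  have d1: "partial_deriv (exi j) a differentiable_on UNIV" for j using symbol_bound_smooth[OF s1] by (rule smooth_differentiable0)
  have s2: "symbol_bound l 2 K (partial_deriv (exi k) (partial_deriv (exi j) a))" for j k
    using symbol_bound_exi[OF s1] by (simp add: numeral_2_eq_2)
  show ?thesis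
    unfolding order_zero_def partial_deriv_slice(1)[OF d] partial_deriv_slice(1)[OF d1]
    using partial_deriv_slice(2)[OF d] partial_deriv_slice(2)[OF d1] symbol_bound_le[OF assms] symbol_bound_le[OF s1] symbol_bound_le[OF s2]
    by simp
qed

lemma symbol_bound_continuous: "symbol_bound l m K a \<Longrightarrow> continuous_on UNIV a"
  by (intro smooth_continuous symbol_bound_smooth)

lemma symbol_bound_continuous_comp:
  assumes "symbol_bound l m K a" "continuous_on A f" "continuous_on A g"
  shows "continuous_on A (\<lambda>x. a (f x, g x))"
  by (rule continuous_on_compose2[OF symbol_bound_continuous[OF assms(1)]]) (auto intro!: continuous_intros assms)

text \<open>Differentiation in \<open>x\<close> commutes with the average in \<open>\<zeta>\<close>,
  and an \<open>x\<close>-derivative of a symbol is a symbol of the same order. Every derivative of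
  the error is thus an error of the same kind with the same bound. Of the \<open>N + 2\<close>
  derivatives, \<open>N\<close> are spent in \<open>x\<close> and two on the expansion in the
  frequency.\<close>

lemma symmetrized_error_chain:
  fixes a b :: "'n::finite symbol"
  assumes C: "\<And>K s t (\<xi>::real^'n) \<eta>. order_zero K s \<Longrightarrow> order_zero K t \<Longrightarrow>
     norm ((s \<xi> + t \<eta>) / 2 - (LINT \<zeta>|lborel. (s \<zeta> + t \<zeta>) / 2 * complex_of_real (packet \<xi> \<zeta> * packet \<eta> \<zeta>)))
       \<le> C * K * (jap (\<xi> - \<eta>))\<^sup>2 * (1 / jap \<xi> + 1 / jap \<eta>)"
    and a: "symbol_bound (N + 2) 0 K a" and b: "symbol_bound (N + 2) 0 K b"
  shows "deriv_chain N (axis j 1) (C * K * (jap (\<xi> - \<eta>))\<^sup>2 * (1 / jap \<xi> + 1 / jap \<eta>))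
     (\<lambda>i. symmetrized_error ((partial_deriv (ex j) ^^ i) a) ((partial_deriv (ex j) ^^ i) b) \<xi> \<eta>)"
  unfolding deriv_chain_def
proof (intro conjI allI impI)
  have pw: "symbol_bound (N + 2 - i) 0 K ((partial_deriv (ex j) ^^ i) c)" if "symbol_bound (N + 2) 0 K c" "i \<le> N" for i and c :: "'n symbol"
    using that(2)
  proof (induction i)
    case (Suc i)
    have e: "Suc (N + 2 - Suc i) = N + 2 - i" using Suc.prems by simp
    have "symbol_bound (Suc (N + 2 - Suc i)) 0 K ((partial_deriv (ex j) ^^ i) c)" unfolding e using Suc by simp
    then show ?case using symbol_bound_ex by simp
  qed (use that in simp)
  have pw2: "symbol_bound (Suc (Suc 0)) 0 K ((partial_deriv (ex j) ^^ i) c)" if "symbol_bound (N + 2) 0 K c" "i \<le> N" for i and c :: "'n symbol"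
    by (rule symbol_bound_mono[OF pw[OF that]]) (use that in auto)
  have K: "K \<ge> 0" by (rule symbol_bound_nonneg[OF a])
  have pp: "integrable lborel (\<lambda>\<zeta>. K * (packet \<xi> \<zeta> * packet \<eta> \<zeta>))"
    by (intro integrable_mult_right packet_prod_integrable)
  have bd: "norm ((c (x, \<zeta>) + d (x, \<zeta>)) / 2 * complex_of_real (packet \<xi> \<zeta> * packet \<eta> \<zeta>)) \<le> K * (packet \<xi> \<zeta> * packet \<eta> \<zeta>)"
    if "symbol_bound l 0 K c" "symbol_bound l 0 K d" for c d :: "'n symbol" and l x \<zeta>
  proof -
    have "norm (c (x, \<zeta>) + d (x, \<zeta>)) \<le> K + K"
      using symbol_bound_le[OF that(1), of x \<zeta>] symbol_bound_le[OF that(2), of x \<zeta>] by (intro norm_triangle_le) simp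
    then have "norm ((c (x, \<zeta>) + d (x, \<zeta>)) / 2) \<le> K" by (simp add: norm_divide)
    moreover have pq: "packet \<xi> \<zeta> * packet \<eta> \<zeta> \<ge> 0" using packet_nonneg[of \<xi> \<zeta>] packet_nonneg[of \<eta> \<zeta>] by simp
    ultimately show ?thesis
      unfolding norm_mult[of "_ / 2"] norm_of_real abs_of_nonneg[OF pq] by (intro mult_right_mono)
  qed
  have cint: "continuous_on UNIV (\<lambda>x. (c (x, \<zeta>) + d (x, \<zeta>)) / 2 * complex_of_real (packet \<xi> \<zeta> * packet \<eta> \<zeta>))"
     "(\<lambda>\<zeta>. (c (x, \<zeta>) + d (x, \<zeta>)) / 2 * complex_of_real (packet \<xi> \<zeta> * packet \<eta> \<zeta>)) \<in> borel_measurable borel"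
    if "symbol_bound l 0 K c" "symbol_bound l 0 K d" for c d :: "'n symbol" and l x \<zeta>
    by (intro continuous_intros borel_measurable_continuous_onI symbol_bound_continuous_comp[OF that(1)] symbol_bound_continuous_comp[OF that(2)], simp)+
  fix i x
  {
    assume i: "i \<le> N"
    note s = pw2[OF a i] pw2[OF b i]
    show "continuous_on UNIV (symmetrized_error ((partial_deriv (ex j) ^^ i) a) ((partial_deriv (ex j) ^^ i) b) \<xi> \<eta>)"
      unfolding symmetrized_error_def
      by (intro continuous_intros symbol_bound_continuous_comp[OF s(1)] symbol_bound_continuous_comp[OF s(2)]
          continuous_on_integral_param[OF cint(1)[OF s] cint(2)[OF s] bd[OF s] pp]) simp
    show "norm (symmetrized_error ((partial_deriv (ex j) ^^ i) a) ((partial_deriv (ex j) ^^ i) b) \<xi> \<eta> x) \<le> C * K * (jap (\<xi> - \<eta>))\<^sup>2 * (1 / jap \<xi> + 1 / jap \<eta>)"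
      unfolding symmetrized_error_def by (rule C[OF symbol_bound_order_zero[OF s(1)] symbol_bound_order_zero[OF s(2)]])
  }
  fix s :: real
  assume i: "i < N"
  let ?v = "axis j 1 :: real^'n"
  have sc: "symbol_bound (Suc (Suc 0)) 0 K ((partial_deriv (ex j) ^^ i) c)" "symbol_bound (Suc (Suc 0)) 0 K ((partial_deriv (ex j) ^^ Suc i) c)"
    if "symbol_bound (N + 2) 0 K c" for c :: "'n symbol"
    by (rule pw2[OF that]; use i in simp)+
  have line: "((\<lambda>s. (partial_deriv (ex j) ^^ i) c (x + s *\<^sub>R ?v, \<zeta>)) has_vector_derivative (partial_deriv (ex j) ^^ Suc i) c (x + s *\<^sub>R ?v, \<zeta>)) (at s)"
    if "symbol_bound (N + 2) 0 K c" for c :: "'n symbol" and \<zeta> s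
    using partial_deriv_line[OF smooth_differentiable0[OF symbol_bound_smooth[OF sc(1)[OF that]]], of "(x, \<zeta>)" "ex j" s] by simp
  have p2: "((\<lambda>s. (c s + d s) / 2 * z) has_vector_derivative (c' + d') / 2 * z) (at s)"
    if "(c has_vector_derivative c') (at s)" "(d has_vector_derivative d') (at s)" for c d :: "real \<Rightarrow> complex" and c' d' z s
    using has_vector_derivative_mult_left[OF has_vector_derivative_divide[OF has_vector_derivative_add[OF that], of 2], of z] .
  have I: "((\<lambda>s. LINT \<zeta>|lborel. ((partial_deriv (ex j) ^^ i) a (x + s *\<^sub>R ?v, \<zeta>) + (partial_deriv (ex j) ^^ i) b (x + s *\<^sub>R ?v, \<zeta>)) / 2 * complex_of_real (packet \<xi> \<zeta> * packet \<eta> \<zeta>))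
     has_vector_derivative (LINT \<zeta>|lborel. ((partial_deriv (ex j) ^^ Suc i) a (x + s *\<^sub>R ?v, \<zeta>) + (partial_deriv (ex j) ^^ Suc i) b (x + s *\<^sub>R ?v, \<zeta>)) / 2 * complex_of_real (packet \<xi> \<zeta> * packet \<eta> \<zeta>))) (at s)"
  proof (rule has_vector_derivative_integral_param[OF p2[OF line[OF a] line[OF b]] _ _ _ pp])
    fix s :: real and \<zeta> :: "real^'n"
    show "integrable lborel (\<lambda>\<zeta>. ((partial_deriv (ex j) ^^ i) a (x + s *\<^sub>R ?v, \<zeta>) + (partial_deriv (ex j) ^^ i) b (x + s *\<^sub>R ?v, \<zeta>)) / 2 * complex_of_real (packet \<xi> \<zeta> * packet \<eta> \<zeta>))"
    proof (rule Bochner_Integration.integrable_bound[OF pp])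
      show "AE \<zeta> in lborel. norm (((partial_deriv (ex j) ^^ i) a (x + s *\<^sub>R ?v, \<zeta>) + (partial_deriv (ex j) ^^ i) b (x + s *\<^sub>R ?v, \<zeta>)) / 2 * complex_of_real (packet \<xi> \<zeta> * packet \<eta> \<zeta>)) \<le> norm (K * (packet \<xi> \<zeta> * packet \<eta> \<zeta>))"
        unfolding real_norm_def by (intro AE_I2 order.trans[OF _ abs_ge_self] bd[OF sc(1)[OF a] sc(1)[OF b]])
    qed (use cint(2)[OF sc(1)[OF a] sc(1)[OF b]] in simp)
    show "(\<lambda>\<zeta>. ((partial_deriv (ex j) ^^ Suc i) a (x + s *\<^sub>R ?v, \<zeta>) + (partial_deriv (ex j) ^^ Suc i) b (x + s *\<^sub>R ?v, \<zeta>)) / 2 * complex_of_real (packet \<xi> \<zeta> * packet \<eta> \<zeta>)) \<in> borel_measurable borel"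
      by (rule cint(2)[OF sc(2)[OF a] sc(2)[OF b]])
    show "norm (((partial_deriv (ex j) ^^ Suc i) a (x + s *\<^sub>R ?v, \<zeta>) + (partial_deriv (ex j) ^^ Suc i) b (x + s *\<^sub>R ?v, \<zeta>)) / 2 * complex_of_real (packet \<xi> \<zeta> * packet \<eta> \<zeta>)) \<le> K * (packet \<xi> \<zeta> * packet \<eta> \<zeta>)"
      by (rule bd[OF sc(2)[OF a] sc(2)[OF b]])
  qed
  have p1: "((\<lambda>s. (c s + d s) / 2) has_vector_derivative (c' + d') / 2) (at s)"
    if "(c has_vector_derivative c') (at s)" "(d has_vector_derivative d') (at s)" for c d :: "real \<Rightarrow> complex" and c' d' s
    by (rule has_vector_derivative_divide[OF has_vector_derivative_add[OF that]])
  show "((\<lambda>s. symmetrized_error ((partial_deriv (ex j) ^^ i) a) ((partial_deriv (ex j) ^^ i) b) \<xi> \<eta> (x + s *\<^sub>R ?v)) has_vector_derivative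
     symmetrized_error ((partial_deriv (ex j) ^^ Suc i) a) ((partial_deriv (ex j) ^^ Suc i) b) \<xi> \<eta> (x + s *\<^sub>R ?v)) (at s)"
    unfolding symmetrized_error_def by (rule has_vector_derivative_diff[OF p1[OF line[OF a] line[OF b]] I])
qed

text \<open>The kernel estimate for Schur's test: the packets supply the small factor
  \<open>1 / jap \<xi> + 1 / jap \<eta>\<close>, smoothness in \<open>x\<close> the decay in
  \<open>\<theta>\<close>. It is applied with \<open>\<theta> = \<eta> - \<xi>\<close>, where two of
  the \<open>N\<close> powers cancel \<open>(jap (\<xi> - \<eta>))\<^sup>2\<close>.\<close>

lemma symmetrized_error_decay:
  "\<exists>C\<ge>0. \<forall>\<alpha>>0. \<forall>k \<theta> (\<xi>::real^'n::finite) \<eta> K a b. symbol_bound (N + 2) 0 K a \<longrightarrow> symbol_bound (N + 2) 0 K b \<longrightarrow>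
     jap \<theta> ^ N * norm (LINT x|lborel. wave_cnj x \<theta> * complex_of_real (exp (- \<alpha> * (norm (x - k))\<^sup>2)) * symmetrized_error a b \<xi> \<eta> x)
       \<le> C * K * (jap (\<xi> - \<eta>))\<^sup>2 * (1 / jap \<xi> + 1 / jap \<eta>) * (1 + sqrt \<alpha>) ^ N * (1 / sqrt \<alpha>) ^ CARD('n)"
proof -
  obtain C1 where C1: "C1 \<ge> 0" "\<And>K s t (\<xi>::real^'n) \<eta>. order_zero K s \<Longrightarrow> order_zero K t \<Longrightarrow>
     norm ((s \<xi> + t \<eta>) / 2 - (LINT \<zeta>|lborel. (s \<zeta> + t \<zeta>) / 2 * complex_of_real (packet \<xi> \<zeta> * packet \<eta> \<zeta>)))
       \<le> C1 * K * (jap (\<xi> - \<eta>))\<^sup>2 * (1 / jap \<xi> + 1 / jap \<eta>)"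
    using order_zero_symmetrized[where 'n='n] by blast
  define Q where "Q = (\<lambda>(N, j) C. C \<ge> 0 \<and> (\<forall>\<alpha>>0. \<forall>k \<theta> \<kappa> \<sigma>. deriv_chain N (axis j 1 :: real^'n) \<kappa> \<sigma> \<longrightarrow>
     \<bar>\<theta> $ j\<bar> ^ N * norm (LINT x|lborel. wave_cnj x \<theta> * complex_of_real (gauss_monomial \<alpha> k j 0 x) * \<sigma> 0 x)
       \<le> C * \<kappa> * (1 + sqrt \<alpha>) ^ N * (1 / sqrt \<alpha>) ^ CARD('n)))"
  have "\<exists>C. Q (N, j) C" for N and j :: 'n
    unfolding Q_def case_prod_conv using gaussian_oscillatory_decay[of N j 0] by blast
  then have "\<forall>p. \<exists>C. Q p C" by simp
  then obtain D' where Q: "\<forall>p. Q p (D' p)" using choice[of Q] by blast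
  define D where "D = (\<lambda>N j. D' (N, j))"
  have QD: "Q (N, j) (D N j)" for N j using Q by (simp add: D_def)
  have D0: "D N j \<ge> 0" for N j using QD[of N j] by (simp add: Q_def)
  have D: "\<bar>\<theta> $ j\<bar> ^ N * norm (LINT x|lborel. wave_cnj x \<theta> * complex_of_real (gauss_monomial \<alpha> k j 0 x) * \<sigma> 0 x)
       \<le> D N j * \<kappa> * (1 + sqrt \<alpha>) ^ N * (1 / sqrt \<alpha>) ^ CARD('n)"
    if "\<alpha> > 0" "deriv_chain N (axis j 1 :: real^'n) \<kappa> \<sigma>" for N j \<alpha> k \<theta> \<kappa> \<sigma>
    using QD[of N j] that unfolding Q_def case_prod_conv by blast
  \<comment> \<open>The summand \<open>D 0 undefined\<close> bounds the integral without any decay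
    and answers the term 1 in \<open>jap_power_le\<close>; for exponent 0 the choice of the axis is
    immaterial.\<close>
  define E where "E = D 0 undefined + (\<Sum>j\<in>UNIV. D N j)"
  have E: "E \<ge> 0" unfolding E_def using D0 by (intro add_nonneg_nonneg sum_nonneg) auto
  show ?thesis
  proof (intro exI[of _ "(real CARD('n) + 1) ^ N * E * C1"] conjI allI impI)
    show "0 \<le> (real CARD('n) + 1) ^ N * E * C1" using E C1 by simp
    fix \<alpha> :: real and k \<theta> \<xi> \<eta> :: "real^'n" and K and a b :: "'n symbol"
    assume \<alpha>: "\<alpha> > 0" and a: "symbol_bound (N + 2) 0 K a" and b: "symbol_bound (N + 2) 0 K b"
    define \<kappa> where "\<kappa> = C1 * K * (jap (\<xi> - \<eta>))\<^sup>2 * (1 / jap \<xi> + 1 / jap \<eta>)"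
    have K: "K \<ge> 0" by (rule symbol_bound_nonneg[OF a])
    have \<kappa>: "\<kappa> \<ge> 0" unfolding \<kappa>_def using C1 K jap_pos[of \<xi>] jap_pos[of \<eta>] by simp
    define \<sigma> where "\<sigma> = (\<lambda>j i. symmetrized_error ((partial_deriv (ex j) ^^ i) a) ((partial_deriv (ex j) ^^ i) b) \<xi> \<eta>)"
    have ch: "deriv_chain N (axis j 1) \<kappa> (\<sigma> j)" for j
      unfolding \<kappa>_def \<sigma>_def by (rule symmetrized_error_chain[OF C1(2) a b])
    then have ch0: "deriv_chain 0 (axis j 1) \<kappa> (\<sigma> j)" for j by (simp add: deriv_chain_def)
    define I where "I = norm (LINT x|lborel. wave_cnj x \<theta> * complex_of_real (exp (- \<alpha> * (norm (x - k))\<^sup>2)) * symmetrized_error a b \<xi> \<eta> x)"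
    define T where "T = \<kappa> * (1 + sqrt \<alpha>) ^ N * (1 / sqrt \<alpha>) ^ CARD('n)"
    have B: "\<bar>\<theta> $ j\<bar> ^ N * I \<le> D N j * T" for j
      using D[OF \<alpha> ch[of j], of \<theta> k] by (simp add: I_def T_def \<sigma>_def gauss_monomial_def mult_ac)
    have "I \<le> D 0 undefined * (\<kappa> * (1 / sqrt \<alpha>) ^ CARD('n) * 1)"
      using D[OF \<alpha> ch0[of undefined], of \<theta> k] by (simp add: I_def \<sigma>_def gauss_monomial_def mult_ac)
    also have "\<dots> \<le> D 0 undefined * (\<kappa> * (1 / sqrt \<alpha>) ^ CARD('n) * (1 + sqrt \<alpha>) ^ N)"
      using D0 \<kappa> \<alpha> by (intro mult_left_mono one_le_power) auto
    finally have B0: "I \<le> D 0 undefined * T" by (simp add: T_def mult_ac)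
    have I0: "I \<ge> 0" by (simp add: I_def)
    have "jap \<theta> ^ N * I \<le> (real CARD('n) + 1) ^ N * (1 + (\<Sum>j\<in>UNIV. \<bar>\<theta> $ j\<bar> ^ N)) * I"
      by (rule mult_right_mono[OF jap_power_le I0])
    also have "\<dots> = (real CARD('n) + 1) ^ N * (I + (\<Sum>j\<in>UNIV. \<bar>\<theta> $ j\<bar> ^ N * I))"
      by (simp add: algebra_simps sum_distrib_left sum_distrib_right)
    also have "\<dots> \<le> (real CARD('n) + 1) ^ N * (D 0 undefined * T + (\<Sum>j\<in>UNIV. D N j * T))"
      by (intro mult_left_mono add_mono sum_mono B B0) auto
    also have "\<dots> = (real CARD('n) + 1) ^ N * E * T" by (simp add: E_def algebra_simps sum_distrib_left sum_distrib_right)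
    also have "\<dots> = (real CARD('n) + 1) ^ N * E * C1 * K * (jap (\<xi> - \<eta>))\<^sup>2 * (1 / jap \<xi> + 1 / jap \<eta>) * (1 + sqrt \<alpha>) ^ N * (1 / sqrt \<alpha>) ^ CARD('n)"
      by (simp only: T_def \<kappa>_def mult.assoc)
    finally show "jap \<theta> ^ N * norm (LINT x|lborel. wave_cnj x \<theta> * complex_of_real (exp (- \<alpha> * (norm (x - k))\<^sup>2)) * symmetrized_error a b \<xi> \<eta> x)
       \<le> (real CARD('n) + 1) ^ N * E * C1 * K * (jap (\<xi> - \<eta>))\<^sup>2 * (1 / jap \<xi> + 1 / jap \<eta>) * (1 + sqrt \<alpha>) ^ N * (1 / sqrt \<alpha>) ^ CARD('n)"
      unfolding I_def .
  qed
qed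

section \<open>Schur's test with weights\<close>

lemma integrable_inverse_jap_power: "integrable lborel (\<lambda>x::'a::euclidean_space. 1 / jap x ^ (2 * DIM('a)))"
proof (rule Bochner_Integration.integrable_bound)
  have "integrable lborel (\<lambda>s::real. 1 / (1 + s\<^sup>2))"
    using integrable_inverse_1_plus_square by (simp add: set_integrable_def divide_inverse)
  then show "integrable lborel (\<lambda>x::'a. \<Prod>b\<in>Basis. 1 / (1 + (x \<bullet> b)\<^sup>2))"
    by (rule lborel_integrable_prod[where f = "\<lambda>b s. 1 / (1 + s\<^sup>2)"])
  show "AE x in lborel. norm (1 / jap x ^ (2 * DIM('a))) \<le> norm (\<Prod>b\<in>Basis. 1 / (1 + ((x::'a) \<bullet> b)\<^sup>2))"
  proof (rule AE_I2)
    fix x :: 'a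
    \<comment> \<open>Each of the \<open>DIM('a)\<close> factors is at most
      \<open>(jap x)\<^sup>2\<close>, so the power of \<open>jap\<close> is dominated by a product
      of the one-dimensional functions \<open>1 / (1 + s\<^sup>2)\<close>.\<close>
    have "(\<Prod>b\<in>Basis. 1 + (x \<bullet> b)\<^sup>2) \<le> (\<Prod>b\<in>(Basis::'a set). (jap x)\<^sup>2)"
    proof (rule prod_mono, intro conjI)
      fix b :: 'a assume b: "b \<in> Basis"
      have "(x \<bullet> b)\<^sup>2 \<le> (norm x)\<^sup>2" using Basis_le_norm[OF b, of x] by (simp add: abs_le_square_iff[symmetric])
      then show "1 + (x \<bullet> b)\<^sup>2 \<le> (jap x)\<^sup>2" by (simp add: jap_eq)
    qed simp
    also have "\<dots> = jap x ^ (2 * DIM('a))" by (simp add: power_mult)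
    finally have le: "(\<Prod>b\<in>Basis. 1 + (x \<bullet> b)\<^sup>2) \<le> jap x ^ (2 * DIM('a))" .
    have pos: "0 < (\<Prod>b\<in>Basis. 1 + (x \<bullet> b)\<^sup>2)" by (intro prod_pos) (simp add: add_pos_nonneg)
    have "1 / jap x ^ (2 * DIM('a)) \<le> 1 / (\<Prod>b\<in>Basis. 1 + (x \<bullet> b)\<^sup>2)"
      using le pos by (intro divide_left_mono) (auto intro: order.strict_trans2)
    then show "norm (1 / jap x ^ (2 * DIM('a))) \<le> norm (\<Prod>b\<in>Basis. 1 / (1 + (x \<bullet> b)\<^sup>2))"
      using pos jap_pos[of x] by (simp add: prod_dividef abs_of_pos)
  qed
qed measurable

lemma integrable_lborel_prod_iff:
  "integrable (lborel :: ('a::euclidean_space \<times> 'b::euclidean_space) measure) f \<longleftrightarrow> integrable (lborel \<Otimes>\<^sub>M lborel) f"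
  by (simp add: lborel_prod)

lemma integral_lborel_prod:
  fixes f :: "'a::euclidean_space \<times> 'b::euclidean_space \<Rightarrow> 'c::{banach, second_countable_topology}"
  assumes "integrable lborel f"
  shows "(LINT p|lborel. f p) = (LINT x|lborel. LINT y|lborel. f (x, y))"
    and "(LINT p|lborel. f p) = (LINT y|lborel. LINT x|lborel. f (x, y))"
  using lborel_pair.integral_fst'[of f] lborel_pair.integral_snd[of "\<lambda>x y. f (x, y)"] assms
  by (auto simp: lborel_prod[symmetric])

lemma integrable_lborel_swap:
  fixes f :: "'a::euclidean_space \<times> 'b::euclidean_space \<Rightarrow> 'c::{banach, second_countable_topology}"
  assumes "integrable lborel f"
  shows "integrable lborel (\<lambda>(y, x). f (x, y))"
  using lborel_pair.integrable_product_swap[of f] assms by (simp add: lborel_prod)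

text \<open>The arithmetic-geometric mean inequality splits \<open>a * b\<close> into squares, and
  Peetre's inequality exchanges a weight at the wrong frequency for one power of
  \<open>jap (\<xi> - \<eta>)\<close>. The other \<open>2 * CARD('n)\<close> powers make the kernel
  integrable in the difference, so each square is convolved with an integrable function.\<close>

lemma schur_bound:
  fixes D :: "(real^'n::finite) \<times> (real^'n) \<Rightarrow> complex" and f g :: "real^'n \<Rightarrow> complex"
  assumes D: "D \<in> borel_measurable borel" "\<And>\<xi> \<eta>. jap (\<xi> - \<eta>) ^ (2 * CARD('n) + 1) * norm (D (\<xi>, \<eta>)) \<le> M * (1 / jap \<xi> + 1 / jap \<eta>)"
    and M: "M \<ge> 0"
    and f: "f \<in> borel_measurable borel" "integrable lborel (\<lambda>\<xi>. (norm (f \<xi>))\<^sup>2 / jap \<xi>)"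
    and g: "g \<in> borel_measurable borel" "integrable lborel (\<lambda>\<xi>. (norm (g \<xi>))\<^sup>2 / jap \<xi>)"
  shows "norm (LINT p|lborel. f (fst p) * cnj (g (snd p)) * D p)
     \<le> 2 * M * (LINT x::real^'n|lborel. 1 / jap x ^ (2 * CARD('n))) * ((LINT \<xi>|lborel. (norm (f \<xi>))\<^sup>2 / jap \<xi>) + (LINT \<xi>|lborel. (norm (g \<xi>))\<^sup>2 / jap \<xi>))"
proof -
  define w where "w = (\<lambda>x::real^'n. 1 / jap x ^ (2 * CARD('n)))"
  have w: "integrable lborel w" "\<And>x. w x \<ge> 0" "\<And>x. w (- x) = w x"
    using integrable_inverse_jap_power[where 'a="real^'n"] by (auto simp: w_def less_imp_le[OF jap_pos] jap_minus)
  have [measurable]: "w \<in> borel_measurable borel" using w(1) by auto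
  note [measurable] = D(1) f(1) g(1)
  have pt: "norm (f \<xi> * cnj (g \<eta>) * D (\<xi>, \<eta>)) \<le> 2 * M * (w (\<xi> - \<eta>) * ((norm (f \<xi>))\<^sup>2 / jap \<xi>) + w (\<xi> - \<eta>) * ((norm (g \<eta>))\<^sup>2 / jap \<eta>))" for \<xi> \<eta>
  proof -
    define S T J where "S = jap \<xi>" and "T = jap \<eta>" and "J = jap (\<xi> - \<eta>)"
    have p: "S \<ge> 1" "T \<ge> 1" "J \<ge> 1" by (auto simp: S_def T_def J_def jap_ge_1)
    have ST: "S \<le> 2 * T * J" "T \<le> 2 * S * J"
      using jap_peetre[of \<xi> \<eta>] jap_peetre[of \<eta> \<xi>] by (auto simp: S_def T_def J_def jap_minus(2)[of \<eta>])
    define a b where "a = norm (f \<xi>)" and "b = norm (g \<eta>)"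
    have ab: "a \<ge> 0" "b \<ge> 0" by (auto simp: a_def b_def)
    have key: "a * b * (1 / S + 1 / T) \<le> 2 * J * (a\<^sup>2 / S + b\<^sup>2 / T)"
    proof -
      have half: "(x * (2 * J) + y * (2 * J)) / 2 = J * (x + y)" for x y by (simp add: distrib_left mult.commute)
      have h1: "a * b / S \<le> J * (a\<^sup>2 / S + b\<^sup>2 / T)"
      proof -
        have "2 * (a * b) \<le> a\<^sup>2 + b\<^sup>2" using sum_squares_bound[of a b] by simp
        then have "a * b / S \<le> (a\<^sup>2 / S + b\<^sup>2 / S) / 2" using p by (simp add: field_simps)
        also have "\<dots> \<le> (a\<^sup>2 / S * (2 * J) + b\<^sup>2 / T * (2 * J)) / 2"
        proof -
          have "a\<^sup>2 / S * 1 \<le> a\<^sup>2 / S * (2 * J)" using p by (intro mult_left_mono) auto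
          moreover have "b\<^sup>2 / S \<le> b\<^sup>2 / T * (2 * J)"
            using mult_left_mono[OF ST(2), of "b\<^sup>2"] p by (simp add: field_simps)
          ultimately show ?thesis by (intro divide_right_mono add_mono) simp_all
        qed
        finally show ?thesis unfolding half .
      qed
      have h2: "a * b / T \<le> J * (a\<^sup>2 / S + b\<^sup>2 / T)"
      proof -
        have "2 * (a * b) \<le> a\<^sup>2 + b\<^sup>2" using sum_squares_bound[of a b] by simp
        then have "a * b / T \<le> (a\<^sup>2 / T + b\<^sup>2 / T) / 2" using p by (simp add: field_simps)
        also have "\<dots> \<le> (a\<^sup>2 / S * (2 * J) + b\<^sup>2 / T * (2 * J)) / 2"
        proof -
          have "b\<^sup>2 / T * 1 \<le> b\<^sup>2 / T * (2 * J)" using p by (intro mult_left_mono) auto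
          moreover have "a\<^sup>2 / T \<le> a\<^sup>2 / S * (2 * J)"
            using mult_left_mono[OF ST(1), of "a\<^sup>2"] p by (simp add: field_simps)
          ultimately show ?thesis by (intro divide_right_mono add_mono) simp_all
        qed
        finally show ?thesis unfolding half .
      qed
      have "a * b * (1 / S + 1 / T) = a * b / S + a * b / T" by (simp add: distrib_left)
      also have "\<dots> \<le> J * (a\<^sup>2 / S + b\<^sup>2 / T) + J * (a\<^sup>2 / S + b\<^sup>2 / T)" by (rule add_mono[OF h1 h2])
      finally show ?thesis by simp
    qed
    have "norm (D (\<xi>, \<eta>)) \<le> M * (1 / S + 1 / T) / J ^ (2 * CARD('n) + 1)"
      using D(2)[of \<xi> \<eta>] p by (simp add: S_def T_def J_def pos_le_divide_eq mult.commute)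
    then have "norm (f \<xi> * cnj (g \<eta>) * D (\<xi>, \<eta>)) \<le> a * b * (M * (1 / S + 1 / T) / J ^ (2 * CARD('n) + 1))"
      unfolding norm_mult complex_mod_cnj a_def[symmetric] b_def[symmetric] using ab by (intro mult_left_mono) auto
    also have "\<dots> = (M / J ^ (2 * CARD('n) + 1)) * (a * b * (1 / S + 1 / T))" by simp
    also have "\<dots> \<le> (M / J ^ (2 * CARD('n) + 1)) * (2 * J * (a\<^sup>2 / S + b\<^sup>2 / T))"
      using M p by (intro mult_left_mono key) auto
    also have "\<dots> = 2 * M * (1 / J ^ (2 * CARD('n))) * (a\<^sup>2 / S + b\<^sup>2 / T)" using p by (simp add: field_simps)
    finally show ?thesis by (simp add: w_def a_def b_def S_def T_def J_def distrib_left mult.assoc)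
  qed
  have conv: "integrable lborel (\<lambda>p. w (fst p - snd p) * h (fst p))"
     "(LINT p|lborel. w (fst p - snd p) * h (fst p)) = (LINT x|lborel. w x) * (LINT \<xi>|lborel. h \<xi>)"
     "integrable lborel (\<lambda>p. w (fst p - snd p) * h (snd p))"
     "(LINT p|lborel. w (fst p - snd p) * h (snd p)) = (LINT x|lborel. w x) * (LINT \<xi>|lborel. h \<xi>)"
    if h: "integrable lborel h" "\<And>\<xi>. h \<xi> \<ge> 0" for h
  proof -
    have [measurable]: "h \<in> borel_measurable borel" using h(1) by auto
    have sh: "integrable lborel (\<lambda>y. w (x - y))" "(LINT y|lborel. w (x - y)) = (LINT x|lborel. w x)" for x
      by (auto intro!: lborel_integrable_reflect w lborel_integral_reflect)
    have sw: "w (x - y) = w (y - x)" for x y using w(3)[of "x - y"] by simp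
    have "integrable (lborel \<Otimes>\<^sub>M lborel) (\<lambda>(x, y). w (x - y) * h x)"
    proof (rule integrable_pair_lborel[where g = "\<lambda>x y. w (x - y) * h x" and G = "\<lambda>x. (LINT x|lborel. w x) * h x"])
      show "(\<lambda>(x, y). w (x - y) * h x) \<in> borel_measurable borel" by (simp add: borel_prod[symmetric])
    qed (use h w sh in auto)
    then show i: "integrable lborel (\<lambda>p. w (fst p - snd p) * h (fst p))"
      by (simp add: integrable_lborel_prod_iff case_prod_beta')
    show e: "(LINT p|lborel. w (fst p - snd p) * h (fst p)) = (LINT x|lborel. w x) * (LINT \<xi>|lborel. h \<xi>)"
      unfolding integral_lborel_prod(1)[OF i] by (simp add: sh)
    show i2: "integrable lborel (\<lambda>p. w (fst p - snd p) * h (snd p))"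
      using integrable_lborel_swap[OF i] by (simp add: case_prod_beta' sw)
    show "(LINT p|lborel. w (fst p - snd p) * h (snd p)) = (LINT x|lborel. w x) * (LINT \<xi>|lborel. h \<xi>)"
      unfolding integral_lborel_prod(2)[OF i2] by (simp add: sw[of _ "_"] sh)
  qed
  have nn: "(norm (f \<xi>))\<^sup>2 / jap \<xi> \<ge> 0" "(norm (g \<xi>))\<^sup>2 / jap \<xi> \<ge> 0" for \<xi> using jap_pos[of \<xi>] by auto
  note cf = conv[OF f(2) nn(1)] and cg = conv[OF g(2) nn(2)]
  let ?B = "\<lambda>p. 2 * M * (w (fst p - snd p) * ((norm (f (fst p)))\<^sup>2 / jap (fst p)) + w (fst p - snd p) * ((norm (g (snd p)))\<^sup>2 / jap (snd p)))"
  have iB: "integrable lborel ?B" by (intro integrable_mult_right Bochner_Integration.integrable_add cf(1) cg(3))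
  have "norm (LINT p|lborel. f (fst p) * cnj (g (snd p)) * D p) \<le> (LINT p|lborel. norm (f (fst p) * cnj (g (snd p)) * D p))"
    by (rule integral_norm_bound)
  also have "\<dots> \<le> (LINT p|lborel. ?B p)"
  proof (rule Bochner_Integration.integral_mono'[OF iB])
    fix p :: "(real^'n) \<times> (real^'n)"
    show le: "norm (f (fst p) * cnj (g (snd p)) * D p) \<le> ?B p" using pt[of "fst p" "snd p"] by simp
    then show "0 \<le> ?B p" by (rule order.trans[OF norm_ge_zero])
  qed
  also have "\<dots> = 2 * M * ((LINT x|lborel. w x) * (LINT \<xi>|lborel. (norm (f \<xi>))\<^sup>2 / jap \<xi>) + (LINT x|lborel. w x) * (LINT \<xi>|lborel. (norm (g \<xi>))\<^sup>2 / jap \<xi>))"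
    unfolding integral_mult_right_zero Bochner_Integration.integral_add[OF cf(1) cg(3)] cf(2) cg(4) ..
  finally show ?thesis unfolding w_def by (simp add: distrib_left mult.assoc)
qed

section \<open>The localised inequality\<close>

text \<open>Within distance \<open>jap \<xi> / 2\<close> of the centre the two brackets are
  comparable. Farther out \<open>1 / jap \<zeta> \<le> 1\<close> is dominated by a multiple of
  \<open>(norm (\<zeta> - \<xi>))\<^sup>2\<close>, as in Chebyshev's inequality, and the second
  moment applies.\<close>

lemma packet_weight:
  "\<exists>C\<ge>0. \<forall>\<xi>::'a::euclidean_space. integrable lborel (\<lambda>\<zeta>. (packet \<xi> \<zeta>)\<^sup>2 / jap \<zeta>) \<and>
     (LINT \<zeta>|lborel. (packet \<xi> \<zeta>)\<^sup>2 / jap \<zeta>) \<le> C / jap \<xi>"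
proof -
  obtain C where C: "C \<ge> 0" "\<And>\<xi>::'a. integrable lborel (\<lambda>\<zeta>. (norm (\<zeta> - \<xi>))\<^sup>2 * (packet \<xi> \<zeta>)\<^sup>2)"
     "\<And>\<xi>::'a. (LINT \<zeta>|lborel. (norm (\<zeta> - \<xi>))\<^sup>2 * (packet \<xi> \<zeta>)\<^sup>2) \<le> C * jap \<xi>"
    using packet_second_moment[where 'a='a] by blast
  show ?thesis
  proof (intro exI[of _ "2 + 4 * C"] conjI allI)
    fix \<xi> :: 'a
    define S where "S = jap \<xi>"
    have S: "S \<ge> 1" by (simp add: S_def jap_ge_1)
    have [measurable]: "packet \<xi> \<in> borel_measurable borel" by (intro borel_measurable_continuous_onI continuous_intros)
    let ?B = "\<lambda>\<zeta>. (2 / S) * (packet \<xi> \<zeta>)\<^sup>2 + (4 / S\<^sup>2) * ((norm (\<zeta> - \<xi>))\<^sup>2 * (packet \<xi> \<zeta>)\<^sup>2)"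
    have B: "integrable lborel ?B" by (intro Bochner_Integration.integrable_add integrable_mult_right packet_square_integrable C)
    have w: "1 / jap \<zeta> \<le> 2 / S + (4 / S\<^sup>2) * (norm (\<zeta> - \<xi>))\<^sup>2" for \<zeta>
    proof (cases "norm (\<zeta> - \<xi>) \<le> S / 2")
      case True
      then have "S / 2 \<le> jap \<zeta>" using jap_lipschitz[of \<zeta> \<xi>] by (simp add: S_def)
      then have "1 / jap \<zeta> \<le> 1 / (S / 2)" using S jap_pos[of \<zeta>] by (intro divide_left_mono) auto
      then show ?thesis by (simp add: add_increasing2)
    next
      case False
      then have "(S / 2)\<^sup>2 \<le> (norm (\<zeta> - \<xi>))\<^sup>2" using S by (intro power_mono) auto
      then have "(4 / S\<^sup>2) * (S / 2)\<^sup>2 \<le> (4 / S\<^sup>2) * (norm (\<zeta> - \<xi>))\<^sup>2" by (intro mult_left_mono) auto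
      moreover have "(4 / S\<^sup>2) * (S / 2)\<^sup>2 = 1" using S by (simp add: power_divide)
      moreover have "1 / jap \<zeta> \<le> 1" using jap_ge_1[of \<zeta>] by simp
      moreover have "0 \<le> 2 / S" using S by simp
      ultimately show ?thesis by linarith
    qed
    have le: "(packet \<xi> \<zeta>)\<^sup>2 / jap \<zeta> \<le> ?B \<zeta>" for \<zeta>
      using mult_right_mono[OF w[of \<zeta>], of "(packet \<xi> \<zeta>)\<^sup>2"] by (simp add: distrib_right mult.assoc)
    show i: "integrable lborel (\<lambda>\<zeta>. (packet \<xi> \<zeta>)\<^sup>2 / jap \<zeta>)"
    proof (rule Bochner_Integration.integrable_bound[OF B])
      show "AE \<zeta> in lborel. norm ((packet \<xi> \<zeta>)\<^sup>2 / jap \<zeta>) \<le> norm (?B \<zeta>)"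
      proof (rule AE_I2)
        fix \<zeta> show "norm ((packet \<xi> \<zeta>)\<^sup>2 / jap \<zeta>) \<le> norm (?B \<zeta>)"
          using le[of \<zeta>] jap_pos[of \<zeta>] by (simp add: abs_of_pos)
      qed
    qed measurable
    have "(LINT \<zeta>|lborel. (packet \<xi> \<zeta>)\<^sup>2 / jap \<zeta>) \<le> (LINT \<zeta>|lborel. ?B \<zeta>)" by (rule integral_mono[OF i B le])
    also have "\<dots> = 2 / S + (4 / S\<^sup>2) * (LINT \<zeta>|lborel. (norm (\<zeta> - \<xi>))\<^sup>2 * (packet \<xi> \<zeta>)\<^sup>2)"
      using C(2)[of \<xi>] packet_square_integrable[of \<xi>] by (simp add: packet_square_integral)
    also have "\<dots> \<le> 2 / S + (4 / S\<^sup>2) * (C * S)" unfolding S_def by (intro add_left_mono mult_left_mono C) auto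
    also have "\<dots> = (2 + 4 * C) / S" using S by (simp add: power2_eq_square field_simps)
    finally show "(LINT \<zeta>|lborel. (packet \<xi> \<zeta>)\<^sup>2 / jap \<zeta>) \<le> (2 + 4 * C) / jap \<xi>" by (simp add: S_def)
  qed (use C in auto)
qed

text \<open>The form of the amplitude operator \<open>r x \<xi> \<eta>\<close> with the spatial cut-off \<open>g\<close>, on the Fourier side;
  its argument is \<open>q = ((\<xi>, \<eta>), x)\<close>.\<close>

definition amp_weight :: "(real^'n::finite \<Rightarrow> real) \<Rightarrow> (real^'n \<Rightarrow> complex) \<Rightarrow> (real^'n \<Rightarrow> complex) \<Rightarrow>
    ((real^'n) \<times> (real^'n)) \<times> (real^'n) \<Rightarrow> complex" where
  "amp_weight g f h q = wave_cnj (snd q) ((snd (fst q) - fst (fst q))) * complex_of_real (g (snd q))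
     * (f (fst (fst q)) * cnj (h (snd (fst q))))"

text \<open>With the spatial factor and both frequency functions integrable, the integral over
  \<open>((\<xi>, \<eta>), x)\<close> converges absolutely for every bounded measurable amplitude.
  The proof lives on the freedom to choose which variable is integrated innermost.\<close>

locale wave_data =
  fixes g :: "real^'n::finite \<Rightarrow> real" and f h :: "real^'n \<Rightarrow> complex"
  assumes g: "continuous_on UNIV g" "integrable lborel g"
    and f: "continuous_on UNIV f" "integrable lborel f"
    and h: "continuous_on UNIV h" "integrable lborel h"
begin

lemma meas [measurable]: "g \<in> borel_measurable borel" "f \<in> borel_measurable borel" "h \<in> borel_measurable borel"
  using g f h by (auto intro: borel_measurable_continuous_onI)

lemma cnj_meas [measurable]: "(\<lambda>x. cnj (h x)) \<in> borel_measurable borel"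
  by (intro borel_measurable_continuous_onI continuous_intros h)

lemma weight_meas [measurable]: "amp_weight g f h \<in> borel_measurable borel"
  unfolding amp_weight_def[abs_def]
  by (intro borel_measurable_continuous_onI continuous_intros continuous_on_compose2[OF g(1)]
      continuous_on_compose2[OF f(1)] continuous_on_compose2[OF h(1)]) auto

lemma fh_integrable: "integrable lborel (\<lambda>p. f (fst p) * cnj (h (snd p)))"
proof -
  have "integrable (lborel \<Otimes>\<^sub>M lborel) (\<lambda>(x, y). f x * cnj (h y))"
  proof (rule integrable_pair_lborel_mult[where g = "\<lambda>x. norm (f x)" and h = "\<lambda>x. norm (h x)"])
    show "(\<lambda>(x, y). f x * cnj (h y)) \<in> borel_measurable borel" by (simp add: borel_prod[symmetric])
  qed (use f h in \<open>auto simp: norm_mult\<close>)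
  then show ?thesis by (simp add: integrable_lborel_prod_iff case_prod_beta')
qed

lemma weight_integrable: "integrable lborel (amp_weight g f h)"
proof -
  have "integrable (lborel \<Otimes>\<^sub>M lborel) (\<lambda>(p, x). amp_weight g f h (p, x))"
  proof (rule integrable_pair_lborel_mult[where g = "\<lambda>p. norm (f (fst p) * cnj (h (snd p)))" and h = "\<lambda>x. norm (g x)"])
    show "norm (amp_weight g f h (p, x)) \<le> norm (f (fst p) * cnj (h (snd p))) * norm (g x)" for p x
      by (simp add: amp_weight_def norm_mult)
  qed (use fh_integrable g in auto)
  then show ?thesis by (simp add: integrable_lborel_prod_iff)
qed

lemma amp_integrable:
  assumes "r \<in> borel_measurable borel" "\<And>q. norm (r q) \<le> R"
  shows "integrable lborel (\<lambda>q. amp_weight g f h q * r q)"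
proof (rule Bochner_Integration.integrable_bound[OF integrable_mult_right[OF integrable_norm[OF weight_integrable], of R]])
  have R: "R \<ge> 0" using assms(2)[of undefined] norm_ge_zero order.trans by blast
  show "(\<lambda>q. amp_weight g f h q * r q) \<in> borel_measurable lborel" using assms(1) by measurable
  show "AE q in lborel. norm (amp_weight g f h q * r q) \<le> norm (R * norm (amp_weight g f h q))"
    using assms(2) R by (auto simp: norm_mult mult.commute[of R] intro!: mult_left_mono)
qed

text \<open>Taking the \<open>x\<close>-integral innermost exposes the kernel in the two frequencies
  on which Schur's test operates.\<close>

lemma amp_integral_kernel:
  assumes "r \<in> borel_measurable borel" "\<And>q. norm (r q) \<le> R"
  shows "(LINT q|lborel. amp_weight g f h q * r q) = (LINT p|lborel. f (fst p) * cnj (h (snd p)) *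
     (LINT x|lborel. wave_cnj x (snd p - fst p) * complex_of_real (g x) * r (p, x)))"
  unfolding integral_lborel_prod(1)[OF amp_integrable[OF assms]]
  by (simp add: amp_weight_def mult_ac flip: integral_mult_right_zero)

text \<open>Taking the frequency integrals innermost, a factorised amplitude leaves an integral over
  \<open>x\<close> of a product of two functions of \<open>x\<close>. Forms of operators are
  recognised in this shape, and positivity pointwise in \<open>x\<close> can be used in it.\<close>

lemma amp_integral_product:
  assumes a: "a \<in> borel_measurable borel" "\<And>q. norm (a q) \<le> R" and b: "b \<in> borel_measurable borel" "\<And>q. norm (b q) \<le> R"
  shows "(LINT q|lborel. amp_weight g f h q * (a (snd q, fst (fst q)) * cnj (b (snd q, snd (fst q))))) =
    (LINT x|lborel. complex_of_real (g x) * ((LINT \<xi>|lborel. wave x \<xi> * a (x, \<xi>) * f \<xi>)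
        * cnj (LINT \<eta>|lborel. wave x \<eta> * b (x, \<eta>) * h \<eta>)))"
    and "integrable lborel (\<lambda>x. complex_of_real (g x) * ((LINT \<xi>|lborel. wave x \<xi> * a (x, \<xi>) * f \<xi>)
        * cnj (LINT \<eta>|lborel. wave x \<eta> * b (x, \<eta>) * h \<eta>)))"
proof -
  have [measurable]: "a \<in> borel_measurable (borel \<Otimes>\<^sub>M borel)" "b \<in> borel_measurable (borel \<Otimes>\<^sub>M borel)"
    using a(1) b(1) by (simp_all add: borel_prod)
  have cnjb [measurable]: "(\<lambda>q. cnj (b q)) \<in> borel_measurable (borel \<Otimes>\<^sub>M borel)"
    by (rule measurable_compose[of b _ borel cnj]) (auto intro!: borel_measurable_continuous_onI continuous_intros)
  let ?r = "\<lambda>q. a (snd q, fst (fst q)) * cnj (b (snd q, snd (fst q)))"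
  have R: "R \<ge> 0" using a(2)[of undefined] norm_ge_zero order.trans by blast
  have r: "?r \<in> borel_measurable borel" "\<And>q. norm (?r q) \<le> R * R"
    using a(2) b(2) R by (auto simp: norm_mult borel_prod[symmetric] intro!: mult_mono)
  have ia: "integrable lborel (\<lambda>\<xi>. wave x \<xi> * a (x, \<xi>) * f \<xi>)" for x
    by (rule Bochner_Integration.integrable_bound[OF integrable_mult_right[OF integrable_norm[OF f(2)], of R]])
      (use a(2) R in \<open>auto simp: norm_mult intro!: mult_right_mono\<close>)
  have ib: "integrable lborel (\<lambda>\<xi>. wave x \<xi> * b (x, \<xi>) * h \<xi>)" for x
    by (rule Bochner_Integration.integrable_bound[OF integrable_mult_right[OF integrable_norm[OF h(2)], of R]])
      (use b(2) R in \<open>auto simp: norm_mult intro!: mult_right_mono\<close>)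
  have inner: "(LINT p|lborel. amp_weight g f h (p, x) * ?r (p, x)) =
     complex_of_real (g x) * ((LINT \<xi>|lborel. wave x \<xi> * a (x, \<xi>) * f \<xi>)
        * cnj (LINT \<eta>|lborel. wave x \<eta> * b (x, \<eta>) * h \<eta>))" for x
  proof -
    let ?a = "\<lambda>\<xi>. wave x \<xi> * a (x, \<xi>) * f \<xi>"
    let ?b = "\<lambda>\<xi>. wave x \<xi> * b (x, \<xi>) * h \<xi>"
    have eq: "amp_weight g f h (p, x) * ?r (p, x) = complex_of_real (g x) * (?a (fst p) * cnj (?b (snd p)))" for p
    proof -
      have "wave_cnj x (snd p - fst p) = wave x (fst p) * cnj (wave x (snd p))"
        by (simp add: exp_cnj inner_diff_right exp_add[symmetric] algebra_simps)
      then show ?thesis by (simp add: amp_weight_def mult_ac)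
    qed
    have "integrable (lborel \<Otimes>\<^sub>M lborel) (\<lambda>(\<xi>, \<eta>). ?a \<xi> * cnj (?b \<eta>))"
    proof (rule integrable_pair_lborel_mult[where g = "\<lambda>x. norm (?a x)" and h = "\<lambda>x. norm (?b x)"])
      define A B where "A = ?a" and "B = (\<lambda>\<eta>. cnj (?b \<eta>))"
      have [measurable]: "A \<in> borel_measurable borel" using ia[of x] by (auto simp: A_def)
      have [measurable]: "B \<in> borel_measurable borel" unfolding B_def
        by (rule measurable_compose[of ?b _ borel cnj])
          (use ib[of x] in \<open>auto intro!: borel_measurable_continuous_onI continuous_intros\<close>)
      have "(\<lambda>(\<xi>, \<eta>). A \<xi> * B \<eta>) \<in> borel_measurable (borel \<Otimes>\<^sub>M borel)" by measurable
      then show "(\<lambda>(\<xi>, \<eta>). ?a \<xi> * cnj (?b \<eta>)) \<in> borel_measurable borel"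
        unfolding A_def B_def borel_prod .
    qed (use integrable_norm[OF ia[of x]] integrable_norm[OF ib[of x]] in \<open>simp_all add: norm_mult\<close>)
    then have i: "integrable lborel (\<lambda>p. ?a (fst p) * cnj (?b (snd p)))" by (simp add: integrable_lborel_prod_iff case_prod_beta')
    have "(LINT p|lborel. ?a (fst p) * cnj (?b (snd p))) = (LINT \<xi>|lborel. ?a \<xi> * cnj (LINT \<eta>|lborel. ?b \<eta>))"
      unfolding integral_lborel_prod(1)[OF i] fst_conv snd_conv integral_mult_right_zero Bochner_Integration.integral_cnj ..
    also have "\<dots> = (LINT \<xi>|lborel. ?a \<xi>) * cnj (LINT \<eta>|lborel. ?b \<eta>)" by (rule integral_mult_left_zero)
    finally show ?thesis unfolding eq integral_mult_right_zero by (simp only:)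
  qed
  note I = amp_integrable[OF r]
  show "(LINT q|lborel. amp_weight g f h q * ?r q) =
    (LINT x|lborel. complex_of_real (g x) * ((LINT \<xi>|lborel. wave x \<xi> * a (x, \<xi>) * f \<xi>)
        * cnj (LINT \<eta>|lborel. wave x \<eta> * b (x, \<eta>) * h \<eta>)))"
    unfolding integral_lborel_prod(2)[OF I] inner ..
  have "integrable lborel (\<lambda>x. LINT p|lborel. amp_weight g f h (p, x) * ?r (p, x))"
    using lborel_pair.integrable_snd[of "\<lambda>p x. amp_weight g f h (p, x) * ?r (p, x)"] I
    by (simp add: integrable_lborel_prod_iff case_prod_beta')
  then show "integrable lborel (\<lambda>x. complex_of_real (g x) * ((LINT \<xi>|lborel. wave x \<xi> * a (x, \<xi>) * f \<xi>)
        * cnj (LINT \<eta>|lborel. wave x \<eta> * b (x, \<eta>) * h \<eta>)))"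
    unfolding inner .
qed

text \<open>Pulls the average over \<open>\<zeta>\<close> out of the form, so that a lower bound can
  be proved for one \<open>\<zeta>\<close> at a time.\<close>

lemma amp_integral_swap:
  assumes s: "(\<lambda>(\<zeta>, q). s \<zeta> q) \<in> borel_measurable borel" "\<And>\<zeta> q. norm (s \<zeta> q) \<le> S \<zeta> q" "\<And>q. integrable lborel (\<lambda>\<zeta>. S \<zeta> q)" "\<And>q. (LINT \<zeta>|lborel. S \<zeta> q) \<le> R"
  shows "(LINT q|lborel. amp_weight g f h q * (LINT \<zeta>|lborel. s (\<zeta>::real^'n) q)) = (LINT \<zeta>|lborel. LINT q|lborel. amp_weight g f h q * s \<zeta> q)"
    and "integrable lborel (\<lambda>\<zeta>. LINT q|lborel. amp_weight g f h q * s \<zeta> q)"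
proof -
  have [measurable]: "(\<lambda>(\<zeta>, q). s \<zeta> q) \<in> borel_measurable (borel \<Otimes>\<^sub>M borel)" using s(1) by (simp add: borel_prod)
  have "integrable (lborel \<Otimes>\<^sub>M lborel) (\<lambda>(q, \<zeta>). amp_weight g f h q * s \<zeta> q)"
  proof (rule integrable_pair_lborel[where g = "\<lambda>q \<zeta>. norm (amp_weight g f h q) * S \<zeta> q" and G = "\<lambda>q. norm (amp_weight g f h q) * R"])
    show "(\<lambda>(q, \<zeta>). amp_weight g f h q * s \<zeta> q) \<in> borel_measurable borel"
    proof -
      have "(\<lambda>p. (\<lambda>(\<zeta>, q). s \<zeta> q) (snd p, fst p)) \<in> borel_measurable (borel \<Otimes>\<^sub>M borel)" by measurable
      then have s': "(\<lambda>p. s (snd p) (fst p)) \<in> borel_measurable borel" by (simp add: borel_prod)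
      have "(\<lambda>p::(((real^'n) \<times> (real^'n)) \<times> (real^'n)) \<times> (real^'n). amp_weight g f h (fst p)) \<in> borel_measurable borel"
        by (rule measurable_compose[OF _ weight_meas]) (intro borel_measurable_continuous_onI continuous_intros)
      then show ?thesis using s' by (simp add: case_prod_beta')
    qed
    show "norm (amp_weight g f h q * s \<zeta> q) \<le> norm (amp_weight g f h q) * S \<zeta> q" for q \<zeta>
      by (simp add: norm_mult s(2) mult_left_mono)
    show "integrable lborel (\<lambda>\<zeta>. norm (amp_weight g f h q) * S \<zeta> q)" for q by (intro integrable_mult_right s)
    show "(LINT \<zeta>|lborel. norm (amp_weight g f h q) * S \<zeta> q) \<le> norm (amp_weight g f h q) * R" for q
      unfolding integral_mult_right_zero by (intro mult_left_mono s) simp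
    show "integrable lborel (\<lambda>q. norm (amp_weight g f h q) * R)" by (intro integrable_mult_left integrable_norm weight_integrable)
  qed
  from lborel_pair.Fubini_integral[OF this] lborel_pair.integrable_snd[OF this]
  show "(LINT q|lborel. amp_weight g f h q * (LINT \<zeta>|lborel. s (\<zeta>::real^'n) q)) = (LINT \<zeta>|lborel. LINT q|lborel. amp_weight g f h q * s \<zeta> q)"
    and "integrable lborel (\<lambda>\<zeta>. LINT q|lborel. amp_weight g f h q * s \<zeta> q)"
    by simp_all
qed

end

lemma weighted_square_integrable:
  fixes w :: "real^'n::finite \<Rightarrow> complex"
  assumes "continuous_on UNIV w" "integrable lborel w" "\<And>x. norm (w x) \<le> B"
  shows "integrable lborel (\<lambda>\<xi>. (norm (w \<xi>))\<^sup>2)" "integrable lborel (\<lambda>\<xi>. (norm (w \<xi>))\<^sup>2 / jap \<xi>)"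
proof -
  have [measurable]: "w \<in> borel_measurable borel" using assms(1) by (rule borel_measurable_continuous_onI)
  have B: "B \<ge> 0" using assms(3)[of 0] norm_ge_zero order.trans by blast
  have le: "(norm (w \<xi>))\<^sup>2 \<le> B * norm (w \<xi>)" for \<xi> unfolding power2_eq_square by (intro mult_right_mono assms) simp
  show i: "integrable lborel (\<lambda>\<xi>. (norm (w \<xi>))\<^sup>2)"
    by (rule Bochner_Integration.integrable_bound[OF integrable_mult_right[OF integrable_norm[OF assms(2)], of B]])
      (use le B in \<open>auto simp: abs_mult\<close>)
  show "integrable lborel (\<lambda>\<xi>. (norm (w \<xi>))\<^sup>2 / jap \<xi>)"
  proof (rule Bochner_Integration.integrable_bound[OF i])
    show "AE \<xi> in lborel. norm ((norm (w \<xi>))\<^sup>2 / jap \<xi>) \<le> norm ((norm (w \<xi>))\<^sup>2)"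
    proof (rule AE_I2)
      fix \<xi> show "norm ((norm (w \<xi>))\<^sup>2 / jap \<xi>) \<le> norm ((norm (w \<xi>))\<^sup>2)"
        using jap_ge_1[of \<xi>] by (simp add: divide_le_eq mult_le_cancel_left1)
    qed
  qed measurable
qed

lemma packet_prod_integral_le_1: "(LINT \<zeta>|lborel. packet \<xi> \<zeta> * packet \<eta> \<zeta>) \<le> 1"
proof -
  have "(LINT \<zeta>|lborel. packet \<xi> \<zeta> * packet \<eta> \<zeta>) \<le> (LINT \<zeta>|lborel. (1/2) * ((packet \<xi> \<zeta>)\<^sup>2 + (packet \<eta> \<zeta>)\<^sup>2))"
  proof (rule integral_mono[OF packet_prod_integrable])
    show "integrable lborel (\<lambda>\<zeta>. (1/2) * ((packet \<xi> \<zeta>)\<^sup>2 + (packet \<eta> \<zeta>)\<^sup>2))"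
      by (intro integrable_mult_right Bochner_Integration.integrable_add packet_square_integrable)
    show "packet \<xi> \<zeta> * packet \<eta> \<zeta> \<le> (1/2) * ((packet \<xi> \<zeta>)\<^sup>2 + (packet \<eta> \<zeta>)\<^sup>2)" for \<zeta>
      using sum_squares_bound[of "packet \<xi> \<zeta>" "packet \<eta> \<zeta>"] by simp
  qed
  also have "\<dots> = 1"
    unfolding integral_mult_right_zero Bochner_Integration.integral_add[OF packet_square_integrable packet_square_integrable] packet_square_integral
    by simp
  finally show ?thesis .
qed

lemma average_norm_le:
  assumes "symbol_bound l 0 K a" "symbol_bound l 0 K b"
  shows "norm ((a (x, \<xi>) + b (y, \<eta>)) / 2) \<le> K"
proof -
  have "norm (a (x, \<xi>) + b (y, \<eta>)) \<le> K + K"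
    using symbol_bound_le[OF assms(1), of x \<xi>] symbol_bound_le[OF assms(2), of y \<eta>] by (intro norm_triangle_le) simp
  then show ?thesis by (simp add: norm_divide)
qed

lemma average_packet_norm_le:
  assumes "symbol_bound l 0 K a" "symbol_bound l 0 K b"
  shows "norm ((a (x, \<zeta>) + b (x, \<zeta>)) / 2 * complex_of_real (packet \<xi> \<zeta> * packet \<eta> \<zeta>)) \<le> K * (packet \<xi> \<zeta> * packet \<eta> \<zeta>)"
proof -
  have pq: "packet \<xi> \<zeta> * packet \<eta> \<zeta> \<ge> 0" using packet_nonneg[of \<xi> \<zeta>] packet_nonneg[of \<eta> \<zeta>] by simp
  show ?thesis
    unfolding norm_mult[of "_ / 2"] norm_of_real abs_of_nonneg[OF pq] by (intro mult_right_mono average_norm_le[OF assms] pq)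
qed

lemma average_packet_measurable:
  fixes a b :: "'n::finite symbol"
  assumes "symbol_bound l 0 K a" "symbol_bound l 0 K b"
  shows "(\<lambda>(\<zeta>, q). (a (snd q, \<zeta>) + b (snd q, \<zeta>)) / 2 * complex_of_real (packet (fst (fst q)) \<zeta> * packet (snd (fst q)) \<zeta>)) \<in> borel_measurable borel"
proof -
  have "continuous_on UNIV (\<lambda>p. (a (snd (snd p), fst p) + b (snd (snd p), fst p)) / 2 * complex_of_real (packet (fst (fst (snd p))) (fst p) * packet (snd (fst (snd p))) (fst p)))"
    by (intro continuous_intros symbol_bound_continuous_comp[OF assms(1)] symbol_bound_continuous_comp[OF assms(2)]) simp
  then show ?thesis unfolding case_prod_beta' by (rule borel_measurable_continuous_onI)
qed

lemma borel_measurable_integral_param: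
  fixes f :: "'a::euclidean_space \<Rightarrow> 'b::euclidean_space \<Rightarrow> 'c::{banach, second_countable_topology}"
  assumes "case_prod f \<in> borel_measurable borel"
  shows "(\<lambda>x. LINT y|lborel. f x y) \<in> borel_measurable borel"
proof (rule lborel.borel_measurable_lebesgue_integral)
  have "sets (borel \<Otimes>\<^sub>M lborel :: ('a \<times> 'b) measure) = sets (borel \<Otimes>\<^sub>M borel)" by (rule sets_pair_measure_cong) simp_all
  then have "(borel_measurable (borel \<Otimes>\<^sub>M lborel) :: ('a \<times> 'b \<Rightarrow> 'c) set) = borel_measurable (borel \<Otimes>\<^sub>M borel)"
    by (rule measurable_cong_sets) simp
  then show "case_prod f \<in> borel_measurable (borel \<Otimes>\<^sub>M lborel)" using assms by (simp only: borel_prod)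
qed

lemma symmetrized_error_measurable:
  fixes a b :: "'n::finite symbol"
  assumes "symbol_bound l 0 K a" "symbol_bound l 0 K b"
  shows "(\<lambda>q. LINT \<zeta>|lborel. (a (snd q, \<zeta>) + b (snd q, \<zeta>)) / 2 * complex_of_real (packet (fst (fst q)) \<zeta> * packet (snd (fst q)) \<zeta>)) \<in> borel_measurable borel"
    and "(\<lambda>q. symmetrized_error a b (fst (fst q)) (snd (fst q)) (snd q)) \<in> borel_measurable borel"
proof -
  let ?f = "\<lambda>q \<zeta>. (a (snd q, \<zeta>) + b (snd q, \<zeta>)) / 2 * complex_of_real (packet (fst (fst q)) \<zeta> * packet (snd (fst q)) \<zeta>)"
  have "continuous_on UNIV (\<lambda>p. ?f (fst p) (snd p))"
    by (intro continuous_intros symbol_bound_continuous_comp[OF assms(1)] symbol_bound_continuous_comp[OF assms(2)]) simp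
  then have "(\<lambda>(q, \<zeta>). ?f q \<zeta>) \<in> borel_measurable borel"
    unfolding case_prod_beta' by (rule borel_measurable_continuous_onI)
  then show m: "(\<lambda>q. LINT \<zeta>|lborel. ?f q \<zeta>) \<in> borel_measurable borel"
    by (rule borel_measurable_integral_param)
  have "(\<lambda>q. (a (snd q, fst (fst q)) + b (snd q, snd (fst q))) / 2) \<in> borel_measurable borel"
    by (intro borel_measurable_continuous_onI continuous_intros symbol_bound_continuous_comp[OF assms(1)] symbol_bound_continuous_comp[OF assms(2)]) simp
  then show "(\<lambda>q. symmetrized_error a b (fst (fst q)) (snd (fst q)) (snd q)) \<in> borel_measurable borel"
    unfolding symmetrized_error_def using m by (rule borel_measurable_diff)
qed

lemma average_integral_norm_le:
  fixes a b :: "'n::finite symbol"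
  assumes "symbol_bound l 0 K a" "symbol_bound l 0 K b"
  shows "norm (LINT \<zeta>|lborel. (a (x, \<zeta>) + b (x, \<zeta>)) / 2 * complex_of_real (packet \<xi> \<zeta> * packet \<eta> \<zeta>)) \<le> K"
proof -
  have K: "K \<ge> 0" by (rule symbol_bound_nonneg[OF assms(1)])
  have "norm (LINT \<zeta>|lborel. (a (x, \<zeta>) + b (x, \<zeta>)) / 2 * complex_of_real (packet \<xi> \<zeta> * packet \<eta> \<zeta>)) \<le> (LINT \<zeta>|lborel. norm ((a (x, \<zeta>) + b (x, \<zeta>)) / 2 * complex_of_real (packet \<xi> \<zeta> * packet \<eta> \<zeta>)))"
    by (rule integral_norm_bound)
  also have "\<dots> \<le> (LINT \<zeta>|lborel. K * (packet \<xi> \<zeta> * packet \<eta> \<zeta>))"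
    by (rule Bochner_Integration.integral_mono'[OF integrable_mult_right[OF packet_prod_integrable] average_packet_norm_le[OF assms]])
      (use K packet_nonneg[of \<xi>] packet_nonneg[of \<eta>] in simp)
  also have "\<dots> \<le> K * 1" unfolding integral_mult_right_zero by (intro mult_left_mono packet_prod_integral_le_1 K)
  finally show ?thesis by simp
qed

text \<open>The real part of the form belongs to the Hermitian amplitude, the mean of
  \<open>s i j\<close> at \<open>\<xi>\<close> and of the conjugate of \<open>s j i\<close> at
  \<open>\<eta>\<close>. Its difference from the packet average is left to Schur's test. In the
  packet average the symbol is evaluated at \<open>\<zeta>\<close>, so for each
  \<open>\<zeta>\<close> the integrand is the quadratic form of \<open>s (x, \<zeta>)\<close> on a
  vector depending on \<open>x\<close>, and the hypothesis applies to it directly.\<close>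

lemma localized_garding:
  "\<exists>C\<ge>0. \<forall>\<alpha>>0. \<forall>(k::real^'n::finite) K M (s :: 'm::finite \<Rightarrow> 'm \<Rightarrow> 'n symbol) w.
     (\<forall>i j. symbol_bound (2 * CARD('n) + 5) 0 K (s i j)) \<longrightarrow> 0 \<le> M \<longrightarrow>
     (\<forall>x \<zeta> z. - (M / jap \<zeta>) * (\<Sum>i\<in>UNIV. (norm (z i))\<^sup>2) \<le> Re (\<Sum>i\<in>UNIV. \<Sum>j\<in>UNIV. s i j (x, \<zeta>) * z j * cnj (z i))) \<longrightarrow>
     (\<forall>i. continuous_on UNIV (w i) \<and> integrable lborel (w i) \<and> (\<exists>B. \<forall>x. norm (w i x) \<le> B)) \<longrightarrow>
     - (C * (K + M) * (1 + sqrt \<alpha>) ^ (2 * CARD('n) + 3) * (1 + (1 / sqrt \<alpha>) ^ CARD('n)) * (\<Sum>i\<in>UNIV. LINT \<xi>|lborel. (norm (w i \<xi>))\<^sup>2 / jap \<xi>))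
      \<le> Re (\<Sum>i\<in>UNIV. \<Sum>j\<in>UNIV. LINT x|lborel. complex_of_real (exp (- \<alpha> * (norm (x - k))\<^sup>2)) *
            ((LINT \<xi>|lborel. wave x \<xi> * s i j (x, \<xi>) * w j \<xi>) * cnj (LINT \<eta>|lborel. wave x \<eta> * w i \<eta>)))"
proof -
  define n where "n = CARD('n)"
  \<comment> \<open>Schur's test takes \<open>2 * n + 1\<close> of these powers; the remaining two
    cancel the factor \<open>(jap (\<xi> - \<eta>))\<^sup>2\<close> of the error estimate.\<close>
  define N where "N = 2 * n + 3"
  obtain C1 where C1: "C1 \<ge> 0" "\<forall>\<alpha>>0. \<forall>k \<theta> (\<xi>::real^'n::finite) \<eta> K a b. symbol_bound (N + 2) 0 K a \<longrightarrow> symbol_bound (N + 2) 0 K b \<longrightarrow>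
     jap \<theta> ^ N * norm (LINT x|lborel. wave_cnj x \<theta> * complex_of_real (exp (- \<alpha> * (norm (x - k))\<^sup>2)) * symmetrized_error a b \<xi> \<eta> x)
       \<le> C1 * K * (jap (\<xi> - \<eta>))\<^sup>2 * (1 / jap \<xi> + 1 / jap \<eta>) * (1 + sqrt \<alpha>) ^ N * (1 / sqrt \<alpha>) ^ CARD('n)"
    using symmetrized_error_decay[of N, where 'n='n] by (elim exE conjE) (rule that)
  obtain C2 where C2: "C2 \<ge> 0" "\<And>\<xi>::real^'n. integrable lborel (\<lambda>\<zeta>. (packet \<xi> \<zeta>)\<^sup>2 / jap \<zeta>)"
     "\<And>\<xi>::real^'n. (LINT \<zeta>|lborel. (packet \<xi> \<zeta>)\<^sup>2 / jap \<zeta>) \<le> C2 / jap \<xi>"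
    using packet_weight[where 'a="real^'n"] by blast
  define c where "c = (LINT x::real^'n|lborel. 1 / jap x ^ (2 * CARD('n)))"
  have c: "c \<ge> 0" unfolding c_def by (simp add: less_imp_le[OF jap_pos])
  define m where "m = real CARD('m)"
  have m: "m \<ge> 0" by (simp add: m_def)
  define C where "C = 4 * m * c * C1 + (2 * pi) ^ n * C2"
  have C: "C \<ge> 0" using m c C1 C2 by (simp add: C_def)
  show ?thesis
  proof (intro exI[of _ C] conjI allI impI C)
    fix \<alpha> :: real and k :: "real^'n" and K M and s :: "'m \<Rightarrow> 'm \<Rightarrow> 'n symbol" and w :: "'m \<Rightarrow> real^'n \<Rightarrow> complex"
    assume \<alpha>: "\<alpha> > 0" and s': "\<forall>i j. symbol_bound (2 * CARD('n) + 5) 0 K (s i j)" and M: "0 \<le> M"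
      and pos: "\<forall>x \<zeta> z. - (M / jap \<zeta>) * (\<Sum>i\<in>UNIV. (norm (z i))\<^sup>2) \<le> Re (\<Sum>i\<in>UNIV. \<Sum>j\<in>UNIV. s i j (x, \<zeta>) * z j * cnj (z i))"
      and w: "\<forall>i. continuous_on UNIV (w i) \<and> integrable lborel (w i) \<and> (\<exists>B. \<forall>x. norm (w i x) \<le> B)"
    have "N + 2 = 2 * CARD('n) + 5" by (simp add: N_def n_def)
    then have s: "symbol_bound (N + 2) 0 K (s i j)" for i j using s' by (simp only:)
    have K: "K \<ge> 0" by (rule symbol_bound_nonneg[OF s])
    have w1: "continuous_on UNIV (w i)" "integrable lborel (w i)" for i using w by auto
    obtain B where B: "\<And>i x. norm (w i x) \<le> B i" using w by metis
    \<comment> \<open>Entries of the adjoint symbol: conjugating the form of the entry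
      \<open>(j, i)\<close> moves its symbol from the first frequency to the second and produces
      \<open>t i j\<close>.\<close>
    define t where "t = (\<lambda>i j z. cnj (s j i z))"
    have t: "symbol_bound (N + 2) 0 K (t i j)" for i j
      using symbol_bound_bounded_linear[OF s[of j i] bounded_linear_cnj, of 1] by (simp add: t_def)
    define g where "g = (\<lambda>x. exp (- \<alpha> * (norm (x - k))\<^sup>2))"
    have g: "continuous_on UNIV g" "integrable lborel g" "\<And>x. 0 \<le> g x" "\<And>x. g x \<le> 1"
      using gaussian_shift_integrable[OF \<alpha>, of k] \<alpha> by (auto simp: g_def intro!: continuous_intros)
    have wd: "wave_data g (w j) (w i)" for i j by standard (use g w1 in auto)
    note sq = weighted_square_integrable[OF w1 B]
    define S where "S = (\<lambda>i. LINT \<xi>|lborel. (norm (w i \<xi>))\<^sup>2 / jap \<xi>)"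
    have S0: "S i \<ge> 0" for i unfolding S_def by (simp add: less_imp_le[OF jap_pos])
    define Y where "Y = (\<lambda>i j. LINT x|lborel. complex_of_real (g x) *
            ((LINT \<xi>|lborel. wave x \<xi> * s i j (x, \<xi>) * w j \<xi>) * cnj (LINT \<eta>|lborel. wave x \<eta> * w i \<eta>)))"
    define E where "E = (\<lambda>i j. LINT q|lborel. amp_weight g (w j) (w i) q * symmetrized_error (s i j) (t i j) (fst (fst q)) (snd (fst q)) (snd q))"
    let ?av = "\<lambda>i j \<zeta> q. (s i j (snd q, \<zeta>) + t i j (snd q, \<zeta>)) / 2 * complex_of_real (packet (fst (fst q)) \<zeta> * packet (snd (fst q)) \<zeta>)"
    define P where "P = (\<lambda>i j \<zeta>. LINT q|lborel. amp_weight g (w j) (w i) q * ?av i j \<zeta> q)"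

    have sm: "s i j \<in> borel_measurable borel" "norm (s i j q) \<le> K" for i j q
      using symbol_bound_continuous[OF s[of i j]] symbol_bound_le[OF s[of i j], of "fst q" "snd q"] by (auto intro: borel_measurable_continuous_onI)
    \<comment> \<open>\<open>amp_integral_product\<close> has one bound for both factors;
      \<open>max K 1\<close> serves the symbol and the constant amplitude 1.\<close>
    have K1: "K \<le> max K 1" "1 \<le> max K 1" by auto
    have Y1: "Y i j = (LINT q|lborel. amp_weight g (w j) (w i) q * s i j (snd q, fst (fst q)))" for i j
      using wave_data.amp_integral_product(1)[OF wd[of j i], of "s i j" "max K 1" "\<lambda>_. 1"] sm[of i j] order.trans[OF sm(2)[of i j] K1(1)]
      by (simp add: Y_def)
    have Y2: "cnj (Y j i) = (LINT q|lborel. amp_weight g (w j) (w i) q * t i j (snd q, snd (fst q)))" for i j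
    proof -
      have "(LINT q|lborel. amp_weight g (w j) (w i) q * (1 * cnj (s j i (snd q, snd (fst q))))) =
         (LINT x|lborel. complex_of_real (g x) * ((LINT \<xi>|lborel. wave x \<xi> * 1 * w j \<xi>)
        * cnj (LINT \<eta>|lborel. wave x \<eta> * s j i (x, \<eta>) * w i \<eta>)))"
        using wave_data.amp_integral_product(1)[OF wd[of j i], of "\<lambda>_. 1" "max K 1" "s j i"] sm[of j i] order.trans[OF sm(2)[of j i] K1(1)] by simp
      also have "\<dots> = cnj (Y j i)"
        unfolding Y_def by (subst Bochner_Integration.integral_cnj[symmetric]) (simp add: mult.commute)
      finally show ?thesis by (simp add: t_def)
    qed
    have amp: "integrable lborel (\<lambda>q. amp_weight g (w j) (w i) q * s i j (snd q, fst (fst q)))"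
      "integrable lborel (\<lambda>q. amp_weight g (w j) (w i) q * t i j (snd q, snd (fst q)))" for i j
    proof -
      have 1: "(\<lambda>q::((real^'n) \<times> (real^'n)) \<times> (real^'n). s i j (snd q, fst (fst q))) \<in> borel_measurable borel"
        "(\<lambda>q::((real^'n) \<times> (real^'n)) \<times> (real^'n). t i j (snd q, snd (fst q))) \<in> borel_measurable borel"
        by (intro borel_measurable_continuous_onI symbol_bound_continuous_comp[OF s] symbol_bound_continuous_comp[OF t] continuous_intros)+
      have 2: "norm (s i j (snd q, fst (fst q))) \<le> K" "norm (t i j (snd q, snd (fst q))) \<le> K" for q :: "((real^'n) \<times> (real^'n)) \<times> (real^'n)"
        using symbol_bound_le[OF s[of i j]] symbol_bound_le[OF t[of i j]] by simp_all
      show "integrable lborel (\<lambda>q. amp_weight g (w j) (w i) q * s i j (snd q, fst (fst q)))"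
        by (rule wave_data.amp_integrable[OF wd 1(1) 2(1)])
      show "integrable lborel (\<lambda>q. amp_weight g (w j) (w i) q * t i j (snd q, snd (fst q)))"
        by (rule wave_data.amp_integrable[OF wd 1(2) 2(2)])
    qed
    have swap: "(LINT q|lborel. amp_weight g (w j) (w i) q * (LINT \<zeta>|lborel. ?av i j \<zeta> q)) = (LINT \<zeta>|lborel. P i j \<zeta>)"
      "integrable lborel (P i j)" for i j
      unfolding P_def
      by (rule wave_data.amp_integral_swap[OF wd average_packet_measurable[OF s t] average_packet_norm_le[OF s t], where R = K];
        use packet_prod_integral_le_1 K in \<open>auto intro!: integrable_mult_right packet_prod_integrable mult_left_le\<close>)+
    have err_m: "(\<lambda>q. symmetrized_error (s i j) (t i j) (fst (fst q)) (snd (fst q)) (snd q)) \<in> borel_measurable borel" for i j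
      by (rule symmetrized_error_measurable[OF s t])
    have err_b: "norm (symmetrized_error (s i j) (t i j) \<xi> \<eta> x) \<le> 2 * K" for i j \<xi> \<eta> x
      unfolding symmetrized_error_def
      by (rule order.trans[OF norm_triangle_ineq4]) (use average_norm_le[OF s[of i j] t[of i j], of x \<xi> x \<eta>] average_integral_norm_le[OF s[of i j] t[of i j], of x \<xi> \<eta>] in linarith)
    have I_err: "integrable lborel (\<lambda>q. amp_weight g (w j) (w i) q * symmetrized_error (s i j) (t i j) (fst (fst q)) (snd (fst q)) (snd q))" for i j
      by (rule wave_data.amp_integrable[OF wd err_m err_b])
    have I_av: "integrable lborel (\<lambda>q. amp_weight g (w j) (w i) q * (LINT \<zeta>|lborel. ?av i j \<zeta> q))" for i j
      by (rule wave_data.amp_integrable[OF wd symmetrized_error_measurable(1)[OF s t] average_integral_norm_le[OF s t]])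
    have dec: "(1/2) * (Y i j + cnj (Y j i)) = E i j + (LINT \<zeta>|lborel. P i j \<zeta>)" for i j
    proof -
      have "(1/2) * (Y i j + cnj (Y j i)) = (LINT q|lborel. (1/2) * (amp_weight g (w j) (w i) q * s i j (snd q, fst (fst q)) + amp_weight g (w j) (w i) q * t i j (snd q, snd (fst q))))"
        unfolding integral_mult_right_zero Bochner_Integration.integral_add[OF amp] Y2 unfolding Y1 ..
      also have "\<dots> = (LINT q|lborel. amp_weight g (w j) (w i) q * symmetrized_error (s i j) (t i j) (fst (fst q)) (snd (fst q)) (snd q) + amp_weight g (w j) (w i) q * (LINT \<zeta>|lborel. ?av i j \<zeta> q))"
        unfolding symmetrized_error_def by (intro Bochner_Integration.integral_cong refl) (simp add: algebra_simps add_divide_distrib)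
      also have "\<dots> = E i j + (LINT \<zeta>|lborel. P i j \<zeta>)"
        unfolding Bochner_Integration.integral_add[OF I_err I_av] swap E_def ..
      finally show ?thesis .
    qed
    have ReY: "Re (\<Sum>i\<in>UNIV. \<Sum>j\<in>UNIV. Y i j) = (\<Sum>i\<in>UNIV. \<Sum>j\<in>UNIV. Re (E i j)) + (LINT \<zeta>|lborel. Re (\<Sum>i\<in>UNIV. \<Sum>j\<in>UNIV. P i j \<zeta>))"
    proof -
      have "Re (\<Sum>i\<in>UNIV. \<Sum>j\<in>UNIV. Y j i) = Re (\<Sum>i\<in>UNIV. \<Sum>j\<in>UNIV. Y i j)" by (subst sum.swap) simp
      then have "Re (\<Sum>i\<in>UNIV. \<Sum>j\<in>UNIV. Y i j) = (\<Sum>i\<in>UNIV. \<Sum>j\<in>UNIV. Re ((1/2) * (Y i j + cnj (Y j i))))"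
        by (simp add: sum.distrib add_divide_distrib sum_divide_distrib[symmetric])
      also have "\<dots> = (\<Sum>i\<in>UNIV. \<Sum>j\<in>UNIV. Re (E i j)) + (\<Sum>i\<in>UNIV. \<Sum>j\<in>UNIV. Re (LINT \<zeta>|lborel. P i j \<zeta>))"
        unfolding dec by (simp add: sum.distrib)
      also have "(\<Sum>i\<in>UNIV. \<Sum>j\<in>UNIV. Re (LINT \<zeta>|lborel. P i j \<zeta>)) = (LINT \<zeta>|lborel. (\<Sum>i\<in>UNIV. \<Sum>j\<in>UNIV. Re (P i j \<zeta>)))"
        using swap(2) by (simp add: integral_Re)
      finally show ?thesis by simp
    qed

    define M' where "M' = C1 * K * (1 + sqrt \<alpha>) ^ N * (1 / sqrt \<alpha>) ^ CARD('n)"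
    have M': "M' \<ge> 0" using C1 K \<alpha> by (simp add: M'_def)
    have Eb: "norm (E i j) \<le> 2 * M' * c * (S j + S i)" for i j
    proof -
      let ?D = "\<lambda>p. LINT x|lborel. wave_cnj x (snd p - fst p) * complex_of_real (g x) * symmetrized_error (s i j) (t i j) (fst p) (snd p) x"
      have EE: "E i j = (LINT p|lborel. w j (fst p) * cnj (w i (snd p)) * ?D p)"
        unfolding E_def wave_data.amp_integral_kernel[OF wd err_m err_b] fst_conv snd_conv ..
      have "norm (LINT p|lborel. w j (fst p) * cnj (w i (snd p)) * ?D p) \<le> 2 * M' * (LINT x::real^'n|lborel. 1 / jap x ^ (2 * CARD('n))) * ((LINT \<xi>|lborel. (norm (w j \<xi>))\<^sup>2 / jap \<xi>) + (LINT \<xi>|lborel. (norm (w i \<xi>))\<^sup>2 / jap \<xi>))"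
      proof (rule schur_bound[OF _ _ M' _ sq(2) _ sq(2)])
        have gm: "g \<in> borel_measurable borel" using g by (auto intro: borel_measurable_continuous_onI)
        have m1: "(\<lambda>q::((real^'n) \<times> (real^'n)) \<times> (real^'n). wave_cnj (snd q) ((snd (fst q) - fst (fst q))) * complex_of_real (g (snd q))) \<in> borel_measurable borel"
          by (intro borel_measurable_continuous_onI continuous_intros continuous_on_compose2[OF g(1)]) auto
        have "(\<lambda>q. wave_cnj (snd q) ((snd (fst q) - fst (fst q))) * complex_of_real (g (snd q)) * symmetrized_error (s i j) (t i j) (fst (fst q)) (snd (fst q)) (snd q)) \<in> borel_measurable borel"
          by (rule borel_measurable_times[OF m1 err_m])
        then have "(\<lambda>(p, x). wave_cnj x (snd p - fst p) * complex_of_real (g x) * symmetrized_error (s i j) (t i j) (fst p) (snd p) x) \<in> borel_measurable borel"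
          unfolding case_prod_beta' .
        then show "?D \<in> borel_measurable borel" by (rule borel_measurable_integral_param)
        fix \<xi> \<eta> :: "real^'n"
        define J where "J = jap (\<xi> - \<eta>)"
        have J: "J > 0" "jap (\<eta> - \<xi>) = J" by (simp_all add: J_def jap_pos jap_minus(2)[of \<eta>])
        have "J\<^sup>2 * (J ^ (2 * CARD('n) + 1) * norm (?D (\<xi>, \<eta>))) = J ^ N * norm (?D (\<xi>, \<eta>))"
          by (simp add: N_def n_def power_add power2_eq_square power3_eq_cube mult_ac)
        also have "\<dots> \<le> C1 * K * J\<^sup>2 * (1 / jap \<xi> + 1 / jap \<eta>) * (1 + sqrt \<alpha>) ^ N * (1 / sqrt \<alpha>) ^ CARD('n)"
          using C1(2)[rule_format, OF \<alpha> s[of i j] t[of i j], of "\<eta> - \<xi>" k \<xi> \<eta>] by (simp only: J J_def[symmetric] g_def fst_conv snd_conv)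
        also have "\<dots> = J\<^sup>2 * (M' * (1 / jap \<xi> + 1 / jap \<eta>))" by (simp only: M'_def mult_ac)
        finally show "jap (\<xi> - \<eta>) ^ (2 * CARD('n) + 1) * norm (?D (\<xi>, \<eta>)) \<le> M' * (1 / jap \<xi> + 1 / jap \<eta>)"
          using J by (simp add: J_def)
      qed (use w1 in \<open>auto intro: borel_measurable_continuous_onI\<close>)
      then show ?thesis unfolding EE c_def S_def .
    qed

    \<comment> \<open>The cost of the negative lower bound. Plancherel at fixed
      \<open>\<zeta>\<close> leaves the squared packet with weight \<open>1 / jap \<zeta>\<close>,
      and integrating over \<open>\<zeta>\<close> turns this into \<open>1 / jap \<xi>\<close> by
      \<open>packet_weight\<close>.\<close>
    define G where "G = (\<lambda>i \<zeta>. LINT \<xi>|lborel. (packet \<xi> \<zeta>)\<^sup>2 / jap \<zeta> * (norm (w i \<xi>))\<^sup>2)"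
    have G: "integrable lborel (G i)" "(LINT \<zeta>|lborel. G i \<zeta>) \<le> C2 * S i" for i
    proof -
      have cj: "jap x \<noteq> 0" for x :: "real^'n" using jap_pos[of x] by simp
      have I: "integrable (lborel \<Otimes>\<^sub>M lborel) (\<lambda>(\<xi>, \<zeta>). (packet \<xi> \<zeta>)\<^sup>2 / jap \<zeta> * (norm (w i \<xi>))\<^sup>2)"
      proof (rule integrable_pair_lborel[where g = "\<lambda>\<xi> \<zeta>. (packet \<xi> \<zeta>)\<^sup>2 / jap \<zeta> * (norm (w i \<xi>))\<^sup>2" and G = "\<lambda>\<xi>. C2 * ((norm (w i \<xi>))\<^sup>2 / jap \<xi>)"])
        have "continuous_on UNIV (\<lambda>p. (packet (fst p) (snd p))\<^sup>2 / jap (snd p) * (norm (w i (fst p)))\<^sup>2)"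
          by (intro continuous_intros continuous_on_compose2[OF w1(1)]) (auto simp: cj)
        then show "(\<lambda>(\<xi>, \<zeta>). (packet \<xi> \<zeta>)\<^sup>2 / jap \<zeta> * (norm (w i \<xi>))\<^sup>2) \<in> borel_measurable borel"
          unfolding case_prod_beta' by (rule borel_measurable_continuous_onI)
        show "norm ((packet \<xi> \<zeta>)\<^sup>2 / jap \<zeta> * (norm (w i \<xi>))\<^sup>2) \<le> (packet \<xi> \<zeta>)\<^sup>2 / jap \<zeta> * (norm (w i \<xi>))\<^sup>2" for \<xi> \<zeta>
          using jap_pos[of \<zeta>] by (simp add: abs_mult)
        show "integrable lborel (\<lambda>\<zeta>. (packet \<xi> \<zeta>)\<^sup>2 / jap \<zeta> * (norm (w i \<xi>))\<^sup>2)" for \<xi>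
          by (intro integrable_mult_left C2)
        show "(LINT \<zeta>|lborel. (packet \<xi> \<zeta>)\<^sup>2 / jap \<zeta> * (norm (w i \<xi>))\<^sup>2) \<le> C2 * ((norm (w i \<xi>))\<^sup>2 / jap \<xi>)" for \<xi>
          unfolding integral_mult_left_zero using mult_right_mono[OF C2(3)[of \<xi>], of "(norm (w i \<xi>))\<^sup>2"] by simp
        show "integrable lborel (\<lambda>\<xi>. C2 * ((norm (w i \<xi>))\<^sup>2 / jap \<xi>))" by (intro integrable_mult_right sq)
      qed
      show "integrable lborel (G i)" unfolding G_def using lborel_pair.integrable_snd[OF I] .
      have "(LINT \<zeta>|lborel. G i \<zeta>) = (LINT \<xi>|lborel. LINT \<zeta>|lborel. (packet \<xi> \<zeta>)\<^sup>2 / jap \<zeta> * (norm (w i \<xi>))\<^sup>2)"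
        unfolding G_def by (rule lborel_pair.Fubini_integral[OF I])
      also have "\<dots> \<le> (LINT \<xi>|lborel. C2 * ((norm (w i \<xi>))\<^sup>2 / jap \<xi>))"
      proof (rule integral_mono)
        show "integrable lborel (\<lambda>\<xi>. LINT \<zeta>|lborel. (packet \<xi> \<zeta>)\<^sup>2 / jap \<zeta> * (norm (w i \<xi>))\<^sup>2)"
          using lborel_pair.integrable_fst[OF I] .
        show "integrable lborel (\<lambda>\<xi>. C2 * ((norm (w i \<xi>))\<^sup>2 / jap \<xi>))" by (intro integrable_mult_right sq)
        show "(LINT \<zeta>|lborel. (packet \<xi> \<zeta>)\<^sup>2 / jap \<zeta> * (norm (w i \<xi>))\<^sup>2) \<le> C2 * ((norm (w i \<xi>))\<^sup>2 / jap \<xi>)" for \<xi>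
          unfolding integral_mult_left_zero using mult_right_mono[OF C2(3)[of \<xi>], of "(norm (w i \<xi>))\<^sup>2"] by simp
      qed
      finally show "(LINT \<zeta>|lborel. G i \<zeta>) \<le> C2 * S i" unfolding S_def integral_mult_right_zero .
    qed

    have Pb: "- (M * (2 * pi) ^ n * (\<Sum>i\<in>UNIV. G i \<zeta>)) \<le> Re (\<Sum>i\<in>UNIV. \<Sum>j\<in>UNIV. P i j \<zeta>)" for \<zeta>
    proof -
      \<comment> \<open>Each packet is absorbed into the frequency function of its own variable, so
        the remaining amplitude depends on \<open>x\<close> and the fixed \<open>\<zeta>\<close>
        alone.\<close>
      define v where "v = (\<lambda>i \<xi>. complex_of_real (packet \<xi> \<zeta>) * w i \<xi>)"
      define \<phi> where "\<phi> = (\<lambda>i x. LINT \<xi>|lborel. wave x \<xi> * v i \<xi>)"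
      have pb: "norm (complex_of_real (packet \<xi> \<zeta>)) \<le> 1" for \<xi> using packet_nonneg[of \<xi> \<zeta>] packet_le_1[of \<xi> \<zeta>] by simp
      have vb: "norm (v i \<xi>) \<le> norm (w i \<xi>)" for i \<xi>
        unfolding v_def norm_mult using mult_right_mono[OF pb[of \<xi>], of "norm (w i \<xi>)"] by simp
      have v1: "continuous_on UNIV (v i)" for i unfolding v_def by (intro continuous_intros w1)
      have v2: "integrable lborel (v i)" for i
        by (rule Bochner_Integration.integrable_bound[OF w1(2)[of i]]) (use v1 vb in \<open>auto intro: borel_measurable_continuous_onI\<close>)
      have v3: "norm (v i \<xi>) \<le> B i" for i \<xi> using vb[of i \<xi>] B[of i \<xi>] by simp
      have \<phi>f: "\<phi> i x = fourier (v i) (- x)" for i x by (simp add: \<phi>_def fourier_def inner_commute)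
      have \<phi>2: "integrable lborel (\<lambda>x. (norm (\<phi> i x))\<^sup>2)" "(LINT x|lborel. (norm (\<phi> i x))\<^sup>2) = (2 * pi) ^ n * (LINT \<xi>|lborel. (norm (v i \<xi>))\<^sup>2)" for i
      proof -
        note pl = plancherel_integrable[OF v2[of i] v1[of i] v3] plancherel[OF v2[of i] v1[of i] v3]
        show "integrable lborel (\<lambda>x. (norm (\<phi> i x))\<^sup>2)" unfolding \<phi>f using lborel_integrable_reflect[OF pl(1), of 0] by simp
        show "(LINT x|lborel. (norm (\<phi> i x))\<^sup>2) = (2 * pi) ^ n * (LINT \<xi>|lborel. (norm (v i \<xi>))\<^sup>2)"
          unfolding \<phi>f n_def pl(2)[symmetric] using lborel_integral_reflect[of "\<lambda>\<xi>. (norm (fourier (v i) \<xi>))\<^sup>2" 0] borel_measurable_integrable[OF pl(1)] by simp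
      qed
      let ?h = "\<lambda>i j x. (s i j (x, \<zeta>) + t i j (x, \<zeta>)) / 2"
      have PP: "P i j \<zeta> = (LINT x|lborel. complex_of_real (g x) * (?h i j x * \<phi> j x * cnj (\<phi> i x)))"
        "integrable lborel (\<lambda>x. complex_of_real (g x) * (?h i j x * \<phi> j x * cnj (\<phi> i x)))" for i j
      proof -
        let ?a = "\<lambda>z. ?h i j (fst z) * complex_of_real (packet (snd z) \<zeta>)"
        let ?b = "\<lambda>z::(real^'n) \<times> (real^'n). complex_of_real (packet (snd z) \<zeta>)"
        have a: "?a \<in> borel_measurable borel" "\<And>z. norm (?a z) \<le> max K 1"
        proof -
          show "?a \<in> borel_measurable borel"
            by (intro borel_measurable_continuous_onI continuous_intros symbol_bound_continuous_comp[OF s] symbol_bound_continuous_comp[OF t]) simp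
          show "norm (?a z) \<le> max K 1" for z
            unfolding norm_mult[of "_ / 2"] using mult_mono[OF average_norm_le[OF s[of i j] t[of i j], of "fst z" \<zeta> "fst z" \<zeta>] pb[of "snd z"]] K by simp
        qed
        have b: "?b \<in> borel_measurable borel" "\<And>z. norm (?b z) \<le> max K 1"
          using pb by (auto intro!: borel_measurable_continuous_onI continuous_intros simp: le_max_iff_disj)
        have e1: "(LINT \<xi>|lborel. wave x \<xi> * ?a (x, \<xi>) * w j \<xi>) = ?h i j x * \<phi> j x" for x
          unfolding \<phi>_def v_def integral_mult_right_zero[symmetric] by (simp add: mult_ac)
        have e2: "(LINT \<xi>|lborel. wave x \<xi> * ?b (x, \<xi>) * w i \<xi>) = \<phi> i x" for x
          unfolding \<phi>_def v_def by (simp add: mult_ac)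
        note ap = wave_data.amp_integral_product[OF wd[of j i] a b, unfolded e1 e2]
        show "P i j \<zeta> = (LINT x|lborel. complex_of_real (g x) * (?h i j x * \<phi> j x * cnj (\<phi> i x)))"
          unfolding P_def ap(1)[symmetric] by (simp add: mult_ac)
        show "integrable lborel (\<lambda>x. complex_of_real (g x) * (?h i j x * \<phi> j x * cnj (\<phi> i x)))" by (rule ap(2))
      qed
      \<comment> \<open>The real part of a quadratic form sees only the Hermitian part of its
        matrix, so the hypothesis on \<open>s\<close> can be used for the mean of \<open>s\<close>
        and \<open>t\<close>.\<close>
      have herm: "Re (\<Sum>i\<in>UNIV. \<Sum>j\<in>UNIV. ?h i j x * z j * cnj (z i)) = Re (\<Sum>i\<in>UNIV. \<Sum>j\<in>UNIV. s i j (x, \<zeta>) * z j * cnj (z i))" for x z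
      proof -
        have "Re (\<Sum>i\<in>UNIV. \<Sum>j\<in>UNIV. t i j (x, \<zeta>) * z j * cnj (z i)) = Re (cnj (\<Sum>i\<in>UNIV. \<Sum>j\<in>UNIV. s j i (x, \<zeta>) * z i * cnj (z j)))"
          by (simp add: t_def mult_ac)
        also have "\<dots> = Re (\<Sum>i\<in>UNIV. \<Sum>j\<in>UNIV. s i j (x, \<zeta>) * z j * cnj (z i))"
          unfolding cnj.sel by (subst sum.swap) (rule refl)
        finally have e: "Re (\<Sum>i\<in>UNIV. \<Sum>j\<in>UNIV. t i j (x, \<zeta>) * z j * cnj (z i)) = Re (\<Sum>i\<in>UNIV. \<Sum>j\<in>UNIV. s i j (x, \<zeta>) * z j * cnj (z i))" .
        have "(\<Sum>i\<in>UNIV. \<Sum>j\<in>UNIV. ?h i j x * z j * cnj (z i)) = (1/2) * ((\<Sum>i\<in>UNIV. \<Sum>j\<in>UNIV. s i j (x, \<zeta>) * z j * cnj (z i)) + (\<Sum>i\<in>UNIV. \<Sum>j\<in>UNIV. t i j (x, \<zeta>) * z j * cnj (z i)))"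
          by (simp add: sum.distrib[symmetric] sum_distrib_left algebra_simps add_divide_distrib)
        moreover have "Re ((1/2) * (A + T)) = Re A / 2 + Re T / 2" for A T by simp
        ultimately show ?thesis by (simp only: e field_sum_of_halves)
      qed
      have L: "Re (\<Sum>i\<in>UNIV. \<Sum>j\<in>UNIV. P i j \<zeta>) = (LINT x|lborel. g x * Re (\<Sum>i\<in>UNIV. \<Sum>j\<in>UNIV. s i j (x, \<zeta>) * \<phi> j x * cnj (\<phi> i x)))"
        "integrable lborel (\<lambda>x. g x * Re (\<Sum>i\<in>UNIV. \<Sum>j\<in>UNIV. s i j (x, \<zeta>) * \<phi> j x * cnj (\<phi> i x)))"
      proof -
        have e: "g x * Re (\<Sum>i\<in>UNIV. \<Sum>j\<in>UNIV. s i j (x, \<zeta>) * \<phi> j x * cnj (\<phi> i x)) = (\<Sum>i\<in>UNIV. \<Sum>j\<in>UNIV. Re (complex_of_real (g x) * (?h i j x * \<phi> j x * cnj (\<phi> i x))))" for x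
          unfolding herm[symmetric] by (simp add: sum_distrib_left)
        show "Re (\<Sum>i\<in>UNIV. \<Sum>j\<in>UNIV. P i j \<zeta>) = (LINT x|lborel. g x * Re (\<Sum>i\<in>UNIV. \<Sum>j\<in>UNIV. s i j (x, \<zeta>) * \<phi> j x * cnj (\<phi> i x)))"
          unfolding e PP(1) using PP(2) by (simp only: Re_sum integral_Re[symmetric] Bochner_Integration.integral_sum Bochner_Integration.integrable_sum integrable_Re)
        show "integrable lborel (\<lambda>x. g x * Re (\<Sum>i\<in>UNIV. \<Sum>j\<in>UNIV. s i j (x, \<zeta>) * \<phi> j x * cnj (\<phi> i x)))"
          unfolding e by (intro Bochner_Integration.integrable_sum integrable_Re PP)
      qed
      have R: "integrable lborel (\<lambda>x. - (M / jap \<zeta>) * (\<Sum>i\<in>UNIV. (norm (\<phi> i x))\<^sup>2))"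
        by (intro integrable_mult_right Bochner_Integration.integrable_sum \<phi>2)
      have "(LINT x|lborel. - (M / jap \<zeta>) * (\<Sum>i\<in>UNIV. (norm (\<phi> i x))\<^sup>2)) \<le> Re (\<Sum>i\<in>UNIV. \<Sum>j\<in>UNIV. P i j \<zeta>)"
        unfolding L(1)
      proof (rule integral_mono[OF R L(2)])
        fix x
        have q: "0 \<le> M / jap \<zeta> * (\<Sum>i\<in>UNIV. (norm (\<phi> i x))\<^sup>2)" using M jap_pos[of \<zeta>] by (intro mult_nonneg_nonneg sum_nonneg) auto
        \<comment> \<open>The bound is nonpositive and \<open>g x \<le> 1\<close>, so inserting the
          cut-off only raises it. The integral without the cut-off is then given by
          Plancherel.\<close>
        have "- (M / jap \<zeta>) * (\<Sum>i\<in>UNIV. (norm (\<phi> i x))\<^sup>2) \<le> g x * (- (M / jap \<zeta>) * (\<Sum>i\<in>UNIV. (norm (\<phi> i x))\<^sup>2))"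
          using mult_right_mono[OF g(4)[of x] q] by simp
        also have "\<dots> \<le> g x * Re (\<Sum>i\<in>UNIV. \<Sum>j\<in>UNIV. s i j (x, \<zeta>) * \<phi> j x * cnj (\<phi> i x))"
          by (intro mult_left_mono g pos[rule_format])
        finally show "- (M / jap \<zeta>) * (\<Sum>i\<in>UNIV. (norm (\<phi> i x))\<^sup>2) \<le> g x * Re (\<Sum>i\<in>UNIV. \<Sum>j\<in>UNIV. s i j (x, \<zeta>) * \<phi> j x * cnj (\<phi> i x))" .
      qed
      moreover have "(LINT x|lborel. - (M / jap \<zeta>) * (\<Sum>i\<in>UNIV. (norm (\<phi> i x))\<^sup>2)) = - (M * (2 * pi) ^ n * (\<Sum>i\<in>UNIV. G i \<zeta>))"
      proof -
        have "G i \<zeta> = (1 / jap \<zeta>) * (LINT \<xi>|lborel. (norm (v i \<xi>))\<^sup>2)" for i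
          unfolding G_def v_def integral_mult_right_zero[symmetric] by (simp add: norm_mult power_mult_distrib)
        then have "(\<Sum>i\<in>UNIV. G i \<zeta>) = (1 / jap \<zeta>) * (\<Sum>i\<in>UNIV. LINT \<xi>|lborel. (norm (v i \<xi>))\<^sup>2)"
          by (simp only: sum_distrib_left)
        then show ?thesis
          unfolding integral_mult_right_zero Bochner_Integration.integral_sum[OF \<phi>2(1)] \<phi>2(2) sum_distrib_left[symmetric]
          by simp
      qed
      ultimately show ?thesis by simp
    qed
    have Pint: "- (M * (2 * pi) ^ n * (\<Sum>i\<in>UNIV. C2 * S i)) \<le> (LINT \<zeta>|lborel. Re (\<Sum>i\<in>UNIV. \<Sum>j\<in>UNIV. P i j \<zeta>))"
    proof -
      have i1: "integrable lborel (\<lambda>\<zeta>. - (M * (2 * pi) ^ n * (\<Sum>i\<in>UNIV. G i \<zeta>)))"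
        by (intro Bochner_Integration.integrable_minus integrable_mult_right Bochner_Integration.integrable_sum G)
      have i2: "integrable lborel (\<lambda>\<zeta>. Re (\<Sum>i\<in>UNIV. \<Sum>j\<in>UNIV. P i j \<zeta>))"
        by (intro integrable_Re Bochner_Integration.integrable_sum swap)
      have "- (M * (2 * pi) ^ n * (\<Sum>i\<in>UNIV. C2 * S i)) \<le> - (M * (2 * pi) ^ n * (\<Sum>i\<in>UNIV. LINT \<zeta>|lborel. G i \<zeta>))"
        using M by (intro le_imp_neg_le mult_left_mono sum_mono G) auto
      also have "\<dots> = (LINT \<zeta>|lborel. - (M * (2 * pi) ^ n * (\<Sum>i\<in>UNIV. G i \<zeta>)))"
        using G(1) by simp
      also have "\<dots> \<le> (LINT \<zeta>|lborel. Re (\<Sum>i\<in>UNIV. \<Sum>j\<in>UNIV. P i j \<zeta>))" by (rule integral_mono[OF i1 i2 Pb])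
      finally show ?thesis .
    qed
    define T where "T = (\<Sum>i\<in>UNIV. S i)"
    have T: "T \<ge> 0" unfolding T_def by (intro sum_nonneg S0)
    have Esum: "- (4 * m * c * M' * T) \<le> (\<Sum>i\<in>UNIV. \<Sum>j\<in>UNIV. Re (E i j))"
    proof -
      have "- (4 * m * c * M' * T) = (\<Sum>i\<in>(UNIV::'m set). \<Sum>j\<in>(UNIV::'m set). - (2 * M' * c * (S j + S i)))"
      proof -
        have "(\<Sum>i\<in>(UNIV::'m set). \<Sum>j\<in>(UNIV::'m set). S j + S i) = 2 * m * T"
          by (simp add: sum.distrib T_def m_def sum_distrib_left[symmetric])
        moreover have "(\<Sum>i\<in>(UNIV::'m set). \<Sum>j\<in>(UNIV::'m set). - (2 * M' * c * (S j + S i))) = - (2 * M' * c * (\<Sum>i\<in>(UNIV::'m set). \<Sum>j\<in>(UNIV::'m set). S j + S i))"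
          by (simp only: sum_negf sum_distrib_left)
        ultimately show ?thesis by simp
      qed
      also have "\<dots> \<le> (\<Sum>i\<in>UNIV. \<Sum>j\<in>UNIV. Re (E i j))"
      proof (intro sum_mono)
        fix i j :: 'm
        show "- (2 * M' * c * (S j + S i)) \<le> Re (E i j)" using Eb[of i j] abs_Re_le_cmod[of "E i j"] by linarith
      qed
      finally show ?thesis .
    qed
    have "- (4 * m * c * M' * T) - M * (2 * pi) ^ n * (C2 * T) \<le> Re (\<Sum>i\<in>UNIV. \<Sum>j\<in>UNIV. Y i j)"
      unfolding ReY using Esum Pint by (simp add: T_def sum_distrib_left)
    moreover have "4 * m * c * M' * T + M * (2 * pi) ^ n * (C2 * T) \<le> C * (K + M) * (1 + sqrt \<alpha>) ^ N * (1 + (1 / sqrt \<alpha>) ^ n) * T"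
    proof -
      define u v where "u = (1 + sqrt \<alpha>) ^ N" and "v = (1 / sqrt \<alpha>) ^ n"
      have u: "u \<ge> 1" unfolding u_def using \<alpha> by (intro one_le_power) simp
      have v: "v \<ge> 0" using \<alpha> by (simp add: v_def)
      define a b where "a = 4 * m * c * C1" and "b = (2 * pi) ^ n * C2"
      have ab: "a \<ge> 0" "b \<ge> 0" using m c C1 C2 by (auto simp: a_def b_def)
      have "a * (K * (u * v)) \<le> a * ((K + M) * (u * (1 + v)))"
        using K M u v by (intro mult_left_mono mult_mono ab) auto
      moreover have "b * (M * (1 * 1)) \<le> b * ((K + M) * (u * (1 + v)))"
        using K M u v by (intro mult_left_mono mult_mono ab) auto
      ultimately have "a * (K * (u * v)) + b * (M * (1 * 1)) \<le> (a + b) * ((K + M) * (u * (1 + v)))" by (simp add: distrib_right)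
      then have "(a * (K * (u * v)) + b * (M * (1 * 1))) * T \<le> (a + b) * ((K + M) * (u * (1 + v))) * T" by (rule mult_right_mono[OF _ T])
      moreover have "4 * m * c * M' * T + M * (2 * pi) ^ n * (C2 * T) = (a * (K * (u * v)) + b * (M * (1 * 1))) * T"
        by (simp add: a_def b_def u_def v_def M'_def n_def distrib_right distrib_left mult_ac)
      ultimately show ?thesis by (simp only: C_def a_def b_def u_def v_def mult.assoc)
    qed
    ultimately have "- (C * (K + M) * (1 + sqrt \<alpha>) ^ N * (1 + (1 / sqrt \<alpha>) ^ n) * T) \<le> Re (\<Sum>i\<in>UNIV. \<Sum>j\<in>UNIV. Y i j)" by linarith
    then show "- (C * (K + M) * (1 + sqrt \<alpha>) ^ (2 * CARD('n) + 3) * (1 + (1 / sqrt \<alpha>) ^ CARD('n)) * (\<Sum>i\<in>UNIV. LINT \<xi>|lborel. (norm (w i \<xi>))\<^sup>2 / jap \<xi>))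
      \<le> Re (\<Sum>i\<in>UNIV. \<Sum>j\<in>UNIV. LINT x|lborel. complex_of_real (exp (- \<alpha> * (norm (x - k))\<^sup>2)) *
            ((LINT \<xi>|lborel. wave x \<xi> * s i j (x, \<xi>) * w j \<xi>) * cnj (LINT \<eta>|lborel. wave x \<eta> * w i \<eta>)))"
      unfolding T_def S_def Y_def g_def N_def n_def .
  qed
qed

section \<open>Integration by parts on Schwartz functions\<close>

definition rapid :: "(real^'n::finite \<Rightarrow> complex) \<Rightarrow> bool" where
  "rapid f \<longleftrightarrow> (\<forall>N. \<exists>C. \<forall>x. jap x ^ N * norm (f x) \<le> C)"

definition bessel_weight :: "real^'n::finite \<Rightarrow> real" where
  "bessel_weight z = 1 / (1 + (2/3) * (norm z)\<^sup>2)"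

lemma bessel_weight_bounds: "0 < bessel_weight z" "bessel_weight z \<le> 1"
proof -
  define r where "r = 1 + (2/3) * (norm z)\<^sup>2"
  have "1 \<le> r" by (simp add: r_def)
  then show "0 < bessel_weight z" "bessel_weight z \<le> 1" unfolding bessel_weight_def r_def[symmetric] by auto
qed

text \<open>All functions that arise from a Schwartz function \<open>u\<close> by differentiation, multiplication by
  coordinates and by the inverse of the polynomial that \<open>resolvent_op\<close> induces on the kernel.\<close>

inductive schwartz_span :: "(real^'n::finite \<Rightarrow> complex) \<Rightarrow> real^'n \<Rightarrow> (real^'n \<Rightarrow> complex) \<Rightarrow> bool"
  for u and x where
  span_deriv: "set vs \<subseteq> Basis \<Longrightarrow> schwartz_span u x (iter_deriv vs u)"
| span_add: "schwartz_span u x f \<Longrightarrow> schwartz_span u x h \<Longrightarrow> schwartz_span u x (\<lambda>y. f y + h y)"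
| span_scale: "schwartz_span u x f \<Longrightarrow> schwartz_span u x (\<lambda>y. c * f y)"
| span_coord: "schwartz_span u x f \<Longrightarrow> schwartz_span u x (\<lambda>y. complex_of_real (y $ j) * f y)"
| span_weight: "schwartz_span u x f \<Longrightarrow> schwartz_span u x (\<lambda>y. complex_of_real (bessel_weight (x - y)) * f y)"

text \<open>By \<open>jap_power_le\<close> it suffices to bound the powers of single coordinates, so
  the Schwartz condition is used with monomials concentrated on one index \<open>j\<close>.\<close>

lemma rapid_schwartz:
  fixes u :: "real^'n::finite \<Rightarrow> complex"
  assumes u: "schwartz u" and vs: "set vs \<subseteq> Basis"
  shows "rapid (iter_deriv vs u)"
  unfolding rapid_def
proof
  fix N
  let ?f = "iter_deriv vs u"
  have sm: "smooth u" using u by (simp add: schwartz_def)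
  \<comment> \<open>Recovers the coordinate of a basis vector, so that the list \<open>vs\<close> of
    directions is represented by the multi-index \<open>count_list (map idx vs)\<close>.\<close>
  define idx where "idx = (\<lambda>v::real^'n. SOME i. v = axis i 1)"
  have idx: "axis (idx v) 1 = v" if "v \<in> Basis" for v
  proof -
    have "\<exists>i. v = axis i 1" using that by (auto simp: Basis_vec_def)
    then show ?thesis unfolding idx_def by (metis (mono_tags, lifting) someI_ex)
  qed
  have "map (\<lambda>i. axis i 1) (map idx vs) = map (\<lambda>v. v) vs"
    unfolding map_map by (rule map_cong) (use vs idx in auto)
  then have vs': "map (\<lambda>i. axis i 1) (map idx vs) = vs" by simp
  have r: "range (\<lambda>i. axis i 1 :: real^'n) \<subseteq> Basis" by (auto simp: axis_in_Basis_iff)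
  have md: "multi_deriv (\<lambda>i. axis i 1) (count_list (map idx vs)) u = ?f"
    unfolding multi_deriv_count_list[OF sm r] vs' ..
  have bd: "\<exists>B. \<forall>x. \<bar>x $ j\<bar> ^ M * norm (?f x) \<le> B" for j M
  proof -
    have "bounded (range (\<lambda>x. (\<Prod>i\<in>UNIV. (x $ i) ^ (if i = j then M else 0)) *\<^sub>R multi_deriv (\<lambda>i. axis i 1) (count_list (map idx vs)) u x))"
      using u by (simp add: schwartz_def)
    then obtain B where B: "norm ((\<Prod>i\<in>UNIV. (x $ i) ^ (if i = j then M else 0)) *\<^sub>R ?f x) \<le> B" for x
      unfolding md by (auto simp: bounded_iff)
    have "(\<Prod>i\<in>UNIV. (x $ i) ^ (if i = j then M else 0)) = (\<Prod>i\<in>UNIV. if i = j then (x $ i) ^ M else 1)" for x :: "real^'n"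
      by (rule prod.cong) auto
    then have "(\<Prod>i\<in>UNIV. (x $ i) ^ (if i = j then M else 0)) = (x $ j) ^ M" for x :: "real^'n"
      by (simp add: prod.delta)
    then show ?thesis using B by (auto simp: power_abs)
  qed
  then have "\<forall>j. \<exists>B. \<forall>x. \<bar>x $ j\<bar> ^ N * norm (?f x) \<le> B" by blast
  then obtain B where B: "\<And>j x. \<bar>x $ j\<bar> ^ N * norm (?f x) \<le> B j" using choice[of "\<lambda>j B. \<forall>x. \<bar>x $ j\<bar> ^ N * norm (?f x) \<le> B"] by blast
  obtain B0 where B0: "\<And>x. norm (?f x) \<le> B0" using bd[of undefined 0] by auto
  show "\<exists>C. \<forall>x. jap x ^ N * norm (?f x) \<le> C"
  proof (intro exI allI)
    fix x
    have "jap x ^ N * norm (?f x) \<le> (real CARD('n) + 1) ^ N * (1 + (\<Sum>j\<in>UNIV. \<bar>x $ j\<bar> ^ N)) * norm (?f x)"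
      by (intro mult_right_mono jap_power_le) simp
    also have "\<dots> = (real CARD('n) + 1) ^ N * (norm (?f x) + (\<Sum>j\<in>UNIV. \<bar>x $ j\<bar> ^ N * norm (?f x)))"
      by (simp add: algebra_simps sum_distrib_left sum_distrib_right)
    also have "\<dots> \<le> (real CARD('n) + 1) ^ N * (B0 + (\<Sum>j\<in>UNIV. B j))"
      by (intro mult_left_mono add_mono sum_mono B B0) simp
    finally show "jap x ^ N * norm (?f x) \<le> (real CARD('n) + 1) ^ N * (B0 + (\<Sum>j\<in>UNIV. B j))" .
  qed
qed

lemma rapid_bound_mult:
  fixes f :: "real^'n::finite \<Rightarrow> complex"
  assumes "rapid f" "\<And>y. norm (h y) \<le> C * jap y ^ m * norm (f y)"
  shows "rapid h"
  unfolding rapid_def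
proof
  fix N
  obtain D where D: "\<And>x. jap x ^ (N + m) * norm (f x) \<le> D" using assms(1) unfolding rapid_def by blast
  show "\<exists>C. \<forall>x. jap x ^ N * norm (h x) \<le> C"
  proof (intro exI allI)
    fix x
    have "jap x ^ N * norm (h x) \<le> jap x ^ N * (\<bar>C\<bar> * jap x ^ m * norm (f x))"
    proof (intro mult_left_mono order.trans[OF assms(2)] mult_right_mono)
      show "0 \<le> jap x ^ N" "0 \<le> jap x ^ m" using jap_pos[of x] by auto
    qed auto
    also have "\<dots> = \<bar>C\<bar> * (jap x ^ (N + m) * norm (f x))" by (simp add: power_add)
    also have "\<dots> \<le> \<bar>C\<bar> * D" by (intro mult_left_mono D) simp
    finally show "jap x ^ N * norm (h x) \<le> \<bar>C\<bar> * D" .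
  qed
qed

lemma rapid_add:
  fixes f h :: "real^'n::finite \<Rightarrow> complex"
  assumes "rapid f" "rapid h"
  shows "rapid (\<lambda>y. f y + h y)"
  unfolding rapid_def
proof
  fix N
  obtain C D where CD: "\<And>x. jap x ^ N * norm (f x) \<le> C" "\<And>x. jap x ^ N * norm (h x) \<le> D"
    using assms unfolding rapid_def by blast
  have "jap x ^ N * norm (f x + h x) \<le> C + D" for x
  proof -
    have "jap x ^ N * norm (f x + h x) \<le> jap x ^ N * (norm (f x) + norm (h x))"
      using jap_pos[of x] by (intro mult_left_mono norm_triangle_ineq) auto
    then show ?thesis using CD[of x] by (simp add: distrib_left)
  qed
  then show "\<exists>C. \<forall>x. jap x ^ N * norm (f x + h x) \<le> C" by blast
qed

lemma schwartz_span_rapid: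
  fixes u :: "real^'n::finite \<Rightarrow> complex"
  assumes u: "schwartz u" and "schwartz_span u x f"
  shows "rapid f"
  using assms(2)
proof induction
  case (span_deriv vs)
  then show ?case by (rule rapid_schwartz[OF u])
next
  case (span_add f h)
  then show ?case by (intro rapid_add)
next
  case (span_scale f c)
  show ?case by (rule rapid_bound_mult[OF span_scale.IH, of _ "norm c" 0]) (simp add: norm_mult)
next
  case (span_coord f j)
  have "norm (complex_of_real (y $ j) * f y) \<le> 1 * jap y ^ 1 * norm (f y)" for y
    using component_le_norm_cart[of y j] jap_ge_norm[of y] by (simp add: norm_mult mult_right_mono)
  then show ?case by (rule rapid_bound_mult[OF span_coord.IH])
next
  case (span_weight f)
  have "norm (complex_of_real (bessel_weight (x - y)) * f y) \<le> 1 * jap y ^ 0 * norm (f y)" for y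
    using bessel_weight_bounds[of "x - y"] by (simp add: norm_mult mult_left_le_one_le)
  then show ?case by (rule rapid_bound_mult[OF span_weight.IH])
qed

lemma bessel_weight_derivative:
  fixes x :: "real^'n::finite"
  shows "((\<lambda>y. complex_of_real (bessel_weight (x - y))) has_derivative
    (\<lambda>v. complex_of_real ((4/3) * ((x - y) \<bullet> v) * (bessel_weight (x - y))\<^sup>2))) (at y)"
proof -
  have nz: "1 + (2/3) * ((x - y) \<bullet> (x - y)) \<noteq> 0" for y
    using inner_ge_zero[of "x - y"] by linarith
  have "((\<lambda>y. 1 / (1 + (2/3) * ((x - y) \<bullet> (x - y)))) has_derivative
     (\<lambda>v. (4/3) * ((x - y) \<bullet> v) * (1 / (1 + (2/3) * ((x - y) \<bullet> (x - y))))\<^sup>2)) (at y)"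
    using nz[of y] by (auto intro!: derivative_eq_intros simp: inner_commute power2_eq_square divide_simps)
  then have "((\<lambda>y. bessel_weight (x - y)) has_derivative (\<lambda>v. (4/3) * ((x - y) \<bullet> v) * (bessel_weight (x - y))\<^sup>2)) (at y)"
    by (simp add: bessel_weight_def power2_norm_eq_inner)
  then show ?thesis by (rule has_derivative_of_real)
qed

text \<open>Closure under derivatives is what permits repeated integration by parts. The delicate
  generator is the weight: its derivative is a coordinate of \<open>x - y\<close> times the square
  of the weight, hence again in the span.\<close>

lemma schwartz_span_differentiable:
  fixes u :: "real^'n::finite \<Rightarrow> complex"
  assumes u: "smooth u" and "schwartz_span u x f"
  shows "f differentiable_on UNIV \<and> schwartz_span u x (partial_deriv (axis k 1) f)"
  using assms(2)
proof induction
  case (span_deriv vs)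
  have "schwartz_span u x (iter_deriv (axis k 1 # vs) u)"
    by (rule schwartz_span.span_deriv) (use span_deriv in \<open>auto simp: axis_in_Basis_iff\<close>)
  then show ?case using smooth_differentiable[OF u span_deriv] by simp
next
  case (span_add f h)
  then show ?case using partial_deriv_add[of f h] by (auto intro: schwartz_span.span_add)
next
  case (span_scale f c)
  then show ?case using partial_deriv_bounded_linear[OF bounded_linear_mult_right[of c], of f] by (auto intro: schwartz_span.span_scale)
next
  case (span_coord f j)
  have d: "((\<lambda>y::real^'n. complex_of_real (y $ j)) has_derivative (\<lambda>v. complex_of_real (v $ j))) (at y)" for y
    by (intro has_derivative_of_real bounded_linear_imp_has_derivative bounded_linear_vec_nth)
  then have d': "(\<lambda>y::real^'n. complex_of_real (y $ j)) differentiable_on UNIV" by (auto simp: differentiable_on_def differentiable_def)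
  have "partial_deriv (axis k 1) (\<lambda>y. complex_of_real (y $ j) * f y) = (\<lambda>y. complex_of_real (y $ j) * partial_deriv (axis k 1) f y + complex_of_real (axis k 1 $ j) * f y)"
    using partial_deriv_mult(1)[OF d', of f "axis k 1"] span_coord.IH partial_deriv_unique[OF d] by simp
  moreover have "schwartz_span u x \<dots>"
    by (intro schwartz_span.span_add schwartz_span.span_coord schwartz_span.span_scale) (use span_coord in auto)
  ultimately show ?case using partial_deriv_mult(2)[OF d', of f] span_coord.IH by simp
next
  case (span_weight f)
  let ?b = "\<lambda>y. complex_of_real (bessel_weight (x - y))"
  note d = bessel_weight_derivative[of x]
  then have d': "?b differentiable_on UNIV" by (auto simp: differentiable_on_def differentiable_def)
  have e1: "partial_deriv (axis k 1) (\<lambda>y. ?b y * f y) = (\<lambda>y. ?b y * partial_deriv (axis k 1) f y + partial_deriv (axis k 1) ?b y * f y)"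
    using partial_deriv_mult(1)[OF d', of f "axis k 1"] span_weight.IH by simp
  \<comment> \<open>The derivative of the weight is written as two factors of the weight around a
    combination of \<open>f\<close> and \<open>y $ k\<close> times \<open>f\<close>, each layer
    being one constructor of the span.\<close>
  have e2: "partial_deriv (axis k 1) ?b y * f y = ?b y * (?b y * (complex_of_real ((4/3) * x $ k) * f y + (- (4/3)) * (complex_of_real (y $ k) * f y)))" for y
  proof -
    have alg: "complex_of_real ((4/3) * (a - b) * w\<^sup>2) * z = complex_of_real w * (complex_of_real w * (complex_of_real ((4/3) * a) * z + (- (4/3)) * (complex_of_real b * z)))" for a b w z
      by (simp add: power2_eq_square field_simps)
    have "(x - y) \<bullet> axis k 1 = x $ k - y $ k" by (simp add: inner_axis)
    then show ?thesis unfolding partial_deriv_unique[OF d] by (simp only: alg)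
  qed
  have "schwartz_span u x (\<lambda>y. ?b y * partial_deriv (axis k 1) f y + ?b y * (?b y * (complex_of_real ((4/3) * x $ k) * f y + (- (4/3)) * (complex_of_real (y $ k) * f y))))"
    by (intro schwartz_span.intros(2-5)) (use span_weight in auto)
  then show ?case using partial_deriv_mult(2)[OF d', of f] span_weight.IH unfolding e1 e2 by simp
qed

lemma integrable_of_jap_decay:
  fixes f :: "'a::euclidean_space \<Rightarrow> complex"
  assumes "f \<in> borel_measurable borel" "\<And>x. norm (f x) \<le> C * (1 / jap x ^ (2 * DIM('a)))"
  shows "integrable lborel f"
proof (rule Bochner_Integration.integrable_bound[OF integrable_mult_right[OF integrable_inverse_jap_power, of C]])
  show "AE x in lborel. norm (f x) \<le> norm (C * (1 / jap x ^ (2 * DIM('a))))"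
    unfolding real_norm_def by (intro AE_I2 order.trans[OF assms(2) abs_ge_self])
qed (use assms(1) in simp)

lemma rapid_integrable:
  fixes f :: "real^'n::finite \<Rightarrow> complex"
  assumes "rapid f" "continuous_on UNIV f"
  shows "integrable lborel f" "\<exists>B. \<forall>x. norm (f x) \<le> B"
proof -
  obtain C where C: "\<And>x. jap x ^ (2 * DIM(real^'n)) * norm (f x) \<le> C" using assms(1) unfolding rapid_def by blast
  have le: "norm (f x) \<le> C * (1 / jap x ^ (2 * DIM(real^'n)))" for x
    using C[of x] jap_pos[of x] by (simp add: pos_le_divide_eq mult.commute)
  show "integrable lborel f"
    by (rule integrable_of_jap_decay[OF borel_measurable_continuous_onI[OF assms(2)] le])
  obtain C where "\<And>x. jap x ^ 0 * norm (f x) \<le> C" using assms(1) unfolding rapid_def by blast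
  then show "\<exists>B. \<forall>x. norm (f x) \<le> B" by auto
qed

text \<open>The point \<open>x\<close> is frozen because the weights
  \<open>bessel_weight (x - y)\<close> depend on it; only \<open>\<xi>\<close> and \<open>y\<close>
  are variables of integration.\<close>

locale schwartz_data =
  fixes u :: "real^'n::finite \<Rightarrow> complex" and x :: "real^'n"
  assumes u: "schwartz u"
begin

abbreviation "sp \<equiv> schwartz_span u x"

lemma span_u: "sp u" using schwartz_span.span_deriv[of "[]" u x] by simp

lemma sm: "smooth u" using u by (simp add: schwartz_def)

lemma span_rapid: "sp f \<Longrightarrow> rapid f" by (rule schwartz_span_rapid[OF u])
lemma span_diff: "sp f \<Longrightarrow> f differentiable_on UNIV" using schwartz_span_differentiable[OF sm] by blast
lemma span_pd: "sp f \<Longrightarrow> sp (partial_deriv (axis k 1) f)" using schwartz_span_differentiable[OF sm] by blast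
lemma span_continuous: "sp f \<Longrightarrow> continuous_on UNIV f" using span_diff differentiable_imp_continuous_on by blast
lemma span_integrable: "sp f \<Longrightarrow> integrable lborel f" using rapid_integrable(1) span_rapid span_continuous by blast
lemma span_bounded: "sp f \<Longrightarrow> \<exists>B. \<forall>x. norm (f x) \<le> B" using rapid_integrable(2) span_rapid span_continuous by blast

lemma fourier_partial_deriv:
  assumes f: "sp f"
  shows "fourier (partial_deriv (axis j 1) f) \<xi> = \<i> * complex_of_real (\<xi> $ j) * fourier f \<xi>"
proof -
  let ?e = "\<lambda>y. wave_cnj y \<xi>"
  let ?h' = "\<lambda>y. ?e y * partial_deriv (axis j 1) f y + ?e y * (- \<i> * complex_of_real (axis j 1 \<bullet> \<xi>)) * f y"
  have eq: "?h' y = ?e y * partial_deriv (axis j 1) f y + (- \<i> * complex_of_real (\<xi> $ j)) * (?e y * f y)" for y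
    by (simp add: inner_axis')
  note i = fourier_integrand_integrable[OF span_integrable[OF f], of \<xi>] fourier_integrand_integrable[OF span_integrable[OF span_pd[OF f]], of \<xi>]
  have "(LINT y|lborel. ?h' y) = 0"
  proof (rule integral_directional_derivative_zero[where h = "\<lambda>y. ?e y * f y" and v = "axis j 1"])
    show "((\<lambda>s. ?e (y + s *\<^sub>R axis j 1) * f (y + s *\<^sub>R axis j 1)) has_vector_derivative ?h' (y + s *\<^sub>R axis j 1)) (at s)" for y s
      by (intro has_vector_derivative_mult exp_line partial_deriv_line span_diff f)
    show "integrable lborel ?h'" unfolding eq by (intro Bochner_Integration.integrable_add integrable_mult_right i)
    show "continuous_on UNIV ?h'" by (intro continuous_intros span_continuous span_pd f)
  qed (rule i)
  moreover have "(LINT y|lborel. ?h' y) = fourier (partial_deriv (axis j 1) f) \<xi> + (- \<i> * complex_of_real (\<xi> $ j)) * fourier f \<xi>"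
    unfolding eq fourier_def using i by (simp only: Bochner_Integration.integral_add integrable_mult_right integral_mult_right_zero)
  ultimately show ?thesis by (simp add: add_eq_0_iff)
qed

lemma span_pd_pow: "sp f \<Longrightarrow> sp ((partial_deriv (axis j 1) ^^ N) f)"
  by (induction N) (auto intro: span_pd)

lemma fourier_partial_deriv_pow:
  assumes "sp f"
  shows "fourier ((partial_deriv (axis j 1) ^^ N) f) \<xi> = (\<i> * complex_of_real (\<xi> $ j)) ^ N * fourier f \<xi>"
  by (induction N) (simp_all add: fourier_partial_deriv span_pd_pow[OF assms])

text \<open>The transform of the derivative of order \<open>2 * DIM\<close> along each axis is
  bounded, which amounts to decay like the integrable function
  \<open>1 / jap \<xi> ^ (2 * DIM)\<close>.\<close>

lemma fourier_span_integrable: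
  assumes f: "sp f"
  shows "integrable lborel (fourier f)"
proof -
  let ?N = "2 * DIM(real^'n)"
  define B where "B = (\<lambda>j. LINT y|lborel. norm ((partial_deriv (axis j 1) ^^ ?N) f y))"
  define B0 where "B0 = (LINT y|lborel. norm (f y))"
  have le: "\<bar>\<xi> $ j\<bar> ^ ?N * norm (fourier f \<xi>) \<le> B j" for \<xi> j
    using norm_fourier_le[of "(partial_deriv (axis j 1) ^^ ?N) f" \<xi>]
    unfolding fourier_partial_deriv_pow[OF f] by (simp add: B_def norm_mult norm_power)
  have le0: "norm (fourier f \<xi>) \<le> B0" for \<xi> unfolding B0_def by (rule norm_fourier_le)
  define C where "C = (real CARD('n) + 1) ^ ?N * (B0 + (\<Sum>j\<in>UNIV. B j))"
  have bd: "norm (fourier f \<xi>) \<le> C * (1 / jap \<xi> ^ ?N)" for \<xi>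
  proof -
    have "jap \<xi> ^ ?N * norm (fourier f \<xi>) \<le> (real CARD('n) + 1) ^ ?N * (1 + (\<Sum>j\<in>UNIV. \<bar>\<xi> $ j\<bar> ^ ?N)) * norm (fourier f \<xi>)"
      by (intro mult_right_mono jap_power_le) simp
    also have "\<dots> = (real CARD('n) + 1) ^ ?N * (norm (fourier f \<xi>) + (\<Sum>j\<in>UNIV. \<bar>\<xi> $ j\<bar> ^ ?N * norm (fourier f \<xi>)))"
      by (simp only: mult.assoc distrib_right mult_1 sum_distrib_right)
    also have "\<dots> \<le> C" unfolding C_def by (intro mult_left_mono add_mono sum_mono le le0) simp
    finally show ?thesis using jap_pos[of \<xi>] by (simp add: pos_le_divide_eq mult.commute)
  qed
  show ?thesis
    by (rule integrable_of_jap_decay[OF borel_measurable_fourier[OF span_integrable[OF f]] bd])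
qed

lemma span_shift_coord:
  assumes "sp f"
  shows "sp (\<lambda>y. complex_of_real ((x - y) $ j) * f y)"
proof -
  have "(\<lambda>y. complex_of_real ((x - y) $ j) * f y) = (\<lambda>y. complex_of_real (x $ j) * f y + (-1) * (complex_of_real (y $ j) * f y))"
    by (simp add: algebra_simps)
  then show ?thesis using assms by (simp only: schwartz_span.intros)
qed

text \<open>The transform with positions measured from \<open>x\<close>: by \<open>Psi_eq\<close>
  the kernel is \<open>wave (x - y) \<xi>\<close>. A frequency derivative then multiplies
  \<open>f\<close> by \<open>\<i>\<close> times a coordinate of \<open>x - y\<close>, and
  polynomials in \<open>x - y\<close> arise directly.\<close>

definition Psi :: "(real^'n \<Rightarrow> complex) \<Rightarrow> real^'n \<Rightarrow> complex" where
  "Psi f \<xi> = wave x \<xi> * fourier f \<xi>"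

lemma Psi_integrable: "sp f \<Longrightarrow> integrable lborel (Psi f)"
proof -
  assume f: "sp f"
  have [measurable]: "fourier f \<in> borel_measurable borel" by (rule borel_measurable_fourier[OF span_integrable[OF f]])
  show ?thesis
    unfolding Psi_def[abs_def]
    by (rule Bochner_Integration.integrable_bound[OF fourier_span_integrable[OF f]]) (auto simp: norm_mult)
qed

lemma Psi_continuous: "sp f \<Longrightarrow> continuous_on UNIV (Psi f)"
  unfolding Psi_def[abs_def] by (intro continuous_intros continuous_on_fourier span_integrable)

lemma Psi_eq: "Psi f \<xi> = (LINT y|lborel. wave (x - y) \<xi> * f y)"
proof -
  have e: "wave (x - y) \<xi> = wave x \<xi> * wave_cnj y \<xi>" for y
    by (simp add: inner_diff_left exp_add[symmetric] algebra_simps)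
  show ?thesis unfolding e by (simp only: Psi_def fourier_def mult.assoc integral_mult_right_zero)
qed

lemma Psi_line:
  assumes f: "sp f"
  shows "((\<lambda>s. Psi f (\<xi> + s *\<^sub>R axis j 1)) has_vector_derivative \<i> * Psi (\<lambda>y. complex_of_real ((x - y) $ j) * f y) (\<xi> + s *\<^sub>R axis j 1)) (at s)"
proof -
  let ?F' = "\<lambda>s y. wave_cnj (\<xi> + s *\<^sub>R axis j 1) (y - x) * (- \<i> * complex_of_real (axis j 1 \<bullet> (y - x))) * f y"
  have f': "sp (\<lambda>y. complex_of_real ((x - y) $ j) * f y)" by (rule span_shift_coord[OF f])
  have [measurable]: "f \<in> borel_measurable borel" using span_integrable[OF f] by auto
  have "((\<lambda>s. LINT y|lborel. wave_cnj (\<xi> + s *\<^sub>R axis j 1) (y - x) * f y) has_vector_derivative (LINT y|lborel. ?F' s y)) (at s)"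
  proof (rule has_vector_derivative_integral_param[where w = "\<lambda>y. norm (complex_of_real ((x - y) $ j) * f y)"])
    show "((\<lambda>s. wave_cnj (\<xi> + s *\<^sub>R axis j 1) (y - x) * f y) has_vector_derivative ?F' s y) (at s)" for s y
      by (intro has_vector_derivative_mult_left exp_line)
    show "integrable lborel (\<lambda>y. wave_cnj (\<xi> + s *\<^sub>R axis j 1) (y - x) * f y)" for s
      by (rule Bochner_Integration.integrable_bound[OF span_integrable[OF f]]) (auto simp: norm_mult)
    show "?F' s \<in> borel_measurable borel" for s by measurable
    show "norm (?F' s y) \<le> norm (complex_of_real ((x - y) $ j) * f y)" for s y
      by (simp add: norm_mult inner_axis' norm_minus_commute)
    show "integrable lborel (\<lambda>y. norm (complex_of_real ((x - y) $ j) * f y))"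
      by (intro integrable_norm span_integrable f')
  qed
  moreover have e1: "wave_cnj \<eta> (y - x) = wave (x - y) \<eta>" for \<eta> y
    by (simp add: inner_commute inner_diff_left algebra_simps)
  moreover have e2: "- \<i> * complex_of_real (axis j 1 \<bullet> (y - x)) = \<i> * complex_of_real ((x - y) $ j)" for y
    by (simp add: inner_axis' algebra_simps)
  moreover have "(LINT y|lborel. wave (x - y) \<eta> * (\<i> * complex_of_real ((x - y) $ j)) * f y)
     = \<i> * (LINT y|lborel. wave (x - y) \<eta> * (complex_of_real ((x - y) $ j) * f y))" for \<eta>
    unfolding integral_mult_right_zero[symmetric] by (rule Bochner_Integration.integral_cong[OF refl]) (simp only: mult_ac)
  ultimately show ?thesis unfolding Psi_eq by (simp only:)
qed

lemma Psi_integrable_mult: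
  assumes "sp f" "continuous_on UNIV b" "\<And>\<xi>. norm (b \<xi>) \<le> K"
  shows "integrable lborel (\<lambda>\<xi>. b \<xi> * Psi f \<xi>)"
proof (rule Bochner_Integration.integrable_bound[OF integrable_mult_right[OF Psi_integrable[OF assms(1)], of K]])
  have K: "K \<ge> 0" using assms(3)[of 0] norm_ge_zero order.trans by blast
  have [measurable]: "b \<in> borel_measurable borel" "Psi f \<in> borel_measurable borel"
    using assms(2) Psi_continuous[OF assms(1)] by (auto intro: borel_measurable_continuous_onI)
  show "(\<lambda>\<xi>. b \<xi> * Psi f \<xi>) \<in> borel_measurable lborel" by measurable
  show "AE \<xi> in lborel. norm (b \<xi> * Psi f \<xi>) \<le> norm (complex_of_real K * Psi f \<xi>)"
    using assms(3) K by (auto simp: norm_mult intro!: mult_right_mono)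
qed

lemma Psi_by_parts:
  assumes f: "sp f" and b: "symbol_bound (Suc l) 0 K b"
  shows "(LINT \<xi>|lborel. partial_deriv (exi j) b (x, \<xi>) * Psi f \<xi>) = - \<i> * (LINT \<xi>|lborel. b (x, \<xi>) * Psi (\<lambda>y. complex_of_real ((x - y) $ j) * f y) \<xi>)"
proof -
  let ?f' = "\<lambda>y. complex_of_real ((x - y) $ j) * f y"
  have f': "sp ?f'" by (rule span_shift_coord[OF f])
  have b': "symbol_bound l 0 K (partial_deriv (exi j) b)" by (rule symbol_bound_mono[OF symbol_bound_exi[OF b]]) auto
  have sl: "continuous_on UNIV (\<lambda>\<xi>. b (x, \<xi>))" "continuous_on UNIV (\<lambda>\<xi>. partial_deriv (exi j) b (x, \<xi>))"
    by (intro symbol_bound_continuous_comp[OF b] symbol_bound_continuous_comp[OF b'] continuous_intros)+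
  have bd: "norm (b (x, \<xi>)) \<le> K" "norm (partial_deriv (exi j) b (x, \<xi>)) \<le> K" for \<xi>
    using symbol_bound_le[OF b, of x \<xi>] symbol_bound_le[OF b', of x \<xi>] by auto
  note i = Psi_integrable_mult[OF f sl(1) bd(1)] Psi_integrable_mult[OF f' sl(1) bd(1)] Psi_integrable_mult[OF f sl(2) bd(2)]
  let ?h' = "\<lambda>\<xi>. b (x, \<xi>) * (\<i> * Psi ?f' \<xi>) + partial_deriv (exi j) b (x, \<xi>) * Psi f \<xi>"
  have eq: "?h' \<xi> = \<i> * (b (x, \<xi>) * Psi ?f' \<xi>) + partial_deriv (exi j) b (x, \<xi>) * Psi f \<xi>" for \<xi> by simp
  have "(LINT \<xi>|lborel. ?h' \<xi>) = 0"
  proof (rule integral_directional_derivative_zero[where h = "\<lambda>\<xi>. b (x, \<xi>) * Psi f \<xi>" and v = "axis j 1"])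
    have bl: "((\<lambda>s. b (x, \<xi> + s *\<^sub>R axis j 1)) has_vector_derivative partial_deriv (exi j) b (x, \<xi> + s *\<^sub>R axis j 1)) (at s)" for \<xi> s
      using partial_deriv_line[OF smooth_differentiable0[OF symbol_bound_smooth[OF b]], of "(x, \<xi>)" "exi j" s] by simp
    show "((\<lambda>s. b (x, \<xi> + s *\<^sub>R axis j 1) * Psi f (\<xi> + s *\<^sub>R axis j 1)) has_vector_derivative ?h' (\<xi> + s *\<^sub>R axis j 1)) (at s)" for \<xi> s
      by (intro has_vector_derivative_mult bl Psi_line f)
    show "integrable lborel ?h'" unfolding eq by (intro Bochner_Integration.integrable_add integrable_mult_right i)
    show "continuous_on UNIV ?h'" by (intro continuous_intros sl Psi_continuous f f')
  qed (rule i)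
  moreover have "(LINT \<xi>|lborel. ?h' \<xi>) = \<i> * (LINT \<xi>|lborel. b (x, \<xi>) * Psi ?f' \<xi>) + (LINT \<xi>|lborel. partial_deriv (exi j) b (x, \<xi>) * Psi f \<xi>)"
    unfolding eq using i by (simp only: Bochner_Integration.integral_add integrable_mult_right integral_mult_right_zero)
  ultimately show ?thesis by (simp add: add_eq_0_iff add.commute)
qed

text \<open>Two integrations by parts move the frequency Laplacian from the symbol to
  \<open>Psi\<close>, where it becomes multiplication by \<open>- (norm (x - y))\<^sup>2\<close>.
  Together with the identity this is the polynomial whose reciprocal is the weight, and the two
  cancel.\<close>

lemma Psi_resolvent:
  assumes f: "sp f" and a: "symbol_bound (Suc (Suc l)) 0 K a"
  shows "(LINT \<xi>|lborel. resolvent_op a (x, \<xi>) * Psi (\<lambda>y. complex_of_real (bessel_weight (x - y)) * f y) \<xi>) = (LINT \<xi>|lborel. a (x, \<xi>) * Psi f \<xi>)"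
proof -
  define f1 where "f1 = (\<lambda>y. complex_of_real (bessel_weight (x - y)) * f y)"
  define f2 where "f2 = (\<lambda>j y. complex_of_real ((x - y) $ j) * (complex_of_real ((x - y) $ j) * f1 y))"
  have s1: "sp f1" unfolding f1_def by (rule schwartz_span.span_weight[OF f])
  have s2: "sp (f2 j)" for j unfolding f2_def by (intro span_shift_coord s1)
  have a1: "symbol_bound (Suc l) 0 K (partial_deriv (exi j) a)" for j by (rule symbol_bound_mono[OF symbol_bound_exi[OF a]]) auto
  have a2: "symbol_bound l 0 K (partial_deriv (exi j) (partial_deriv (exi j) a))" for j by (rule symbol_bound_mono[OF symbol_bound_exi[OF a1]]) auto
  have I: "integrable lborel (\<lambda>\<xi>. c (x, \<xi>) * Psi h \<xi>)" if "sp h" "symbol_bound l' 0 K c" for c h l'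
    by (rule Psi_integrable_mult[OF that(1), of _ K]) (use symbol_bound_le[OF that(2)] in \<open>auto intro!: symbol_bound_continuous_comp[OF that(2)] continuous_intros\<close>)
  have lin: "e * z + (2/3) * (e * w) = e * (z + (2/3) * w)" for e z w :: complex by (simp add: algebra_simps)
  have p2: "(LINT \<xi>|lborel. partial_deriv (exi j) (partial_deriv (exi j) a) (x, \<xi>) * Psi f1 \<xi>) = - (LINT \<xi>|lborel. a (x, \<xi>) * Psi (f2 j) \<xi>)" for j
    unfolding Psi_by_parts[OF s1 a1] Psi_by_parts[OF span_shift_coord[OF s1] a] f2_def by simp
  have "(LINT \<xi>|lborel. resolvent_op a (x, \<xi>) * Psi f1 \<xi>) = (LINT \<xi>|lborel. a (x, \<xi>) * Psi f1 \<xi> - (2/3) * (\<Sum>j\<in>UNIV. partial_deriv (exi j) (partial_deriv (exi j) a) (x, \<xi>) * Psi f1 \<xi>))"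
    unfolding resolvent_op_def by (simp add: left_diff_distrib sum_distrib_right mult.assoc)
  also have "\<dots> = (LINT \<xi>|lborel. a (x, \<xi>) * Psi f1 \<xi>) - (2/3) * (\<Sum>j\<in>UNIV. (LINT \<xi>|lborel. partial_deriv (exi j) (partial_deriv (exi j) a) (x, \<xi>) * Psi f1 \<xi>))"
    by (subst Bochner_Integration.integral_diff) (auto intro!: I[OF s1 a] I[OF s1 a2] integrable_mult_right Bochner_Integration.integrable_sum simp: Bochner_Integration.integral_sum[OF I[OF s1 a2]])
  also have "\<dots> = (LINT \<xi>|lborel. a (x, \<xi>) * Psi f1 \<xi>) + (2/3) * (\<Sum>j\<in>UNIV. (LINT \<xi>|lborel. a (x, \<xi>) * Psi (f2 j) \<xi>))"
    unfolding p2 by (simp add: sum_negf)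
  also have "\<dots> = (LINT \<xi>|lborel. a (x, \<xi>) * Psi f1 \<xi> + (2/3) * (\<Sum>j\<in>UNIV. a (x, \<xi>) * Psi (f2 j) \<xi>))"
    by (subst Bochner_Integration.integral_add) (auto intro!: I[OF s1 a] I[OF s2 a] integrable_mult_right Bochner_Integration.integrable_sum simp: Bochner_Integration.integral_sum[OF I[OF s2 a]])
  also have "\<dots> = (LINT \<xi>|lborel. a (x, \<xi>) * Psi f \<xi>)"
  proof (rule Bochner_Integration.integral_cong[OF refl])
    fix \<xi>
    have "Psi f1 \<xi> + (2/3) * (\<Sum>j\<in>UNIV. Psi (f2 j) \<xi>) = Psi f \<xi>"
    proof -
      let ?e = "\<lambda>y. wave (x - y) \<xi>"
      have ie: "integrable lborel (\<lambda>y. ?e y * h y)" if "sp h" for h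
      proof (rule Bochner_Integration.integrable_bound[OF span_integrable[OF that]])
        have [measurable]: "h \<in> borel_measurable borel" using span_integrable[OF that] by auto
        show "(\<lambda>y. ?e y * h y) \<in> borel_measurable lborel" by measurable
      qed (simp add: norm_mult)
      have pt: "?e y * f1 y + (2/3) * (\<Sum>j\<in>UNIV. ?e y * f2 j y) = ?e y * f y" for y
      proof -
        have "(\<Sum>j\<in>UNIV. f2 j y) = complex_of_real ((norm (x - y))\<^sup>2) * f1 y"
          by (simp add: f2_def power2_norm_eq_inner inner_vec_def sum_distrib_right mult.assoc)
        then have "f1 y + (2/3) * (\<Sum>j\<in>UNIV. f2 j y) = complex_of_real (1 + (2/3) * (norm (x - y))\<^sup>2) * f1 y"
          by (simp add: algebra_simps)
        also have "\<dots> = f y"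
        proof -
          have "(1 + (2/3) * (norm (x - y))\<^sup>2) * bessel_weight (x - y) = 1"
            using bessel_weight_bounds(1)[of "x - y"] unfolding bessel_weight_def by (cases "1 + (2/3) * (norm (x - y))\<^sup>2 = 0") auto
          then show ?thesis unfolding f1_def mult.assoc[symmetric] of_real_mult[symmetric] by simp
        qed
        finally have "?e y * (f1 y + (2/3) * (\<Sum>j\<in>UNIV. f2 j y)) = ?e y * f y" by simp
        then show ?thesis unfolding sum_distrib_left[symmetric] by (simp only: lin)
      qed
      have "Psi f1 \<xi> + (2/3) * (\<Sum>j\<in>UNIV. Psi (f2 j) \<xi>) = (LINT y|lborel. ?e y * f1 y + (2/3) * (\<Sum>j\<in>UNIV. ?e y * f2 j y))"
        unfolding Psi_eq
        by (subst Bochner_Integration.integral_add) (auto intro!: ie s1 s2 integrable_mult_right Bochner_Integration.integrable_sum simp: Bochner_Integration.integral_sum[OF ie[OF s2]])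
      then show ?thesis unfolding pt Psi_eq .
    qed
    then have "a (x, \<xi>) * (Psi f1 \<xi> + (2/3) * (\<Sum>j\<in>UNIV. Psi (f2 j) \<xi>)) = a (x, \<xi>) * Psi f \<xi>" by simp
    then show "a (x, \<xi>) * Psi f1 \<xi> + (2/3) * (\<Sum>j\<in>UNIV. a (x, \<xi>) * Psi (f2 j) \<xi>) = a (x, \<xi>) * Psi f \<xi>"
      unfolding sum_distrib_left[symmetric] by (simp only: lin)
  qed
  finally show ?thesis unfolding f1_def .
qed

lemma span_weight_pow: "sp f \<Longrightarrow> sp (\<lambda>y. complex_of_real (bessel_weight (x - y) ^ J) * f y)"
proof (induction J)
  case (Suc J)
  from schwartz_span.span_weight[OF Suc.IH[OF Suc.prems]] show ?case by (simp add: mult.assoc)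
qed simp

lemma Psi_resolvent_iter:
  assumes f: "sp f" and a: "symbol_bound (2 * J) 0 K a"
  shows "(LINT \<xi>|lborel. (resolvent_op ^^ J) a (x, \<xi>) * Psi (\<lambda>y. complex_of_real (bessel_weight (x - y) ^ J) * f y) \<xi>) = (LINT \<xi>|lborel. a (x, \<xi>) * Psi f \<xi>)"
  using a
proof (induction J arbitrary: K)
  case (Suc J)
  have "symbol_bound (Suc (Suc 0)) 0 ((real CARD('n) + 1) ^ J * K) ((resolvent_op ^^ J) a)"
    by (rule symbol_bound_resolvent_iter, rule symbol_bound_mono[OF Suc.prems]) auto
  from Psi_resolvent[OF span_weight_pow[OF f, of J] this]
  have "(LINT \<xi>|lborel. (resolvent_op ^^ Suc J) a (x, \<xi>) * Psi (\<lambda>y. complex_of_real (bessel_weight (x - y) ^ Suc J) * f y) \<xi>)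
     = (LINT \<xi>|lborel. (resolvent_op ^^ J) a (x, \<xi>) * Psi (\<lambda>y. complex_of_real (bessel_weight (x - y) ^ J) * f y) \<xi>)"
    by (simp add: mult.assoc)
  also have "\<dots> = (LINT \<xi>|lborel. a (x, \<xi>) * Psi f \<xi>)"
    by (rule Suc.IH, rule symbol_bound_mono[OF Suc.prems]) auto
  finally show ?case .
qed simp

end

section \<open>Gaussian windows\<close>

lemma convolution_integrable:
  fixes w h :: "'a::euclidean_space \<Rightarrow> real"
  assumes w: "integrable lborel w" "\<And>x. 0 \<le> w x" and h: "integrable lborel h" "\<And>x. 0 \<le> h x"
  shows "integrable lborel (\<lambda>p. w (fst p - snd p) * h (snd p))"
    and "(LINT p|lborel. w (fst p - snd p) * h (snd p)) = (LINT x|lborel. w x) * (LINT x|lborel. h x)"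
proof -
  have [measurable]: "w \<in> borel_measurable borel" "h \<in> borel_measurable borel" using w h by auto
  have sh: "integrable lborel (\<lambda>x. w (x - y))" "(LINT x|lborel. w (x - y)) = (LINT x|lborel. w x)" for y
    using lborel_integrable_shift[OF w(1), of "- y"] lborel_integral_shift[of w "- y"] by auto
  have "integrable (lborel \<Otimes>\<^sub>M lborel) (\<lambda>(y, x). w (x - y) * h y)"
  proof (rule integrable_pair_lborel[where g = "\<lambda>y x. w (x - y) * h y" and G = "\<lambda>y. (LINT x|lborel. w x) * h y"])
    show "(\<lambda>(y, x). w (x - y) * h y) \<in> borel_measurable borel" by (simp add: borel_prod[symmetric])
  qed (use h w sh in auto)
  then have "integrable lborel (\<lambda>(y, x). w (x - y) * h y)" by (simp add: integrable_lborel_prod_iff)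
  from integrable_lborel_swap[OF this] show i: "integrable lborel (\<lambda>p. w (fst p - snd p) * h (snd p))" by (simp add: case_prod_beta')
  show "(LINT p|lborel. w (fst p - snd p) * h (snd p)) = (LINT x|lborel. w x) * (LINT x|lborel. h x)"
    unfolding integral_lborel_prod(2)[OF i] by (simp add: sh)
qed

lemma
  fixes u :: "real^'n::finite \<Rightarrow> complex"
  assumes "schwartz u"
  shows schwartz_continuous: "continuous_on UNIV u" and schwartz_integrable: "integrable lborel u"
    and schwartz_bounded: "\<exists>B. \<forall>x. norm (u x) \<le> B" and schwartz_fourier_integrable: "integrable lborel (fourier u)"
    and schwartz_inversion: "u y = complex_of_real (1 / (2 * pi) ^ CARD('n)) * (LINT \<eta>|lborel. wave y \<eta> * fourier u \<eta>)"
proof -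
  interpret schwartz_data u 0 by standard fact
  show c: "continuous_on UNIV u" and i: "integrable lborel u" and b: "\<exists>B. \<forall>x. norm (u x) \<le> B" and f: "integrable lborel (fourier u)"
    by (rule span_continuous span_integrable span_bounded fourier_span_integrable, rule span_u)+
  obtain B where B: "\<And>x. norm (u x) \<le> B" using b by blast
  show "u y = complex_of_real (1 / (2 * pi) ^ CARD('n)) * (LINT \<eta>|lborel. wave y \<eta> * fourier u \<eta>)"
    unfolding fourier_inversion[OF i c B f] by simp
qed

definition window :: "real \<Rightarrow> real^'n::finite \<Rightarrow> (real^'n \<Rightarrow> complex) \<Rightarrow> real^'n \<Rightarrow> complex" where
  "window \<alpha> k u y = complex_of_real (exp (- \<alpha> * (norm (y - k))\<^sup>2)) * u y"

text \<open>The transform of the centred Gaussian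
  \<open>exp (- \<alpha> * (norm y)\<^sup>2)\<close>; a centre \<open>k\<close> enters only as the
  phase \<open>wave_cnj k \<theta>\<close>.\<close>

definition window_hat :: "real \<Rightarrow> real^'n::finite \<Rightarrow> real" where
  "window_hat \<alpha> \<theta> = sqrt (pi / \<alpha>) ^ CARD('n) * exp (- (norm \<theta>)\<^sup>2 / (4 * \<alpha>))"

lemma window_continuous: "continuous_on UNIV u \<Longrightarrow> continuous_on UNIV (window \<alpha> k u)"
  unfolding window_def[abs_def] by (intro continuous_intros)

lemma window_norm_le: "\<alpha> > 0 \<Longrightarrow> norm (window \<alpha> k u y) \<le> norm (u y)"
  unfolding window_def norm_mult by (simp add: mult_left_le_one_le)

lemma window_integrable:
  assumes "\<alpha> > 0" "continuous_on UNIV u" "integrable lborel u"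
  shows "integrable lborel (window \<alpha> k u)"
proof (rule Bochner_Integration.integrable_bound[OF assms(3)])
  show "AE y in lborel. norm (window \<alpha> k u y) \<le> norm (u y)" by (intro AE_I2 window_norm_le[OF assms(1)])
qed (use window_continuous[OF assms(2)] in \<open>simp add: borel_measurable_continuous_onI\<close>)

lemma window_hat_integral:
  assumes "\<alpha> > 0"
  shows "integrable lborel (window_hat \<alpha> :: real^'n::finite \<Rightarrow> real)" "(LINT \<theta>::real^'n|lborel. window_hat \<alpha> \<theta>) = (2 * pi) ^ CARD('n)"
proof -
  have a: "1 / (4 * \<alpha>) > 0" using assms by simp
  have e: "window_hat \<alpha> = (\<lambda>\<theta>::real^'n. sqrt (pi / \<alpha>) ^ CARD('n) * exp (- (1 / (4 * \<alpha>)) * (norm \<theta>)\<^sup>2))"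
    by (simp add: window_hat_def fun_eq_iff)
  show "integrable lborel (window_hat \<alpha> :: real^'n \<Rightarrow> real)"
    unfolding e by (intro integrable_mult_right gaussian_integrable a)
  have "sqrt (pi / \<alpha>) * sqrt (pi / (1 / (4 * \<alpha>))) = 2 * pi"
    using assms by (simp add: real_sqrt_mult[symmetric] real_sqrt_divide[symmetric]) (simp add: real_sqrt_mult)
  then show "(LINT \<theta>::real^'n|lborel. window_hat \<alpha> \<theta>) = (2 * pi) ^ CARD('n)"
    unfolding e integral_mult_right_zero gaussian_integral[OF a] by (simp only: power_mult_distrib[symmetric] DIM_cart DIM_real mult_1_right)
qed

lemma window_hat_nonneg: "\<alpha> > 0 \<Longrightarrow> 0 \<le> window_hat \<alpha> \<theta>"
  by (simp add: window_hat_def)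

lemma window_hat_continuous: "continuous_on UNIV f \<Longrightarrow> continuous_on UNIV (\<lambda>x. window_hat \<alpha> (f x))"
  unfolding window_hat_def divide_inverse by (intro continuous_intros)

lemma gaussian_shift_fourier:
  fixes k \<theta> :: "real^'n::finite"
  assumes "\<alpha> > 0"
  shows "(LINT y|lborel. wave_cnj y \<theta> * complex_of_real (exp (- \<alpha> * (norm (y - k))\<^sup>2)))
     = wave_cnj k \<theta> * complex_of_real (window_hat \<alpha> \<theta>)"
proof -
  let ?f = "\<lambda>y. wave_cnj y \<theta> * complex_of_real (exp (- \<alpha> * (norm (y - k))\<^sup>2))"
  have "(LINT y|lborel. ?f y) = (LINT y|lborel. ?f (k + y))"
    by (rule lborel_integral_shift[symmetric]) measurable
  also have "\<dots> = (LINT y|lborel. wave_cnj k \<theta> * (wave_cnj y \<theta> * complex_of_real (exp (- \<alpha> * (norm y)\<^sup>2))))"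
  proof (rule Bochner_Integration.integral_cong[OF refl])
    fix y
    have "wave_cnj (k + y) \<theta> = wave_cnj k \<theta> * wave_cnj y \<theta>"
      by (simp add: inner_add_left exp_add[symmetric] algebra_simps)
    then show "?f (k + y) = wave_cnj k \<theta> * (wave_cnj y \<theta> * complex_of_real (exp (- \<alpha> * (norm y)\<^sup>2)))"
      by simp
  qed
  also have "\<dots> = wave_cnj k \<theta> * complex_of_real (window_hat \<alpha> \<theta>)"
    unfolding integral_mult_right_zero gaussian_fourier[OF assms] window_hat_def by simp
  finally show ?thesis .
qed

text \<open>Expanding \<open>u\<close> by Fourier inversion and exchanging integrals gives the
  convolution theorem for the window. The centre \<open>k\<close> is confined to the phase, which
  \<open>window_fourier_L2\<close> exploits.\<close>

lemma window_fourier: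
  fixes u :: "real^'n::finite \<Rightarrow> complex"
  assumes \<alpha>: "\<alpha> > 0" and u: "schwartz u"
  shows "fourier (window \<alpha> k u) \<xi> = complex_of_real (1 / (2 * pi) ^ CARD('n)) *
    (LINT \<eta>|lborel. fourier u \<eta> * (wave_cnj k (\<xi> - \<eta>) * complex_of_real (window_hat \<alpha> (\<xi> - \<eta>))))"
proof -
  define c where "c = complex_of_real (1 / (2 * pi) ^ CARD('n))"
  have [measurable]: "fourier u \<in> borel_measurable borel" by (rule borel_measurable_fourier[OF schwartz_integrable[OF u]])
  define f where "f = (\<lambda>y \<eta>. wave_cnj y (\<xi> - \<eta>) * complex_of_real (exp (- \<alpha> * (norm (y - k))\<^sup>2)) * fourier u \<eta>)"
  have f: "integrable (lborel \<Otimes>\<^sub>M lborel) (case_prod f)"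
  proof (rule integrable_pair_lborel_mult[where g = "\<lambda>y. exp (- \<alpha> * (norm (y - k))\<^sup>2)" and h = "\<lambda>\<eta>. norm (fourier u \<eta>)"])
    show "case_prod f \<in> borel_measurable borel" unfolding f_def by (simp add: borel_prod[symmetric])
    show "integrable lborel (\<lambda>y. exp (- \<alpha> * (norm (y - k))\<^sup>2))" by (rule gaussian_shift_integrable[OF \<alpha>])
  qed (use schwartz_fourier_integrable[OF u] in \<open>auto simp: f_def norm_mult\<close>)
  have "wave_cnj y \<xi> * window \<alpha> k u y = c * (LINT \<eta>|lborel. f y \<eta>)" for y
  proof -
    have e: "wave_cnj y (\<xi> - \<eta>) = wave_cnj y \<xi> * wave y \<eta>" for \<eta>
      by (simp add: inner_diff_right exp_add[symmetric] algebra_simps)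
    have "f y = (\<lambda>\<eta>. (wave_cnj y \<xi> * complex_of_real (exp (- \<alpha> * (norm (y - k))\<^sup>2))) * (wave y \<eta> * fourier u \<eta>))"
      unfolding f_def e by (simp only: mult_ac)
    then have "(LINT \<eta>|lborel. f y \<eta>) = (wave_cnj y \<xi> * complex_of_real (exp (- \<alpha> * (norm (y - k))\<^sup>2))) * (LINT \<eta>|lborel. wave y \<eta> * fourier u \<eta>)"
      by (simp only: integral_mult_right_zero)
    moreover have "A * (G * (c * I)) = c * (A * G * I)" for A G I :: complex by (simp only: mult_ac)
    ultimately show ?thesis
      unfolding window_def schwartz_inversion[OF u, of y] c_def[symmetric] by simp
  qed
  then have "fourier (window \<alpha> k u) \<xi> = c * (LINT y|lborel. LINT \<eta>|lborel. f y \<eta>)"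
    unfolding fourier_def[of "window \<alpha> k u"] by (simp only: integral_mult_right_zero)
  also have "(LINT y|lborel. LINT \<eta>|lborel. f y \<eta>) = (LINT \<eta>|lborel. LINT y|lborel. f y \<eta>)"
    by (rule lborel_pair.Fubini_integral[OF f, symmetric])
  also have "\<dots> = (LINT \<eta>|lborel. fourier u \<eta> * (wave_cnj k (\<xi> - \<eta>) * complex_of_real (window_hat \<alpha> (\<xi> - \<eta>))))"
    unfolding f_def integral_mult_left_zero gaussian_shift_fourier[OF \<alpha>] by (simp only: mult_ac)
  finally show ?thesis unfolding c_def .
qed

text \<open>\<open>window_hat\<close> has total mass \<open>(2 * pi) ^ CARD('n)\<close>, just the
  inverse of the factor in front of the convolution. The resulting bound is uniform in
  \<open>\<alpha>\<close> and \<open>k\<close> and makes the superposition of windows absolutely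
  convergent.\<close>

lemma
  fixes u :: "real^'n::finite \<Rightarrow> complex"
  assumes \<alpha>: "\<alpha> > 0" and u: "schwartz u"
  shows window_fourier_integrable: "integrable lborel (fourier (window \<alpha> k u))"
    and window_fourier_L1: "(LINT \<xi>|lborel. norm (fourier (window \<alpha> k u) \<xi>)) \<le> (LINT \<xi>|lborel. norm (fourier u \<xi>))"
proof -
  define c where "c = 1 / (2 * pi) ^ CARD('n)"
  have c: "c \<ge> 0" by (simp add: c_def)
  note cv = convolution_integrable[OF window_hat_integral(1)[OF \<alpha>, where 'n='n] window_hat_nonneg[OF \<alpha>] integrable_norm[OF schwartz_fourier_integrable[OF u]] norm_ge_zero]
  let ?B = "\<lambda>\<xi>. c * (LINT \<eta>|lborel. window_hat \<alpha> (\<xi> - \<eta>) * norm (fourier u \<eta>))"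
  have le: "norm (fourier (window \<alpha> k u) \<xi>) \<le> ?B \<xi>" for \<xi>
  proof -
    have "norm (LINT \<eta>|lborel. fourier u \<eta> * (wave_cnj k (\<xi> - \<eta>) * complex_of_real (window_hat \<alpha> (\<xi> - \<eta>))))
      \<le> (LINT \<eta>|lborel. norm (fourier u \<eta> * (wave_cnj k (\<xi> - \<eta>) * complex_of_real (window_hat \<alpha> (\<xi> - \<eta>)))))"
      by (rule integral_norm_bound)
    also have "\<dots> = (LINT \<eta>|lborel. window_hat \<alpha> (\<xi> - \<eta>) * norm (fourier u \<eta>))"
      by (simp add: norm_mult mult.commute abs_of_nonneg[OF window_hat_nonneg[OF \<alpha>]])
    finally show ?thesis unfolding window_fourier[OF \<alpha> u] norm_mult c_def[symmetric] using c by (simp add: mult_left_mono)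
  qed
  have "integrable lborel (\<lambda>\<xi>. LINT \<eta>|lborel. window_hat \<alpha> (\<xi> - \<eta>) * norm (fourier u \<eta>))"
    using lborel_pair.integrable_fst'[of "\<lambda>p. window_hat \<alpha> (fst p - snd p) * norm (fourier u (snd p))"] cv(1) by (simp add: lborel_prod)
  then have B: "integrable lborel ?B" by (rule integrable_mult_right)
  show i: "integrable lborel (fourier (window \<alpha> k u))"
  proof (rule Bochner_Integration.integrable_bound[OF B])
    show "AE \<xi> in lborel. norm (fourier (window \<alpha> k u) \<xi>) \<le> norm (?B \<xi>)"
      unfolding real_norm_def by (intro AE_I2 order.trans[OF le abs_ge_self])
  qed (use borel_measurable_fourier[OF window_integrable[OF \<alpha> schwartz_continuous[OF u] schwartz_integrable[OF u]]] in simp)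
  have "(LINT \<xi>|lborel. norm (fourier (window \<alpha> k u) \<xi>)) \<le> (LINT \<xi>|lborel. ?B \<xi>)"
    by (rule integral_mono[OF integrable_norm[OF i] B le])
  also have "\<dots> = c * ((2 * pi) ^ CARD('n) * (LINT \<xi>|lborel. norm (fourier u \<xi>)))"
    unfolding integral_mult_right_zero using integral_lborel_prod(1)[OF cv(1)] cv(2) window_hat_integral(2)[OF \<alpha>, where 'n='n] by simp
  finally show "(LINT \<xi>|lborel. norm (fourier (window \<alpha> k u) \<xi>)) \<le> (LINT \<xi>|lborel. norm (fourier u \<xi>))"
    by (simp add: c_def)
qed

lemma window_fourier_measurable:
  fixes u :: "real^'n::finite \<Rightarrow> complex"
  assumes "continuous_on UNIV u"
  shows "(\<lambda>q. fourier (window (fst (fst q)) (snd (fst q)) u) (snd q)) \<in> borel_measurable borel"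
  unfolding fourier_def
proof (rule borel_measurable_integral_param)
  have "continuous_on UNIV (\<lambda>p. wave_cnj (snd p) (snd (fst p)) * window (fst (fst (fst p))) (snd (fst (fst p))) u (snd p))"
    unfolding window_def by (intro continuous_intros continuous_on_compose2[OF assms]) auto
  then show "(\<lambda>(q, y). wave_cnj y (snd q) * window (fst (fst q)) (snd (fst q)) u y) \<in> borel_measurable borel"
    unfolding case_prod_beta' by (rule borel_measurable_continuous_onI)
qed

text \<open>The square of \<open>window_hat\<close> is a Gaussian of exponent
  \<open>1 / (2 * \<alpha>)\<close> with prefactor \<open>(pi / \<alpha>) ^ n\<close>, so its mass
  is a multiple of \<open>(1 / sqrt \<alpha>) ^ n\<close>. Estimating \<open>jap \<theta>\<close> by
  its square adds a second moment, which is larger by a factor of order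
  \<open>\<alpha>\<close>.\<close>

lemma window_hat_square_moment:
  "\<exists>C\<ge>0. \<forall>\<alpha>>0. integrable lborel (\<lambda>\<theta>::real^'n::finite. jap \<theta> * (window_hat \<alpha> \<theta>)\<^sup>2) \<and>
     (LINT \<theta>::real^'n|lborel. jap \<theta> * (window_hat \<alpha> \<theta>)\<^sup>2) \<le> C * (1 + \<alpha>) * (1 / sqrt \<alpha>) ^ CARD('n)"
proof -
  obtain C where C: "C \<ge> 1" "\<And>\<beta>. \<beta> > 0 \<Longrightarrow> integrable lborel (\<lambda>x::real^'n. (sqrt \<beta> * norm x) ^ 2 * exp (- \<beta> * (norm x)\<^sup>2))"
     "\<And>\<beta>. \<beta> > 0 \<Longrightarrow> (LINT x::real^'n|lborel. (sqrt \<beta> * norm x) ^ 2 * exp (- \<beta> * (norm x)\<^sup>2)) \<le> C * (1 / sqrt \<beta>) ^ DIM(real^'n)"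
    using gaussian_moment[of 2, where 'a="real^'n"] by blast
  define n where "n = CARD('n)"
  define D where "D = sqrt pi ^ n + 2 * C"
  have D: "D \<ge> 0" using C by (simp add: D_def)
  show ?thesis
  proof (intro exI[of _ "(pi * sqrt 2) ^ n * D"] conjI allI impI)
    show "0 \<le> (pi * sqrt 2) ^ n * D" using D by simp
    fix \<alpha> :: real assume \<alpha>: "\<alpha> > 0"
    define \<beta> where "\<beta> = 1 / (2 * \<alpha>)"
    have \<beta>: "\<beta> > 0" "2 * \<alpha> * \<beta> = 1" using \<alpha> by (auto simp: \<beta>_def)
    have sq: "(window_hat \<alpha> \<theta>)\<^sup>2 = (pi / \<alpha>) ^ n * exp (- \<beta> * (norm \<theta>)\<^sup>2)" for \<theta> :: "real^'n"
    proof -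
      have "(sqrt (pi / \<alpha>) ^ n)\<^sup>2 = (pi / \<alpha>) ^ n"
        using \<alpha> by (simp add: power_mult[symmetric] mult.commute[of n]) (simp add: power_mult)
      moreover have "(exp (- (norm \<theta>)\<^sup>2 / (4 * \<alpha>)))\<^sup>2 = exp (- \<beta> * (norm \<theta>)\<^sup>2)"
        using \<alpha> by (simp add: exp_double[symmetric] \<beta>_def)
      ultimately show ?thesis by (simp add: window_hat_def power_mult_distrib n_def)
    qed
    let ?B = "\<lambda>\<theta>::real^'n. (pi / \<alpha>) ^ n * (exp (- \<beta> * (norm \<theta>)\<^sup>2) + 2 * \<alpha> * ((sqrt \<beta> * norm \<theta>) ^ 2 * exp (- \<beta> * (norm \<theta>)\<^sup>2)))"
    have B: "integrable lborel ?B" by (intro integrable_mult_right Bochner_Integration.integrable_add gaussian_integrable \<beta> C)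
    have le: "jap \<theta> * (window_hat \<alpha> \<theta>)\<^sup>2 \<le> ?B \<theta>" for \<theta> :: "real^'n"
    proof -
      have "jap \<theta> \<le> (jap \<theta>)\<^sup>2" using jap_ge_1[of \<theta>] by (simp add: power2_eq_square)
      also have "\<dots> = 1 + 2 * \<alpha> * (sqrt \<beta> * norm \<theta>) ^ 2" using \<beta> by (simp add: jap_eq power_mult_distrib)
      finally have "jap \<theta> * (window_hat \<alpha> \<theta>)\<^sup>2 \<le> (1 + 2 * \<alpha> * (sqrt \<beta> * norm \<theta>) ^ 2) * (window_hat \<alpha> \<theta>)\<^sup>2"
        by (intro mult_right_mono) auto
      then show ?thesis unfolding sq by (simp add: algebra_simps)
    qed
    show i: "integrable lborel (\<lambda>\<theta>::real^'n. jap \<theta> * (window_hat \<alpha> \<theta>)\<^sup>2)"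
    proof (rule Bochner_Integration.integrable_bound[OF B])
      have [measurable]: "(window_hat \<alpha> :: real^'n \<Rightarrow> real) \<in> borel_measurable borel"
        using window_hat_continuous[OF continuous_on_id, where \<alpha>=\<alpha>] by (rule borel_measurable_continuous_onI)
      show "(\<lambda>\<theta>::real^'n. jap \<theta> * (window_hat \<alpha> \<theta>)\<^sup>2) \<in> borel_measurable lborel" by measurable
      show "AE \<theta> in lborel. norm (jap \<theta> * (window_hat \<alpha> \<theta>)\<^sup>2) \<le> norm (?B \<theta>)"
      proof (rule AE_I2)
        fix \<theta> :: "real^'n"
        have "norm (jap \<theta> * (window_hat \<alpha> \<theta>)\<^sup>2) = jap \<theta> * (window_hat \<alpha> \<theta>)\<^sup>2" using jap_pos[of \<theta>] by simp
        then show "norm (jap \<theta> * (window_hat \<alpha> \<theta>)\<^sup>2) \<le> norm (?B \<theta>)" using le[of \<theta>] by (simp only: real_norm_def)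
      qed
    qed
    have "(LINT \<theta>::real^'n|lborel. jap \<theta> * (window_hat \<alpha> \<theta>)\<^sup>2) \<le> (LINT \<theta>|lborel. ?B \<theta>)" by (rule integral_mono[OF i B le])
    also have "\<dots> = (pi / \<alpha>) ^ n * (sqrt (pi / \<beta>) ^ n + 2 * \<alpha> * (LINT \<theta>::real^'n|lborel. (sqrt \<beta> * norm \<theta>) ^ 2 * exp (- \<beta> * (norm \<theta>)\<^sup>2)))"
      unfolding integral_mult_right_zero
      by (subst Bochner_Integration.integral_add[OF gaussian_integrable[OF \<beta>(1)] integrable_mult_right[OF C(2)[OF \<beta>(1)]]])
        (simp only: integral_mult_right_zero gaussian_integral[OF \<beta>(1)], simp add: n_def)
    also have "\<dots> \<le> (pi / \<alpha>) ^ n * (sqrt (pi / \<beta>) ^ n + 2 * \<alpha> * (C * (1 / sqrt \<beta>) ^ n))"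
      using C(3)[OF \<beta>(1)] \<alpha> by (intro mult_left_mono add_left_mono) (auto simp: n_def)
    also have "\<dots> = (pi / \<alpha>) ^ n * (1 / sqrt \<beta>) ^ n * (sqrt pi ^ n + 2 * C * \<alpha>)"
    proof -
      have "sqrt (pi / \<beta>) = sqrt pi * (1 / sqrt \<beta>)" by (simp add: real_sqrt_divide)
      then have "sqrt (pi / \<beta>) ^ n = sqrt pi ^ n * (1 / sqrt \<beta>) ^ n" by (simp only: power_mult_distrib)
      moreover have "P * (R * B + 2 * \<alpha> * (C * B)) = P * B * (R + 2 * C * \<alpha>)" for P R B :: real by (simp add: algebra_simps)
      ultimately show ?thesis by (simp only:)
    qed
    also have "\<dots> \<le> (pi / \<alpha>) ^ n * (1 / sqrt \<beta>) ^ n * (D * (1 + \<alpha>))"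
      using \<alpha> \<beta> C by (intro mult_left_mono) (auto simp: D_def algebra_simps)
    also have "(pi / \<alpha>) ^ n * (1 / sqrt \<beta>) ^ n = (pi * sqrt 2) ^ n * (1 / sqrt \<alpha>) ^ n"
    proof -
      have "sqrt \<alpha> * sqrt \<alpha> = \<alpha>" using \<alpha> by simp
      then have "(pi / \<alpha>) * (1 / sqrt \<beta>) = (pi * sqrt 2) * (1 / sqrt \<alpha>)"
        using \<alpha> by (simp add: \<beta>_def real_sqrt_divide real_sqrt_mult divide_simps)
      then show ?thesis by (metis power_mult_distrib)
    qed
    finally show "(LINT \<theta>::real^'n|lborel. jap \<theta> * (window_hat \<alpha> \<theta>)\<^sup>2) \<le> (pi * sqrt 2) ^ n * D * (1 + \<alpha>) * (1 / sqrt \<alpha>) ^ CARD('n)"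
      by (simp add: n_def mult_ac)
  qed
qed

text \<open>For fixed \<open>\<xi>\<close> the transform of the window, as a function of the centre,
  is up to a phase and a constant the Fourier transform of \<open>h \<xi>\<close> at
  \<open>- k\<close>. Plancherel in \<open>k\<close> evaluates the integral over all centres
  exactly. There remains a convolution in the frequency, in which Peetre's inequality moves the
  weight from \<open>\<xi>\<close> to \<open>\<eta>\<close>.\<close>

lemma window_fourier_L2:
  "\<exists>C\<ge>0. \<forall>\<alpha>>0. \<forall>u::real^'n::finite \<Rightarrow> complex. schwartz u \<longrightarrow>
     integrable lborel (\<lambda>k. LINT \<xi>|lborel. (norm (fourier (window \<alpha> k u) \<xi>))\<^sup>2 / jap \<xi>) \<and>
     (LINT k|lborel. LINT \<xi>|lborel. (norm (fourier (window \<alpha> k u) \<xi>))\<^sup>2 / jap \<xi>)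
       \<le> C * (1 + \<alpha>) * (1 / sqrt \<alpha>) ^ CARD('n) * (LINT \<xi>|lborel. (norm (fourier u \<xi>))\<^sup>2 / jap \<xi>)"
proof -
  obtain C where C: "C \<ge> 0" "\<And>\<alpha>. \<alpha> > 0 \<Longrightarrow> integrable lborel (\<lambda>\<theta>::real^'n::finite. jap \<theta> * (window_hat \<alpha> \<theta>)\<^sup>2)"
     "\<And>\<alpha>. \<alpha> > 0 \<Longrightarrow> (LINT \<theta>::real^'n|lborel. jap \<theta> * (window_hat \<alpha> \<theta>)\<^sup>2) \<le> C * (1 + \<alpha>) * (1 / sqrt \<alpha>) ^ CARD('n)"
    using window_hat_square_moment[where 'n='n] by blast
  define c where "c = 1 / (2 * pi) ^ CARD('n)"
  have c: "c > 0" by (simp add: c_def)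
  show ?thesis
  proof (intro exI[of _ "c * 2 * C"] allI impI)
    show "0 \<le> c * 2 * C \<and> (\<forall>\<alpha>>0. \<forall>u::real^'n \<Rightarrow> complex. schwartz u \<longrightarrow>
     integrable lborel (\<lambda>k. LINT \<xi>|lborel. (norm (fourier (window \<alpha> k u) \<xi>))\<^sup>2 / jap \<xi>) \<and>
     (LINT k|lborel. LINT \<xi>|lborel. (norm (fourier (window \<alpha> k u) \<xi>))\<^sup>2 / jap \<xi>)
       \<le> c * 2 * C * (1 + \<alpha>) * (1 / sqrt \<alpha>) ^ CARD('n) * (LINT \<xi>|lborel. (norm (fourier u \<xi>))\<^sup>2 / jap \<xi>))"
    proof (intro conjI allI impI)
      show "0 \<le> c * 2 * C" using c C by simp
      fix \<alpha> :: real and u :: "real^'n \<Rightarrow> complex" assume \<alpha>: "\<alpha> > 0" and u: "schwartz u"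
      have fc: "continuous_on UNIV (fourier u)" by (rule continuous_on_fourier[OF schwartz_integrable[OF u]])
      have fi: "integrable lborel (fourier u)" by (rule schwartz_fourier_integrable[OF u])
      define B where "B = (LINT x|lborel. norm (u x))"
      have fb: "norm (fourier u \<xi>) \<le> B" for \<xi> unfolding B_def by (rule norm_fourier_le)
      note sq = weighted_square_integrable[OF fc fi fb]
      define A where "A = sqrt (pi / \<alpha>) ^ CARD('n)"
      have wA: "window_hat \<alpha> \<theta> \<le> A" for \<theta> :: "real^'n"
        using \<alpha> by (simp add: window_hat_def A_def mult_left_le)
      define h where "h = (\<lambda>\<xi> \<eta>. fourier u \<eta> * complex_of_real (window_hat \<alpha> (\<xi> - \<eta>)))"
      have h1: "continuous_on UNIV (h \<xi>)" for \<xi> unfolding h_def by (intro continuous_intros fc window_hat_continuous)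
      have hn: "norm (h \<xi> \<eta>) \<le> A * norm (fourier u \<eta>)" for \<xi> \<eta>
        using mult_left_mono[OF wA[of "\<xi> - \<eta>"] norm_ge_zero[of "fourier u \<eta>"]] window_hat_nonneg[OF \<alpha>, of "\<xi> - \<eta>"]
        by (simp add: h_def norm_mult mult.commute)
      have A0: "A \<ge> 0" using \<alpha> by (simp add: A_def)
      have h2: "integrable lborel (h \<xi>)" for \<xi>
        by (rule Bochner_Integration.integrable_bound[OF integrable_mult_right[OF integrable_norm[OF fi], of A]])
          (use h1 hn A0 in \<open>auto intro: borel_measurable_continuous_onI\<close>)
      have h3: "norm (h \<xi> \<eta>) \<le> A * B" for \<xi> \<eta>
        using order.trans[OF hn mult_left_mono[OF fb A0]] .
      note pl = plancherel_integrable[OF h2 h1 h3] plancherel[OF h2 h1 h3]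
      have wf: "(norm (fourier (window \<alpha> k u) \<xi>))\<^sup>2 = c\<^sup>2 * (norm (fourier (h \<xi>) (- k)))\<^sup>2" for k \<xi>
      proof -
        have "fourier u \<eta> * (wave_cnj k (\<xi> - \<eta>) * complex_of_real (window_hat \<alpha> (\<xi> - \<eta>)))
          = wave_cnj k \<xi> * (wave_cnj \<eta> (- k) * h \<xi> \<eta>)" for \<eta>
        proof -
          have "wave_cnj k (\<xi> - \<eta>) = wave_cnj k \<xi> * wave_cnj \<eta> (- k)"
            by (simp add: inner_diff_right inner_commute exp_add[symmetric] algebra_simps)
          then show ?thesis by (simp only: h_def mult_ac)
        qed
        then have "fourier (window \<alpha> k u) \<xi> = complex_of_real c * (wave_cnj k \<xi> * fourier (h \<xi>) (- k))"
          unfolding window_fourier[OF \<alpha> u] c_def by (simp only: fourier_def integral_mult_right_zero)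
        then show ?thesis using c by (simp only: norm_mult norm_exp_i norm_of_real power_mult_distrib) simp
      qed
      have k1: "integrable lborel (\<lambda>k. (norm (fourier (window \<alpha> k u) \<xi>))\<^sup>2 / jap \<xi>)"
        "(LINT k|lborel. (norm (fourier (window \<alpha> k u) \<xi>))\<^sup>2 / jap \<xi>) = c * (LINT \<eta>|lborel. (norm (h \<xi> \<eta>))\<^sup>2 / jap \<xi>)" for \<xi>
      proof -
        have i: "integrable lborel (\<lambda>k. (norm (fourier (h \<xi>) (- k)))\<^sup>2)"
          using lborel_integrable_reflect[OF pl(1)[of \<xi>], of 0] by simp
        have "(LINT k|lborel. (norm (fourier (h \<xi>) (- k)))\<^sup>2) = (LINT k|lborel. (norm (fourier (h \<xi>) k))\<^sup>2)"
          using lborel_integral_reflect[of "\<lambda>k. (norm (fourier (h \<xi>) k))\<^sup>2" 0] borel_measurable_integrable[OF pl(1)[of \<xi>]] by simp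
        then have e: "(LINT k|lborel. (norm (fourier (h \<xi>) (- k)))\<^sup>2) = (2 * pi) ^ CARD('n) * (LINT \<eta>|lborel. (norm (h \<xi> \<eta>))\<^sup>2)"
          using pl(2) by simp
        show "integrable lborel (\<lambda>k. (norm (fourier (window \<alpha> k u) \<xi>))\<^sup>2 / jap \<xi>)"
          unfolding wf using i by simp
        have "c * (c * (2 * pi) ^ CARD('n)) = c" by (simp add: c_def)
        then show "(LINT k|lborel. (norm (fourier (window \<alpha> k u) \<xi>))\<^sup>2 / jap \<xi>) = c * (LINT \<eta>|lborel. (norm (h \<xi> \<eta>))\<^sup>2 / jap \<xi>)"
          unfolding wf power2_eq_square[of c] by (simp only: integral_divide_zero integral_mult_right_zero e mult.assoc[symmetric] times_divide_eq_right)
      qed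
      let ?w = "\<lambda>\<theta>::real^'n. jap \<theta> * (window_hat \<alpha> \<theta>)\<^sup>2"
      have wnn: "?w \<theta> \<ge> 0" for \<theta> using jap_pos[of \<theta>] by simp
      have snn: "(norm (fourier u \<eta>))\<^sup>2 / jap \<eta> \<ge> 0" for \<eta> using jap_pos[of \<eta>] by simp
      note cv = convolution_integrable[OF C(2)[OF \<alpha>] wnn sq(2) snn]
      have hle: "(norm (h \<xi> \<eta>))\<^sup>2 / jap \<xi> \<le> 2 * (?w (\<xi> - \<eta>) * ((norm (fourier u \<eta>))\<^sup>2 / jap \<eta>))" for \<xi> \<eta>
      proof -
        have j: "jap \<xi> > 0" "jap \<eta> > 0" by (simp_all add: jap_pos)
        have "jap \<eta> \<le> 2 * jap \<xi> * jap (\<xi> - \<eta>)" using jap_peetre[of \<eta> \<xi>] by (simp add: jap_minus(2)[of \<eta>])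
        then have "1 / jap \<xi> \<le> 2 * jap (\<xi> - \<eta>) / jap \<eta>" using j by (simp add: field_simps)
        then have "(norm (h \<xi> \<eta>))\<^sup>2 * (1 / jap \<xi>) \<le> (norm (h \<xi> \<eta>))\<^sup>2 * (2 * jap (\<xi> - \<eta>) / jap \<eta>)"
          by (rule mult_left_mono) simp
        moreover have "(norm (h \<xi> \<eta>))\<^sup>2 = (norm (fourier u \<eta>))\<^sup>2 * (window_hat \<alpha> (\<xi> - \<eta>))\<^sup>2"
          by (simp add: h_def norm_mult power_mult_distrib)
        ultimately show ?thesis by (simp add: mult_ac)
      qed
      have cv1: "integrable lborel (\<lambda>p. 2 * (?w (fst p - snd p) * ((norm (fourier u (snd p)))\<^sup>2 / jap (snd p))))" by (rule integrable_mult_right[OF cv(1)])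
      have I2: "integrable lborel (\<lambda>p. (norm (h (fst p) (snd p)))\<^sup>2 / jap (fst p))"
      proof (rule Bochner_Integration.integrable_bound[OF cv1])
        have "jap x \<noteq> 0" for x :: "real^'n" using jap_pos[of x] by simp
        then have "continuous_on UNIV (\<lambda>p. (norm (h (fst p) (snd p)))\<^sup>2 / jap (fst p))"
          unfolding h_def by (intro continuous_intros continuous_on_compose2[OF fc] window_hat_continuous) auto
        then show "(\<lambda>p. (norm (h (fst p) (snd p)))\<^sup>2 / jap (fst p)) \<in> borel_measurable lborel"
          by (simp add: borel_measurable_continuous_onI)
        show "AE p in lborel. norm ((norm (h (fst p) (snd p)))\<^sup>2 / jap (fst p)) \<le> norm (2 * (?w (fst p - snd p) * ((norm (fourier u (snd p)))\<^sup>2 / jap (snd p))))"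
        proof (rule AE_I2)
          fix p
          have "norm ((norm (h (fst p) (snd p)))\<^sup>2 / jap (fst p)) = (norm (h (fst p) (snd p)))\<^sup>2 / jap (fst p)" using jap_pos[of "fst p"] by simp
          then show "norm ((norm (h (fst p) (snd p)))\<^sup>2 / jap (fst p)) \<le> norm (2 * (?w (fst p - snd p) * ((norm (fourier u (snd p)))\<^sup>2 / jap (snd p))))"
            using order.trans[OF hle[of "fst p" "snd p"] abs_ge_self] by (simp only: real_norm_def)
        qed
      qed
      have "integrable lborel (\<lambda>\<xi>. LINT \<eta>|lborel. (norm (h \<xi> \<eta>))\<^sup>2 / jap \<xi>)"
        using lborel_pair.integrable_fst'[of "\<lambda>p. (norm (h (fst p) (snd p)))\<^sup>2 / jap (fst p)"] I2 by (simp add: lborel_prod)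
      then have G: "integrable lborel (\<lambda>\<xi>. c * (LINT \<eta>|lborel. (norm (h \<xi> \<eta>))\<^sup>2 / jap \<xi>))" by (rule integrable_mult_right)
      have Gb: "(LINT \<xi>|lborel. c * (LINT \<eta>|lborel. (norm (h \<xi> \<eta>))\<^sup>2 / jap \<xi>)) \<le> c * (2 * (C * (1 + \<alpha>) * (1 / sqrt \<alpha>) ^ CARD('n) * (LINT \<xi>|lborel. (norm (fourier u \<xi>))\<^sup>2 / jap \<xi>)))"
      proof -
        have "(LINT \<xi>|lborel. LINT \<eta>|lborel. (norm (h \<xi> \<eta>))\<^sup>2 / jap \<xi>) = (LINT p|lborel. (norm (h (fst p) (snd p)))\<^sup>2 / jap (fst p))"
          using integral_lborel_prod(1)[OF I2] by simp
        also have "\<dots> \<le> (LINT p|lborel. 2 * (?w (fst p - snd p) * ((norm (fourier u (snd p)))\<^sup>2 / jap (snd p))))"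
          by (rule integral_mono[OF I2 cv1 hle])
        also have "\<dots> = 2 * ((LINT \<theta>|lborel. ?w \<theta>) * (LINT \<xi>|lborel. (norm (fourier u \<xi>))\<^sup>2 / jap \<xi>))"
          unfolding integral_mult_right_zero cv(2) ..
        also have "\<dots> \<le> 2 * (C * (1 + \<alpha>) * (1 / sqrt \<alpha>) ^ CARD('n) * (LINT \<xi>|lborel. (norm (fourier u \<xi>))\<^sup>2 / jap \<xi>))"
          by (intro mult_left_mono mult_right_mono C(3)[OF \<alpha>] Bochner_Integration.integral_nonneg snn) simp
        finally show ?thesis unfolding integral_mult_right_zero using c by (intro mult_left_mono) auto
      qed
      have P: "integrable (lborel \<Otimes>\<^sub>M lborel) (\<lambda>(\<xi>, k). (norm (fourier (window \<alpha> k u) \<xi>))\<^sup>2 / jap \<xi>)"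
      proof (rule integrable_pair_lborel[where g = "\<lambda>\<xi> k. (norm (fourier (window \<alpha> k u) \<xi>))\<^sup>2 / jap \<xi>" and G = "\<lambda>\<xi>. c * (LINT \<eta>|lborel. (norm (h \<xi> \<eta>))\<^sup>2 / jap \<xi>)"])
        have m0: "(\<lambda>q::(real^'n) \<times> (real^'n). ((\<alpha>, snd q), fst q)) \<in> borel \<rightarrow>\<^sub>M borel"
          by (intro borel_measurable_continuous_onI continuous_intros)
        have m: "(\<lambda>q. fourier (window \<alpha> (snd q) u) (fst q)) \<in> borel_measurable borel"
          using measurable_compose[OF m0 window_fourier_measurable[OF schwartz_continuous[OF u]]] by simp
        have j: "(\<lambda>q::(real^'n) \<times> (real^'n). jap (fst q)) \<in> borel_measurable borel"
          by (intro borel_measurable_continuous_onI continuous_intros)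
        show "(\<lambda>(\<xi>, k). (norm (fourier (window \<alpha> k u) \<xi>))\<^sup>2 / jap \<xi>) \<in> borel_measurable borel"
          unfolding case_prod_beta' by (intro borel_measurable_divide borel_measurable_power measurable_compose[OF m borel_measurable_norm] j)
        show "norm ((norm (fourier (window \<alpha> k u) \<xi>))\<^sup>2 / jap \<xi>) \<le> (norm (fourier (window \<alpha> k u) \<xi>))\<^sup>2 / jap \<xi>" for \<xi> k
          using jap_pos[of \<xi>] by simp
        show "(LINT k|lborel. (norm (fourier (window \<alpha> k u) \<xi>))\<^sup>2 / jap \<xi>) \<le> c * (LINT \<eta>|lborel. (norm (h \<xi> \<eta>))\<^sup>2 / jap \<xi>)" for \<xi>
          unfolding k1(2) ..
      qed (rule k1 G)+
      show "integrable lborel (\<lambda>k. LINT \<xi>|lborel. (norm (fourier (window \<alpha> k u) \<xi>))\<^sup>2 / jap \<xi>)"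
        using lborel_pair.integrable_snd[OF P] .
      have "(LINT k|lborel. LINT \<xi>|lborel. (norm (fourier (window \<alpha> k u) \<xi>))\<^sup>2 / jap \<xi>) = (LINT \<xi>|lborel. LINT k|lborel. (norm (fourier (window \<alpha> k u) \<xi>))\<^sup>2 / jap \<xi>)"
        by (rule lborel_pair.Fubini_integral[OF P])
      also have "\<dots> \<le> c * (2 * (C * (1 + \<alpha>) * (1 / sqrt \<alpha>) ^ CARD('n) * (LINT \<xi>|lborel. (norm (fourier u \<xi>))\<^sup>2 / jap \<xi>)))"
        unfolding k1(2) by (rule Gb)
      finally show "(LINT k|lborel. LINT \<xi>|lborel. (norm (fourier (window \<alpha> k u) \<xi>))\<^sup>2 / jap \<xi>)
       \<le> c * 2 * C * (1 + \<alpha>) * (1 / sqrt \<alpha>) ^ CARD('n) * (LINT \<xi>|lborel. (norm (fourier u \<xi>))\<^sup>2 / jap \<xi>)" by (simp only: mult.assoc)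
    qed
  qed
qed

section \<open>Superposition of Gaussian windows\<close>

lemma erlang_integral:
  assumes "l > 0"
  shows "integrable lborel (erlang_density k l)" "(LINT x|lborel. erlang_density k l x) = 1"
proof -
  have "has_bochner_integral lborel (erlang_density k l) 1"
  proof (rule has_bochner_integral_nn_integral)
    show "AE x in lborel. 0 \<le> erlang_density k l x" using assms by (intro AE_I2 erlang_density_nonneg) simp
    show "(\<integral>\<^sup>+ x. ennreal (erlang_density k l x) \<partial>lborel) = ennreal 1"
      using nn_integral_erlang_ith_moment[OF assms, of k 0] by simp
  qed simp_all
  then show "integrable lborel (erlang_density k l)" "(LINT x|lborel. erlang_density k l x) = 1"
    by (auto simp: has_bochner_integral_iff)
qed

text \<open>\<open>localization p x\<close> for \<open>p = (\<alpha>, k)\<close> is normalised so that integrating it over \<open>p\<close> against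
  \<open>exp (-\<alpha>\<bar>y - k\<bar>\<^sup>2)\<close> gives \<open>bessel_weight (x - y) ^ (n + 1)\<close>; the exponent \<open>-2\<alpha>\<bar>x - k\<bar>\<^sup>2\<close> leaves one
  Gaussian for the right-hand factor of the quadratic form and one as cut-off in \<open>x\<close>.\<close>

definition mixing :: "'n::finite itself \<Rightarrow> real \<Rightarrow> real" where
  "mixing _ \<alpha> = erlang_density CARD('n) 1 \<alpha> * sqrt (3 * \<alpha> / pi) ^ CARD('n)"

definition localization :: "real \<times> (real^'n::finite) \<Rightarrow> real^'n \<Rightarrow> real" where
  "localization p x = mixing TYPE('n) (fst p) * exp (- (2 * fst p) * (norm (x - snd p))\<^sup>2)"

lemma mixing_nonneg: "0 \<le> mixing TYPE('n::finite) \<alpha>"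
  by (cases "\<alpha> < 0") (auto simp: mixing_def erlang_density_def)

text \<open>Nonpositive scales, whose Gaussians do not decay, carry weight 0. This settles that case
  in each integral over \<open>p\<close> and allows \<open>\<alpha>\<close> to range over all
  reals.\<close>

lemma mixing_nonpos: "\<alpha> \<le> 0 \<Longrightarrow> mixing TYPE('n::finite) \<alpha> = 0"
  by (cases "\<alpha> < 0") (auto simp: mixing_def erlang_density_def)

lemma mixing_measurable[measurable]: "mixing TYPE('n::finite) \<in> borel_measurable borel"
  unfolding mixing_def[abs_def] by measurable

lemma localization_nonneg: "0 \<le> localization p x"
  by (simp add: localization_def mixing_nonneg)

lemma localization_measurable: "(\<lambda>q. localization (fst q) (snd q)) \<in> borel_measurable borel"
proof -
  have "(\<lambda>q::(real \<times> (real^'n)) \<times> (real^'n). mixing TYPE('n) (fst (fst q))) \<in> borel_measurable borel"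
    by (rule measurable_compose[OF _ mixing_measurable]) (intro borel_measurable_continuous_onI continuous_intros)
  moreover have "(\<lambda>q::(real \<times> (real^'n)) \<times> (real^'n). exp (- (2 * fst (fst q)) * (norm (snd q - snd (fst q)))\<^sup>2)) \<in> borel_measurable borel"
    by (intro borel_measurable_continuous_onI continuous_intros)
  ultimately show ?thesis unfolding localization_def[abs_def] by (rule borel_measurable_times)
qed

lemma localization_measurable2: "(\<lambda>p. localization p x) \<in> borel_measurable borel"
proof -
  have "(\<lambda>p::real \<times> (real^'n). (p, x)) \<in> borel \<rightarrow>\<^sub>M borel" by (intro borel_measurable_continuous_onI continuous_intros)
  from measurable_compose[OF this localization_measurable] show ?thesis by simp
qed

lemma
  fixes x :: "real^'n::finite"
  shows localization_integrable: "integrable lborel (\<lambda>p. localization p x)"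
    and localization_integral: "(LINT p|lborel. localization p x) = sqrt (3 / 2) ^ CARD('n)"
proof -
  let ?f = "\<lambda>\<alpha> k. localization (\<alpha>, k) x"
  have k: "integrable lborel (?f \<alpha>)" "(LINT k|lborel. ?f \<alpha> k) = sqrt (3 / 2) ^ CARD('n) * erlang_density CARD('n) 1 \<alpha>" for \<alpha>
  proof -
    have "integrable lborel (?f \<alpha>) \<and> (LINT k|lborel. ?f \<alpha> k) = sqrt (3 / 2) ^ CARD('n) * erlang_density CARD('n) 1 \<alpha>"
    proof (cases "\<alpha> \<le> 0")
      case True
      then have "erlang_density CARD('n) 1 \<alpha> = 0" by (auto simp: erlang_density_def)
      then show ?thesis using True by (simp add: localization_def mixing_nonpos)
    next
      case False
      then have a: "\<alpha> > 0" "2 * \<alpha> > 0" by auto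
      have e: "?f \<alpha> = (\<lambda>k. mixing TYPE('n) \<alpha> * exp (- (2 * \<alpha>) * (norm (k - x))\<^sup>2))"
        by (simp add: localization_def norm_minus_commute)
      have "sqrt (3 * \<alpha> / pi) * sqrt (pi / (2 * \<alpha>)) = sqrt (3 / 2)"
        unfolding real_sqrt_mult[symmetric] using a by simp
      then have p: "sqrt (3 * \<alpha> / pi) ^ CARD('n) * sqrt (pi / (2 * \<alpha>)) ^ CARD('n) = sqrt (3 / 2) ^ CARD('n)"
        by (simp only: power_mult_distrib[symmetric])
      have "(LINT k::real^'n|lborel. exp (- (2 * \<alpha>) * (norm (k - x))\<^sup>2)) = sqrt (pi / (2 * \<alpha>)) ^ CARD('n)"
        using gaussian_shift_integral[OF a(2), of x] by (simp only: DIM_cart DIM_real mult_1_right)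
      then have "(LINT k|lborel. ?f \<alpha> k) = mixing TYPE('n) \<alpha> * sqrt (pi / (2 * \<alpha>)) ^ CARD('n)"
        unfolding e integral_mult_right_zero by (simp only:)
      also have "\<dots> = sqrt (3 / 2) ^ CARD('n) * erlang_density CARD('n) 1 \<alpha>"
        unfolding mixing_def mult.assoc p by (rule mult.commute)
      finally show ?thesis unfolding e using gaussian_shift_integrable[OF a(2), of x] by simp
    qed
    then show "integrable lborel (?f \<alpha>)" "(LINT k|lborel. ?f \<alpha> k) = sqrt (3 / 2) ^ CARD('n) * erlang_density CARD('n) 1 \<alpha>" by auto
  qed
  have "integrable (lborel \<Otimes>\<^sub>M lborel) (case_prod ?f)"
  proof (rule integrable_pair_lborel[where g = ?f and G = "\<lambda>\<alpha>. sqrt (3 / 2) ^ CARD('n) * erlang_density CARD('n) 1 \<alpha>"])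
    show "case_prod ?f \<in> borel_measurable borel" using localization_measurable2[of x] by (simp add: case_prod_beta')
    show "norm (?f \<alpha> k) \<le> ?f \<alpha> k" for \<alpha> k using localization_nonneg[of "(\<alpha>, k)" x] by simp
  qed (use k erlang_integral[of 1 "CARD('n)"] in auto)
  then show i: "integrable lborel (\<lambda>p. localization p x)" by (simp add: integrable_lborel_prod_iff case_prod_beta')
  show "(LINT p|lborel. localization p x) = sqrt (3 / 2) ^ CARD('n)"
    unfolding integral_lborel_prod(1)[OF i] k(2) using erlang_integral[of 1 "CARD('n)"] by simp
qed

lemma localization_window_integrable:
  fixes x y :: "real^'n::finite"
  shows "integrable lborel (\<lambda>p. localization p x * exp (- fst p * (norm (y - snd p))\<^sup>2))"
proof (rule Bochner_Integration.integrable_bound[OF localization_integrable[of x]])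
  have "(\<lambda>p::real \<times> (real^'n). exp (- fst p * (norm (y - snd p))\<^sup>2)) \<in> borel_measurable borel"
    by (intro borel_measurable_continuous_onI continuous_intros)
  from borel_measurable_times[OF localization_measurable2[of x] this]
  show "(\<lambda>p. localization p x * exp (- fst p * (norm (y - snd p))\<^sup>2)) \<in> borel_measurable lborel" by simp
  show "AE p in lborel. norm (localization p x * exp (- fst p * (norm (y - snd p))\<^sup>2)) \<le> norm (localization p x)"
  proof (rule AE_I2)
    fix p :: "real \<times> (real^'n)"
    show "norm (localization p x * exp (- fst p * (norm (y - snd p))\<^sup>2)) \<le> norm (localization p x)"
    proof (cases "fst p \<le> 0")
      case False
      then have "exp (- fst p * (norm (y - snd p))\<^sup>2) \<le> 1" by simp
      then have "norm (exp (- fst p * (norm (y - snd p))\<^sup>2)) \<le> 1" by simp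
      from mult_left_mono[OF this norm_ge_zero[of "localization p x"]] show ?thesis by (simp only: norm_mult mult_1_right)
    qed (simp add: localization_def mixing_nonpos)
  qed
qed

text \<open>Integrating out \<open>k\<close> leaves
  \<open>exp (- (2 / 3 * \<alpha>) * (norm (x - y))\<^sup>2)\<close>. Multiplied by it, the Erlang
  density of rate 1 becomes that of rate \<open>l\<close> up to the normalisation
  \<open>1 / l ^ Suc CARD('n)\<close>. As Erlang densities have mass 1, this normalisation is the
  value: the Gamma integral in probabilistic form.\<close>

lemma localization_window_integral:
  fixes x y :: "real^'n::finite"
  shows "(LINT p|lborel. localization p x * exp (- fst p * (norm (y - snd p))\<^sup>2)) = bessel_weight (x - y) ^ Suc CARD('n)"
proof -
  define l where "l = 1 + (2 / 3) * (norm (x - y))\<^sup>2"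
  have l: "l > 0" by (simp add: l_def add_pos_nonneg)
  have "(LINT k|lborel. localization (\<alpha>, k) x * exp (- \<alpha> * (norm (y - k))\<^sup>2)) = erlang_density CARD('n) l \<alpha> / l ^ Suc CARD('n)" for \<alpha>
  proof (cases "\<alpha> \<le> 0")
    case True
    then have "erlang_density CARD('n) l \<alpha> = 0" by (auto simp: erlang_density_def)
    then show ?thesis using True by (simp add: localization_def mixing_nonpos)
  next
    case False
    then have a: "\<alpha> > 0" "2 * \<alpha> > 0" by auto
    have "(LINT k|lborel. localization (\<alpha>, k) x * exp (- \<alpha> * (norm (y - k))\<^sup>2))
      = mixing TYPE('n) \<alpha> * (LINT k|lborel. exp (- (2 * \<alpha>) * (norm (x - k))\<^sup>2) * exp (- \<alpha> * (norm (y - k))\<^sup>2))"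
      unfolding localization_def by (simp only: fst_conv snd_conv mult.assoc integral_mult_right_zero)
    also have "\<dots> = mixing TYPE('n) \<alpha> * (sqrt (pi / (3 * \<alpha>)) ^ CARD('n) * exp (- (2 / 3 * \<alpha>) * (norm (x - y))\<^sup>2))"
    proof -
      have "2 * \<alpha> + \<alpha> = 3 * \<alpha>" "2 * \<alpha> * \<alpha> / (3 * \<alpha>) = 2 / 3 * \<alpha>" using a by auto
      then show ?thesis unfolding gaussian_product_integral[OF a(2,1), of x y] by (simp only: DIM_cart DIM_real mult_1_right)
    qed
    also have "\<dots> = erlang_density CARD('n) 1 \<alpha> * (sqrt (3 * \<alpha> / pi) ^ CARD('n) * sqrt (pi / (3 * \<alpha>)) ^ CARD('n)) * exp (- (2 / 3 * \<alpha>) * (norm (x - y))\<^sup>2)"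
      unfolding mixing_def by (simp only: mult.assoc)
    also have "sqrt (3 * \<alpha> / pi) ^ CARD('n) * sqrt (pi / (3 * \<alpha>)) ^ CARD('n) = 1"
    proof -
      have "sqrt (3 * \<alpha> / pi) * sqrt (pi / (3 * \<alpha>)) = 1" unfolding real_sqrt_mult[symmetric] using a by simp
      then show ?thesis by (simp only: power_mult_distrib[symmetric] power_one)
    qed
    also have "erlang_density CARD('n) 1 \<alpha> * 1 * exp (- (2 / 3 * \<alpha>) * (norm (x - y))\<^sup>2) = erlang_density CARD('n) l \<alpha> / l ^ Suc CARD('n)"
    proof -
      have "exp (- \<alpha>) * exp (- (2 / 3 * \<alpha>) * (norm (x - y))\<^sup>2) = exp (- l * \<alpha>)"
        by (simp add: l_def exp_add[symmetric] algebra_simps)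
      then show ?thesis using a l by (simp add: erlang_density_def)
    qed
    finally show ?thesis .
  qed
  moreover have "bessel_weight (x - y) = 1 / l" by (simp add: bessel_weight_def l_def)
  ultimately show ?thesis
    using integral_lborel_prod(1)[OF localization_window_integrable[of x y]] erlang_integral[OF l, of "CARD('n)"]
    by (simp add: power_one_over)
qed

lemma window_fourier_bound:
  fixes u :: "real^'n::finite \<Rightarrow> complex"
  assumes u: "schwartz u" and \<alpha>: "\<alpha> > 0" and b: "\<And>\<xi>. norm (b \<xi>) \<le> K" "continuous_on UNIV b"
  shows "integrable lborel (\<lambda>\<xi>. b \<xi> * fourier (window \<alpha> k u) \<xi>)"
    and "norm (LINT \<xi>|lborel. b \<xi> * fourier (window \<alpha> k u) \<xi>) \<le> K * (LINT \<xi>|lborel. norm (fourier u \<xi>))"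
    and "(LINT \<xi>|lborel. norm (b \<xi> * fourier (window \<alpha> k u) \<xi>)) \<le> K * (LINT \<xi>|lborel. norm (fourier u \<xi>))"
proof -
  let ?w = "fourier (window \<alpha> k u)"
  have K: "K \<ge> 0" using b(1)[of 0] norm_ge_zero order.trans by blast
  have le: "norm (b \<xi> * ?w \<xi>) \<le> K * norm (?w \<xi>)" for \<xi> unfolding norm_mult by (intro mult_right_mono b) simp
  note wi = window_fourier_integrable[OF \<alpha> u, of k]
  have wK: "integrable lborel (\<lambda>\<xi>. K * norm (?w \<xi>))" by (intro integrable_mult_right integrable_norm wi)
  show i: "integrable lborel (\<lambda>\<xi>. b \<xi> * ?w \<xi>)"
  proof (rule Bochner_Integration.integrable_bound[OF wK])
    show "(\<lambda>\<xi>. b \<xi> * ?w \<xi>) \<in> borel_measurable lborel"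
      using borel_measurable_continuous_onI[OF b(2)] borel_measurable_integrable[OF wi] by simp
    show "AE \<xi> in lborel. norm (b \<xi> * ?w \<xi>) \<le> norm (K * norm (?w \<xi>))"
      unfolding real_norm_def by (intro AE_I2 order.trans[OF le abs_ge_self])
  qed
  have "(LINT \<xi>|lborel. norm (b \<xi> * ?w \<xi>)) \<le> (LINT \<xi>|lborel. K * norm (?w \<xi>))"
    by (rule integral_mono[OF integrable_norm[OF i] wK le])
  also have "\<dots> \<le> K * (LINT \<xi>|lborel. norm (fourier u \<xi>))"
    unfolding integral_mult_right_zero by (intro mult_left_mono window_fourier_L1[OF \<alpha> u] K)
  finally show L: "(LINT \<xi>|lborel. norm (b \<xi> * ?w \<xi>)) \<le> K * (LINT \<xi>|lborel. norm (fourier u \<xi>))" .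
  show "norm (LINT \<xi>|lborel. b \<xi> * ?w \<xi>) \<le> K * (LINT \<xi>|lborel. norm (fourier u \<xi>))"
    by (rule order.trans[OF integral_norm_bound L])
qed

text \<open>The superposition of the weight is carried through two integrals. The exchange with
  \<open>y\<close> is dominated by the integrability of \<open>u\<close>, the exchange with
  \<open>\<xi>\<close> by \<open>window_fourier_L1\<close>, whose bound does not depend on
  \<open>p\<close>.\<close>

lemma bessel_window_decomposition:
  fixes u :: "real^'n::finite \<Rightarrow> complex"
  assumes u: "schwartz u" and b: "\<And>\<xi>. norm (b \<xi>) \<le> K" "continuous_on UNIV b"
  shows "integrable lborel (\<lambda>p. complex_of_real (localization p x) * (LINT \<xi>|lborel. b \<xi> * (wave x \<xi> * fourier (window (fst p) (snd p) u) \<xi>)))"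
    and "(LINT \<xi>|lborel. b \<xi> * (wave x \<xi> * fourier (\<lambda>y. complex_of_real (bessel_weight (x - y) ^ Suc CARD('n)) * u y) \<xi>))
      = (LINT p|lborel. complex_of_real (localization p x) * (LINT \<xi>|lborel. b \<xi> * (wave x \<xi> * fourier (window (fst p) (snd p) u) \<xi>)))"
proof -
  have um[measurable]: "u \<in> borel_measurable borel" by (rule borel_measurable_continuous_onI[OF schwartz_continuous[OF u]])
  define e where "e = (\<lambda>\<xi>. wave x \<xi>)"
  define Gs where "Gs = (\<lambda>p y::real^'n. exp (- fst p * (norm (y - snd p))\<^sup>2))"
  have win: "window (fst p) (snd p) u y = complex_of_real (Gs p y) * u y" for p y by (simp add: window_def Gs_def)
  have m1: "(\<lambda>q. Gs (snd q) (fst q)) \<in> borel_measurable borel"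
    unfolding Gs_def by (intro borel_measurable_continuous_onI continuous_intros)
  have m2: "(\<lambda>q::(real^'n) \<times> real \<times> (real^'n). localization (snd q) x) \<in> borel_measurable borel"
    by (rule measurable_compose[OF _ localization_measurable2]) (intro borel_measurable_continuous_onI continuous_intros)
  have fw: "fourier (\<lambda>y. complex_of_real (bessel_weight (x - y) ^ Suc CARD('n)) * u y) \<xi>
     = (LINT p|lborel. complex_of_real (localization p x) * fourier (window (fst p) (snd p) u) \<xi>)" for \<xi>
  proof -
    define f where "f = (\<lambda>y p. wave_cnj y \<xi> * u y * complex_of_real (localization p x * Gs p y))"
    have f: "integrable (lborel \<Otimes>\<^sub>M lborel) (case_prod f)"
    proof (rule integrable_pair_lborel[where g = "\<lambda>y p. norm (u y) * (localization p x * Gs p y)" and G = "\<lambda>y. norm (u y)"])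
      have "(\<lambda>q::(real^'n) \<times> real \<times> (real^'n). wave_cnj (fst q) \<xi> * u (fst q)) \<in> borel_measurable borel"
        by (intro borel_measurable_continuous_onI continuous_intros continuous_on_compose2[OF schwartz_continuous[OF u]]) auto
      moreover have "(\<lambda>q. complex_of_real (localization (snd q) x * Gs (snd q) (fst q))) \<in> borel_measurable borel"
        by (rule measurable_compose[OF borel_measurable_times[OF m2 m1]]) simp
      ultimately show "case_prod f \<in> borel_measurable borel"
        unfolding f_def case_prod_beta' by (rule borel_measurable_times)
      show "norm (f y p) \<le> norm (u y) * (localization p x * Gs p y)" for y p
        unfolding f_def by (simp add: norm_mult localization_nonneg Gs_def)
      show "integrable lborel (\<lambda>p. norm (u y) * (localization p x * Gs p y))" for y
        unfolding Gs_def by (rule integrable_mult_right[OF localization_window_integrable])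
      show "(LINT p|lborel. norm (u y) * (localization p x * Gs p y)) \<le> norm (u y)" for y
      proof -
        have "bessel_weight (x - y) ^ Suc CARD('n) \<le> 1"
          by (rule power_le_one) (simp_all add: bessel_weight_bounds less_imp_le)
        then show ?thesis unfolding integral_mult_right_zero Gs_def localization_window_integral
          by (intro mult_left_le) simp_all
      qed
    qed (intro integrable_norm schwartz_integrable[OF u])
    have "wave_cnj y \<xi> * (complex_of_real (bessel_weight (x - y) ^ Suc CARD('n)) * u y) = (LINT p|lborel. f y p)" for y
      unfolding f_def integral_mult_right_zero integral_complex_of_real Gs_def localization_window_integral by (simp only: mult_ac)
    then have "fourier (\<lambda>y. complex_of_real (bessel_weight (x - y) ^ Suc CARD('n)) * u y) \<xi> = (LINT y|lborel. LINT p|lborel. f y p)"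
      unfolding fourier_def by (simp only:)
    also have "\<dots> = (LINT p|lborel. LINT y|lborel. f y p)" by (rule lborel_pair.Fubini_integral[OF f, symmetric])
    finally have "fourier (\<lambda>y. complex_of_real (bessel_weight (x - y) ^ Suc CARD('n)) * u y) \<xi> = (LINT p|lborel. LINT y|lborel. f y p)" .
    moreover have "(LINT y|lborel. f y p) = complex_of_real (localization p x) * fourier (window (fst p) (snd p) u) \<xi>" for p
    proof -
      have "f y p = complex_of_real (localization p x) * (wave_cnj y \<xi> * window (fst p) (snd p) u y)" for y
        unfolding f_def win by simp
      then show ?thesis unfolding fourier_def integral_mult_right_zero[symmetric] by (simp only:)
    qed
    ultimately show ?thesis by (simp only:)
  qed
  define L where "L = K * (LINT \<xi>|lborel. norm (fourier u \<xi>))"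
  define F where "F = (\<lambda>p \<xi>. complex_of_real (localization p x) * (b \<xi> * (e \<xi> * fourier (window (fst p) (snd p) u) \<xi>)))"
  have be: "norm (b \<xi> * e \<xi>) \<le> K" "continuous_on UNIV (\<lambda>\<xi>. b \<xi> * e \<xi>)" for \<xi>
    using b(1)[of \<xi>] unfolding e_def norm_mult by (simp, intro continuous_intros b)
  have wb: "integrable lborel (\<lambda>\<xi>. b \<xi> * e \<xi> * fourier (window (fst p) (snd p) u) \<xi>)" "(LINT \<xi>|lborel. norm (b \<xi> * e \<xi> * fourier (window (fst p) (snd p) u) \<xi>)) \<le> L" if "fst p > 0" for p
    unfolding L_def by (rule window_fourier_bound(1)[OF u that be], rule window_fourier_bound(3)[OF u that be])
  have F: "integrable (lborel \<Otimes>\<^sub>M lborel) (case_prod F)"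
  proof (rule integrable_pair_lborel[where g = "\<lambda>p \<xi>. localization p x * norm (b \<xi> * e \<xi> * fourier (window (fst p) (snd p) u) \<xi>)" and G = "\<lambda>p. L * localization p x"])
    have l: "(\<lambda>q::(real \<times> (real^'n)) \<times> (real^'n). complex_of_real (localization (fst q) x)) \<in> borel_measurable borel"
      by (rule measurable_compose[OF measurable_compose[OF _ localization_measurable2[of x]]]) (auto intro!: borel_measurable_continuous_onI continuous_intros)
    have be': "(\<lambda>q::(real \<times> (real^'n)) \<times> (real^'n). b (snd q) * e (snd q)) \<in> borel_measurable borel"
      by (intro borel_measurable_continuous_onI continuous_on_compose2[OF be(2)] continuous_intros) auto
    have "(\<lambda>q. complex_of_real (localization (fst q) x) * (b (snd q) * e (snd q) * fourier (window (fst (fst q)) (snd (fst q)) u) (snd q))) \<in> borel_measurable borel"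
      by (rule borel_measurable_times[OF l borel_measurable_times[OF be' window_fourier_measurable[OF schwartz_continuous[OF u]]]])
    then show "case_prod F \<in> borel_measurable borel" unfolding F_def case_prod_beta' by (simp only: mult.assoc)
    show "norm (F p \<xi>) \<le> localization p x * norm (b \<xi> * e \<xi> * fourier (window (fst p) (snd p) u) \<xi>)" for p \<xi>
      unfolding F_def by (simp add: norm_mult localization_nonneg mult.assoc)
    show "integrable lborel (\<lambda>\<xi>. localization p x * norm (b \<xi> * e \<xi> * fourier (window (fst p) (snd p) u) \<xi>))" for p
    proof (cases "fst p > 0")
      case True
      show ?thesis by (intro integrable_mult_right integrable_norm wb True)
    qed (simp add: localization_def mixing_nonpos)
    show "(LINT \<xi>|lborel. localization p x * norm (b \<xi> * e \<xi> * fourier (window (fst p) (snd p) u) \<xi>)) \<le> L * localization p x" for p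
    proof (cases "fst p > 0")
      case True
      from mult_left_mono[OF wb(2)[OF True] localization_nonneg[of p x]] show ?thesis
        unfolding integral_mult_right_zero by (simp only: mult.commute[of L])
    qed (simp add: localization_def mixing_nonpos)
    show "integrable lborel (\<lambda>p. L * localization p x)" by (rule integrable_mult_right[OF localization_integrable])
  qed
  have in_\<xi>: "(LINT \<xi>|lborel. F p \<xi>) = complex_of_real (localization p x) * (LINT \<xi>|lborel. b \<xi> * (e \<xi> * fourier (window (fst p) (snd p) u) \<xi>))" for p
    unfolding F_def by (rule integral_mult_right_zero)
  show "integrable lborel (\<lambda>p. complex_of_real (localization p x) * (LINT \<xi>|lborel. b \<xi> * (wave x \<xi> * fourier (window (fst p) (snd p) u) \<xi>)))"
    using lborel_pair.integrable_fst[OF F] unfolding in_\<xi> e_def .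
  have "b \<xi> * (e \<xi> * fourier (\<lambda>y. complex_of_real (bessel_weight (x - y) ^ Suc CARD('n)) * u y) \<xi>) = (LINT p|lborel. F p \<xi>)" for \<xi>
  proof -
    have "F p \<xi> = (b \<xi> * e \<xi>) * (complex_of_real (localization p x) * fourier (window (fst p) (snd p) u) \<xi>)" for p
      unfolding F_def by (simp only: mult_ac)
    then show ?thesis unfolding fw by (simp only: integral_mult_right_zero mult.assoc)
  qed
  then have "(LINT \<xi>|lborel. b \<xi> * (e \<xi> * fourier (\<lambda>y. complex_of_real (bessel_weight (x - y) ^ Suc CARD('n)) * u y) \<xi>)) = (LINT \<xi>|lborel. LINT p|lborel. F p \<xi>)"
    by (simp only:)
  also have "\<dots> = (LINT p|lborel. LINT \<xi>|lborel. F p \<xi>)" by (rule lborel_pair.Fubini_integral[OF F])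
  finally show "(LINT \<xi>|lborel. b \<xi> * (wave x \<xi> * fourier (\<lambda>y. complex_of_real (bessel_weight (x - y) ^ Suc CARD('n)) * u y) \<xi>))
      = (LINT p|lborel. complex_of_real (localization p x) * (LINT \<xi>|lborel. b \<xi> * (wave x \<xi> * fourier (window (fst p) (snd p) u) \<xi>)))"
    unfolding in_\<xi> e_def .
qed

lemma window_inversion:
  fixes u :: "real^'n::finite \<Rightarrow> complex"
  assumes \<alpha>: "\<alpha> > 0" and u: "schwartz u"
  shows "window \<alpha> k u y = complex_of_real (1 / (2 * pi) ^ CARD('n)) * (LINT \<eta>|lborel. wave y \<eta> * fourier (window \<alpha> k u) \<eta>)"
proof -
  obtain B where B: "\<And>x. norm (u x) \<le> B" using schwartz_bounded[OF u] by blast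
  have "norm (window \<alpha> k u x) \<le> B" for x by (rule order.trans[OF window_norm_le[OF \<alpha>] B])
  from fourier_inversion[where x = y, OF window_integrable[OF \<alpha> schwartz_continuous[OF u] schwartz_integrable[OF u]] window_continuous[OF schwartz_continuous[OF u]] this window_fourier_integrable[OF \<alpha> u]]
  show ?thesis by simp
qed

text \<open>Integration by parts brings in the weight to the power \<open>Suc CARD('n)\<close>, and
  the weight brings in windows of \<open>u\<close>. One Gaussian in \<open>x\<close> is joined to
  \<open>v\<close>, whose window is then expressed by Fourier inversion; this produces
  \<open>c\<close> and the right-hand factor that \<open>localized_garding\<close> expects.\<close>

lemma form_decomposition:
  fixes u v :: "real^'n::finite \<Rightarrow> complex" and a :: "'n symbol"
  assumes u: "schwartz u" and v: "schwartz v" and a: "symbol_bound (2 * Suc CARD('n)) 0 K a"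
  defines "Y \<equiv> \<lambda>p. LINT x|lborel. complex_of_real (exp (- fst p * (norm (x - snd p))\<^sup>2)) *
      ((LINT \<xi>|lborel. wave x \<xi> * (resolvent_op ^^ Suc CARD('n)) a (x, \<xi>) * fourier (window (fst p) (snd p) u) \<xi>)
       * cnj (LINT \<eta>|lborel. wave x \<eta> * fourier (window (fst p) (snd p) v) \<eta>))"
  defines "c \<equiv> 1 / (2 * pi) ^ CARD('n)"
  shows "integrable lborel (\<lambda>p. complex_of_real (c * mixing TYPE('n) (fst p)) * Y p)"
    and "(LINT x|lborel. (LINT \<xi>|lborel. wave x \<xi> * a (x, \<xi>) * fourier u \<xi>) * cnj (v x))
       = (LINT p|lborel. complex_of_real (c * mixing TYPE('n) (fst p)) * Y p)"
proof -
  define b where "b = (resolvent_op ^^ Suc CARD('n)) a"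
  define Kt where "Kt = (real CARD('n) + 1) ^ Suc CARD('n) * K"
  have b: "symbol_bound 0 0 Kt b" unfolding b_def Kt_def by (rule symbol_bound_resolvent_iter) (use a in simp)
  have ab: "norm (b (x, \<xi>)) \<le> Kt" for x \<xi> using symbol_bound_le[OF b, of x \<xi>] by simp
  have ac: "continuous_on UNIV (\<lambda>\<xi>. b (x, \<xi>))" for x by (intro symbol_bound_continuous_comp[OF b] continuous_intros)
  define L where "L = Kt * (LINT \<xi>|lborel. norm (fourier u \<xi>))"
  have L: "0 \<le> L" unfolding L_def by (intro mult_nonneg_nonneg symbol_bound_nonneg[OF b] Bochner_Integration.integral_nonneg) simp
  define \<Phi> where "\<Phi> = (\<lambda>p x. LINT \<xi>|lborel. b (x, \<xi>) * (wave x \<xi> * fourier (window (fst p) (snd p) u) \<xi>))"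
  have \<Phi>b: "norm (\<Phi> p x) \<le> L" if "fst p > 0" for p x
  proof -
    have n: "norm (b (x, \<xi>) * wave x \<xi>) \<le> Kt" for \<xi> using ab[of x \<xi>] by (simp add: norm_mult)
    have "continuous_on UNIV (\<lambda>\<xi>. b (x, \<xi>) * wave x \<xi>)" by (intro continuous_intros ac)
    from window_fourier_bound(2)[OF u that n this] show ?thesis unfolding \<Phi>_def L_def by (simp only: mult.assoc)
  qed
  define T where "T = (\<lambda>x p. complex_of_real (localization p x) * \<Phi> p x * cnj (v x))"
  have \<Phi>m: "(\<lambda>q. \<Phi> (snd q) (fst q)) \<in> borel_measurable borel"
    unfolding \<Phi>_def
  proof (rule borel_measurable_integral_param)
    have "(\<lambda>r::((real^'n) \<times> (real \<times> (real^'n))) \<times> (real^'n). b (fst (fst r), snd r)) \<in> borel_measurable borel"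
      by (intro borel_measurable_continuous_onI symbol_bound_continuous_comp[OF b] continuous_intros)
    moreover have "(\<lambda>r::((real^'n) \<times> (real \<times> (real^'n))) \<times> (real^'n). wave (fst (fst r)) (snd r)) \<in> borel_measurable borel"
      by (intro borel_measurable_continuous_onI continuous_intros)
    moreover have "(\<lambda>r::((real^'n) \<times> (real \<times> (real^'n))) \<times> (real^'n). fourier (window (fst (snd (fst r))) (snd (snd (fst r))) u) (snd r)) \<in> borel_measurable borel"
    proof -
      have "(\<lambda>r::((real^'n) \<times> (real \<times> (real^'n))) \<times> (real^'n). (snd (fst r), snd r)) \<in> borel \<rightarrow>\<^sub>M borel"
        by (intro borel_measurable_continuous_onI continuous_intros)
      from measurable_compose[OF this window_fourier_measurable[OF schwartz_continuous[OF u]]] show ?thesis by simp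
    qed
    ultimately show "(\<lambda>(q, \<xi>). b (fst q, \<xi>) * (wave (fst q) \<xi> * fourier (window (fst (snd q)) (snd (snd q)) u) \<xi>)) \<in> borel_measurable borel"
      unfolding case_prod_beta' by (intro borel_measurable_times)
  qed
  have T: "integrable (lborel \<Otimes>\<^sub>M lborel) (case_prod T)"
  proof (rule integrable_pair_lborel[where g = "\<lambda>x p. (L * norm (v x)) * localization p x" and G = "\<lambda>x. L * norm (v x) * sqrt (3 / 2) ^ CARD('n)"])
    have "(\<lambda>q::(real^'n) \<times> (real \<times> (real^'n)). (snd q, fst q)) \<in> borel \<rightarrow>\<^sub>M borel"
      by (intro borel_measurable_continuous_onI continuous_intros)
    from measurable_compose[OF this localization_measurable]
    have l0: "(\<lambda>q::(real^'n) \<times> (real \<times> (real^'n)). localization (snd q) (fst q)) \<in> borel_measurable borel" by simp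
    have l: "(\<lambda>q::(real^'n) \<times> (real \<times> (real^'n)). complex_of_real (localization (snd q) (fst q))) \<in> borel_measurable borel"
      by (rule measurable_compose[OF l0 borel_measurable_of_real])
    have v': "(\<lambda>q::(real^'n) \<times> (real \<times> (real^'n)). cnj (v (fst q))) \<in> borel_measurable borel"
      by (intro borel_measurable_continuous_onI continuous_intros continuous_on_compose2[OF schwartz_continuous[OF v]]) auto
    show "case_prod T \<in> borel_measurable borel"
      unfolding T_def case_prod_beta' by (rule borel_measurable_times[OF borel_measurable_times[OF l \<Phi>m] v'])
    show "norm (T x p) \<le> (L * norm (v x)) * localization p x" for x p
    proof (cases "fst p > 0")
      case True
      have "norm (T x p) = localization p x * norm (\<Phi> p x) * norm (v x)" by (simp add: T_def norm_mult localization_nonneg)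
      also have "\<dots> \<le> localization p x * L * norm (v x)"
        by (intro mult_left_mono mult_right_mono \<Phi>b[OF True] localization_nonneg) simp
      finally show ?thesis by (simp only: mult_ac)
    qed (simp add: T_def localization_def mixing_nonpos)
    show "integrable lborel (\<lambda>x. L * norm (v x) * sqrt (3 / 2) ^ CARD('n))"
      by (intro integrable_mult_left integrable_mult_right integrable_norm schwartz_integrable[OF v])
  qed (intro integrable_mult_right localization_integrable, simp add: localization_integral)
  have inner: "(LINT x|lborel. T x p) = complex_of_real (c * mixing TYPE('n) (fst p)) * Y p" for p
  proof (cases "fst p > 0")
    case True
    have "T x p = complex_of_real (c * mixing TYPE('n) (fst p)) * (complex_of_real (exp (- fst p * (norm (x - snd p))\<^sup>2)) *
       ((LINT \<xi>|lborel. wave x \<xi> * b (x, \<xi>) * fourier (window (fst p) (snd p) u) \<xi>)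
       * cnj (LINT \<eta>|lborel. wave x \<eta> * fourier (window (fst p) (snd p) v) \<eta>)))" for x
    proof -
      define E where "E = exp (- fst p * (norm (x - snd p))\<^sup>2)"
      define I where "I = (LINT \<eta>|lborel. wave x \<eta> * fourier (window (fst p) (snd p) v) \<eta>)"
      have "complex_of_real E * v x = complex_of_real c * I"
        using window_inversion[OF True v, of "snd p" x] by (simp add: window_def E_def I_def c_def)
      from arg_cong[OF this, of cnj] have w: "complex_of_real E * cnj (v x) = complex_of_real c * cnj I" by simp
      \<comment> \<open>One factor \<open>E\<close> turns \<open>v\<close> into a window, the other
        stays behind as the cut-off in \<open>Y\<close>.\<close>
      have l: "localization p x = mixing TYPE('n) (fst p) * (E * E)"
        by (simp add: localization_def E_def exp_add[symmetric])
      have \<Phi>e: "\<Phi> p x = (LINT \<xi>|lborel. wave x \<xi> * b (x, \<xi>) * fourier (window (fst p) (snd p) u) \<xi>)"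
        unfolding \<Phi>_def by (simp only: mult_ac)
      have "T x p = complex_of_real (mixing TYPE('n) (fst p)) * complex_of_real E * \<Phi> p x * (complex_of_real E * cnj (v x))"
        unfolding T_def l by (simp add: mult_ac)
      also have "\<dots> = complex_of_real (c * mixing TYPE('n) (fst p)) * (complex_of_real E * (\<Phi> p x * cnj I))"
        unfolding w by (simp add: mult_ac)
      finally show ?thesis unfolding \<Phi>e E_def I_def .
    qed
    then show ?thesis unfolding Y_def b_def by (simp only: integral_mult_right_zero)
  qed (simp add: T_def localization_def mixing_nonpos)
  show "integrable lborel (\<lambda>p. complex_of_real (c * mixing TYPE('n) (fst p)) * Y p)"
    using lborel_pair.integrable_snd[OF T] unfolding inner .
  have "(LINT \<xi>|lborel. wave x \<xi> * a (x, \<xi>) * fourier u \<xi>) * cnj (v x) = (LINT p|lborel. T x p)" for x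
  proof -
    interpret schwartz_data u x by standard (rule u)
    have "(LINT \<xi>|lborel. wave x \<xi> * a (x, \<xi>) * fourier u \<xi>) = (LINT \<xi>|lborel. a (x, \<xi>) * Psi u \<xi>)"
      unfolding Psi_def by (simp only: mult_ac)
    also have "\<dots> = (LINT \<xi>|lborel. b (x, \<xi>) * Psi (\<lambda>y. complex_of_real (bessel_weight (x - y) ^ Suc CARD('n)) * u y) \<xi>)"
      unfolding b_def by (rule Psi_resolvent_iter[OF span_u a, symmetric])
    also have "\<dots> = (LINT p|lborel. complex_of_real (localization p x) * \<Phi> p x)"
      unfolding Psi_def \<Phi>_def by (rule bessel_window_decomposition(2)[OF u ab ac])
    finally show ?thesis unfolding T_def by (simp only: integral_mult_left_zero)
  qed
  then have "(LINT x|lborel. (LINT \<xi>|lborel. wave x \<xi> * a (x, \<xi>) * fourier u \<xi>) * cnj (v x)) = (LINT x|lborel. LINT p|lborel. T x p)"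
    by (simp only:)
  also have "\<dots> = (LINT p|lborel. LINT x|lborel. T x p)" by (rule lborel_pair.Fubini_integral[OF T, symmetric])
  finally show "(LINT x|lborel. (LINT \<xi>|lborel. wave x \<xi> * a (x, \<xi>) * fourier u \<xi>) * cnj (v x))
       = (LINT p|lborel. complex_of_real (c * mixing TYPE('n) (fst p)) * Y p)" unfolding inner .
qed

lemma power_le_fact_exp:
  fixes t :: real
  assumes "0 \<le> t"
  shows "t ^ Q \<le> fact Q * exp t"
proof -
  have "(\<Sum>k\<in>{Q}. t ^ k /\<^sub>R fact k) \<le> (\<Sum>k. t ^ k /\<^sub>R fact k)"
    by (rule sum_le_suminf) (use assms summable_exp_generic[of t] in auto)
  then have "t ^ Q / fact Q \<le> exp t" by (simp add: exp_def divide_inverse mult.commute)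
  then show ?thesis by (simp add: divide_le_eq mult.commute)
qed

text \<open>Near 0 the weight vanishes to order \<open>3 n / 2\<close>, more than the
  \<open>n\<close> half powers lost twice, in the localised inequality and in the integral over
  centres. At infinity one half of the exponential absorbs all powers; the other half remains as an
  integrable Erlang density of rate 1/2.\<close>

lemma mixing_moment:
  "\<exists>C\<ge>0. \<forall>\<alpha>>0. mixing TYPE('n::finite) \<alpha> * ((1 + sqrt \<alpha>) ^ N * (1 + (1 / sqrt \<alpha>) ^ CARD('n))) * ((1 + \<alpha>) * (1 / sqrt \<alpha>) ^ CARD('n))
     \<le> C * erlang_density 0 (1/2) \<alpha>"
proof -
  define n where "n = CARD('n)"
  \<comment> \<open>The number of factors \<open>1 + \<alpha>\<close> once
    \<open>sqrt \<alpha>\<close> has been estimated by \<open>1 + \<alpha>\<close>: \<open>N\<close>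
    from the power of \<open>1 + s\<close>, \<open>n\<close> from the bracket with the
    \<open>n\<close>-th powers, and one from \<open>1 + \<alpha>\<close> itself.\<close>
  define Q where "Q = n + N + 1"
  define C where "C = 4 * 2 ^ N * (2 ^ Q * fact Q * exp (1/2 :: real))"
  show ?thesis
  proof (intro exI[of _ C] conjI allI impI)
    show "0 \<le> C" by (simp add: C_def)
    fix \<alpha> :: real assume \<alpha>: "\<alpha> > 0"
    define s where "s = sqrt \<alpha>"
    have s: "s > 0" "s * s = \<alpha>" "s * (1 / s) = 1" "\<alpha> * (1 / s) = s" using \<alpha> by (auto simp: s_def real_div_sqrt)
    have "0 \<le> (s - 1)\<^sup>2" by simp
    then have s1: "s \<le> 1 + \<alpha>" using s by (simp add: power2_eq_square algebra_simps)
    have "sqrt (3 * \<alpha> / pi) = sqrt (3 / pi) * s" by (simp add: s_def real_sqrt_mult real_sqrt_divide)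
    then have "mixing TYPE('n) \<alpha> * (1 / s) ^ n = \<alpha> ^ n * exp (- \<alpha>) / fact n * (sqrt (3 / pi) ^ n * (s * (1 / s)) ^ n)"
      using \<alpha> by (simp add: mixing_def erlang_density_def n_def power_mult_distrib power_divide)
    also have "\<dots> = \<alpha> ^ n * exp (- \<alpha>) * (sqrt (3 / pi) ^ n / fact n)" unfolding s(3) by simp
    also have "\<dots> \<le> \<alpha> ^ n * exp (- \<alpha>) * 1"
    proof (intro mult_left_mono)
      have "sqrt (3 / pi) ^ n \<le> 1" by (rule power_le_one) (use pi_gt3 in auto)
      moreover have "(1::real) \<le> fact n" by (rule fact_ge_1)
      ultimately have "sqrt (3 / pi) ^ n \<le> fact n" by linarith
      then show "sqrt (3 / pi) ^ n / fact n \<le> 1" by simp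
    qed (use \<alpha> in simp)
    finally have m: "mixing TYPE('n) \<alpha> * (1 / s) ^ n \<le> \<alpha> ^ n * exp (- \<alpha>)" by simp
    have "mixing TYPE('n) \<alpha> * ((1 + s) ^ N * (1 + (1 / s) ^ n)) * ((1 + \<alpha>) * (1 / s) ^ n)
       = mixing TYPE('n) \<alpha> * (1 / s) ^ n * ((1 + s) ^ N * (1 + (1 / s) ^ n) * (1 + \<alpha>))" by (simp only: mult_ac)
    also have "\<dots> \<le> \<alpha> ^ n * exp (- \<alpha>) * ((1 + s) ^ N * (1 + (1 / s) ^ n) * (1 + \<alpha>))"
      using s \<alpha> by (intro mult_right_mono m) auto
    also have "\<dots> = exp (- \<alpha>) * ((1 + s) ^ N * (\<alpha> ^ n + (\<alpha> * (1 / s)) ^ n) * (1 + \<alpha>))"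
    proof -
      have "a * e * (t * (1 + b) * d) = e * (t * (a + a * b) * d)" for a b d e t :: real by (simp add: algebra_simps)
      then show ?thesis unfolding power_mult_distrib[of \<alpha>] .
    qed
    also have "\<dots> \<le> exp (- \<alpha>) * ((2 * (1 + \<alpha>)) ^ N * ((1 + \<alpha>) ^ n + (1 + \<alpha>) ^ n) * (1 + \<alpha>))"
      unfolding s(4) using s s1 \<alpha> by (intro mult_left_mono mult_right_mono mult_mono add_mono power_mono) auto
    also have "\<dots> = 2 * 2 ^ N * (exp (- \<alpha>) * (1 + \<alpha>) ^ Q)"
    proof -
      have "e * ((2 * b) ^ N * (b ^ n + b ^ n) * b) = 2 * 2 ^ N * (e * b ^ Q)" for b e :: real
        by (simp add: Q_def power_mult_distrib power_add)
      then show ?thesis .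
    qed
    also have "\<dots> \<le> 2 * 2 ^ N * (exp (- \<alpha>) * (2 ^ Q * (fact Q * exp ((1 + \<alpha>) / 2))))"
    proof -
      have "2 * ((1 + \<alpha>) / 2) = 1 + \<alpha>" by simp
      then have "(1 + \<alpha>) ^ Q = 2 ^ Q * ((1 + \<alpha>) / 2) ^ Q" by (metis power_mult_distrib)
      also have "\<dots> \<le> 2 ^ Q * (fact Q * exp ((1 + \<alpha>) / 2))" using \<alpha> by (intro mult_left_mono power_le_fact_exp) auto
      finally show ?thesis by (intro mult_left_mono) auto
    qed
    also have "\<dots> = C * (1/2 * exp (- \<alpha> / 2))"
    proof -
      have "exp (- \<alpha>) * exp ((1 + \<alpha>) / 2) = exp (1/2) * exp (- \<alpha> / 2)" by (simp add: exp_add[symmetric] field_simps)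
      moreover have "2 * 2 ^ N * (a * (2 ^ Q * (fact Q * b))) = 2 * 2 ^ N * (2 ^ Q * fact Q * (a * b))" for a b :: real by simp
      ultimately show ?thesis by (simp only:) (simp add: C_def)
    qed
    also have "1/2 * exp (- \<alpha> / 2) = erlang_density 0 (1/2) \<alpha>" using \<alpha> by (simp add: erlang_density_def)
    finally show "mixing TYPE('n) \<alpha> * ((1 + sqrt \<alpha>) ^ N * (1 + (1 / sqrt \<alpha>) ^ CARD('n))) * ((1 + \<alpha>) * (1 / sqrt \<alpha>) ^ CARD('n))
     \<le> C * erlang_density 0 (1/2) \<alpha>" unfolding s_def n_def .
  qed
qed

text \<open>Cauchy-Schwarz for the sum of the norms; this is where the size of the matrix enters the
  constants.\<close>

lemma norm_form_le:
  fixes z :: "'m::finite \<Rightarrow> complex" and b :: "'m \<Rightarrow> 'm \<Rightarrow> complex"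
  assumes "\<And>i j. norm (b i j) \<le> D"
  shows "norm (\<Sum>i\<in>UNIV. \<Sum>j\<in>UNIV. b i j * z j * cnj (z i)) \<le> D * real CARD('m) * (\<Sum>i\<in>UNIV. (norm (z i))\<^sup>2)"
proof -
  have D: "0 \<le> D" using assms[of undefined undefined] norm_ge_zero order.trans by blast
  have "norm (\<Sum>i\<in>UNIV. \<Sum>j\<in>UNIV. b i j * z j * cnj (z i)) \<le> (\<Sum>i\<in>UNIV. \<Sum>j\<in>UNIV. D * norm (z j) * norm (z i))"
    by (intro sum_norm_le order.trans[OF norm_sum sum_mono]) (simp add: norm_mult mult_right_mono assms)
  also have "\<dots> = D * (\<Sum>i\<in>UNIV. norm (z i))\<^sup>2"
    by (simp add: power2_eq_square sum_product sum_distrib_left mult_ac)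
  also have "\<dots> \<le> D * ((\<Sum>i\<in>UNIV. (norm (z i))\<^sup>2) * real CARD('m))"
    by (intro mult_left_mono sum_squared_le_sum_of_squares D)
  finally show ?thesis by (simp only: mult_ac)
qed

lemma resolvent_form_lower_bound:
  fixes a :: "'m::finite \<Rightarrow> 'm \<Rightarrow> 'n::finite symbol" and K :: real
  assumes a: "\<And>i j. symbol_bound (2 * J) 0 K (a i j)"
    and pos: "\<And>x \<zeta> z. - (M / jap \<zeta>) * (\<Sum>i\<in>UNIV. (norm (z i))\<^sup>2) \<le> Re (\<Sum>i\<in>UNIV. \<Sum>j\<in>UNIV. a i j (x, \<zeta>) * z j * cnj (z i))"
  shows "- ((M + real CARD('m) * real J * (real CARD('n) + 1) ^ J * K) / jap \<zeta>) * (\<Sum>i\<in>UNIV. (norm (z i))\<^sup>2)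
    \<le> Re (\<Sum>i\<in>UNIV. \<Sum>j\<in>UNIV. (resolvent_op ^^ J) (a i j) (x, \<zeta>) * z j * cnj (z i))"
proof -
  define D where "D = real J * (real CARD('n) + 1) ^ J * K / jap \<zeta>"
  define S where "S = (\<Sum>i\<in>UNIV. (norm (z i))\<^sup>2)"
  define A where "A = (\<Sum>i\<in>UNIV. \<Sum>j\<in>UNIV. a i j (x, \<zeta>) * z j * cnj (z i))"
  define B where "B = (\<Sum>i\<in>UNIV. \<Sum>j\<in>UNIV. ((resolvent_op ^^ J) (a i j) (x, \<zeta>) - a i j (x, \<zeta>)) * z j * cnj (z i))"
  have "norm B \<le> D * real CARD('m) * S"
    unfolding B_def S_def by (rule norm_form_le) (simp only: D_def resolvent_iter_diff[OF a])
  then have "Re B \<ge> - (D * real CARD('m) * S)" using abs_Re_le_cmod[of B] by linarith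
  moreover have "Re A \<ge> - (M / jap \<zeta>) * S" unfolding A_def S_def by (rule pos)
  moreover have "(\<Sum>i\<in>UNIV. \<Sum>j\<in>UNIV. (resolvent_op ^^ J) (a i j) (x, \<zeta>) * z j * cnj (z i)) = A + B"
    unfolding A_def B_def sum.distrib[symmetric] by (simp add: algebra_simps)
  moreover have "- ((M + real CARD('m) * real J * (real CARD('n) + 1) ^ J * K) / jap \<zeta>) * S = - (M / jap \<zeta>) * S - D * real CARD('m) * S"
    by (simp add: D_def add_divide_distrib algebra_simps)
  ultimately show ?thesis unfolding S_def by (simp only: plus_complex.sel)
qed

text \<open>The localised inequality is integrated against the nonnegative weight
  \<open>mixing\<close>: over the centres by \<open>window_fourier_L2\<close>, over the scales by
  \<open>mixing_moment\<close>. The \<open>4 * CARD('n) + 7\<close> derivatives are the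
  \<open>2 * CARD('n) + 5\<close> of the localised inequality and two for each of the
  \<open>Suc CARD('n)\<close> resolvents.\<close>

lemma schwartz_garding:
  "\<exists>C\<ge>0. \<forall>K M (a :: 'm::finite \<Rightarrow> 'm \<Rightarrow> 'n::finite symbol) u.
     (\<forall>i j. symbol_bound (4 * CARD('n) + 7) 0 K (a i j)) \<longrightarrow> 0 \<le> M \<longrightarrow>
     (\<forall>x \<zeta> z. - (M / jap \<zeta>) * (\<Sum>i\<in>UNIV. (norm (z i))\<^sup>2) \<le> Re (\<Sum>i\<in>UNIV. \<Sum>j\<in>UNIV. a i j (x, \<zeta>) * z j * cnj (z i))) \<longrightarrow>
     (\<forall>i. schwartz (u i)) \<longrightarrow>
     - (C * (K + M) * (\<Sum>i\<in>UNIV. LINT \<xi>|lborel. (norm (fourier (u i) \<xi>))\<^sup>2 / jap \<xi>))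
      \<le> Re (\<Sum>i\<in>UNIV. \<Sum>j\<in>UNIV. LINT x|lborel. (LINT \<xi>|lborel. wave x \<xi> * a i j (x, \<xi>) * fourier (u j) \<xi>) * cnj (u i x))"
proof -
  define n where "n = CARD('n)"
  define c where "c = 1 / (2 * pi) ^ CARD('n)"
  have c: "c \<ge> 0" by (simp add: c_def)
  define q where "q = (\<lambda>\<alpha>. (1 + sqrt \<alpha>) ^ (2 * n + 3) * (1 + (1 / sqrt \<alpha>) ^ n))"
  obtain C1 where C1: "C1 \<ge> 0" "\<forall>\<alpha>>0. \<forall>(k::real^'n::finite) K M (s :: 'm::finite \<Rightarrow> 'm \<Rightarrow> 'n symbol) w.
     (\<forall>i j. symbol_bound (2 * CARD('n) + 5) 0 K (s i j)) \<longrightarrow> 0 \<le> M \<longrightarrow>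
     (\<forall>x \<zeta> z. - (M / jap \<zeta>) * (\<Sum>i\<in>UNIV. (norm (z i))\<^sup>2) \<le> Re (\<Sum>i\<in>UNIV. \<Sum>j\<in>UNIV. s i j (x, \<zeta>) * z j * cnj (z i))) \<longrightarrow>
     (\<forall>i. continuous_on UNIV (w i) \<and> integrable lborel (w i) \<and> (\<exists>B. \<forall>x. norm (w i x) \<le> B)) \<longrightarrow>
     - (C1 * (K + M) * (1 + sqrt \<alpha>) ^ (2 * CARD('n) + 3) * (1 + (1 / sqrt \<alpha>) ^ CARD('n)) * (\<Sum>i\<in>UNIV. LINT \<xi>|lborel. (norm (w i \<xi>))\<^sup>2 / jap \<xi>))
      \<le> Re (\<Sum>i\<in>UNIV. \<Sum>j\<in>UNIV. LINT x|lborel. complex_of_real (exp (- \<alpha> * (norm (x - k))\<^sup>2)) *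
            ((LINT \<xi>|lborel. wave x \<xi> * s i j (x, \<xi>) * w j \<xi>) * cnj (LINT \<eta>|lborel. wave x \<eta> * w i \<eta>)))"
    using localized_garding[where 'n='n and 'm='m] by (elim exE conjE) (rule that)
  obtain C2 where C2: "C2 \<ge> 0" "\<forall>\<alpha>>0. \<forall>u::real^'n \<Rightarrow> complex. schwartz u \<longrightarrow>
     integrable lborel (\<lambda>k. LINT \<xi>|lborel. (norm (fourier (window \<alpha> k u) \<xi>))\<^sup>2 / jap \<xi>) \<and>
     (LINT k|lborel. LINT \<xi>|lborel. (norm (fourier (window \<alpha> k u) \<xi>))\<^sup>2 / jap \<xi>)
       \<le> C2 * (1 + \<alpha>) * (1 / sqrt \<alpha>) ^ CARD('n) * (LINT \<xi>|lborel. (norm (fourier u \<xi>))\<^sup>2 / jap \<xi>)"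
    using window_fourier_L2[where 'n='n] by (elim exE conjE) (rule that)
  obtain C4 where C4: "C4 \<ge> 0" "\<forall>\<alpha>>0. mixing TYPE('n) \<alpha> * ((1 + sqrt \<alpha>) ^ (2 * n + 3) * (1 + (1 / sqrt \<alpha>) ^ CARD('n))) * ((1 + \<alpha>) * (1 / sqrt \<alpha>) ^ CARD('n)) \<le> C4 * erlang_density 0 (1/2) \<alpha>"
    using mixing_moment[where 'n='n, of "2 * n + 3"] by (elim exE conjE) (rule that)
  define \<kappa> where "\<kappa> = (real n + 1) ^ Suc n"
  define C3 where "C3 = 1 + \<kappa> + real CARD('m) * real (Suc n) * \<kappa>"
  have \<kappa>: "\<kappa> \<ge> 0" by (simp add: \<kappa>_def)
  have C3: "C3 \<ge> 0" unfolding C3_def using \<kappa> by simp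
  \<comment> \<open>In the constant, \<open>c\<close> stems from the inversion of the right-hand
    window, \<open>C1\<close> from the localised inequality and \<open>C3\<close> from the
    resolvents; \<open>C2\<close> and \<open>C4\<close> come from integrating over centres and
    scales.\<close>
  show ?thesis
  proof (intro exI[of _ "c * C1 * C3 * C2 * C4"] conjI allI impI)
    show "0 \<le> c * C1 * C3 * C2 * C4" using c C1 C2 C3 C4 by simp
    fix K M :: real and a :: "'m \<Rightarrow> 'm \<Rightarrow> 'n symbol" and u :: "'m \<Rightarrow> real^'n \<Rightarrow> complex"
    assume a: "\<forall>i j. symbol_bound (4 * CARD('n) + 7) 0 K (a i j)" and M: "0 \<le> M"
      and pos: "\<forall>x \<zeta> z. - (M / jap \<zeta>) * (\<Sum>i\<in>UNIV. (norm (z i))\<^sup>2) \<le> Re (\<Sum>i\<in>UNIV. \<Sum>j\<in>UNIV. a i j (x, \<zeta>) * z j * cnj (z i))"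
      and u: "\<forall>i. schwartz (u i)"
    have K: "K \<ge> 0" using a symbol_bound_nonneg by blast
    have a2: "symbol_bound (2 * Suc CARD('n)) 0 K (a i j)" for i j
      by (rule symbol_bound_mono[OF a[rule_format, of i j]]) auto
    define s where "s = (\<lambda>i j. (resolvent_op ^^ Suc CARD('n)) (a i j))"
    define M' where "M' = M + real CARD('m) * real (Suc n) * \<kappa> * K"
    have M': "M' \<ge> 0" using M K \<kappa> by (simp add: M'_def)
    have s: "symbol_bound (2 * CARD('n) + 5) 0 (\<kappa> * K) (s i j)" for i j
      unfolding s_def \<kappa>_def n_def
    proof (rule symbol_bound_resolvent_iter)
      have "2 * CARD('n) + 5 + 2 * Suc CARD('n) = 4 * CARD('n) + 7" by simp
      then show "symbol_bound (2 * CARD('n) + 5 + 2 * Suc CARD('n)) 0 K (a i j)" using a by (simp only:)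
    qed
    have spos: "- (M' / jap \<zeta>) * (\<Sum>i\<in>UNIV. (norm (z i))\<^sup>2) \<le> Re (\<Sum>i\<in>UNIV. \<Sum>j\<in>UNIV. s i j (x, \<zeta>) * z j * cnj (z i))" for x \<zeta> z
      unfolding M'_def \<kappa>_def n_def s_def by (rule resolvent_form_lower_bound[OF a2 pos[rule_format]])
    have KM: "\<kappa> * K + M' \<le> C3 * (K + M)"
    proof -
      have "0 \<le> (\<kappa> + real CARD('m) * real (Suc n) * \<kappa>) * M + K" using \<kappa> M K by simp
      then show ?thesis by (simp add: C3_def M'_def algebra_simps)
    qed
    define Y where "Y = (\<lambda>i j (p::real \<times> (real^'n)). LINT x|lborel. complex_of_real (exp (- fst p * (norm (x - snd p))\<^sup>2)) *
      ((LINT \<xi>|lborel. wave x \<xi> * s i j (x, \<xi>) * fourier (window (fst p) (snd p) (u j)) \<xi>)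
       * cnj (LINT \<eta>|lborel. wave x \<eta> * fourier (window (fst p) (snd p) (u i)) \<eta>)))"
    note fd = form_decomposition[OF u[rule_format] u[rule_format] a2]
    have Yi: "integrable lborel (\<lambda>p. complex_of_real (c * mixing TYPE('n) (fst p)) * Y i j p)" for i j
      unfolding c_def Y_def s_def by (rule fd(1))
    have Yf: "(LINT x|lborel. (LINT \<xi>|lborel. wave x \<xi> * a i j (x, \<xi>) * fourier (u j) \<xi>) * cnj (u i x))
       = (LINT p|lborel. complex_of_real (c * mixing TYPE('n) (fst p)) * Y i j p)" for i j
      unfolding c_def Y_def s_def by (rule fd(2))
    define g where "g = (\<lambda>i p. LINT \<xi>|lborel. (norm (fourier (window (fst p) (snd p) (u i)) \<xi>))\<^sup>2 / jap \<xi>)"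
    define E where "E = (\<lambda>\<alpha>. c * C1 * (\<kappa> * K + M') * (mixing TYPE('n) \<alpha> * q \<alpha>))"
    define R where "R = (\<lambda>p. c * mixing TYPE('n) (fst p) * Re (\<Sum>i\<in>UNIV. \<Sum>j\<in>UNIV. Y i j p))"
    define Nm where "Nm = (\<Sum>i\<in>UNIV. LINT \<xi>|lborel. (norm (fourier (u i) \<xi>))\<^sup>2 / jap \<xi>)"
    have jp: "0 \<le> (norm z)\<^sup>2 / jap \<xi>" for z :: complex and \<xi> :: "real^'n" using jap_pos[of \<xi>] by simp
    have g0: "g i p \<ge> 0" for i p unfolding g_def by (intro Bochner_Integration.integral_nonneg jp)
    have Nm0: "Nm \<ge> 0" unfolding Nm_def by (intro sum_nonneg Bochner_Integration.integral_nonneg jp)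
    have KM0: "0 \<le> \<kappa> * K + M'" using \<kappa> K M' by simp
    have q0: "q \<alpha> \<ge> 0" if "\<alpha> > 0" for \<alpha> using that by (simp add: q_def)
    have E0: "E \<alpha> \<ge> 0" for \<alpha>
      by (cases "\<alpha> > 0") (use c C1 KM0 q0 mixing_nonneg[where 'n='n] in \<open>auto simp: E_def mixing_nonpos\<close>)
    have RE: "R p = (\<Sum>i\<in>UNIV. \<Sum>j\<in>UNIV. Re (complex_of_real (c * mixing TYPE('n) (fst p)) * Y i j p))" for p
      unfolding R_def by (simp add: sum_distrib_left)
    have Ri: "integrable lborel R" unfolding RE by (intro Bochner_Integration.integrable_sum integrable_Re Yi)
    have RI: "Re (\<Sum>i\<in>UNIV. \<Sum>j\<in>UNIV. LINT x|lborel. (LINT \<xi>|lborel. wave x \<xi> * a i j (x, \<xi>) * fourier (u j) \<xi>) * cnj (u i x)) = (LINT p|lborel. R p)"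
    proof -
      have "(LINT p|lborel. R p) = (\<Sum>i\<in>UNIV. \<Sum>j\<in>UNIV. LINT p|lborel. Re (complex_of_real (c * mixing TYPE('n) (fst p)) * Y i j p))"
        unfolding RE by (subst Bochner_Integration.integral_sum; (intro Bochner_Integration.integrable_sum integrable_Re Yi)?)+ (rule refl)
      also have "\<dots> = (\<Sum>i\<in>UNIV. \<Sum>j\<in>UNIV. Re (LINT p|lborel. complex_of_real (c * mixing TYPE('n) (fst p)) * Y i j p))"
        by (intro sum.cong refl integral_Re Yi)
      finally show ?thesis unfolding Yf by simp
    qed
    have RB: "- (E (fst p) * (\<Sum>i\<in>UNIV. g i p)) \<le> R p" for p
    proof (cases "fst p > 0")
      case True
      have "- (C1 * (\<kappa> * K + M') * (1 + sqrt (fst p)) ^ (2 * CARD('n) + 3) * (1 + (1 / sqrt (fst p)) ^ CARD('n)) * (\<Sum>i\<in>UNIV. g i p))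
         \<le> Re (\<Sum>i\<in>UNIV. \<Sum>j\<in>UNIV. Y i j p)"
        unfolding g_def Y_def
      proof (rule C1(2)[rule_format, OF True s M' spos])
        fix i
        note sc = schwartz_continuous[OF u[rule_format]] schwartz_integrable[OF u[rule_format]]
        note wi = window_integrable[OF True sc]
        show "continuous_on UNIV (fourier (window (fst p) (snd p) (u i))) \<and> integrable lborel (fourier (window (fst p) (snd p) (u i)))
           \<and> (\<exists>B. \<forall>x. norm (fourier (window (fst p) (snd p) (u i)) x) \<le> B)"
          using norm_fourier_le by (blast intro: continuous_on_fourier wi window_fourier_integrable[OF True u[rule_format]])
      qed
      then have "c * mixing TYPE('n) (fst p) * - (C1 * (\<kappa> * K + M') * (1 + sqrt (fst p)) ^ (2 * CARD('n) + 3) * (1 + (1 / sqrt (fst p)) ^ CARD('n)) * (\<Sum>i\<in>UNIV. g i p)) \<le> R p"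
        unfolding R_def by (intro mult_left_mono mult_nonneg_nonneg c mixing_nonneg)
      then show ?thesis unfolding E_def q_def n_def by (simp only: mult_minus_right mult_ac)
    qed (simp add: E_def R_def mixing_nonpos)
    define G where "G = (\<lambda>\<alpha>. c * C1 * (\<kappa> * K + M') * C2 * Nm * (C4 * erlang_density 0 (1/2) \<alpha>))"
    have gk: "integrable lborel (\<lambda>k. E \<alpha> * (\<Sum>i\<in>UNIV. g i (\<alpha>, k))) \<and> (LINT k|lborel. E \<alpha> * (\<Sum>i\<in>UNIV. g i (\<alpha>, k))) \<le> G \<alpha>" for \<alpha>
    proof (cases "\<alpha> > 0")
      case True
      have i: "integrable lborel (\<lambda>k. g i (\<alpha>, k))" "(LINT k|lborel. g i (\<alpha>, k)) \<le> C2 * (1 + \<alpha>) * (1 / sqrt \<alpha>) ^ CARD('n) * (LINT \<xi>|lborel. (norm (fourier (u i) \<xi>))\<^sup>2 / jap \<xi>)" for i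
        using C2(2)[rule_format, OF True u[rule_format, of i]] by (auto simp: g_def)
      have "(LINT k|lborel. (\<Sum>i\<in>UNIV. g i (\<alpha>, k))) = (\<Sum>i\<in>UNIV. LINT k|lborel. g i (\<alpha>, k))"
        by (rule Bochner_Integration.integral_sum) (rule i)
      also have "\<dots> \<le> C2 * (1 + \<alpha>) * (1 / sqrt \<alpha>) ^ CARD('n) * Nm"
        unfolding Nm_def sum_distrib_left by (intro sum_mono i)
      finally have "E \<alpha> * (LINT k|lborel. (\<Sum>i\<in>UNIV. g i (\<alpha>, k))) \<le> E \<alpha> * (C2 * (1 + \<alpha>) * (1 / sqrt \<alpha>) ^ CARD('n) * Nm)"
        by (rule mult_left_mono[OF _ E0])
      also have "\<dots> = c * C1 * (\<kappa> * K + M') * C2 * Nm * (mixing TYPE('n) \<alpha> * q \<alpha> * ((1 + \<alpha>) * (1 / sqrt \<alpha>) ^ CARD('n)))"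
        unfolding E_def by (simp only: mult_ac)
      also have "\<dots> \<le> G \<alpha>"
        unfolding G_def using C4(2)[rule_format, OF True]
        by (intro mult_left_mono mult_nonneg_nonneg c C1 C2 KM0 Nm0) (simp only: q_def n_def)
      finally have "(LINT k|lborel. E \<alpha> * (\<Sum>i\<in>UNIV. g i (\<alpha>, k))) \<le> G \<alpha>" unfolding integral_mult_right_zero .
      then show ?thesis by (intro conjI integrable_mult_right Bochner_Integration.integrable_sum i)
    next
      case False
      then have "E \<alpha> = 0" by (simp add: E_def mixing_nonpos)
      moreover have "G \<alpha> \<ge> 0" unfolding G_def by (intro mult_nonneg_nonneg c C1 C2 C4 KM0 Nm0 erlang_density_nonneg) simp
      ultimately show ?thesis by simp
    qed
    have Gi: "integrable lborel G" "(LINT \<alpha>|lborel. G \<alpha>) = c * C1 * (\<kappa> * K + M') * C2 * Nm * C4"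
      unfolding G_def using erlang_integral[of "1/2" 0] by simp_all
    have gm: "g i \<in> borel_measurable borel" for i
      unfolding g_def
    proof (rule borel_measurable_integral_param)
      have j: "(\<lambda>q::(real \<times> (real^'n)) \<times> (real^'n). jap (snd q)) \<in> borel_measurable borel"
        by (intro borel_measurable_continuous_onI continuous_intros)
      have w: "(\<lambda>q. norm (fourier (window (fst (fst q)) (snd (fst q)) (u i)) (snd q))) \<in> borel_measurable borel"
        by (rule measurable_compose[OF window_fourier_measurable[OF schwartz_continuous[OF u[rule_format]]] borel_measurable_norm])
      show "(\<lambda>(p, \<xi>). (norm (fourier (window (fst p) (snd p) (u i)) \<xi>))\<^sup>2 / jap \<xi>) \<in> borel_measurable borel"
        unfolding case_prod_beta' by (intro borel_measurable_divide borel_measurable_power w j)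
    qed
    have B: "integrable (lborel \<Otimes>\<^sub>M lborel) (\<lambda>(\<alpha>, k). E \<alpha> * (\<Sum>i\<in>UNIV. g i (\<alpha>, k)))"
    proof (rule integrable_pair_lborel[where g = "\<lambda>\<alpha> k. E \<alpha> * (\<Sum>i\<in>UNIV. g i (\<alpha>, k))" and G = G])
      have E: "E \<in> borel_measurable borel" unfolding E_def q_def by measurable
      have "(fst :: real \<times> (real^'n) \<Rightarrow> real) \<in> borel \<rightarrow>\<^sub>M borel" by (intro borel_measurable_continuous_onI continuous_intros)
      from measurable_compose[OF this E] have Em: "(\<lambda>p::real \<times> (real^'n). E (fst p)) \<in> borel_measurable borel" .
      have "(\<lambda>p. \<Sum>i\<in>UNIV. g i p) \<in> borel_measurable borel" by (rule borel_measurable_sum) (rule gm)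
      with Em have "(\<lambda>p. E (fst p) * (\<Sum>i\<in>UNIV. g i p)) \<in> borel_measurable borel" by (rule borel_measurable_times)
      then show "(\<lambda>(\<alpha>, k). E \<alpha> * (\<Sum>i\<in>UNIV. g i (\<alpha>, k))) \<in> borel_measurable borel" by (simp add: case_prod_beta')
      show "norm (E \<alpha> * (\<Sum>i\<in>UNIV. g i (\<alpha>, k))) \<le> E \<alpha> * (\<Sum>i\<in>UNIV. g i (\<alpha>, k))" for \<alpha> k
        by (simp add: E0 g0 sum_nonneg)
      show "integrable lborel (\<lambda>k. E \<alpha> * (\<Sum>i\<in>UNIV. g i (\<alpha>, k)))" for \<alpha> by (rule gk[THEN conjunct1])
      show "(LINT k|lborel. E \<alpha> * (\<Sum>i\<in>UNIV. g i (\<alpha>, k))) \<le> G \<alpha>" for \<alpha> by (rule gk[THEN conjunct2])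
    qed (rule Gi)
    then have Bi: "integrable lborel (\<lambda>p. E (fst p) * (\<Sum>i\<in>UNIV. g i p))"
      by (simp add: integrable_lborel_prod_iff case_prod_beta')
    have iB: "integrable lborel (\<lambda>\<alpha>. LINT k|lborel. E \<alpha> * (\<Sum>i\<in>UNIV. g i (\<alpha>, k)))"
      using lborel_pair.integrable_fst[OF B] .
    have "(LINT p|lborel. E (fst p) * (\<Sum>i\<in>UNIV. g i p)) \<le> (LINT \<alpha>|lborel. G \<alpha>)"
      unfolding integral_lborel_prod(1)[OF Bi] fst_conv by (rule integral_mono[OF iB Gi(1)]) (rule gk[THEN conjunct2])
    also have "\<dots> = (c * C1 * C2 * C4 * Nm) * (\<kappa> * K + M')" unfolding Gi(2) by (simp only: mult_ac)
    also have "\<dots> \<le> (c * C1 * C2 * C4 * Nm) * (C3 * (K + M))"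
      by (intro mult_left_mono mult_nonneg_nonneg KM c C1 C2 C4 Nm0)
    finally have "- (c * C1 * C3 * C2 * C4 * (K + M) * Nm) \<le> (LINT p|lborel. - (E (fst p) * (\<Sum>i\<in>UNIV. g i p)))"
      by (simp add: mult_ac)
    also have "\<dots> \<le> (LINT p|lborel. R p)"
      by (rule integral_mono[OF Bochner_Integration.integrable_minus[OF Bi] Ri RB])
    finally show "- (c * C1 * C3 * C2 * C4 * (K + M) * (\<Sum>i\<in>UNIV. LINT \<xi>|lborel. (norm (fourier (u i) \<xi>))\<^sup>2 / jap \<xi>))
      \<le> Re (\<Sum>i\<in>UNIV. \<Sum>j\<in>UNIV. LINT x|lborel. (LINT \<xi>|lborel. wave x \<xi> * a i j (x, \<xi>) * fourier (u j) \<xi>) * cnj (u i x))"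
      unfolding RI Nm_def .
  qed
qed

section \<open>Garding's inequality\<close>

lemma psido_schwartz_integrable:
  fixes u v :: "real^'n::finite \<Rightarrow> complex"
  assumes u: "schwartz u" and v: "schwartz v" and a: "symbol_bound 0 0 K a"
  shows "integrable lborel (\<lambda>\<xi>. wave x \<xi> * a (x, \<xi>) * fourier u \<xi>)"
    and "integrable lborel (\<lambda>x. (LINT \<xi>|lborel. wave x \<xi> * a (x, \<xi>) * fourier u \<xi>) * cnj (v x))"
proof -
  note fi = schwartz_fourier_integrable[OF u]
  note fc = continuous_on_fourier[OF schwartz_integrable[OF u]]
  have le: "norm (wave x \<xi> * a (x, \<xi>) * fourier u \<xi>) \<le> K * norm (fourier u \<xi>)" for x \<xi>
    using symbol_bound_le[OF a, of x \<xi>] by (simp add: norm_mult mult_right_mono)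
  have Ki: "integrable lborel (\<lambda>\<xi>. K * norm (fourier u \<xi>))" by (intro integrable_mult_right integrable_norm fi)
  have i: "integrable lborel (\<lambda>\<xi>. wave x \<xi> * a (x, \<xi>) * fourier u \<xi>)" for x
  proof (rule Bochner_Integration.integrable_bound[OF Ki])
    have "continuous_on UNIV (\<lambda>\<xi>. wave x \<xi> * a (x, \<xi>) * fourier u \<xi>)"
      by (intro continuous_intros symbol_bound_continuous_comp[OF a] fc)
    then show "(\<lambda>\<xi>. wave x \<xi> * a (x, \<xi>) * fourier u \<xi>) \<in> borel_measurable lborel"
      by (simp add: borel_measurable_continuous_onI)
    show "AE \<xi> in lborel. norm (wave x \<xi> * a (x, \<xi>) * fourier u \<xi>) \<le> norm (K * norm (fourier u \<xi>))"
      unfolding real_norm_def by (intro AE_I2 order.trans[OF le abs_ge_self])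
  qed
  show "integrable lborel (\<lambda>\<xi>. wave x \<xi> * a (x, \<xi>) * fourier u \<xi>)" by (rule i)
  define I where "I = (\<lambda>x. LINT \<xi>|lborel. wave x \<xi> * a (x, \<xi>) * fourier u \<xi>)"
  define L where "L = (LINT \<xi>|lborel. K * norm (fourier u \<xi>))"
  have Ib: "norm (I x) \<le> L" for x unfolding I_def L_def
    by (rule order.trans[OF integral_norm_bound integral_mono[OF integrable_norm[OF i] Ki le]])
  have Im: "I \<in> borel_measurable borel"
    unfolding I_def
  proof (rule borel_measurable_integral_param)
    have "continuous_on UNIV (\<lambda>q::(real^'n) \<times> (real^'n). wave (fst q) (snd q) * a (fst q, snd q) * fourier u (snd q))"
      by (intro continuous_intros symbol_bound_continuous_comp[OF a] continuous_on_compose2[OF fc]) auto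
    then show "(\<lambda>(x, \<xi>). wave x \<xi> * a (x, \<xi>) * fourier u \<xi>) \<in> borel_measurable borel"
      unfolding case_prod_beta' by (rule borel_measurable_continuous_onI)
  qed
  have "integrable lborel (\<lambda>x. I x * cnj (v x))"
  proof (rule Bochner_Integration.integrable_bound[OF integrable_mult_right[OF integrable_norm[OF schwartz_integrable[OF v]], of L]])
    have "(\<lambda>x. cnj (v x)) \<in> borel_measurable borel"
      by (intro borel_measurable_continuous_onI continuous_intros schwartz_continuous[OF v])
    from borel_measurable_times[OF Im this] show "(\<lambda>x. I x * cnj (v x)) \<in> borel_measurable lborel" by simp
    have "norm (I x * cnj (v x)) \<le> L * norm (v x)" for x
      by (simp add: norm_mult mult_right_mono Ib)
    then show "AE x in lborel. norm (I x * cnj (v x)) \<le> norm (L * norm (v x))"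
      unfolding real_norm_def by (intro AE_I2 order.trans[OF _ abs_ge_self])
  qed
  then show "integrable lborel (\<lambda>x. (LINT \<xi>|lborel. wave x \<xi> * a (x, \<xi>) * fourier u \<xi>) * cnj (v x))"
    unfolding I_def .
qed

lemma psido_eq:
  fixes u :: "real^'n::finite \<Rightarrow> complex"
  shows "(LINT \<xi>|lborel. wave x \<xi> * a (x, \<xi>) * fourier u \<xi>) = complex_of_real ((2 * pi) ^ CARD('n)) * psido a u x"
proof -
  have "(2 * pi) powr (- real CARD('n)) = 1 / (2 * pi) ^ CARD('n)"
    by (simp add: powr_minus powr_realpow divide_inverse)
  then show ?thesis by (simp add: psido_def)
qed

lemma power2_norm_vec: "(norm (x :: complex ^ 'm::finite))\<^sup>2 = (\<Sum>i\<in>UNIV. (norm (x $ i))\<^sup>2)"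
  by (simp add: norm_vec_def L2_set_def sum_nonneg)

text \<open>The multiplier does not depend on the position, so the operator is an inverse Fourier
  transform. Order 0 is Fourier inversion; for order -1/2 Plancherel produces the weight
  \<open>1 / jap \<xi>\<close> in which all estimates above are phrased.\<close>

lemma sobolev_norm_eq:
  fixes u :: "real^'n::finite \<Rightarrow> complex^'m::finite"
  assumes u: "\<And>j. schwartz (\<lambda>x. u x $ j)"
  shows "(sobolev_norm 0 u)\<^sup>2 = (LINT x|lborel. (\<Sum>i\<in>UNIV. (norm (u x $ i))\<^sup>2))"
    and "(2 * pi) ^ CARD('n) * (sobolev_norm (- 1 / 2) u)\<^sup>2 = (\<Sum>i\<in>UNIV. LINT \<xi>|lborel. (norm (fourier (\<lambda>x. u x $ i) \<xi>))\<^sup>2 / jap \<xi>)"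
proof -
  define \<psi> where "\<psi> = (\<lambda>s x j. psido (\<lambda>(y, \<xi>). complex_of_real (jap \<xi> powr s)) (\<lambda>y. u y $ j) x)"
  have sn: "(sobolev_norm s u)\<^sup>2 = (LINT x|lborel. (\<Sum>j\<in>UNIV. (norm (\<psi> s x j))\<^sup>2))" for s
    unfolding sobolev_norm_def L2_norm_def power2_norm_vec vec_lambda_beta \<psi>_def
    by (rule real_sqrt_pow2) (intro Bochner_Integration.integral_nonneg sum_nonneg zero_le_power2)
  have e: "complex_of_real ((2 * pi) ^ CARD('n)) * \<psi> s x j = (LINT \<xi>|lborel. wave x \<xi> * complex_of_real (jap \<xi> powr s) * fourier (\<lambda>y. u y $ j) \<xi>)" for s x j
    unfolding \<psi>_def psido_eq[symmetric] by simp
  have p: "complex_of_real ((2 * pi) ^ CARD('n)) \<noteq> 0" by simp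
  have "\<psi> 0 x j = u x $ j" for x j
  proof -
    have "jap \<xi> powr 0 = 1" for \<xi> :: "real^'n" using jap_pos[of \<xi>] by simp
    then have "complex_of_real ((2 * pi) ^ CARD('n)) * \<psi> 0 x j = complex_of_real ((2 * pi) ^ CARD('n)) * u x $ j"
      unfolding e by (subst schwartz_inversion[OF u]) simp
    then show ?thesis using p by (simp only: mult_cancel_left) simp
  qed
  then show "(sobolev_norm 0 u)\<^sup>2 = (LINT x|lborel. (\<Sum>i\<in>UNIV. (norm (u x $ i))\<^sup>2))"
    unfolding sn by (simp only:)
  define h where "h = (\<lambda>j \<xi>. complex_of_real (jap \<xi> powr (- 1 / 2)) * fourier (\<lambda>y. u y $ j) \<xi>)"
  have jb: "norm (complex_of_real (jap \<xi> powr (- 1 / 2))) \<le> 1" for \<xi> :: "real^'n"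
    using powr_mono[of "- 1 / 2" 0 "jap \<xi>"] jap_ge_1[of \<xi>] by simp
  have hn: "norm (h j \<xi>) \<le> norm (fourier (\<lambda>y. u y $ j) \<xi>)" for j \<xi>
    unfolding h_def norm_mult using mult_right_mono[OF jb norm_ge_zero] by (simp only: mult_1_left)
  have jc: "continuous_on UNIV (\<lambda>\<xi>::real^'n. jap \<xi> powr (- 1 / 2))"
  proof (intro continuous_on_powr continuous_intros)
    show "\<forall>\<xi>\<in>UNIV. jap (\<xi>::real^'n) \<noteq> 0" using jap_pos[where 'a = "real^'n"] by (metis less_irrefl)
  qed
  have h1: "continuous_on UNIV (h j)" for j
    unfolding h_def by (intro continuous_intros jc continuous_on_fourier schwartz_integrable u)
  have h2: "integrable lborel (h j)" for j
  proof (rule Bochner_Integration.integrable_bound[OF schwartz_fourier_integrable[OF u]])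
    show "AE \<xi> in lborel. norm (h j \<xi>) \<le> norm (fourier (\<lambda>y. u y $ j) \<xi>)" by (intro AE_I2 hn)
  qed (use h1 in \<open>simp add: borel_measurable_continuous_onI\<close>)
  have h3: "norm (h j \<xi>) \<le> (LINT x|lborel. norm (u x $ j))" for j \<xi> by (rule order.trans[OF hn norm_fourier_le])
  note pl = plancherel_integrable[OF h2 h1 h3] plancherel[OF h2 h1 h3]
  have \<psi>h: "complex_of_real ((2 * pi) ^ CARD('n)) * \<psi> (- 1 / 2) x j = fourier (h j) (- x)" for x j
    unfolding e fourier_def[of "h j"] unfolding h_def by (simp add: inner_commute mult.assoc)
  have n2: "((2 * pi) ^ CARD('n))\<^sup>2 * (norm (\<psi> (- 1 / 2) x j))\<^sup>2 = (norm (fourier (h j) (- x)))\<^sup>2" for x j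
  proof -
    have "(norm (complex_of_real P * z))\<^sup>2 = P\<^sup>2 * (norm z)\<^sup>2" for P z by (simp add: norm_mult power_mult_distrib)
    then show ?thesis unfolding \<psi>h[symmetric] by (simp only:)
  qed
  have r: "integrable lborel (\<lambda>x. (norm (fourier (h j) (- x)))\<^sup>2)" for j
    using lborel_integrable_reflect[OF pl(1)[of j], of 0] by simp
  have rI: "(LINT x|lborel. (norm (fourier (h j) (- x)))\<^sup>2) = (2 * pi) ^ CARD('n) * (LINT \<xi>|lborel. (norm (h j \<xi>))\<^sup>2)" for j
    using lborel_integral_reflect[of "\<lambda>k. (norm (fourier (h j) k))\<^sup>2" 0] borel_measurable_integrable[OF pl(1)[of j]] pl(2)[of j] by simp
  have hj: "(norm (h j \<xi>))\<^sup>2 = (norm (fourier (\<lambda>x. u x $ j) \<xi>))\<^sup>2 / jap \<xi>" for j \<xi>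
  proof -
    have "jap \<xi> powr (- 1 / 2) * jap \<xi> powr (- 1 / 2) = jap \<xi> powr (- 1 / 2 + - 1 / 2)" by (rule powr_add[symmetric])
    then have "(jap \<xi> powr (- 1 / 2))\<^sup>2 = 1 / jap \<xi>"
      using powr_neg_one[OF jap_pos[of \<xi>]] by (simp add: power2_eq_square)
    then show ?thesis by (simp add: h_def norm_mult power_mult_distrib)
  qed
  have "((2 * pi) ^ CARD('n))\<^sup>2 * (sobolev_norm (- 1 / 2) u)\<^sup>2 = (LINT x|lborel. (\<Sum>j\<in>UNIV. (norm (fourier (h j) (- x)))\<^sup>2))"
    unfolding sn integral_mult_right_zero[symmetric] sum_distrib_left n2 ..
  also have "\<dots> = (\<Sum>j\<in>UNIV. LINT x|lborel. (norm (fourier (h j) (- x)))\<^sup>2)" by (rule Bochner_Integration.integral_sum) (rule r)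
  also have "\<dots> = (2 * pi) ^ CARD('n) * (\<Sum>i\<in>UNIV. LINT \<xi>|lborel. (norm (fourier (\<lambda>x. u x $ i) \<xi>))\<^sup>2 / jap \<xi>)"
    unfolding rI hj sum_distrib_left ..
  finally show "(2 * pi) ^ CARD('n) * (sobolev_norm (- 1 / 2) u)\<^sup>2 = (\<Sum>i\<in>UNIV. LINT \<xi>|lborel. (norm (fourier (\<lambda>x. u x $ i) \<xi>))\<^sup>2 / jap \<xi>)"
    by (simp add: power2_eq_square)
qed

text \<open>The form of the Hermitian part is the mean of the form of \<open>B\<close> and its
  conjugate, hence its real part. The order is tested on nonzero vectors, so \<open>z = 0\<close> is
  a case of its own.\<close>

lemma mat_ge_Re_mat:
  fixes B :: "complex^'m::finite^'m"
  assumes "mat_ge (Re_mat B) (mat (complex_of_real c))"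
  shows "c * (\<Sum>i\<in>UNIV. (norm (z i))\<^sup>2) \<le> Re (\<Sum>i\<in>UNIV. \<Sum>j\<in>UNIV. B $ i $ j * z j * cnj (z i))"
proof (cases "\<forall>i. z i = 0")
  case False
  define v where "v = (\<chi> i. z i)"
  have vz: "v $ i = z i" for i by (simp add: v_def)
  have "v \<noteq> 0" using False by (auto simp: vec_eq_iff vz)
  then have ge: "(\<Sum>i\<in>UNIV. cnj (v $ i) * ((Re_mat B - mat (complex_of_real c)) *v v) $ i) \<in> \<real>\<^sub>\<ge>\<^sub>0"
    using assms by (auto simp: mat_ge_def)
  define Q where "Q = (\<Sum>i\<in>UNIV. \<Sum>j\<in>UNIV. B $ i $ j * z j * cnj (z i))"
  have "cnj Q = (\<Sum>j\<in>UNIV. \<Sum>i\<in>UNIV. cnj (B $ i $ j) * z i * cnj (z j))"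
    unfolding Q_def by (subst sum.swap) (simp add: mult_ac)
  then have Q': "cnj Q = (\<Sum>i\<in>UNIV. \<Sum>j\<in>UNIV. cnj (B $ j $ i) * z j * cnj (z i))" .
  have "cnj (v $ i) * ((Re_mat B - mat (complex_of_real c)) *v v) $ i
     = (1/2) * (\<Sum>j\<in>UNIV. B $ i $ j * z j * cnj (z i)) + (1/2) * (\<Sum>j\<in>UNIV. cnj (B $ j $ i) * z j * cnj (z i)) - complex_of_real (c * (norm (z i))\<^sup>2)" for i
  proof -
    have "((Re_mat B - mat (complex_of_real c)) *v v) $ i = (\<Sum>j\<in>UNIV. Re_mat B $ i $ j * z j) - (\<Sum>j\<in>UNIV. (if i = j then complex_of_real c * z j else 0))"
      unfolding matrix_vector_mult_def vec_lambda_beta sum_subtractf[symmetric]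
      by (rule sum.cong) (auto simp: mat_def vz left_diff_distrib)
    also have "(\<Sum>j\<in>UNIV. (if i = j then complex_of_real c * z j else 0)) = complex_of_real c * z i" by simp
    also have "(\<Sum>j\<in>UNIV. Re_mat B $ i $ j * z j) = (1/2) * (\<Sum>j\<in>UNIV. B $ i $ j * z j) + (1/2) * (\<Sum>j\<in>UNIV. cnj (B $ j $ i) * z j)"
      unfolding sum_distrib_left sum.distrib[symmetric]
      by (rule sum.cong) (auto simp: Re_mat_def adj_def transpose_def map_matrix_def scaleR_conv_of_real[where 'a=complex] algebra_simps)
    finally have e: "((Re_mat B - mat (complex_of_real c)) *v v) $ i = (1/2) * (\<Sum>j\<in>UNIV. B $ i $ j * z j) + (1/2) * (\<Sum>j\<in>UNIV. cnj (B $ j $ i) * z j) - complex_of_real c * z i" .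
    have "complex_of_real ((norm (z i))\<^sup>2) = z i * cnj (z i)" by (rule complex_norm_square)
    then show ?thesis unfolding e vz of_real_mult
      by (simp add: sum_distrib_left sum_distrib_right algebra_simps)
  qed
  then have "(\<Sum>i\<in>UNIV. cnj (v $ i) * ((Re_mat B - mat (complex_of_real c)) *v v) $ i)
     = (1/2) * Q + (1/2) * cnj Q - complex_of_real (c * (\<Sum>i\<in>UNIV. (norm (z i))\<^sup>2))"
    unfolding Q' unfolding Q_def by (simp add: sum_subtractf sum.distrib sum_distrib_left)
  then have "Re (\<Sum>i\<in>UNIV. cnj (v $ i) * ((Re_mat B - mat (complex_of_real c)) *v v) $ i) = Re Q - c * (\<Sum>i\<in>UNIV. (norm (z i))\<^sup>2)"
    by simp
  moreover have "Re (\<Sum>i\<in>UNIV. cnj (v $ i) * ((Re_mat B - mat (complex_of_real c)) *v v) $ i) \<ge> 0"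
    using ge by (simp add: complex_nonneg_Reals_iff)
  ultimately show ?thesis unfolding Q_def by linarith
qed simp

text \<open>The inequality for a single symbol, with the dependence on the seminorms and on
  \<open>r\<close> made explicit. It will be applied to each \<open>\<epsilon>\<close> separately,
  so that only the growth of this explicit constant remains to be discussed for nets.\<close>

lemma operator_garding:
  "\<exists>C\<ge>0. \<forall>(A :: ('n::finite, 'm::finite) matrix_symbol) c r u.
     (\<forall>i j. (\<lambda>z. A z $ i $ j) \<in> S0) \<longrightarrow>
     (\<forall>x \<xi>. r \<le> norm \<xi> \<longrightarrow> mat_ge (Re_mat (A (x, \<xi>))) (mat (complex_of_real c))) \<longrightarrow>
     (\<forall>j. schwartz (\<lambda>x. u x $ j)) \<longrightarrow>
     c * (sobolev_norm 0 u)\<^sup>2 - C * (\<Sum>i\<in>UNIV. \<Sum>j\<in>UNIV. S0_seminorm (4 * CARD('n) + 7) (\<lambda>z. A z $ i $ j)) * (1 + \<bar>r\<bar>) * (sobolev_norm (- 1 / 2) u)\<^sup>2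
       \<le> Re (L2_inner (matrix_psido A u) u)"
proof -
  define l where "l = 4 * CARD('n) + 7"
  obtain C where C: "C \<ge> 0" "\<forall>K M (a :: 'm::finite \<Rightarrow> 'm \<Rightarrow> 'n::finite symbol) u.
     (\<forall>i j. symbol_bound (4 * CARD('n) + 7) 0 K (a i j)) \<longrightarrow> 0 \<le> M \<longrightarrow>
     (\<forall>x \<zeta> z. - (M / jap \<zeta>) * (\<Sum>i\<in>UNIV. (norm (z i))\<^sup>2) \<le> Re (\<Sum>i\<in>UNIV. \<Sum>j\<in>UNIV. a i j (x, \<zeta>) * z j * cnj (z i))) \<longrightarrow>
     (\<forall>i. schwartz (u i)) \<longrightarrow>
     - (C * (K + M) * (\<Sum>i\<in>UNIV. LINT \<xi>|lborel. (norm (fourier (u i) \<xi>))\<^sup>2 / jap \<xi>))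
      \<le> Re (\<Sum>i\<in>UNIV. \<Sum>j\<in>UNIV. LINT x|lborel. (LINT \<xi>|lborel. wave x \<xi> * a i j (x, \<xi>) * fourier (u j) \<xi>) * cnj (u i x))"
    using schwartz_garding[where 'n='n and 'm='m] by (elim exE conjE) (rule that)
  define m where "m = real CARD('m)"
  show ?thesis
  proof (intro exI[of _ "C * (1 + 3 * m)"] conjI allI impI)
    show "0 \<le> C * (1 + 3 * m)" using C by (simp add: m_def)
    fix A :: "('n, 'm) matrix_symbol" and c r :: real and u :: "real^'n \<Rightarrow> complex^'m"
    assume A: "\<forall>i j. (\<lambda>z. A z $ i $ j) \<in> S0"
      and pos: "\<forall>x \<xi>. r \<le> norm \<xi> \<longrightarrow> mat_ge (Re_mat (A (x, \<xi>))) (mat (complex_of_real c))"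
      and u: "\<forall>j. schwartz (\<lambda>x. u x $ j)"
    define a where "a = (\<lambda>i j z. A z $ i $ j)"
    define S where "S = (\<Sum>i\<in>UNIV. \<Sum>j\<in>UNIV. S0_seminorm l (a i j))"
    have sb: "symbol_bound l 0 (S0_seminorm l (a i j)) (a i j)" for i j
      using A by (intro S0_symbol_bound) (simp add: a_def)
    have s0: "0 \<le> S0_seminorm l (a i j)" for i j by (rule symbol_bound_nonneg[OF sb])
    have sS: "S0_seminorm l (a i j) \<le> S" for i j
    proof -
      have "S0_seminorm l (a i j) \<le> (\<Sum>j\<in>UNIV. S0_seminorm l (a i j))" by (rule member_le_sum) (use s0 in auto)
      also have "\<dots> \<le> S" unfolding S_def
        by (rule member_le_sum[where f = "\<lambda>i. \<Sum>j\<in>UNIV. S0_seminorm l (a i j)"]) (use s0 in \<open>auto intro: sum_nonneg\<close>)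
      finally show ?thesis .
    qed
    have aS: "symbol_bound l 0 S (a i j)" for i j by (rule symbol_bound_mono[OF sb _ _ sS]) auto
    have S: "0 \<le> S" using s0 sS order.trans by blast
    define T where "T = m * S"
    have T: "0 \<le> T" using S by (simp add: T_def m_def)
    define Q where "Q = (\<lambda>x \<zeta> z. \<Sum>i\<in>UNIV. \<Sum>j\<in>UNIV. a i j (x, \<zeta>) * z j * cnj (z i))"
    define N2 where "N2 = (\<lambda>z::'m \<Rightarrow> complex. \<Sum>i\<in>UNIV. (norm (z i))\<^sup>2)"
    have N2e: "(\<Sum>i\<in>UNIV. (norm (z i))\<^sup>2) = N2 z" for z by (simp add: N2_def)
    have N2: "0 \<le> N2 z" for z unfolding N2_def by (intro sum_nonneg) simp
    have Qb: "\<bar>Re (Q x \<zeta> z)\<bar> \<le> T * N2 z" for x \<zeta> z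
    proof -
      have "norm (a i j (x, \<zeta>)) \<le> S" for i j using symbol_bound_le[OF aS, of i j x \<zeta>] by simp
      then have "norm (Q x \<zeta> z) \<le> S * m * N2 z" unfolding Q_def N2_def m_def by (rule norm_form_le)
      then have "norm (Q x \<zeta> z) \<le> T * N2 z" unfolding T_def by (simp only: mult.commute)
      then show ?thesis by (rule order.trans[OF abs_Re_le_cmod])
    qed
    have Qc: "c * N2 z \<le> Re (Q x \<zeta> z)" if "r \<le> norm \<zeta>" for x \<zeta> z
      unfolding Q_def N2_def a_def using mat_ge_Re_mat[OF pos[rule_format, OF that]] .
    \<comment> \<open>Frequencies of norm at least \<open>r\<close> exist, and \<open>Qb\<close>
      bounds the form there by \<open>T\<close>; comparing the two on one nonzero vector caps
      \<open>c\<close> from above.\<close>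
    have cT: "c \<le> T"
    proof -
      define \<zeta> :: "real^'n" where "\<zeta> = axis undefined \<bar>r\<bar>"
      have "r \<le> norm \<zeta>" using component_le_norm_cart[of \<zeta> undefined] by (simp add: \<zeta>_def axis_def)
      from Qc[OF this, of "\<lambda>_. 1" 0] Qb[of 0 \<zeta> "\<lambda>_. 1"] have "c * N2 (\<lambda>_. 1) \<le> T * N2 (\<lambda>_. 1)" by linarith
      moreover have "N2 (\<lambda>_. 1) > 0" by (simp add: N2_def)
      ultimately show ?thesis by simp
    qed
    \<comment> \<open>The bound \<open>\<bar>c'\<bar> \<le> T\<close> keeps the symbol estimates of
      the shifted matrix within \<open>S + T\<close>.\<close>
    define c' where "c' = max c (- T)"
    have c': "\<bar>c'\<bar> \<le> T" "c \<le> c'" using cT T by (auto simp: c'_def)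
    have Qc': "c' * N2 z \<le> Re (Q x \<zeta> z)" if "r \<le> norm \<zeta>" for x \<zeta> z
      using Qc[OF that, of z x] Qb[of x \<zeta> z] by (auto simp: c'_def max_def)
    define b where "b = (\<lambda>i j z. a i j z + complex_of_real (if i = j then - c' else 0))"
    have b: "symbol_bound (4 * CARD('n) + 7) 0 (S + T) (b i j)" for i j
    proof -
      have "symbol_bound l 0 (S + norm (complex_of_real (if i = j then - c' else 0))) (b i j)"
        unfolding b_def by (rule symbol_bound_add[OF aS symbol_bound_const])
      then show ?thesis unfolding l_def by (rule symbol_bound_mono) (use c' T in auto)
    qed
    \<comment> \<open>For \<open>norm \<zeta> < r\<close> the shifted form may be as low as
      \<open>- 2 * T\<close>. There \<open>jap \<zeta> \<le> 1 + \<bar>r\<bar>\<close>, so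
      \<open>M / jap \<zeta>\<close> covers the deficit. The absolute value provides for negative
      \<open>r\<close>.\<close>
    define M where "M = 2 * T * (1 + \<bar>r\<bar>)"
    have M: "0 \<le> M" using T by (simp add: M_def)
    have split: "(\<Sum>j\<in>UNIV. (f j + (if i = j then d else 0)) * g j * w) = (\<Sum>j\<in>UNIV. f j * g j * w) + d * g i * w" for f g :: "'m \<Rightarrow> complex" and d w i
    proof -
      have "(f j + (if i = j then d else 0)) * g j * w = f j * g j * w + (if i = j then d * g j * w else 0)" for j
        by (simp add: algebra_simps)
      then show ?thesis by (simp add: sum.distrib)
    qed
    have bQ: "Re (\<Sum>i\<in>UNIV. \<Sum>j\<in>UNIV. b i j (x, \<zeta>) * z j * cnj (z i)) = Re (Q x \<zeta> z) - c' * N2 z" for x \<zeta> z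
    proof -
      have "(\<Sum>i\<in>UNIV. \<Sum>j\<in>UNIV. b i j (x, \<zeta>) * z j * cnj (z i)) = Q x \<zeta> z + (\<Sum>i\<in>UNIV. complex_of_real (- c') * z i * cnj (z i))"
        unfolding b_def Q_def if_distrib[of complex_of_real] of_real_0 split sum.distrib ..
      also have "(\<Sum>i\<in>UNIV. complex_of_real (- c') * z i * cnj (z i)) = complex_of_real (- c' * N2 z)"
        unfolding N2_def of_real_mult of_real_sum complex_norm_square sum_distrib_left by (simp only: mult.assoc)
      finally show ?thesis by simp
    qed
    have bpos: "- (M / jap \<zeta>) * (\<Sum>i\<in>UNIV. (norm (z i))\<^sup>2) \<le> Re (\<Sum>i\<in>UNIV. \<Sum>j\<in>UNIV. b i j (x, \<zeta>) * z j * cnj (z i))" for x \<zeta> z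
      unfolding bQ N2e
    proof (cases "r \<le> norm \<zeta>")
      case True
      have "0 \<le> (M / jap \<zeta>) * N2 z" using M N2 jap_pos[of \<zeta>] by (intro mult_nonneg_nonneg divide_nonneg_pos)
      then show "- (M / jap \<zeta>) * N2 z \<le> Re (Q x \<zeta> z) - c' * N2 z" using Qc'[OF True, of z x] by simp
    next
      case False
      have "jap \<zeta> \<le> 1 + norm \<zeta>" using jap_lipschitz[of \<zeta> 0] by (simp add: jap_eq[of "0::real^'n"])
      then have "jap \<zeta> \<le> 1 + \<bar>r\<bar>" using False by linarith
      then have "2 * T * jap \<zeta> \<le> M" unfolding M_def using T by (intro mult_left_mono) auto
      then have "2 * T \<le> M / jap \<zeta>" using jap_pos[of \<zeta>] by (simp add: pos_le_divide_eq)
      then have "2 * T * N2 z \<le> M / jap \<zeta> * N2 z" by (rule mult_right_mono[OF _ N2])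
      moreover have "c' * N2 z \<le> T * N2 z" using c' by (intro mult_right_mono N2) linarith
      moreover have "- (T * N2 z) \<le> Re (Q x \<zeta> z)" using Qb[of x \<zeta> z] by linarith
      ultimately show "- (M / jap \<zeta>) * N2 z \<le> Re (Q x \<zeta> z) - c' * N2 z" by linarith
    qed
    define v where "v = (\<lambda>i x. u x $ i)"
    have v: "schwartz (v i)" for i using u by (simp add: v_def)
    define P where "P = (2 * pi) ^ CARD('n)"
    have P: "P > 0" by (simp add: P_def)
    define F where "F = (\<lambda>i j. LINT x|lborel. (LINT \<xi>|lborel. wave x \<xi> * b i j (x, \<xi>) * fourier (v j) \<xi>) * cnj (v i x))"
    have G: "- (C * (S + T + M) * (P * (sobolev_norm (- 1 / 2) u)\<^sup>2)) \<le> Re (\<Sum>i\<in>UNIV. \<Sum>j\<in>UNIV. F i j)"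
      using C(2)[rule_format, OF b M bpos v] unfolding F_def P_def sobolev_norm_eq(2)[OF u[rule_format]] v_def .
    have a0: "symbol_bound 0 0 S (a i j)" for i j by (rule symbol_bound_mono[OF aS]) auto
    have one: "symbol_bound 0 0 1 (\<lambda>_::(real^'n) \<times> (real^'n). 1 :: complex)" using symbol_bound_const[of 0 1, where 'a='n] by simp
    define I where "I = (\<lambda>i j. LINT x|lborel. psido (a i j) (v j) x * cnj (v i x))"
    define U where "U = (\<lambda>i j. LINT x|lborel. v j x * cnj (v i x))"
    have pI: "integrable lborel (\<lambda>x. psido (a i j) (v j) x * cnj (v i x))" for i j
    proof -
      have "integrable lborel (\<lambda>x. complex_of_real (1 / P) * ((complex_of_real P * psido (a i j) (v j) x) * cnj (v i x)))"
        using psido_schwartz_integrable(2)[OF v v a0] unfolding psido_eq P_def[symmetric] by (rule integrable_mult_right)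
      then show ?thesis using P by simp
    qed
    have inv: "(LINT \<xi>|lborel. wave x \<xi> * fourier (v j) \<xi>) = complex_of_real P * v j x" for j x
      using schwartz_inversion[OF v, of j x] P by (simp add: P_def)
    have uI: "integrable lborel (\<lambda>x. v j x * cnj (v i x))" for i j
    proof -
      have "integrable lborel (\<lambda>x. complex_of_real (1 / P) * ((complex_of_real P * v j x) * cnj (v i x)))"
        using psido_schwartz_integrable(2)[OF v v one, of j i] unfolding mult_1_right inv by (rule integrable_mult_right)
      then show ?thesis using P by simp
    qed
    have Fe: "F i j = complex_of_real P * (I i j + complex_of_real (if i = j then - c' else 0) * U i j)" for i j
    proof -
      define d where "d = complex_of_real (if i = j then - c' else 0)"
      have "(LINT \<xi>|lborel. wave x \<xi> * b i j (x, \<xi>) * fourier (v j) \<xi>)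
         = complex_of_real P * (psido (a i j) (v j) x + d * v j x)" for x
      proof -
        have "wave x \<xi> * b i j (x, \<xi>) * fourier (v j) \<xi>
          = wave x \<xi> * a i j (x, \<xi>) * fourier (v j) \<xi> + d * (wave x \<xi> * 1 * fourier (v j) \<xi>)" for \<xi>
          by (simp add: b_def d_def algebra_simps)
        then have "(LINT \<xi>|lborel. wave x \<xi> * b i j (x, \<xi>) * fourier (v j) \<xi>)
          = (LINT \<xi>|lborel. wave x \<xi> * a i j (x, \<xi>) * fourier (v j) \<xi>) + d * (LINT \<xi>|lborel. wave x \<xi> * 1 * fourier (v j) \<xi>)"
          by (simp only: integral_mult_right_zero Bochner_Integration.integral_add[OF psido_schwartz_integrable(1)[OF v v a0] integrable_mult_right[OF psido_schwartz_integrable(1)[OF v v one]]])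
        then show ?thesis unfolding psido_eq P_def[symmetric] mult_1_right inv by (simp add: algebra_simps)
      qed
      then have "F i j = (LINT x|lborel. complex_of_real P * (psido (a i j) (v j) x * cnj (v i x) + d * (v j x * cnj (v i x))))"
        unfolding F_def by (simp add: algebra_simps)
      also have "\<dots> = complex_of_real P * (I i j + d * U i j)"
        unfolding I_def U_def by (simp only: integral_mult_right_zero Bochner_Integration.integral_add[OF pI integrable_mult_right[OF uI]])
      finally show ?thesis unfolding d_def .
    qed
    have L2: "L2_inner (matrix_psido A u) u = (\<Sum>i\<in>UNIV. \<Sum>j\<in>UNIV. I i j)"
    proof -
      have "L2_inner (matrix_psido A u) u = (LINT x|lborel. (\<Sum>i\<in>UNIV. \<Sum>j\<in>UNIV. psido (a i j) (v j) x * cnj (v i x)))"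
        unfolding L2_inner_def matrix_psido_def a_def v_def by (simp add: sum_distrib_right)
      also have "\<dots> = (\<Sum>i\<in>UNIV. \<Sum>j\<in>UNIV. I i j)"
        unfolding I_def by (simp add: Bochner_Integration.integral_sum Bochner_Integration.integrable_sum pI)
      finally show ?thesis .
    qed
    have s0: "(\<Sum>i\<in>UNIV. U i i) = complex_of_real ((sobolev_norm 0 u)\<^sup>2)"
    proof -
      have "(\<Sum>i\<in>UNIV. U i i) = (LINT x|lborel. (\<Sum>i\<in>UNIV. v i x * cnj (v i x)))"
        unfolding U_def by (rule Bochner_Integration.integral_sum[symmetric]) (rule uI)
      also have "\<dots> = (LINT x|lborel. complex_of_real (\<Sum>i\<in>UNIV. (norm (u x $ i))\<^sup>2))"
        unfolding of_real_sum complex_norm_square v_def ..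
      finally show ?thesis unfolding integral_complex_of_real sobolev_norm_eq(1)[OF u[rule_format]] .
    qed
    have "(\<Sum>i\<in>UNIV. \<Sum>j\<in>UNIV. F i j) = complex_of_real P * ((\<Sum>i\<in>UNIV. \<Sum>j\<in>UNIV. I i j) + (\<Sum>i\<in>UNIV. complex_of_real (- c') * U i i))"
    proof -
      have "(\<Sum>j\<in>UNIV. complex_of_real (if i = j then - c' else 0) * U i j) = complex_of_real (- c') * U i i" for i
      proof -
        have "complex_of_real (if i = j then - c' else 0) * U i j = (if i = j then complex_of_real (- c') * U i j else 0)" for j by simp
        then show ?thesis by (simp only: sum.delta') simp
      qed
      then show ?thesis unfolding Fe sum_distrib_left[symmetric] sum.distrib by (simp only: sum_distrib_left)
    qed
    also have "\<dots> = complex_of_real P * (L2_inner (matrix_psido A u) u + complex_of_real (- c' * (sobolev_norm 0 u)\<^sup>2))"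
      unfolding L2 sum_distrib_left[symmetric] s0 of_real_mult ..
    finally have "Re (\<Sum>i\<in>UNIV. \<Sum>j\<in>UNIV. F i j) = P * (Re (L2_inner (matrix_psido A u) u) - c' * (sobolev_norm 0 u)\<^sup>2)"
      by simp
    with G have "P * - (C * (S + T + M) * (sobolev_norm (- 1 / 2) u)\<^sup>2) \<le> P * (Re (L2_inner (matrix_psido A u) u) - c' * (sobolev_norm 0 u)\<^sup>2)"
      by (simp add: mult_ac)
    then have main: "- (C * (S + T + M) * (sobolev_norm (- 1 / 2) u)\<^sup>2) \<le> Re (L2_inner (matrix_psido A u) u) - c' * (sobolev_norm 0 u)\<^sup>2"
      by (rule mult_left_le_imp_le[OF _ P])
    have "S + T + M \<le> (1 + 3 * m) * S * (1 + \<bar>r\<bar>)"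
    proof -
      have "0 \<le> (S + m * S) * \<bar>r\<bar>" using S by (simp add: m_def)
      then show ?thesis by (simp add: T_def M_def algebra_simps)
    qed
    then have "C * (S + T + M) * (sobolev_norm (- 1 / 2) u)\<^sup>2 \<le> C * ((1 + 3 * m) * S * (1 + \<bar>r\<bar>)) * (sobolev_norm (- 1 / 2) u)\<^sup>2"
      using C by (intro mult_right_mono mult_left_mono) auto
    moreover have "c * (sobolev_norm 0 u)\<^sup>2 \<le> c' * (sobolev_norm 0 u)\<^sup>2" by (rule mult_right_mono[OF c'(2)]) simp
    ultimately have "c * (sobolev_norm 0 u)\<^sup>2 - C * ((1 + 3 * m) * S * (1 + \<bar>r\<bar>)) * (sobolev_norm (- 1 / 2) u)\<^sup>2 \<le> Re (L2_inner (matrix_psido A u) u)"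
      using main by linarith
    then show "c * (sobolev_norm 0 u)\<^sup>2 - C * (1 + 3 * m) * (\<Sum>i\<in>UNIV. \<Sum>j\<in>UNIV. S0_seminorm (4 * CARD('n) + 7) (\<lambda>z. A z $ i $ j)) * (1 + \<bar>r\<bar>) * (sobolev_norm (- 1 / 2) u)\<^sup>2
       \<le> Re (L2_inner (matrix_psido A u) u)"
      unfolding S_def a_def l_def by (simp only: mult.assoc)
  qed
qed

text \<open>The closure properties that slow scale and logarithmic slow scale nets have in common;
  through them parts (i) and (ii) become two instances of one statement.\<close>

definition scale_class :: "((real \<Rightarrow> real) \<Rightarrow> bool) \<Rightarrow> bool" where
  "scale_class Sc \<longleftrightarrow> (\<forall>f g. Sc f \<longrightarrow> Sc g \<longrightarrow> Sc (\<lambda>\<epsilon>. f \<epsilon> * g \<epsilon>)) \<and> (\<forall>f g. Sc f \<longrightarrow> Sc g \<longrightarrow> Sc (\<lambda>\<epsilon>. f \<epsilon> + g \<epsilon>)) \<and>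
     (\<forall>c. Sc (\<lambda>_. c)) \<and> (\<forall>f g. Sc g \<longrightarrow> f \<in> O[at_right 0](g) \<longrightarrow> Sc f)"

text \<open>Products stay in the class because the estimate holds for every positive exponent: each
  factor is estimated with \<open>p / 2\<close>.\<close>

lemma scale_class_bigo:
  fixes h :: "real \<Rightarrow> real \<Rightarrow> real"
  assumes one: "\<And>p. p > 0 \<Longrightarrow> (\<lambda>_. 1 :: real) \<in> O[at_right 0](h p)"
    and half: "\<And>p \<epsilon>. h p \<epsilon> = h (p / 2) \<epsilon> * h (p / 2) \<epsilon>"
  shows "scale_class (\<lambda>\<omega>. \<forall>p>0. \<omega> \<in> O[at_right 0](h p))"
  unfolding scale_class_def
proof (intro conjI allI impI)
  fix f g :: "real \<Rightarrow> real" and p :: real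
  assume f: "\<forall>p>0. f \<in> O[at_right 0](h p)" and g: "\<forall>p>0. g \<in> O[at_right 0](h p)" and p: "p > 0"
  have "(\<lambda>\<epsilon>. f \<epsilon> * g \<epsilon>) \<in> O[at_right 0](\<lambda>\<epsilon>. h (p / 2) \<epsilon> * h (p / 2) \<epsilon>)"
    using f g p by (intro landau_o.big.mult) auto
  then show "(\<lambda>\<epsilon>. f \<epsilon> * g \<epsilon>) \<in> O[at_right 0](h p)" unfolding half[of p, symmetric] .
  show "(\<lambda>\<epsilon>. f \<epsilon> + g \<epsilon>) \<in> O[at_right 0](h p)" using f g p by (intro sum_in_bigo) auto
next
  fix c p :: real assume p: "p > 0"
  have "(\<lambda>_. c) \<in> O[at_right 0](\<lambda>_. 1 :: real)" by simp
  then show "(\<lambda>_. c) \<in> O[at_right 0](h p)" by (rule landau_o.big_trans[OF _ one[OF p]])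
next
  fix f g :: "real \<Rightarrow> real" and p :: real
  assume "\<forall>p>0. g \<in> O[at_right 0](h p)" "f \<in> O[at_right 0](g)" "p > 0"
  then show "f \<in> O[at_right 0](h p)" by (blast intro: landau_o.big_trans)
qed

lemma eventually_lt_at_right_0: "0 < b \<Longrightarrow> \<forall>\<^sub>F \<epsilon> in at_right (0::real). 0 < \<epsilon> \<and> \<epsilon> < b"
  by (auto simp: eventually_at_right)

lemma scale_class_slow_scale: "scale_class slow_scale"
proof -
  have "scale_class (\<lambda>\<omega>. \<forall>p>0. \<omega> \<in> O[at_right 0](\<lambda>\<epsilon>. \<epsilon> powr (- p)))"
  proof (rule scale_class_bigo)
    fix p :: real assume p: "p > 0"
    show "(\<lambda>_. 1 :: real) \<in> O[at_right 0](\<lambda>\<epsilon>. \<epsilon> powr (- p))"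
    proof (rule bigoI[where c = 1], rule eventually_mono[OF eventually_lt_at_right_0[of 1]])
      fix \<epsilon> :: real assume "0 < \<epsilon> \<and> \<epsilon> < 1"
      then have "1 \<le> \<epsilon> powr (- p)" using p powr_mono'[of "- p" 0 \<epsilon>] by simp
      then show "norm (1::real) \<le> 1 * norm (\<epsilon> powr (- p))" by simp
    qed simp
  next
    show "\<epsilon> powr (- q) = \<epsilon> powr (- (q / 2)) * \<epsilon> powr (- (q / 2))" for q \<epsilon> :: real
      unfolding powr_add[symmetric] by simp
  qed
  then show ?thesis unfolding slow_scale_def[abs_def] .
qed

lemma scale_class_log_slow_scale: "scale_class log_slow_scale"
proof -
  have "scale_class (\<lambda>\<omega>. \<forall>p>0. \<omega> \<in> O[at_right 0](\<lambda>\<epsilon>. ln (1 / \<epsilon>) powr p))"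
  proof (rule scale_class_bigo)
    fix p :: real assume p: "p > 0"
    \<comment> \<open>Below \<open>exp (- 1)\<close> the logarithm of \<open>1 / \<epsilon>\<close>
      is at least 1, so its positive powers dominate constants.\<close>
    show "(\<lambda>_. 1 :: real) \<in> O[at_right 0](\<lambda>\<epsilon>. ln (1 / \<epsilon>) powr p)"
    proof (rule bigoI[where c = 1], rule eventually_mono[OF eventually_lt_at_right_0[of "exp (- 1)"]])
      fix \<epsilon> :: real assume \<epsilon>: "0 < \<epsilon> \<and> \<epsilon> < exp (- 1)"
      then have "ln \<epsilon> < ln (exp (- 1))" by (subst ln_less_cancel_iff) auto
      then have "1 \<le> ln (1 / \<epsilon>)" using \<epsilon> by (simp add: ln_div)
      then have "1 \<le> ln (1 / \<epsilon>) powr p" using p by (intro ge_one_powr_ge_zero) auto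
      then show "norm (1::real) \<le> 1 * norm (ln (1 / \<epsilon>) powr p)" by simp
    qed simp
  next
    show "ln (1 / \<epsilon>) powr q = ln (1 / \<epsilon>) powr (q / 2) * ln (1 / \<epsilon>) powr (q / 2)" for q \<epsilon> :: real
      unfolding powr_add[symmetric] by simp
  qed
  then show ?thesis unfolding log_slow_scale_def[abs_def] .
qed

lemma scale_class_sum:
  assumes "scale_class Sc" "finite I" "\<And>i. i \<in> I \<Longrightarrow> Sc (f i)"
  shows "Sc (\<lambda>\<epsilon>. \<Sum>i\<in>I. f i \<epsilon>)"
  using assms(2,3)
proof (induction I rule: finite_induct)
  case empty
  then show ?case using assms(1) by (simp add: scale_class_def)
next
  case (insert i I)
  have "Sc (f i)" "Sc (\<lambda>\<epsilon>. \<Sum>i\<in>I. f i \<epsilon>)" using insert by auto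
  then have "Sc (\<lambda>\<epsilon>. f i \<epsilon> + (\<Sum>i\<in>I. f i \<epsilon>))" using assms(1) by (simp add: scale_class_def)
  then show ?case using insert by simp
qed

text \<open>\<open>c1\<close> is given by a formula in the seminorms and \<open>r\<close>, so the
  inequality holds at every \<open>\<epsilon>\<close> of the interval; only the growth of
  \<open>c1\<close> is asymptotic, and it follows from the closure properties of the scales.\<close>

lemma garding_nets:
  fixes A :: "((real \<Rightarrow> 'n::finite symbol) set) ^ 'm::finite ^ 'm" and A\<epsilon> :: "real \<Rightarrow> ('n, 'm) matrix_symbol"
  assumes Sc: "scale_class Sc" and A: "\<And>i j. A $ i $ j \<in> moderate_nets Sc // net_rel Sc"
    and rep: "representative A\<epsilon> A" and r: "Sc r"
    and pos: "\<And>\<epsilon> x \<xi>. \<epsilon> \<in> {0<..1} \<Longrightarrow> r \<epsilon> \<le> norm \<xi> \<Longrightarrow> mat_ge (Re_mat (A\<epsilon> \<epsilon> (x, \<xi>))) (mat (complex_of_real (c \<epsilon>)))"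
  shows "\<exists>c1. Sc c1 \<and> (\<forall>u. (\<forall>j. schwartz (\<lambda>x. u x $ j)) \<longrightarrow>
     (\<forall>\<epsilon>\<in>{0<..1}. Re (L2_inner (matrix_psido (A\<epsilon> \<epsilon>) u) u) \<ge> c \<epsilon> * (sobolev_norm 0 u)\<^sup>2 - c1 \<epsilon> * (sobolev_norm (- 1 / 2) u)\<^sup>2))"
proof -
  define l where "l = 4 * CARD('n) + 7"
  define a where "a = (\<lambda>i j \<epsilon> z. A\<epsilon> \<epsilon> z $ i $ j)"
  \<comment> \<open>\<open>net_rel\<close> relates moderate nets only, so every member of an
    equivalence class is moderate, in particular the given representative.\<close>
  have am: "a i j \<in> moderate_nets Sc" for i j
  proof -
    have "a i j \<in> A $ i $ j" using rep by (simp add: representative_def a_def)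
    moreover obtain b where "A $ i $ j = net_rel Sc `` {b}" using A[of i j] by (auto simp: quotient_def)
    ultimately show ?thesis by (auto simp: net_rel_def)
  qed
  have S: "Sc (\<lambda>\<epsilon>. S0_seminorm l (a i j \<epsilon>))" for i j
  proof -
    obtain \<omega> where "Sc \<omega>" "(\<lambda>\<epsilon>. S0_seminorm l (a i j \<epsilon>)) \<in> O[at_right 0](\<omega>)" using am[of i j] unfolding moderate_nets_def by blast
    then show ?thesis using Sc unfolding scale_class_def by blast
  qed
  obtain C where C: "C \<ge> 0" "\<forall>(A :: ('n, 'm) matrix_symbol) c r u.
     (\<forall>i j. (\<lambda>z. A z $ i $ j) \<in> S0) \<longrightarrow>
     (\<forall>x \<xi>. r \<le> norm \<xi> \<longrightarrow> mat_ge (Re_mat (A (x, \<xi>))) (mat (complex_of_real c))) \<longrightarrow>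
     (\<forall>j. schwartz (\<lambda>x. u x $ j)) \<longrightarrow>
     c * (sobolev_norm 0 u)\<^sup>2 - C * (\<Sum>i\<in>UNIV. \<Sum>j\<in>UNIV. S0_seminorm (4 * CARD('n) + 7) (\<lambda>z. A z $ i $ j)) * (1 + \<bar>r\<bar>) * (sobolev_norm (- 1 / 2) u)\<^sup>2
       \<le> Re (L2_inner (matrix_psido A u) u)"
    using operator_garding[where 'n='n and 'm='m] by (elim exE conjE) (rule that)
  define c1 where "c1 = (\<lambda>\<epsilon>. C * (\<Sum>i\<in>UNIV. \<Sum>j\<in>UNIV. S0_seminorm l (a i j \<epsilon>)) * (1 + \<bar>r \<epsilon>\<bar>))"
  show ?thesis
  proof (intro exI[of _ c1] conjI allI impI ballI)
    have m: "Sc f \<Longrightarrow> Sc g \<Longrightarrow> Sc (\<lambda>\<epsilon>. f \<epsilon> * g \<epsilon>)" and p: "Sc f \<Longrightarrow> Sc g \<Longrightarrow> Sc (\<lambda>\<epsilon>. f \<epsilon> + g \<epsilon>)"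
      and k: "Sc (\<lambda>_. d)" for f g d using Sc by (auto simp: scale_class_def)
    have "(\<lambda>\<epsilon>. \<bar>r \<epsilon>\<bar>) \<in> O[at_right 0](r)" by simp
    then have "Sc (\<lambda>\<epsilon>. \<bar>r \<epsilon>\<bar>)" using Sc r unfolding scale_class_def by blast
    then have r': "Sc (\<lambda>\<epsilon>. 1 + \<bar>r \<epsilon>\<bar>)" by (rule p[OF k])
    have "Sc (\<lambda>\<epsilon>. \<Sum>i\<in>UNIV. \<Sum>j\<in>UNIV. S0_seminorm l (a i j \<epsilon>))"
      by (intro scale_class_sum[OF Sc] S) simp_all
    from m[OF m[OF k this] r'] show "Sc c1" unfolding c1_def .
    fix u :: "real^'n \<Rightarrow> complex^'m" and \<epsilon> :: real
    assume u: "\<forall>j. schwartz (\<lambda>x. u x $ j)" and \<epsilon>: "\<epsilon> \<in> {0<..1}"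
    have "(\<lambda>z. A\<epsilon> \<epsilon> z $ i $ j) \<in> S0" for i j
      using am[of i j] \<epsilon> by (simp add: moderate_nets_def a_def)
    from C(2)[rule_format, OF this pos[OF \<epsilon>] u[rule_format]]
    show "Re (L2_inner (matrix_psido (A\<epsilon> \<epsilon>) u) u) \<ge> c \<epsilon> * (sobolev_norm 0 u)\<^sup>2 - c1 \<epsilon> * (sobolev_norm (- 1 / 2) u)\<^sup>2"
      unfolding c1_def a_def l_def .
  qed
qed

theorem theoremA5:
  shows "(\<forall>A :: ((real \<Rightarrow> 'n::finite symbol) set) ^ 'm ^ 'm::finite.
        (\<forall>i j. A $ i $ j \<in> G_sc) \<longrightarrow>
        (\<forall>A\<epsilon> c r.
           representative A\<epsilon> A \<and>
           (\<forall>\<epsilon>\<in>{0<..1}. c \<epsilon> \<noteq> 0) \<and>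
           slow_scale (\<lambda>\<epsilon>. inverse (c \<epsilon>)) \<and> slow_scale r \<and>
           (\<forall>\<epsilon>\<in>{0<..1}. \<forall>x \<xi>. norm \<xi> \<ge> r \<epsilon> \<longrightarrow>
              mat_ge (Re_mat (A\<epsilon> \<epsilon> (x, \<xi>))) (mat (complex_of_real (c \<epsilon>)))) \<longrightarrow>
           (\<exists>c1. slow_scale c1 \<and>
              (\<forall>u. (\<forall>j. schwartz (\<lambda>x. u x $ j)) \<longrightarrow>
                 (\<forall>\<epsilon>\<in>{0<..1}.
                    Re (L2_inner (matrix_psido (A\<epsilon> \<epsilon>) u) u)
                      \<ge> c \<epsilon> * (sobolev_norm 0 u)\<^sup>2
                         - c1 \<epsilon> * (sobolev_norm (- 1 / 2) u)\<^sup>2)))))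
    \<and>
    (\<forall>A :: ((real \<Rightarrow> 'n::finite symbol) set) ^ 'm ^ 'm::finite.
        (\<forall>i j. A $ i $ j \<in> G_lsc) \<longrightarrow>
        (\<forall>A\<epsilon> c r.
           representative A\<epsilon> A \<and>
           (\<forall>\<epsilon>\<in>{0<..1}. c \<epsilon> \<noteq> 0) \<and>
           log_slow_scale (\<lambda>\<epsilon>. inverse (c \<epsilon>)) \<and> log_slow_scale r \<and>
           (\<forall>\<epsilon>\<in>{0<..1}. \<forall>x \<xi>. norm \<xi> \<ge> r \<epsilon> \<longrightarrow>
              mat_ge (Re_mat (A\<epsilon> \<epsilon> (x, \<xi>))) (mat (complex_of_real (c \<epsilon>)))) \<longrightarrow>
           (\<exists>c1. log_slow_scale c1 \<and>
              (\<forall>u. (\<forall>j. schwartz (\<lambda>x. u x $ j)) \<longrightarrow>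
                 (\<forall>\<epsilon>\<in>{0<..1}.
                    Re (L2_inner (matrix_psido (A\<epsilon> \<epsilon>) u) u)
                      \<ge> c \<epsilon> * (sobolev_norm 0 u)\<^sup>2
                         - c1 \<epsilon> * (sobolev_norm (- 1 / 2) u)\<^sup>2)))))"
proof (rule conjI; intro allI impI; elim conjE)
  fix A :: "((real \<Rightarrow> 'n symbol) set) ^ 'm ^ 'm" and A\<epsilon> c r
  assume A: "\<forall>i j. A $ i $ j \<in> G_sc" and rep: "representative A\<epsilon> A" and r: "slow_scale r"
    and pos: "\<forall>\<epsilon>\<in>{0<..1}. \<forall>x \<xi>. r \<epsilon> \<le> norm \<xi> \<longrightarrow> mat_ge (Re_mat (A\<epsilon> \<epsilon> (x, \<xi>))) (mat (complex_of_real (c \<epsilon>)))"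
  show "\<exists>c1. slow_scale c1 \<and> (\<forall>u. (\<forall>j. schwartz (\<lambda>x. u x $ j)) \<longrightarrow> (\<forall>\<epsilon>\<in>{0<..1}.
     Re (L2_inner (matrix_psido (A\<epsilon> \<epsilon>) u) u) \<ge> c \<epsilon> * (sobolev_norm 0 u)\<^sup>2 - c1 \<epsilon> * (sobolev_norm (- 1 / 2) u)\<^sup>2))"
    by (rule garding_nets[OF scale_class_slow_scale A[unfolded G_sc_def, rule_format] rep r pos[rule_format]])
next
  fix A :: "((real \<Rightarrow> 'n symbol) set) ^ 'm ^ 'm" and A\<epsilon> c r
  assume A: "\<forall>i j. A $ i $ j \<in> G_lsc" and rep: "representative A\<epsilon> A" and r: "log_slow_scale r"
    and pos: "\<forall>\<epsilon>\<in>{0<..1}. \<forall>x \<xi>. r \<epsilon> \<le> norm \<xi> \<longrightarrow> mat_ge (Re_mat (A\<epsilon> \<epsilon> (x, \<xi>))) (mat (complex_of_real (c \<epsilon>)))"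
  show "\<exists>c1. log_slow_scale c1 \<and> (\<forall>u. (\<forall>j. schwartz (\<lambda>x. u x $ j)) \<longrightarrow> (\<forall>\<epsilon>\<in>{0<..1}.
     Re (L2_inner (matrix_psido (A\<epsilon> \<epsilon>) u) u) \<ge> c \<epsilon> * (sobolev_norm 0 u)\<^sup>2 - c1 \<epsilon> * (sobolev_norm (- 1 / 2) u)\<^sup>2))"
    by (rule garding_nets[OF scale_class_log_slow_scale A[unfolded G_lsc_def, rule_format] rep r pos[rule_format]])
qed

end
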